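(* Let $\gamma>p\geq 1$, let $d,e\ge 1$ be integers, let $T>0$, and let $f=(f_1,\dots,f_d):\mathbb{R}^d\to L(\mathbb{R}^d,\mathbb{R}^e)$ be a $Lip(\gamma-1)$ one-form. For every branched $p$-rough path $X:[0,T]\to G_d^{[p]}$, the rough integral $Y_{0,\cdot}=\int_0^{\cdot}f(X_r)dX_r:[0,T]\to G_e^{[p]}$ of $f$ along $X$ (defined in the context) exists, and it is continuous with respect to $X$ in the $d_p$-metric (i.e. the map $X\mapsto \int_0^\cdot f(X_r)dX_r$ is continuous when both the driving branched $p$-rough paths and the integrals are equipped with the $d_p$-metric). Moreover, there exists a constant $C$ depending only on $p,\gamma,d,e$ such that for all $s<t$ in $[0,T]$, $$\left\Vert \int f(X_r)dX_r\right\Vert_{p-var,[s,t]}\leq C\,\Vert f\Vert_{Lip(\gamma-1)}\left(\Vert X\Vert_{p-var,[s,t]}\vee \Vert X\Vert_{p-var,[s,t]}^{p}\right).$$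
   Context: **Trees and forests.** Trees are finite rooted non-planar trees; a forest is a commutative monomial of trees, including the empty forest $\epsilon$. Vertices are labelled by $\{1,\dots,d\}$. $|\rho|$ is the number of vertices of $\rho$ ($|\epsilon|=0$). The depth of a forest is the largest number of vertices on a simple path from a root to a leaf. $T_d$ ($F_d$) is the set of labelled trees (forests), and $T_d^n$ ($F_d^n$) the subset of elements of degree $1,2,\dots,n$. $\bullet_i$ is the one-vertex tree labelled $i$; $[\rho]_i$ is the tree obtained by grafting the roots of all trees of the forest $\rho$ to a new root labelled $i$. The symmetry factor $\sigma$ is defined by $\sigma(\bullet_i)=1$ and $\sigma(\tau_1^{n_1}\cdots\tau_l^{n_l})=\sigma([\tau_1^{n_1}\cdots\tau_l^{n_l}]_i)=n_1!\cdots n_l!\,\sigma(\tau_1)^{n_1}\cdots\sigma(\tau_l)^{n_l}$ for distinct labelled trees $\tau_j$. **The group $G_d^n$.** $\bigtriangleup$ is the (labelled) Connes–Kreimer coproduct given by admissible cuts; it is multiplicative on forests and satisfies $\bigtriangleup[\rho]_j=[\rho]_j\otimes 1+\sum_{\bigtriangleup\rho}\rho_{(1)}\otimes[\rho_{(2)}]_j$, where $\bigtriangleup\rho=\sum_{\bigtriangleup\rho}\rho_{(1)}\otimes\rho_{(2)}$ (so the first factor is the pruned part). $G_d^n$ is the step-$n$ truncated group of characters: maps $a:F_d\to\mathbb{R}$, with $(a,\epsilon)=1$, $(a,\rho_1\rho_2)=(a,\rho_1)(a,\rho_2)$ whenever $|\rho_1|+|\rho_2|\le n$, and $(a,\rho)=0$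 for $|\rho|>n$; product $(ab,\rho)=\sum_{\bigtriangleup\rho}(a,\rho_{(1)})(b,\rho_{(2)})$ for $|\rho|\le n$. Norm: $\|a\|:=\max_{\rho\in F_d,|\rho|=1,\dots,n}|(a,\rho)|^{1/|\rho|}$. **Rough paths.** $[p]$ is the largest integer $\le p$. For a continuous path $X$ in $G_d^{[p]}$ put $X_{s,t}:=X_s^{-1}X_t$ and $\|X\|_{p-var,[s,t]}:=\sup_{D}\big(\sum_k\|X_{t_k,t_{k+1}}\|^p\big)^{1/p}$, the supremum over finite partitions $D=\{t_k\}$ of $[s,t]$. $X:[0,T]\to G_d^{[p]}$ is a branched $p$-rough path if it is continuous and $\|X\|_{p-var,[0,T]}<\infty$. With $\pi_1:G_d^{[p]}\to\mathbb{R}^d$ the projection to degree-1 components, the $d_p$-metric is $$d_p(X^1,X^2):=|\pi_1(X^1_0)-\pi_1(X^2_0)|+\max_{\rho\in F_d^{[p]}}\sup_{D\subset[0,T]}\Big(\sum_{k}|(X^1_{t_k,t_{k+1}},\rho)-(X^2_{t_k,t_{k+1}},\rho)|^{p/|\rho|}\Big)^{1/p}$$ (and analogously with $d$ replaced by $e$). **Lipschitz one-forms.** For $\gamma>0$, $\lfloor\gamma\rfloor$ is the largest integer strictly less than $\gamma$; $f$ is $Lip(\gamma)$ if $\|f\|_{Lip(\gamma)}:=\max_{k=0,\dots,\lfloor\gamma\rfloor}\|D^kf\|_\infty+\sup_{x,y}\frac{\|D^{\lfloor\gamma\rfloor}f(x)-D^{\lfloor\gamma\rfloor}f(y)\|}{|x-y|^{\gamma-\lfloor\gamma\rfloor}}<\infty$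 ($D^k$ is the $k$-th Fréchet derivative). Here $f_i:\mathbb{R}^d\to\mathbb{R}^e$, $i=1,\dots,d$, are the components of $f$. **One-forms along $X$ and their integrals.** A one-form $\beta$ along $X$ with values in $\mathbb{R}^m$ assigns to each $X_t$ a function $\beta(X_t)(a)=\sum_{\rho\in F_d^{[p]}}\beta^\rho(X_t)(a,\rho)$, $a\in G_d^{[p]}$, with $\beta^\rho(X_t)\in\mathbb{R}^m$. Its integral is $\int_s^t\beta(X_r)dX_r:=\lim_{|D|\to0}\sum_k\beta(X_{t_k})(X_{t_k,t_{k+1}})$, over finite partitions $D=\{t_k\}$ of $[s,t]$ with mesh $|D|$ tending to zero. For real-valued $\phi_i=\sum_{\rho}\phi_i^\rho(\cdot,\rho)$ set $(\phi_1\phi_2)(a):=\sum_{\rho_1,\rho_2\in F_d^{[p]},|\rho_1|+|\rho_2|\le[p]}\phi_1^{\rho_1}\phi_2^{\rho_2}(a,\rho_1\rho_2)$; and if $\phi_2$ only has tree components, $(\phi_1\succ\phi_2)(a):=\sum_{\rho\in F_d^{[p]},\tau\in T_d^{[p]},|\rho|+|\tau|\le[p]}\phi_1^\rho\phi_2^\tau(a,\rho\succ\tau)$, where $\rho\succ\tau$ is the tree obtained by grafting the roots of all trees of $\rho$ to the root of $\tau$. **The rough integral.** For $\tau=\bullet_i$ put $f_\tau:=f_i$; for $\tau=[\bullet_{i_1}\cdots\bullet_{i_l}]_i$ with $l\in\{1,\dots,[p]-1\}$ put $f_\tau:=D^l_{i_1,\dots,i_l}f_i$; put $f_\tau:=0$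 if $\tau\in T_d^{[p]}$ has depth greater than 2. With $x_t:=\pi_1(X_t)$ define $\beta(X_t)(a):=\sum_{\tau\in T_d^{[p]}}f_\tau(x_t)\frac{(a,\tau)}{\sigma(\tau)}$, with components $\beta=(\beta^1,\dots,\beta^e)$, and $y_t=(y_t^1,\dots,y_t^e):=\int_0^t\beta(X_r)dX_r$. The rough integral of $f$ along $X$ is $Y:\{(s,t):0\le s<t\le T\}\to G_e^{[p]}$, denoted $Y_{s,t}=\int_s^tf(X_r)dX_r$, defined inductively by $(Y_{s,t},\bullet_j):=y^j_t-y^j_s$; $(Y_{s,t},[\rho]_j):=\int_{r=s}^t(Y_{s,r},\rho)dy^j_r$ for $\rho\in F_e$, $1\le|\rho|\le[p]-1$; and $(Y_{s,t},\tau_1\cdots\tau_l):=(Y_{s,t},\tau_1)\cdots(Y_{s,t},\tau_l)$ for trees with $|\tau_1|+\cdots+|\tau_l|\le[p]$. The iterated integral is understood as an integral of a one-form along $X$: with starting point $s$, one associates to $t\mapsto(Y_{s,t},\rho)$ the one-form $\beta_s^\rho$, where $\beta_s^{\bullet_j}=\beta^j$, $\beta_s^{\rho_1\rho_2}(X_t)=(Y_{s,t},\rho_1)\beta_s^{\rho_2}(X_t)+(Y_{s,t},\rho_2)\beta_s^{\rho_1}(X_t)+\beta_s^{\rho_1}(X_t)\beta_s^{\rho_2}(X_t)$, $\beta_s^{[\rho]_j}(X_t)=(Y_{s,t},\rho)\beta^j(X_t)+\beta_s^\rho(X_t)\succ\beta^j(X_t)$, and $\int_{r=s}^t(Y_{s,r},\rho)dy_r^j:=\int_s^t\beta_s^{[\rho]_j}(X_r)dX_r$.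 The path $\int_0^\cdot f(X_r)dX_r$ is $t\mapsto Y_{0,t}$ (identity at $t=0$), and $\|\int f(X_r)dX_r\|_{p-var,[s,t]}$ is the $p$-variation computed with the increments $Y_{u,v}$. *)

theory Defs
  imports "HOL-Analysis.Analysis" "HOL-Library.Multiset" "HOL-Algebra.Group"
begin

section \<open>Labelled non-planar trees and forests\<close>

text \<open>Labels are the elements of a finite type, and a forest is the multiset of its trees. The
  product of forests is multiset union and the empty forest is the empty multiset.\<close>

datatype 'l tree = Node (label: 'l) (children: "'l tree multiset")

type_synonym 'l forest = "'l tree multiset"

abbreviation bullet :: "'l \<Rightarrow> 'l tree" where
  "bullet i \<equiv> Node i {#}"

primrec tree_deg :: "'l tree \<Rightarrow> nat" where
  "tree_deg (Node i \<rho>) = 1 + \<Sum>\<^sub># (image_mset tree_deg \<rho>)"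

definition deg :: "'l forest \<Rightarrow> nat" where
  "deg \<rho> = \<Sum>\<^sub># (image_mset tree_deg \<rho>)"

primrec depth :: "'l tree \<Rightarrow> nat" where
  "depth (Node i \<rho>) = 1 + Max (insert 0 (set_mset (image_mset depth \<rho>)))"

primrec sym_factor :: "'l tree \<Rightarrow> nat" where
  "sym_factor (Node i \<rho>) =
     (\<Prod>\<tau>\<in>set_mset \<rho>. fact (count \<rho> \<tau>)) * \<Prod>\<^sub># (image_mset sym_factor \<rho>)"

definition trees :: "nat \<Rightarrow> 'l tree set" where
  "trees n = {\<tau>. tree_deg \<tau> \<le> n}"

definition forests :: "nat \<Rightarrow> 'l forest set" where
  "forests n = {\<rho>. 1 \<le> deg \<rho> \<and> deg \<rho> \<le> n}"

definition graft :: "'l forest \<Rightarrow> 'l tree \<Rightarrow> 'l tree" where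
  "graft \<rho> \<tau> = Node (label \<tau>) (\<rho> + children \<tau>)"

lemma deg_simps [simp]:
  "deg {#} = 0" "deg (\<rho>\<^sub>1 + \<rho>\<^sub>2) = deg \<rho>\<^sub>1 + deg \<rho>\<^sub>2" "deg {#Node i \<rho>#} = 1 + deg \<rho>"
  by (simp_all add: deg_def)

lemma tree_deg_pos [simp]: "0 < tree_deg \<tau>"
  by (cases \<tau>) simp

lemma size_le_deg: "size \<rho> \<le> deg \<rho>"
proof (induction \<rho>)
  case empty
  then show ?case by simp
next
  case (add \<tau> \<rho>)
  have "Suc 0 \<le> tree_deg \<tau>" using tree_deg_pos[of \<tau>] by linarith
  then show ?case using add by (simp add: deg_def)
qed

lemma finite_trees: "finite (trees n :: 'l::finite tree set)"
proof (induction n)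
  case 0
  have "trees 0 = ({} :: 'l tree set)" by (simp add: trees_def)
  then show ?case by simp
next
  case (Suc n)
  let ?M = "{\<rho> :: 'l forest. set_mset \<rho> \<subseteq> trees n \<and> size \<rho> \<le> n}"
  have "finite (\<Union>k\<le>n. mset ` {ts :: 'l tree list. set ts \<subseteq> trees n \<and> length ts = k})"
    by (rule finite_UN_I) (use Suc in \<open>simp_all add: finite_lists_length_eq\<close>)
  moreover have "?M \<subseteq> (\<Union>k\<le>n. mset ` {ts. set ts \<subseteq> trees n \<and> length ts = k})"
  proof
    fix \<rho> assume "\<rho> \<in> ?M"
    moreover obtain ts where "mset ts = \<rho>" using ex_mset by blast
    ultimately show "\<rho> \<in> (\<Union>k\<le>n. mset ` {ts. set ts \<subseteq> trees n \<and> length ts = k})"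
      by force
  qed
  ultimately have "finite ?M" by (rule rev_finite_subset)
  then have "finite ((\<lambda>(i, \<rho>). Node i \<rho>) ` (UNIV \<times> ?M))" by simp
  moreover have "trees (Suc n) \<subseteq> (\<lambda>(i, \<rho>). Node i \<rho>) ` (UNIV \<times> ?M)"
  proof
    fix \<tau> :: "'l tree" assume \<tau>: "\<tau> \<in> trees (Suc n)"
    obtain i \<rho> where [simp]: "\<tau> = Node i \<rho>" by (cases \<tau>)
    have d: "deg \<rho> \<le> n" using \<tau> by (simp add: trees_def deg_def)
    have "tree_deg \<tau>' \<le> deg \<rho>" if "\<tau>' \<in># \<rho>" for \<tau>'
      using multi_member_split[OF that] by (auto simp: deg_def)
    then have "\<rho> \<in> ?M"
      using d size_le_deg[of \<rho>] by (auto simp: trees_def intro: order_trans)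
    then show "\<tau> \<in> (\<lambda>(i, \<rho>). Node i \<rho>) ` (UNIV \<times> ?M)" by auto
  qed
  ultimately show ?case by (rule rev_finite_subset)
qed

lemma finite_forests: "finite (forests n :: 'l::finite forest set)"
proof (rule finite_subset)
  show "finite (children ` (trees (Suc n) :: 'l tree set))"
    by (rule finite_imageI[OF finite_trees])
  show "forests n \<subseteq> children ` (trees (Suc n) :: 'l tree set)"
  proof
    fix \<rho> :: "'l forest" assume "\<rho> \<in> forests n"
    then have "Node undefined \<rho> \<in> trees (Suc n)"
      by (simp add: forests_def trees_def deg_def)
    then show "\<rho> \<in> children ` trees (Suc n)"
      by (rule image_eqI[rotated]) simp
  qed
qed

section \<open>The Connes--Kreimer coproduct\<close>

text \<open>A finite sum of tensors of forests is represented by the multiset of its terms; the first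
  component of a term is the pruned part.\<close>

definition tensor_times ::
    "('l forest \<times> 'l forest) multiset \<Rightarrow> ('l forest \<times> 'l forest) multiset
     \<Rightarrow> ('l forest \<times> 'l forest) multiset" where
  "tensor_times A B = \<Sum>\<^sub># (image_mset (\<lambda>(a, b). image_mset (\<lambda>(c, d). (a + c, b + d)) B) A)"

primrec tree_coproduct :: "'l tree \<Rightarrow> ('l forest \<times> 'l forest) multiset" where
  "tree_coproduct (Node i \<rho>) =
     {#({#Node i \<rho>#}, {#})#} +
     image_mset (\<lambda>(\<rho>\<^sub>1, \<rho>\<^sub>2). (\<rho>\<^sub>1, {#Node i \<rho>\<^sub>2#}))
       (fold_mset tensor_times {#({#}, {#})#} (image_mset tree_coproduct \<rho>))"

definition coproduct :: "'l forest \<Rightarrow> ('l forest \<times> 'l forest) multiset" where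
  "coproduct \<rho> = fold_mset tensor_times {#({#}, {#})#} (image_mset tree_coproduct \<rho>)"

lemma tensor_times_simps [simp]:
  "tensor_times {#} B = {#}" "tensor_times A {#} = {#}"
  "tensor_times (A + A') B = tensor_times A B + tensor_times A' B"
  "tensor_times (add_mset (a, b) A) B =
     image_mset (\<lambda>(c, d). (a + c, b + d)) B + tensor_times A B"
  by (induction A) (auto simp: tensor_times_def)

lemma tensor_times_add_right:
  "tensor_times A (add_mset (c, d) B) =
     image_mset (\<lambda>(a, b). (a + c, b + d)) A + tensor_times A B"
  by (induction A) auto

lemma tensor_times_commute: "tensor_times A B = tensor_times B A"
proof (induction A)
  case (add x A)
  then show ?case
    by (cases x) (simp add: tensor_times_add_right add.commute)
qed simp

lemma tensor_times_image:
  "tensor_times (image_mset (\<lambda>(c, d). (a + c, b + d)) A) B =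
     image_mset (\<lambda>(c, d). (a + c, b + d)) (tensor_times A B)"
  by (induction A) (auto simp: multiset.map_comp comp_def case_prod_unfold add.assoc)

lemma tensor_times_assoc:
  "tensor_times (tensor_times A B) C = tensor_times A (tensor_times B C)"
proof (induction A)
  case (add x A)
  then show ?case by (cases x) (simp add: tensor_times_image)
qed simp

interpretation tensor_times: comp_fun_commute tensor_times
proof
  fix A B :: "('a forest \<times> 'a forest) multiset"
  show "tensor_times B \<circ> tensor_times A = tensor_times A \<circ> tensor_times B"
    by (simp only: fun_eq_iff comp_apply flip: tensor_times_assoc)
      (simp only: tensor_times_commute[of B A] simp_thms)
qed

lemma tensor_times_one [simp]: "tensor_times {#({#}, {#})#} A = A"
  by (simp add: case_prod_beta)

lemma coproduct_empty: "coproduct {#} = {#({#}, {#})#}"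
  by (simp add: coproduct_def)

lemma coproduct_add_mset:
  "coproduct (add_mset \<tau> \<rho>) = tensor_times (tree_coproduct \<tau>) (coproduct \<rho>)"
  by (simp add: coproduct_def)

lemma coproduct_plus:
  "coproduct (\<rho>\<^sub>1 + \<rho>\<^sub>2) = tensor_times (coproduct \<rho>\<^sub>1) (coproduct \<rho>\<^sub>2)"
proof (induction \<rho>\<^sub>1)
  case empty
  show ?case by (simp only: coproduct_empty tensor_times_one add_0)
next
  case (add \<tau> \<rho>\<^sub>1)
  then show ?case
    by (simp only: coproduct_add_mset tensor_times_assoc add_mset_add_mset_same_iff
        union_mset_add_mset_left)
qed

lemma coproduct_Node:
  "coproduct {#Node i \<rho>#} =
     {#({#Node i \<rho>#}, {#})#} +
     image_mset (\<lambda>(\<rho>\<^sub>1, \<rho>\<^sub>2). (\<rho>\<^sub>1, {#Node i \<rho>\<^sub>2#})) (coproduct \<rho>)"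
proof -
  have "coproduct {#Node i \<rho>#} = tree_coproduct (Node i \<rho>)"
    by (simp only: coproduct_add_mset coproduct_empty tensor_times_one
        tensor_times_commute[of _ "{#({#}, {#})#}"])
  then show ?thesis by (simp only: tree_coproduct.simps coproduct_def)
qed

section \<open>The truncated group of characters\<close>

definition characters :: "nat \<Rightarrow> ('l forest \<Rightarrow> real) set" where
  "characters n = {a. a {#} = 1 \<and>
     (\<forall>\<rho>\<^sub>1 \<rho>\<^sub>2. deg \<rho>\<^sub>1 + deg \<rho>\<^sub>2 \<le> n \<longrightarrow> a (\<rho>\<^sub>1 + \<rho>\<^sub>2) = a \<rho>\<^sub>1 * a \<rho>\<^sub>2) \<and>
     (\<forall>\<rho>. n < deg \<rho> \<longrightarrow> a \<rho> = 0)}"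

definition char_group :: "nat \<Rightarrow> ('l forest \<Rightarrow> real) monoid" where
  "char_group n = \<lparr>carrier = characters n,
     monoid.mult = (\<lambda>a b \<rho>. if deg \<rho> \<le> n
       then \<Sum>\<^sub># (image_mset (\<lambda>(\<rho>\<^sub>1, \<rho>\<^sub>2). a \<rho>\<^sub>1 * b \<rho>\<^sub>2) (coproduct \<rho>)) else 0),
     one = (\<lambda>\<rho>. if \<rho> = {#} then 1 else 0)\<rparr>"

definition char_norm :: "nat \<Rightarrow> ('l::finite forest \<Rightarrow> real) \<Rightarrow> real" where
  "char_norm n a = Max ((\<lambda>\<rho>. \<bar>a \<rho>\<bar> powr (1 / real (deg \<rho>))) ` forests n)"

definition proj1 :: "('l::finite forest \<Rightarrow> real) \<Rightarrow> real ^ 'l" where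
  "proj1 a = (\<chi> i. a {#bullet i#})"

definition increment ::
    "nat \<Rightarrow> (real \<Rightarrow> 'l forest \<Rightarrow> real) \<Rightarrow> real \<Rightarrow> real \<Rightarrow> 'l forest \<Rightarrow> real" where
  "increment n X s t = inv\<^bsub>char_group n\<^esub> (X s) \<otimes>\<^bsub>char_group n\<^esub> X t"

section \<open>Partitions, variation and rough paths\<close>

definition partitions :: "real \<Rightarrow> real \<Rightarrow> real list set" where
  "partitions s t = {D. D \<noteq> [] \<and> sorted_wrt (<) D \<and> hd D = s \<and> last D = t}"

definition partition_sum ::
    "(real \<Rightarrow> real \<Rightarrow> 'v::comm_monoid_add) \<Rightarrow> real list \<Rightarrow> 'v" where
  "partition_sum g D = (\<Sum>k<length D - 1. g (D ! k) (D ! Suc k))"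

definition mesh :: "real list \<Rightarrow> real" where
  "mesh D = Max (insert 0 ((\<lambda>k. D ! Suc k - D ! k) ` {..<length D - 1}))"

definition mesh_to_zero :: "real \<Rightarrow> real \<Rightarrow> real list filter" where
  "mesh_to_zero s t = (INF \<delta>\<in>{0<..}. principal {D \<in> partitions s t. mesh D < \<delta>})"

definition level :: "real \<Rightarrow> nat" where
  "level p = nat \<lfloor>p\<rfloor>"

text \<open>The \<open>p\<close>-variation of a family of increments \<open>Z u v\<close>.\<close>

definition p_var ::
    "real \<Rightarrow> (real \<Rightarrow> real \<Rightarrow> 'l::finite forest \<Rightarrow> real) \<Rightarrow> real \<Rightarrow> real \<Rightarrow> ennreal" where
  "p_var p Z s t = (SUP D\<in>partitions s t.
     ennreal (partition_sum (\<lambda>u v. char_norm (level p) (Z u v) powr p) D powr (1 / p)))"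

text \<open>Continuity refers to the product topology on real-valued functions on forests, which on
  truncated characters is the topology of finitely many coordinates.\<close>

definition branched_rough_path ::
    "real \<Rightarrow> real \<Rightarrow> (real \<Rightarrow> 'l::finite forest \<Rightarrow> real) \<Rightarrow> bool" where
  "branched_rough_path p T X \<longleftrightarrow>
     X ` {0..T} \<subseteq> carrier (char_group (level p)) \<and> continuous_on {0..T} X \<and>
     p_var p (increment (level p) X) 0 T < \<infinity>"

definition d_p ::
    "real \<Rightarrow> real \<Rightarrow> (real \<Rightarrow> 'l::finite forest \<Rightarrow> real)
     \<Rightarrow> (real \<Rightarrow> 'l forest \<Rightarrow> real) \<Rightarrow> ennreal" where
  "d_p p T X X' = ennreal (norm (proj1 (X 0) - proj1 (X' 0))) +
     Max ((\<lambda>\<rho>. SUP D\<in>partitions 0 T.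
       ennreal (partition_sum (\<lambda>u v.
         \<bar>increment (level p) X u v \<rho> - increment (level p) X' u v \<rho>\<bar> powr (p / real (deg \<rho>))) D
         powr (1 / p))) ` forests (level p))"

section \<open>Lipschitz functions\<close>

text \<open>\<open>iter_deriv f [v\<^sub>1, \<dots>, v\<^sub>k] x\<close> is the \<open>k\<close>-th Frechet derivative of \<open>f\<close> at \<open>x\<close> applied to
  \<open>v\<^sub>1, \<dots>, v\<^sub>k\<close>. As the domain is finite-dimensional, \<open>f\<close> is \<open>k\<close> times Frechet differentiable
  iff each of the functions \<open>iter_deriv f vs\<close> with fewer than \<open>k\<close> directions is
  differentiable.\<close>

primrec iter_deriv ::
    "('a::euclidean_space \<Rightarrow> 'b::real_normed_vector) \<Rightarrow> 'a list \<Rightarrow> 'a \<Rightarrow> 'b" where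
  "iter_deriv f [] = f"
| "iter_deriv f (v # vs) = (\<lambda>x. frechet_derivative (iter_deriv f vs) (at x) v)"

definition times_differentiable ::
    "nat \<Rightarrow> ('a::euclidean_space \<Rightarrow> 'b::real_normed_vector) \<Rightarrow> bool" where
  "times_differentiable k f \<longleftrightarrow>
     (\<forall>vs x. length vs < k \<longrightarrow> iter_deriv f vs differentiable at x)"

text \<open>The operator norm of a \<open>k\<close>-linear map whose arguments are given as a list.\<close>

definition multilinear_norm ::
    "nat \<Rightarrow> ('a::real_normed_vector list \<Rightarrow> 'b::real_normed_vector) \<Rightarrow> ennreal" where
  "multilinear_norm k A =
     (SUP vs\<in>{vs. length vs = k \<and> (\<forall>v\<in>set vs. norm v \<le> 1)}. ennreal (norm (A vs)))"

definition strict_floor :: "real \<Rightarrow> nat" where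
  "strict_floor \<gamma> = nat (\<lceil>\<gamma>\<rceil> - 1)"

definition Lip_norm ::
    "real \<Rightarrow> ('a::euclidean_space \<Rightarrow> 'b::real_normed_vector) \<Rightarrow> ennreal" where
  "Lip_norm \<gamma> f =
     Max ((\<lambda>k. SUP x. multilinear_norm k (\<lambda>vs. iter_deriv f vs x)) ` {0..strict_floor \<gamma>}) +
     (SUP (x, y)\<in>{(x, y). x \<noteq> y}.
       multilinear_norm (strict_floor \<gamma>) (\<lambda>vs. iter_deriv f vs x - iter_deriv f vs y) /
       ennreal (norm (x - y) powr (\<gamma> - real (strict_floor \<gamma>))))"

definition Lip ::
    "real \<Rightarrow> ('a::euclidean_space \<Rightarrow> 'b::real_normed_vector) \<Rightarrow> bool" where
  "Lip \<gamma> f \<longleftrightarrow> times_differentiable (strict_floor \<gamma>) f \<and> Lip_norm \<gamma> f < \<infinity>"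

section \<open>One-forms along a path and their integrals\<close>

text \<open>A one-form along a path is given by its coefficients: at time \<open>t\<close> it is a function
  \<open>\<phi>\<close> from forests to the value space, standing for \<open>a \<mapsto> \<Sum>\<rho>. a \<rho> *\<^sub>R \<phi> \<rho>\<close>. Coefficients at
  forests outside \<open>forests n\<close> play no role.\<close>

definition form_apply ::
    "nat \<Rightarrow> ('l::finite forest \<Rightarrow> 'v::real_normed_vector) \<Rightarrow> ('l forest \<Rightarrow> real) \<Rightarrow> 'v" where
  "form_apply n \<phi> a = (\<Sum>\<rho>\<in>forests n. a \<rho> *\<^sub>R \<phi> \<rho>)"

definition has_form_integral ::
    "nat \<Rightarrow> (real \<Rightarrow> 'l::finite forest \<Rightarrow> real)
     \<Rightarrow> (real \<Rightarrow> 'l forest \<Rightarrow> 'v::real_normed_vector) \<Rightarrow> real \<Rightarrow> real \<Rightarrow> 'v \<Rightarrow> bool" where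
  "has_form_integral n X \<beta> s t I \<longleftrightarrow>
     (partition_sum (\<lambda>u v. form_apply n (\<beta> u) (increment n X u v)) \<longlongrightarrow> I) (mesh_to_zero s t)"

definition form_times ::
    "nat \<Rightarrow> ('l::finite forest \<Rightarrow> real) \<Rightarrow> ('l forest \<Rightarrow> real) \<Rightarrow> 'l forest \<Rightarrow> real" where
  "form_times n \<phi>\<^sub>1 \<phi>\<^sub>2 \<rho> =
     (\<Sum>(\<rho>\<^sub>1, \<rho>\<^sub>2)\<in>{(\<rho>\<^sub>1, \<rho>\<^sub>2). \<rho>\<^sub>1 \<in> forests n \<and> \<rho>\<^sub>2 \<in> forests n \<and>
        deg \<rho>\<^sub>1 + deg \<rho>\<^sub>2 \<le> n \<and> \<rho>\<^sub>1 + \<rho>\<^sub>2 = \<rho>}. \<phi>\<^sub>1 \<rho>\<^sub>1 * \<phi>\<^sub>2 \<rho>\<^sub>2)"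

definition form_graft ::
    "nat \<Rightarrow> ('l::finite forest \<Rightarrow> real) \<Rightarrow> ('l forest \<Rightarrow> real) \<Rightarrow> 'l forest \<Rightarrow> real" where
  "form_graft n \<phi>\<^sub>1 \<phi>\<^sub>2 \<rho> =
     (\<Sum>(\<rho>\<^sub>1, \<tau>)\<in>{(\<rho>\<^sub>1, \<tau>). \<rho>\<^sub>1 \<in> forests n \<and> \<tau> \<in> trees n \<and>
        deg \<rho>\<^sub>1 + tree_deg \<tau> \<le> n \<and> {#graft \<rho>\<^sub>1 \<tau>#} = \<rho>}. \<phi>\<^sub>1 \<rho>\<^sub>1 * \<phi>\<^sub>2 {#\<tau>#})"

lemma form_apply_times:
  "form_apply n (form_times n \<phi>\<^sub>1 \<phi>\<^sub>2) a =
     (\<Sum>(\<rho>\<^sub>1, \<rho>\<^sub>2)\<in>{(\<rho>\<^sub>1, \<rho>\<^sub>2). \<rho>\<^sub>1 \<in> forests n \<and> \<rho>\<^sub>2 \<in> forests n \<and> deg \<rho>\<^sub>1 + deg \<rho>\<^sub>2 \<le> n}.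
        \<phi>\<^sub>1 \<rho>\<^sub>1 * \<phi>\<^sub>2 \<rho>\<^sub>2 * a (\<rho>\<^sub>1 + \<rho>\<^sub>2))" (is "_ = sum _ ?S")
proof -
  have fin: "finite ?S"
    by (rule finite_subset[OF _ finite_cartesian_product[OF finite_forests finite_forests]]) auto
  have "(\<Sum>(\<rho>\<^sub>1, \<rho>\<^sub>2)\<in>?S. \<phi>\<^sub>1 \<rho>\<^sub>1 * \<phi>\<^sub>2 \<rho>\<^sub>2 * a (\<rho>\<^sub>1 + \<rho>\<^sub>2)) =
    (\<Sum>\<rho>\<in>forests n. \<Sum>(\<rho>\<^sub>1, \<rho>\<^sub>2)\<in>{q \<in> ?S. (\<lambda>(\<rho>\<^sub>1, \<rho>\<^sub>2). \<rho>\<^sub>1 + \<rho>\<^sub>2) q = \<rho>}.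
      \<phi>\<^sub>1 \<rho>\<^sub>1 * \<phi>\<^sub>2 \<rho>\<^sub>2 * a (\<rho>\<^sub>1 + \<rho>\<^sub>2))"
    by (rule sum.group[OF fin finite_forests, symmetric]) (auto simp: forests_def)
  also have "\<dots> = form_apply n (form_times n \<phi>\<^sub>1 \<phi>\<^sub>2) a"
    unfolding form_apply_def form_times_def real_scaleR_def sum_distrib_left
    by (intro sum.cong) auto
  finally show ?thesis ..
qed

lemma form_apply_graft:
  "form_apply n (form_graft n \<phi>\<^sub>1 \<phi>\<^sub>2) a =
     (\<Sum>(\<rho>, \<tau>)\<in>{(\<rho>, \<tau>). \<rho> \<in> forests n \<and> \<tau> \<in> trees n \<and> deg \<rho> + tree_deg \<tau> \<le> n}.
        \<phi>\<^sub>1 \<rho> * \<phi>\<^sub>2 {#\<tau>#} * a {#graft \<rho> \<tau>#})" (is "_ = sum _ ?S")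
proof -
  have fin: "finite ?S"
    by (rule finite_subset[OF _ finite_cartesian_product[OF finite_forests finite_trees]]) auto
  have deg_graft: "deg {#graft \<rho> \<tau>#} = deg \<rho> + tree_deg \<tau>" for \<rho> :: "'a forest" and \<tau>
    by (cases \<tau>) (simp add: graft_def deg_def)
  have "(\<Sum>(\<rho>, \<tau>)\<in>?S. \<phi>\<^sub>1 \<rho> * \<phi>\<^sub>2 {#\<tau>#} * a {#graft \<rho> \<tau>#}) =
    (\<Sum>\<rho>'\<in>forests n. \<Sum>(\<rho>, \<tau>)\<in>{q \<in> ?S. (\<lambda>(\<rho>, \<tau>). {#graft \<rho> \<tau>#}) q = \<rho>'}.
      \<phi>\<^sub>1 \<rho> * \<phi>\<^sub>2 {#\<tau>#} * a {#graft \<rho> \<tau>#})"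
    by (rule sum.group[OF fin finite_forests, symmetric]) (auto simp: forests_def deg_graft)
  also have "\<dots> = form_apply n (form_graft n \<phi>\<^sub>1 \<phi>\<^sub>2) a"
    unfolding form_apply_def form_graft_def real_scaleR_def sum_distrib_left
    by (intro sum.cong) auto
  finally show ?thesis ..
qed

section \<open>The rough integral\<close>

text \<open>The labels of the children are put in an arbitrary order; this does not matter where the
  derivatives exist, since they are symmetric.\<close>

definition tree_coeff ::
    "(real ^ 'd \<Rightarrow> (real ^ 'd) \<Rightarrow>\<^sub>L (real ^ 'e)) \<Rightarrow> 'd::finite tree \<Rightarrow> real ^ 'd \<Rightarrow> real ^ 'e"
  where
  "tree_coeff f \<tau> x = (if depth \<tau> \<le> 2
     then iter_deriv (\<lambda>z. blinfun_apply (f z) (axis (label \<tau>) 1))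
       (map (\<lambda>i. axis i 1) (SOME is. mset is = image_mset label (children \<tau>))) x
     else 0)"

definition integrand ::
    "nat \<Rightarrow> (real ^ 'd \<Rightarrow> (real ^ 'd) \<Rightarrow>\<^sub>L (real ^ 'e)) \<Rightarrow> (real \<Rightarrow> 'd::finite forest \<Rightarrow> real)
     \<Rightarrow> real \<Rightarrow> 'd forest \<Rightarrow> real ^ 'e" where
  "integrand n f X t \<rho> =
     (\<Sum>\<tau>\<in>{\<tau> \<in> trees n. {#\<tau>#} = \<rho>}. (1 / real (sym_factor \<tau>)) *\<^sub>R tree_coeff f \<tau> (proj1 (X t)))"

text \<open>\<open>is_rough_integral p T f X Y\<close> says that all the limits in the inductive construction of the
  rough integral of \<open>f\<close> along \<open>X\<close> exist and that \<open>Y s t\<close> is the resulting two-parameter family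
  on \<open>[0, T]\<close>. Here \<open>B s \<rho> t\<close> are the coefficients at time \<open>t\<close> of the one-form associated with
  \<open>t \<mapsto> Y s t \<rho>\<close>. The clauses for products and for trees of positive degree determine \<open>Y\<close> and
  \<open>B\<close> by recursion on the degree; at \<open>s = t\<close> they make \<open>Y s t\<close> the identity.\<close>

definition is_rough_integral ::
    "real \<Rightarrow> real \<Rightarrow> (real ^ 'd \<Rightarrow> (real ^ 'd) \<Rightarrow>\<^sub>L (real ^ 'e))
     \<Rightarrow> (real \<Rightarrow> 'd::finite forest \<Rightarrow> real)
     \<Rightarrow> (real \<Rightarrow> real \<Rightarrow> 'e::finite forest \<Rightarrow> real) \<Rightarrow> bool" where
  "is_rough_integral p T f X Y \<longleftrightarrow>
     (let n = level p; \<beta> = integrand n f X; \<beta>c = (\<lambda>j t \<rho>. \<beta> t \<rho> $ j)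
      in \<exists>y B.
        (\<forall>t. 0 \<le> t \<and> t \<le> T \<longrightarrow> has_form_integral n X \<beta> 0 t (y t)) \<and>
        (\<forall>s t. 0 \<le> s \<and> s \<le> t \<and> t \<le> T \<longrightarrow>
          Y s t \<in> carrier (char_group n) \<and>
          (\<forall>j. Y s t {#bullet j#} = y t $ j - y s $ j) \<and>
          (\<forall>j \<rho>. 1 \<le> deg \<rho> \<and> deg \<rho> \<le> n - 1 \<longrightarrow>
             has_form_integral n X (B s {#Node j \<rho>#}) s t (Y s t {#Node j \<rho>#})) \<and>
          (\<forall>j. B s {#bullet j#} t = \<beta>c j t) \<and>
          (\<forall>\<rho>\<^sub>1 \<rho>\<^sub>2. 1 \<le> deg \<rho>\<^sub>1 \<and> 1 \<le> deg \<rho>\<^sub>2 \<and> deg \<rho>\<^sub>1 + deg \<rho>\<^sub>2 \<le> n \<longrightarrow>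
             B s (\<rho>\<^sub>1 + \<rho>\<^sub>2) t = (\<lambda>\<rho>. Y s t \<rho>\<^sub>1 * B s \<rho>\<^sub>2 t \<rho> + Y s t \<rho>\<^sub>2 * B s \<rho>\<^sub>1 t \<rho> +
               form_times n (B s \<rho>\<^sub>1 t) (B s \<rho>\<^sub>2 t) \<rho>)) \<and>
          (\<forall>j \<rho>. 1 \<le> deg \<rho> \<and> deg \<rho> \<le> n - 1 \<longrightarrow>
             B s {#Node j \<rho>#} t = (\<lambda>\<rho>'. Y s t \<rho> * \<beta>c j t \<rho>' +
               form_graft n (B s \<rho> t) (\<beta>c j t) \<rho>'))))"

end

theory Submission
  imports Defs
begin

text \<open>Instead of the two components of the construction, the values of the integral and the one-forms
  attached to them, one follows a single functional on forests, the one-form together with the value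
  as its coefficient at the empty forest. Call such a functional controlled if at a later time it
  differs from its transport along the increment of \<open>X\<close> by \<open>\<omega>\<close> to the power \<open>(N - |\<tau>|) / p\<close> at each
  forest \<open>\<tau>\<close>, where \<open>\<omega>\<close> is a superadditive function dominating the increments and \<open>p < N\<close>. Taylor's
  formula makes the one-form of \<open>f\<close> controlled; products and graftings preserve the property, and the
  Riemann sums of a grafting have a defect of order \<open>\<omega>\<close> to the power \<open>N / p > 1\<close>, so the sewing lemma
  gives the integral, which is again controlled. The limit over all meshes requires \<open>\<omega>\<close> to be small
  on short intervals; the variation of a higher exponent \<open>q < N\<close> has this property, and for the
  quantitative bound it is combined with the \<open>p\<close>-variation. Continuity follows by interpolating the
  defect of a difference between its order in \<open>\<omega>\<close> and its smallness.\<close>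

section \<open>Sums over the coproduct\<close>

text \<open>Storing the value as the coefficient at the empty forest turns the product rule and the
  grafting rule for one-forms into the same kind of truncated convolution. The transport respects it
  except for pairs of forests of total degree above n, where the pruned parts have degree at least n
  + 1 - |\<tau>|. This fixes N: it is n plus the Hoelder exponent of the derivatives of order n - 1,
  capped at 1, so that N is at most n + 1, and it exceeds p because \<gamma> and n + 1 do. Powers
  are compared under \<omega> at most 1. Rescaling \<omega> achieves this with constants that depend
  on X: harmless for existence, and enough for continuity once they are uniform near X, but too weak
  for the estimate. The estimate is therefore proved where \<omega> is at most 1 anyway, with
  constants depending only on p, \<gamma> and the label types, and Chen's relation extends it: a
  long interval is cut into a number of pieces proportional to \<omega>, whence the p-th power of
  the variation. Each vertex of a forest contributes one factor of the norm of f, so the homogeneous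
  norm of the integral is linear in it.\<close>

lemma forest_induct [case_names empty node plus]:
  assumes e: "P {#}" and nd: "\<And>i \<rho>. P \<rho> \<Longrightarrow> P {#Node i \<rho>#}"
    and pl: "\<And>\<rho>\<^sub>1 \<rho>\<^sub>2. P \<rho>\<^sub>1 \<Longrightarrow> P \<rho>\<^sub>2 \<Longrightarrow> P (\<rho>\<^sub>1 + \<rho>\<^sub>2)"
  shows "P (\<rho> :: 'l forest)"
proof -
  have aux: "P \<rho>" if "\<And>\<tau>. \<tau> \<in># \<rho> \<Longrightarrow> P {#\<tau>#}" for \<rho>
    using that
  proof (induction \<rho>)
    case (add \<tau> \<rho>)
    then have "P ({#\<tau>#} + \<rho>)" by (intro pl) auto
    then show ?case by simp
  qed (rule e)
  have "P {#\<tau>#}" for \<tau>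
  proof (induction \<tau>)
    case (Node i \<rho>)
    then have "P \<rho>" by (rule aux)
    then show ?case by (rule nd)
  qed
  then show ?thesis by (rule aux)
qed

text \<open>A bilinear map evaluated on the coproduct. The Hopf algebra identities are stated for
  all such evaluations, so multisets of tensors never have to be compared.\<close>

definition cop_sum :: "'l forest \<Rightarrow> ('l forest \<Rightarrow> 'l forest \<Rightarrow> real) \<Rightarrow> real" where
  "cop_sum \<rho> F = (\<Sum>(x, y)\<in>#coproduct \<rho>. F x y)"

lemma cop_sum_empty [simp]: "cop_sum {#} F = F {#} {#}"
  by (simp add: cop_sum_def coproduct_empty)

lemma cop_sum_Node:
  "cop_sum {#Node i \<rho>#} F = F {#Node i \<rho>#} {#} + cop_sum \<rho> (\<lambda>x y. F x {#Node i y#})"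
  by (simp add: cop_sum_def coproduct_Node multiset.map_comp comp_def case_prod_unfold)

lemma sum_mset_tensor_times:
  "(\<Sum>(x, y)\<in>#tensor_times A B. F x y) =
     (\<Sum>(a, b)\<in>#A. \<Sum>(c, d)\<in>#B. F (a + c) (b + d))"
  by (induction A) (auto simp: multiset.map_comp comp_def case_prod_unfold)

lemma cop_sum_plus:
  "cop_sum (\<rho> + \<rho>') F = cop_sum \<rho> (\<lambda>a b. cop_sum \<rho>' (\<lambda>c d. F (a + c) (b + d)))"
  by (simp add: cop_sum_def coproduct_plus sum_mset_tensor_times)

lemma cop_sum_cong:
  assumes "\<And>x y. (x, y) \<in># coproduct \<rho> \<Longrightarrow> F x y = G x y"
  shows "cop_sum \<rho> F = cop_sum \<rho> G"
  unfolding cop_sum_def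
  by (rule arg_cong[where f = sum_mset], rule image_mset_cong) (use assms in auto)

lemma cop_sum_add: "cop_sum \<rho> (\<lambda>x y. F x y + G x y) = cop_sum \<rho> F + cop_sum \<rho> G"
  by (simp add: cop_sum_def case_prod_unfold sum_mset.distrib)

lemma cop_sum_mult_left: "cop_sum \<rho> (\<lambda>x y. c * F x y) = c * cop_sum \<rho> F"
  by (simp add: cop_sum_def case_prod_unfold sum_mset_distrib_left)

lemma cop_sum_mult_right: "cop_sum \<rho> (\<lambda>x y. F x y * c) = cop_sum \<rho> F * c"
  using cop_sum_mult_left[of \<rho> c F] by (simp add: mult.commute)

lemma cop_sum_zero [simp]: "cop_sum \<rho> (\<lambda>x y. 0) = 0"
  by (simp add: cop_sum_def case_prod_unfold)

lemma cop_sum_diff: "cop_sum \<rho> (\<lambda>x y. F x y - G x y) = cop_sum \<rho> F - cop_sum \<rho> G"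
  using cop_sum_add[of \<rho> F "\<lambda>x y. - 1 * G x y"] cop_sum_mult_left[of \<rho> "-1" G] by simp

lemma cop_sum_sum:
  "cop_sum \<rho> (\<lambda>x y. \<Sum>i\<in>A. F i x y) = (\<Sum>i\<in>A. cop_sum \<rho> (F i))"
  by (induction A rule: infinite_finite_induct) (simp_all add: cop_sum_add)

lemma cop_sum_swap:
  "cop_sum \<rho> (\<lambda>x y. cop_sum \<rho>' (F x y)) = cop_sum \<rho>' (\<lambda>x' y'. cop_sum \<rho> (\<lambda>x y. F x y x' y'))"
proof -
  have "cop_sum \<rho> (\<lambda>x y. \<Sum>(x', y')\<in>#M. F x y x' y') = (\<Sum>(x', y')\<in>#M. cop_sum \<rho> (\<lambda>x y. F x y x' y'))"
    for M by (induction M) (auto simp: cop_sum_add)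
  then show ?thesis unfolding cop_sum_def[of \<rho>'] .
qed

lemma cop_sum_abs_le:
  assumes "\<And>x y. (x, y) \<in># coproduct \<rho> \<Longrightarrow> \<bar>F x y\<bar> \<le> B"
  shows "\<bar>cop_sum \<rho> F\<bar> \<le> real (size (coproduct \<rho>)) * B"
proof -
  have "\<bar>\<Sum>(x, y)\<in>#M. F x y\<bar> \<le> real (size M) * B" if "\<And>x y. (x, y) \<in># M \<Longrightarrow> \<bar>F x y\<bar> \<le> B" for M
    using that
  proof (induction M)
    case (add z M)
    have "\<bar>F (fst z) (snd z)\<bar> \<le> B" using add.prems[of "fst z" "snd z"] by simp
    moreover have "\<bar>\<Sum>(x, y)\<in>#M. F x y\<bar> \<le> real (size M) * B"
      by (rule add.IH) (use add.prems in auto)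
    ultimately show ?case by (simp add: case_prod_unfold algebra_simps)
  qed simp
  then show ?thesis using assms by (simp add: cop_sum_def)
qed

text \<open>Coassociativity, tested against all trilinear maps. Since \<open>G\<close> is arbitrary,
  the root added by \<open>Node\<close> can be absorbed into it, and the node case needs only the
  hypothesis for the forest below the root.\<close>

lemma cop_sum_coassoc:
  "cop_sum \<rho> (\<lambda>a b. cop_sum a (\<lambda>c d. G c d b)) = cop_sum \<rho> (\<lambda>a b. cop_sum b (\<lambda>c d. G a c d))"
proof (induction \<rho> arbitrary: G rule: forest_induct)
  case (node i \<rho>)
  have "cop_sum \<rho> (\<lambda>a b. cop_sum {#Node i b#} (G a)) =
    cop_sum \<rho> (\<lambda>x y. G x {#Node i y#} {#}) +
    cop_sum \<rho> (\<lambda>x y. cop_sum y (\<lambda>c d. G x c {#Node i d#}))"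
    by (simp add: cop_sum_Node cop_sum_add)
  then show ?case
    using node[of "\<lambda>x c d. G x c {#Node i d#}"] by (simp add: cop_sum_Node)
next
  case (plus \<rho> \<rho>')
  have "cop_sum (\<rho> + \<rho>') (\<lambda>a b. cop_sum a (\<lambda>c d. G c d b)) =
      cop_sum \<rho> (\<lambda>a b. cop_sum \<rho>' (\<lambda>a' b'. cop_sum a (\<lambda>c d. cop_sum a' (\<lambda>c' d'. G (c + c') (d + d') (b + b')))))"
    by (simp only: cop_sum_plus)
  also have "\<dots> = cop_sum \<rho> (\<lambda>a b. cop_sum a (\<lambda>c d. cop_sum \<rho>' (\<lambda>a' b'. cop_sum a' (\<lambda>c' d'. G (c + c') (d + d') (b + b')))))"
    by (intro cop_sum_cong cop_sum_swap)
  also have "\<dots> = cop_sum \<rho> (\<lambda>a b. cop_sum b (\<lambda>c d. cop_sum \<rho>' (\<lambda>a' b'. cop_sum b' (\<lambda>c' d'. G (a + a') (c + c') (d + d')))))"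
    by (simp only: plus.IH)
  also have "\<dots> = cop_sum \<rho> (\<lambda>a b. cop_sum \<rho>' (\<lambda>a' b'. cop_sum b (\<lambda>c d. cop_sum b' (\<lambda>c' d'. G (a + a') (c + c') (d + d')))))"
    by (intro cop_sum_cong cop_sum_swap[symmetric])
  also have "\<dots> = cop_sum (\<rho> + \<rho>') (\<lambda>a b. cop_sum b (\<lambda>c d. G a c d))"
    by (simp only: cop_sum_plus)
  finally show ?case .
qed simp

lemma cop_sum_counit_right: "cop_sum \<rho> (\<lambda>x y. F x * of_bool (y = {#})) = F \<rho>"
proof (induction \<rho> arbitrary: F rule: forest_induct)
  case (node i \<rho>)
  then show ?case by (simp add: cop_sum_Node)
next
  case (plus \<rho>\<^sub>1 \<rho>\<^sub>2)
  have "F (x + x') * of_bool (y = {#} \<and> y' = {#}) = F (x + x') * of_bool (y' = {#}) * of_bool (y = {#})"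
    for x x' and y y' :: "'a forest" by (cases "y = {#}") auto
  then show ?case
    by (simp only: cop_sum_plus union_eq_empty cop_sum_mult_right plus.IH)
qed simp

lemma cop_sum_counit_left: "cop_sum \<rho> (\<lambda>x y. of_bool (x = {#}) * F y) = F \<rho>"
proof (induction \<rho> arbitrary: F rule: forest_induct)
  case (node i \<rho>)
  then show ?case by (simp add: cop_sum_Node)
next
  case (plus \<rho>\<^sub>1 \<rho>\<^sub>2)
  have "of_bool (x = {#} \<and> x' = {#}) * F (y + y') = of_bool (x = {#}) * (of_bool (x' = {#}) * F (y + y'))"
    for y y' and x x' :: "'a forest" by simp
  then show ?case
    by (simp only: cop_sum_plus union_eq_empty cop_sum_mult_left plus.IH)
qed simp

lemma coproduct_deg:
  assumes "(x, y) \<in># coproduct \<rho>"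
  shows "deg x + deg y = deg \<rho>"
  using assms
proof (induction \<rho> arbitrary: x y rule: forest_induct)
  case empty
  then show ?case by (simp add: coproduct_empty)
next
  case (node i \<rho>)
  then show ?case by (fastforce simp: coproduct_Node)
next
  case (plus \<rho>\<^sub>1 \<rho>\<^sub>2)
  then show ?case by (fastforce simp: coproduct_plus tensor_times_def)
qed

lemma coproduct_fst_deg: "(x, y) \<in># coproduct \<rho> \<Longrightarrow> deg x \<le> deg \<rho>"
  and coproduct_snd_deg: "(x, y) \<in># coproduct \<rho> \<Longrightarrow> deg y \<le> deg \<rho>"
  using coproduct_deg by fastforce+

lemma deg_eq_0_iff [simp]: "deg \<rho> = 0 \<longleftrightarrow> \<rho> = {#}"
  using size_le_deg[of \<rho>] by auto

section \<open>The group of truncated characters\<close>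

definition star :: "nat \<Rightarrow> ('l forest \<Rightarrow> real) \<Rightarrow> ('l forest \<Rightarrow> real) \<Rightarrow> 'l forest \<Rightarrow> real" where
  "star n a b = (\<lambda>\<rho>. if deg \<rho> \<le> n then cop_sum \<rho> (\<lambda>x y. a x * b y) else 0)"

lemma char_group_simps [simp]:
  "carrier (char_group n) = characters n"
  "a \<otimes>\<^bsub>char_group n\<^esub> b = star n a b"
  "\<one>\<^bsub>char_group n\<^esub> = (\<lambda>\<rho>. if \<rho> = {#} then 1 else 0)"
  by (simp_all add: char_group_def star_def cop_sum_def fun_eq_iff)

lemma characters_empty [simp]: "a \<in> characters n \<Longrightarrow> a {#} = 1"
  unfolding characters_def by blast

lemma characters_plus:
  "a \<in> characters n \<Longrightarrow> deg \<rho>\<^sub>1 + deg \<rho>\<^sub>2 \<le> n \<Longrightarrow> a (\<rho>\<^sub>1 + \<rho>\<^sub>2) = a \<rho>\<^sub>1 * a \<rho>\<^sub>2"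
  unfolding characters_def by blast

lemma characters_high: "a \<in> characters n \<Longrightarrow> n < deg \<rho> \<Longrightarrow> a \<rho> = 0"
  unfolding characters_def by blast

lemma charactersI:
  assumes "a {#} = 1" "\<And>\<rho>\<^sub>1 \<rho>\<^sub>2. deg \<rho>\<^sub>1 + deg \<rho>\<^sub>2 \<le> n \<Longrightarrow> a (\<rho>\<^sub>1 + \<rho>\<^sub>2) = a \<rho>\<^sub>1 * a \<rho>\<^sub>2"
    "\<And>\<rho>. n < deg \<rho> \<Longrightarrow> a \<rho> = 0"
  shows "a \<in> characters n"
  unfolding characters_def using assms by blast

lemma star_plus:
  assumes a: "a \<in> characters n" and b: "b \<in> characters n" and d: "deg \<rho>\<^sub>1 + deg \<rho>\<^sub>2 \<le> n"
  shows "cop_sum (\<rho>\<^sub>1 + \<rho>\<^sub>2) (\<lambda>x y. a x * b y) = cop_sum \<rho>\<^sub>1 (\<lambda>x y. a x * b y) * cop_sum \<rho>\<^sub>2 (\<lambda>x y. a x * b y)"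
proof -
  have "cop_sum (\<rho>\<^sub>1 + \<rho>\<^sub>2) (\<lambda>x y. a x * b y) =
      cop_sum \<rho>\<^sub>1 (\<lambda>x y. cop_sum \<rho>\<^sub>2 (\<lambda>x' y'. (a x * b y) * (a x' * b y')))"
    unfolding cop_sum_plus
  proof (intro cop_sum_cong)
    fix x y x' y' assume "(x, y) \<in># coproduct \<rho>\<^sub>1" "(x', y') \<in># coproduct \<rho>\<^sub>2"
    from this[THEN coproduct_deg] d have "deg x + deg x' \<le> n" "deg y + deg y' \<le> n" by auto
    then show "a (x + x') * b (y + y') = (a x * b y) * (a x' * b y')"
      using a b by (simp add: characters_plus)
  qed
  then show ?thesis by (simp add: cop_sum_mult_left cop_sum_mult_right)
qed

lemma star_closed: "a \<in> characters n \<Longrightarrow> b \<in> characters n \<Longrightarrow> star n a b \<in> characters n"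
  by (rule charactersI) (simp_all add: star_def star_plus)

lemma star_assoc: "star n (star n a b) c = star n a (star n b c)"
proof
  fix \<rho> :: "'a forest"
  show "star n (star n a b) c \<rho> = star n a (star n b c) \<rho>"
  proof (cases "deg \<rho> \<le> n")
    case True
    have "star n (star n a b) c \<rho> = cop_sum \<rho> (\<lambda>x y. cop_sum x (\<lambda>u v. a u * b v * c y))"
      unfolding star_def using True
      by (auto intro!: cop_sum_cong dest: coproduct_fst_deg simp: cop_sum_mult_right)
    also have "\<dots> = cop_sum \<rho> (\<lambda>x y. cop_sum y (\<lambda>u v. a x * b u * c v))"
      by (rule cop_sum_coassoc)
    also have "\<dots> = star n a (star n b c) \<rho>"
      unfolding star_def using True
      by (auto intro!: cop_sum_cong dest: coproduct_snd_deg simp: cop_sum_mult_left[symmetric] mult.assoc)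
    finally show ?thesis .
  qed (simp add: star_def)
qed

text \<open>Solves \<open>b a = 1\<close> for \<open>b\<close> degree by degree: the term whose
  unpruned part is empty isolates \<open>b \<rho>\<close>, and every other term has a pruned part of
  smaller degree. The filter makes this restriction visible to the termination proof. No truncation
  enters, so the recursion is the same for every \<open>n\<close>.\<close>

function star_inv :: "('l forest \<Rightarrow> real) \<Rightarrow> 'l forest \<Rightarrow> real" where
  "star_inv a \<rho> = (if \<rho> = {#} then 1 else
     - (\<Sum>z\<in>#filter_mset (\<lambda>z. snd z \<noteq> {#}) (coproduct \<rho>). star_inv a (fst z) * a (snd z)))"
  by auto
termination
proof (relation "Wellfounded.measure (\<lambda>(a, \<rho>). deg \<rho>)", goal_cases)
  case (2 a \<rho> z)
  then have "deg (fst z) + deg (snd z) = deg \<rho>" "0 < deg (snd z)"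
    using coproduct_deg[of "fst z" "snd z" \<rho>] by (auto simp: zero_less_iff_neq_zero)
  then show ?case by simp
qed simp

declare star_inv.simps [simp del]

lemma star_inv_empty [simp]: "star_inv a {#} = 1"
  by (simp add: star_inv.simps)

lemma sum_mset_filter:
  "(\<Sum>z\<in>#filter_mset P M. f z) = (\<Sum>z\<in>#M. of_bool (P z) * (f z :: real))"
  by (induction M) auto

lemma star_inv_rec:
  assumes "\<rho> \<noteq> {#}"
  shows "star_inv a \<rho> = - cop_sum \<rho> (\<lambda>x y. of_bool (y \<noteq> {#}) * (star_inv a x * a y))"
  using assms by (subst star_inv.simps) (simp add: sum_mset_filter cop_sum_def case_prod_unfold)

lemma cop_sum_star_inv:
  assumes "a {#} = 1"
  shows "cop_sum \<rho> (\<lambda>x y. star_inv a x * a y) = of_bool (\<rho> = {#})"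
proof (cases "\<rho> = {#}")
  case False
  have "star_inv a x * a y = star_inv a x * of_bool (y = {#}) + of_bool (y \<noteq> {#}) * (star_inv a x * a y)"
    for x y using assms by auto
  then have "cop_sum \<rho> (\<lambda>x y. star_inv a x * a y) =
      cop_sum \<rho> (\<lambda>x y. star_inv a x * of_bool (y = {#}) + of_bool (y \<noteq> {#}) * (star_inv a x * a y))"
    by (intro cop_sum_cong)
  then show ?thesis
    using False star_inv_rec[OF False, of a] by (simp only: cop_sum_add cop_sum_counit_right) simp
qed (use assms in simp)

text \<open>Both sides of the multiplicativity of the inverse are left inverse to \<open>a \<otimes> a\<close>; expanding
  their difference over the two coproducts, only the leading term survives the induction.\<close>

lemma star_inv_plus:
  assumes a: "a \<in> characters n" and "deg \<rho>\<^sub>1 + deg \<rho>\<^sub>2 \<le> n"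
  shows "star_inv a (\<rho>\<^sub>1 + \<rho>\<^sub>2) = star_inv a \<rho>\<^sub>1 * star_inv a \<rho>\<^sub>2"
  using assms(2)
proof (induction "deg \<rho>\<^sub>1 + deg \<rho>\<^sub>2" arbitrary: \<rho>\<^sub>1 \<rho>\<^sub>2 rule: less_induct)
  case less
  define D where "D x x' = star_inv a (x + x') - star_inv a x * star_inv a x'" for x x'
  have "0 = cop_sum (\<rho>\<^sub>1 + \<rho>\<^sub>2) (\<lambda>x y. star_inv a x * a y) -
      cop_sum \<rho>\<^sub>1 (\<lambda>x y. star_inv a x * a y) * cop_sum \<rho>\<^sub>2 (\<lambda>x y. star_inv a x * a y)"
    using a by (simp add: cop_sum_star_inv)
  also have "\<dots> = cop_sum \<rho>\<^sub>1 (\<lambda>x y. cop_sum \<rho>\<^sub>2 (\<lambda>x' y'.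
      star_inv a (x + x') * a (y + y') - (star_inv a x * a y) * (star_inv a x' * a y')))"
    by (simp add: cop_sum_plus cop_sum_diff cop_sum_mult_left cop_sum_mult_right)
  also have "\<dots> = cop_sum \<rho>\<^sub>1 (\<lambda>x y. cop_sum \<rho>\<^sub>2 (\<lambda>x' y'.
      D x x' * of_bool (y' = {#}) * of_bool (y = {#})))"
  proof (intro cop_sum_cong)
    fix x y x' y' assume *: "(x, y) \<in># coproduct \<rho>\<^sub>1" "(x', y') \<in># coproduct \<rho>\<^sub>2"
    note deg = *[THEN coproduct_deg]
    then have "a (y + y') = a y * a y'" using a less.prems by (simp add: characters_plus)
    moreover have "D x x' = 0" if "\<not> (y = {#} \<and> y' = {#})"
    proof -
      from that have "deg y + deg y' \<noteq> 0" by simp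
      then have "deg x + deg x' < deg \<rho>\<^sub>1 + deg \<rho>\<^sub>2" using deg by linarith
      with less show ?thesis by (simp add: D_def)
    qed
    ultimately show "star_inv a (x + x') * a (y + y') - (star_inv a x * a y) * (star_inv a x' * a y') =
        D x x' * of_bool (y' = {#}) * of_bool (y = {#})"
      using a by (cases "y = {#} \<and> y' = {#}") (auto simp: D_def algebra_simps)
  qed
  also have "\<dots> = D \<rho>\<^sub>1 \<rho>\<^sub>2"
    by (simp only: cop_sum_mult_right cop_sum_counit_right)
  finally show ?case by (simp add: D_def)
qed

text \<open>A left unit and left inverses suffice. The inverse is \<open>star_inv\<close> cut off
  above degree \<open>n\<close>, since elements of the carrier vanish there.\<close>

lemma group_char_group: "group (char_group n :: ('l forest \<Rightarrow> real) monoid)"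
proof (rule groupI; unfold char_group_simps)
  show "(\<lambda>\<rho>. if \<rho> = {#} then 1 else 0) \<in> characters n" by (rule charactersI) auto
next
  fix a b c :: "'l forest \<Rightarrow> real"
  assume a: "a \<in> characters n" and b: "b \<in> characters n"
  show "star n a b \<in> characters n" using a b by (rule star_closed)
  show "star n (star n a b) c = star n a (star n b c)" by (rule star_assoc)
  have "cop_sum \<rho> (\<lambda>x y. (if x = {#} then 1 else 0) * a y) = a \<rho>" for \<rho>
    using cop_sum_counit_left[of \<rho> a] by (simp add: of_bool_def)
  then show "star n (\<lambda>\<rho>. if \<rho> = {#} then 1 else 0) a = a"
    using a by (auto simp: star_def fun_eq_iff characters_high)
  define a' where "a' \<rho> = (if deg \<rho> \<le> n then star_inv a \<rho> else 0)" for \<rho>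
  have "a' \<in> characters n"
    by (rule charactersI) (simp_all add: a'_def star_inv_plus[OF a])
  moreover have "star n a' a \<rho> = (if \<rho> = {#} then 1 else 0)" for \<rho>
  proof (cases "deg \<rho> \<le> n")
    case True
    then have "star n a' a \<rho> = cop_sum \<rho> (\<lambda>x y. star_inv a x * a y)"
      by (auto simp: star_def a'_def intro!: cop_sum_cong dest: coproduct_fst_deg)
    then show ?thesis using cop_sum_star_inv[of a \<rho>] a by simp
  qed (auto simp: star_def)
  ultimately show "\<exists>y\<in>characters n. star n y a = (\<lambda>\<rho>. if \<rho> = {#} then 1 else 0)" by blast
qed

text \<open>The group inverse is known only through its defining property, but a left inverse is
  forced by the recursion. The explicit form is what makes increments depend continuously on the
  path.\<close>

lemma inv_char_group:
  assumes a: "a \<in> characters n" and d: "deg \<rho> \<le> n"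
  shows "(inv\<^bsub>char_group n\<^esub> a) \<rho> = star_inv a \<rho>"
proof -
  interpret group "char_group n" by (rule group_char_group)
  define b where "b = inv\<^bsub>char_group n\<^esub> a"
  have b: "b \<in> characters n" "star n b a = (\<lambda>\<rho>. if \<rho> = {#} then 1 else 0)"
    using a inv_closed[of a] l_inv[of a] by (simp_all add: b_def)
  have "b \<rho> = star_inv a \<rho>" using d
  proof (induction "deg \<rho>" arbitrary: \<rho> rule: less_induct)
    case less
    have "0 = cop_sum \<rho> (\<lambda>x y. b x * a y) - cop_sum \<rho> (\<lambda>x y. star_inv a x * a y)"
      using fun_cong[OF b(2), of \<rho>] less.prems a by (simp add: star_def cop_sum_star_inv of_bool_def)
    also have "\<dots> = cop_sum \<rho> (\<lambda>x y. (b x - star_inv a x) * of_bool (y = {#}))"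
      unfolding cop_sum_diff[symmetric]
    proof (intro cop_sum_cong)
      fix x y assume "(x, y) \<in># coproduct \<rho>"
      note dg = coproduct_deg[OF this]
      show "b x * a y - star_inv a x * a y = (b x - star_inv a x) * of_bool (y = {#})"
      proof (cases "y = {#}")
        case False
        then have "deg x < deg \<rho>" using dg by (metis deg_eq_0_iff less_add_same_cancel1 not_gr_zero)
        with less show ?thesis by simp
      qed (use a in simp)
    qed
    also have "\<dots> = b \<rho> - star_inv a \<rho>" by (rule cop_sum_counit_right)
    finally show ?case by simp
  qed
  then show ?thesis by (simp add: b_def)
qed

context
  fixes n :: nat and X :: "real \<Rightarrow> 'l forest \<Rightarrow> real" and S :: "real set"
  assumes X: "X ` S \<subseteq> characters n"
begin

lemma increment_in: "s \<in> S \<Longrightarrow> t \<in> S \<Longrightarrow> increment n X s t \<in> characters n"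
proof -
  assume "s \<in> S" "t \<in> S"
  interpret group "char_group n" by (rule group_char_group)
  show ?thesis using inv_closed[of "X s"] m_closed[of "inv\<^bsub>char_group n\<^esub> X s" "X t"] X \<open>s \<in> S\<close> \<open>t \<in> S\<close>
    by (auto simp: increment_def)
qed

lemma increment_chen:
  "s \<in> S \<Longrightarrow> t \<in> S \<Longrightarrow> u \<in> S \<Longrightarrow> star n (increment n X s t) (increment n X t u) = increment n X s u"
proof -
  assume "s \<in> S" "t \<in> S" "u \<in> S"
  interpret group "char_group n" by (rule group_char_group)
  have "X s \<in> carrier (char_group n)" "X t \<in> carrier (char_group n)" "X u \<in> carrier (char_group n)"
    using X \<open>s \<in> S\<close> \<open>t \<in> S\<close> \<open>u \<in> S\<close> by auto
  then have "(inv\<^bsub>char_group n\<^esub> X s \<otimes>\<^bsub>char_group n\<^esub> X t) \<otimes>\<^bsub>char_group n\<^esub> (inv\<^bsub>char_group n\<^esub> X t \<otimes>\<^bsub>char_group n\<^esub> X u)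
     = inv\<^bsub>char_group n\<^esub> X s \<otimes>\<^bsub>char_group n\<^esub> X u"
    by (simp only: m_assoc inv_closed m_closed) (simp only: m_assoc[symmetric] inv_closed m_closed r_inv l_one)
  then show ?thesis by (simp add: increment_def)
qed

lemma increment_path: "s \<in> S \<Longrightarrow> t \<in> S \<Longrightarrow> star n (X s) (increment n X s t) = X t"
proof -
  assume "s \<in> S" "t \<in> S"
  interpret group "char_group n" by (rule group_char_group)
  have "X s \<in> carrier (char_group n)" "X t \<in> carrier (char_group n)"
    using X \<open>s \<in> S\<close> \<open>t \<in> S\<close> by auto
  then have "X s \<otimes>\<^bsub>char_group n\<^esub> (inv\<^bsub>char_group n\<^esub> X s \<otimes>\<^bsub>char_group n\<^esub> X t) = X t"
    by (simp only: m_assoc[symmetric] inv_closed r_inv l_one)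
  then show ?thesis by (simp add: increment_def)
qed

lemma increment_self: "s \<in> S \<Longrightarrow> increment n X s s = (\<lambda>\<rho>. if \<rho> = {#} then 1 else 0)"
proof -
  assume "s \<in> S"
  interpret group "char_group n" by (rule group_char_group)
  show ?thesis using l_inv[of "X s"] X \<open>s \<in> S\<close> by (auto simp: increment_def)
qed

lemma increment_eqI:
  "s \<in> S \<Longrightarrow> t \<in> S \<Longrightarrow> z \<in> characters n \<Longrightarrow> star n (X s) z = X t \<Longrightarrow> increment n X s t = z"
proof -
  assume *: "s \<in> S" "t \<in> S" "z \<in> characters n" "star n (X s) z = X t"
  interpret group "char_group n" by (rule group_char_group)
  have c: "X s \<in> carrier (char_group n)" "z \<in> carrier (char_group n)"
    using X * by auto
  then have "inv\<^bsub>char_group n\<^esub> X s \<otimes>\<^bsub>char_group n\<^esub> (X s \<otimes>\<^bsub>char_group n\<^esub> z) = z"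
    by (simp only: m_assoc[symmetric] inv_closed l_inv l_one)
  then show ?thesis using * by (simp add: increment_def)
qed

end

lemma proj1_increment:
  assumes "X ` S \<subseteq> characters n" "s \<in> S" "t \<in> S" "1 \<le> n"
  shows "proj1 (X t) $ i - proj1 (X s) $ i = increment n X s t {#bullet i#}"
  using fun_cong[OF increment_path[OF assms(1-3)], of "{#bullet i#}"] assms increment_in[OF assms(1-3)]
  by (auto simp: proj1_def star_def cop_sum_Node image_subset_iff)

section \<open>Partitions and sewing\<close>

lemma partition_sum_single [simp]: "partition_sum g [x] = 0"
  by (simp add: partition_sum_def)

lemma partition_sum_Cons [simp]: "partition_sum g (x # y # r) = g x y + partition_sum g (y # r)"
  by (simp add: partition_sum_def sum.lessThan_Suc_shift del: sum.lessThan_Suc)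

lemma partition_sum_append:
  "partition_sum g (xs @ u # ys) = partition_sum g (xs @ [u]) + partition_sum g (u # ys)"
proof (induction xs)
  case (Cons a xs)
  then show ?case by (cases xs) (simp_all add: add.assoc)
qed simp

lemma mesh_single [simp]: "mesh [x] = 0"
  by (simp add: mesh_def)

lemma mesh_Cons [simp]: "mesh (x # y # r) = max (y - x) (mesh (y # r))"
  by (simp add: mesh_def lessThan_Suc_eq_insert_0 image_image insert_commute[of 0])

lemma partitions_single [simp]: "[x] \<in> partitions s t \<longleftrightarrow> x = s \<and> x = t"
  by (auto simp: partitions_def)

lemma partitions_Cons: "x # y # r \<in> partitions s t \<longleftrightarrow> x = s \<and> x < y \<and> y # r \<in> partitions y t"
  by (auto simp: partitions_def)

lemma partitions_nonempty [simp]: "[] \<notin> partitions s t"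
  by (simp add: partitions_def)

lemma partitions_hd: "x # r \<in> partitions s t \<Longrightarrow> x = s"
  by (simp add: partitions_def)

lemma partitions_append:
  "xs @ u # ys \<in> partitions s t \<longleftrightarrow> xs @ [u] \<in> partitions s u \<and> u # ys \<in> partitions u t"
proof (induction xs arbitrary: s)
  case Nil
  then show ?case by (auto simp: partitions_def)
next
  case (Cons a xs)
  show ?case
  proof (cases xs)
    case Nil
    then show ?thesis by (auto simp: partitions_Cons)
  next
    case (Cons b zs)
    then show ?thesis using Cons.IH[of b] by (simp add: partitions_Cons)
  qed
qed

lemma partitions_induct [consumes 1, case_names single step]:
  assumes "D \<in> partitions s t"
    and single: "P t [t]"
    and step: "\<And>s y r. s < y \<Longrightarrow> y \<le> t \<Longrightarrow> y # r \<in> partitions y t \<Longrightarrow> P y (y # r) \<Longrightarrow> P s (s # y # r)"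
  shows "P s D"
proof -
  have "P s D \<and> s \<le> t" using assms(1)
  proof (induction D arbitrary: s)
    case (Cons x D)
    show ?case
    proof (cases D)
      case Nil
      then show ?thesis using Cons.prems single by auto
    next
      case (Cons y r)
      with Cons.prems have *: "x = s" "s < y" "y # r \<in> partitions y t" by (auto simp: partitions_Cons)
      then show ?thesis using Cons.IH[of y] step[of s y r] Cons by simp
    qed
  qed simp
  then show ?thesis ..
qed

lemma partitions_le: "D \<in> partitions s t \<Longrightarrow> s \<le> t"
  by (induction rule: partitions_induct) auto

lemma partitions_range: "D \<in> partitions s t \<Longrightarrow> x \<in> set D \<Longrightarrow> s \<le> x \<and> x \<le> t"
proof (induction arbitrary: x rule: partitions_induct)
  case (step s y r)
  then show ?case by (cases "x = s") force+
qed simp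

lemma mesh_nonneg: "D \<in> partitions s t \<Longrightarrow> 0 \<le> mesh D"
  by (induction rule: partitions_induct) auto

lemma mesh_append:
  "mesh (xs @ u # ys) = (if xs = [] then mesh (u # ys) else max (mesh (xs @ [u])) (mesh (u # ys)))"
  if "xs @ u # ys \<in> partitions s t"
  using that
proof (induction xs arbitrary: s)
  case (Cons a xs)
  show ?case
  proof (cases xs)
    case Nil
    then show ?thesis using Cons.prems mesh_nonneg[of "u # ys" u t] by (auto simp: partitions_Cons)
  next
    case (Cons b zs)
    then show ?thesis using Cons.IH[of b] Cons.prems by (auto simp: partitions_Cons)
  qed
qed simp

lemma partition_exists:
  assumes "s \<le> t" "0 < (\<delta>::real)"
  shows "\<exists>D\<in>partitions s t. mesh D < \<delta>"
proof -
  \<comment> \<open>The mesh bound is strict, so steps of length \<open>\<delta> / 2\<close> are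
    taken; \<open>k\<close> bounds their number.\<close>
  obtain k :: nat where "(t - s) / (\<delta> / 2) \<le> real k" using real_arch_simple by blast
  then have "t - s \<le> real k * (\<delta> / 2)" using assms by (simp add: field_simps)
  then show ?thesis using assms(1)
  proof (induction k arbitrary: s)
    case 0
    then show ?case using assms by (intro bexI[of _ "[s]"]) auto
  next
    case (Suc k)
    show ?case
    proof (cases "s + \<delta> / 2 \<le> t")
      case True
      have "t - (s + \<delta> / 2) \<le> real k * (\<delta> / 2)" using Suc.prems by (simp add: field_simps)
      from Suc.IH[OF this True] obtain D where D: "D \<in> partitions (s + \<delta> / 2) t" "mesh D < \<delta>" by blast
      then obtain r where "D = (s + \<delta> / 2) # r" by (cases D) (auto dest: partitions_hd)
      with D assms(2) show ?thesis by (intro bexI[of _ "s # D"]) (auto simp: partitions_Cons)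
    next
      case False
      show ?thesis
      proof (cases "s = t")
        case True
        then show ?thesis using assms by (intro bexI[of _ "[s]"]) auto
      next
        case False
        with \<open>\<not> s + \<delta> / 2 \<le> t\<close> Suc.prems show ?thesis using assms
          by (intro bexI[of _ "[s, t]"]) (auto simp: partitions_Cons)
      qed
    qed
  qed
qed

section \<open>Limits over partitions of vanishing mesh\<close>

lemma eventually_mesh:
  "eventually P (mesh_to_zero s t) \<longleftrightarrow> (\<exists>\<delta>>0. \<forall>D\<in>partitions s t. mesh D < \<delta> \<longrightarrow> P D)"
proof -
  have "eventually P (mesh_to_zero s t) \<longleftrightarrow>
      (\<exists>\<delta>\<in>{0<..}. eventually P (principal {D \<in> partitions s t. mesh D < \<delta>}))"
    unfolding mesh_to_zero_def
  proof (rule eventually_INF_base)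
    fix a b :: real assume "a \<in> {0<..}" "b \<in> {0<..}"
    then show "\<exists>x\<in>{0<..}. principal {D \<in> partitions s t. mesh D < x} \<le>
        inf (principal {D \<in> partitions s t. mesh D < a}) (principal {D \<in> partitions s t. mesh D < b})"
      by (intro bexI[of _ "min a b"]) auto
  qed auto
  then show ?thesis by (auto simp: eventually_principal)
qed

lemma mesh_to_zero_neq_bot: "s \<le> t \<Longrightarrow> mesh_to_zero s t \<noteq> bot"
  unfolding trivial_limit_def eventually_mesh using partition_exists[of s t] by force

lemma mesh_limit_iff:
  "((\<lambda>D. f D) \<longlongrightarrow> (J::'v::real_normed_vector)) (mesh_to_zero s t) \<longleftrightarrow>
    (\<forall>\<epsilon>>0. \<exists>\<delta>>0. \<forall>D\<in>partitions s t. mesh D < \<delta> \<longrightarrow> norm (f D - J) < \<epsilon>)"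
  by (simp add: tendsto_iff eventually_mesh dist_norm)

lemma mesh_limit_unique:
  "(f \<longlongrightarrow> J) (mesh_to_zero s t) \<Longrightarrow> (f \<longlongrightarrow> J') (mesh_to_zero s t) \<Longrightarrow> s \<le> t \<Longrightarrow> J = (J'::'v::real_normed_vector)"
  by (rule tendsto_unique[OF mesh_to_zero_neq_bot])

lemma mesh_limit_refl: "(partition_sum g \<longlongrightarrow> (0::'v::real_normed_vector)) (mesh_to_zero s s)"
proof -
  have "partition_sum g D = 0" if "D \<in> partitions s s" for D
    using that
  proof (cases D rule: list.exhaust[case_names Nil Cons])
    case (Cons x r)
    with that show ?thesis by (cases r) (auto simp: partitions_Cons dest: partitions_le)
  qed auto
  then show ?thesis by (auto simp: mesh_limit_iff intro: exI[of _ 1])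
qed

text \<open>Nothing is assumed about [t, u] itself: prefixing one fixed fine partition of [r, t]
  turns a fine partition of [t, u] into one of [r, u], and the sums add. Integrals from a common
  starting time thus yield all increments.\<close>

lemma mesh_limit_diff:
  fixes J J' :: "'v::real_normed_vector"
  assumes "(partition_sum g \<longlongrightarrow> J) (mesh_to_zero r t)" "(partition_sum g \<longlongrightarrow> J') (mesh_to_zero r u)"
    and "r \<le> t" "t \<le> u"
  shows "(partition_sum g \<longlongrightarrow> J' - J) (mesh_to_zero t u)"
  unfolding mesh_limit_iff
proof (intro allI impI)
  fix \<epsilon> :: real assume "0 < \<epsilon>"
  then have "0 < \<epsilon> / 2" by simp
  obtain \<delta> \<delta>' where \<delta>: "0 < \<delta>" "0 < \<delta>'"
    and \<delta>1: "\<forall>D\<in>partitions r t. mesh D < \<delta> \<longrightarrow> norm (partition_sum g D - J) < \<epsilon> / 2"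
    and \<delta>2: "\<forall>D\<in>partitions r u. mesh D < \<delta>' \<longrightarrow> norm (partition_sum g D - J') < \<epsilon> / 2"
    using assms(1,2)[unfolded mesh_limit_iff, rule_format, OF \<open>0 < \<epsilon> / 2\<close>] by (elim exE conjE)
  obtain E where E: "E \<in> partitions r t" "mesh E < min \<delta> \<delta>'"
    using partition_exists[OF assms(3), of "min \<delta> \<delta>'"] \<delta> by auto
  show "\<exists>\<delta>>0. \<forall>D\<in>partitions t u. mesh D < \<delta> \<longrightarrow> norm (partition_sum g D - (J' - J)) < \<epsilon>"
  proof (intro exI[of _ \<delta>'] conjI ballI impI)
    fix D assume D: "D \<in> partitions t u" "mesh D < \<delta>'"
    have "last E = t" "E \<noteq> []" using E(1) by (auto simp: partitions_def)
    then obtain es where eE: "E = es @ [t]" by (metis append_butlast_last_id)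
    obtain ds where eD: "D = t # ds" using D(1) by (cases D) (auto dest: partitions_hd)
    define F where "F = es @ t # ds"
    have F: "F \<in> partitions r u"
      unfolding F_def by (rule iffD2[OF partitions_append]) (use E(1) D(1) eE eD in simp)
    have "mesh F < \<delta>'"
      unfolding F_def using mesh_append[OF F[unfolded F_def]] E(2) D(2) eE eD by auto
    then have "norm (partition_sum g F - J') < \<epsilon> / 2" using F \<delta>2 by blast
    moreover have "norm (partition_sum g E - J) < \<epsilon> / 2" using E \<delta>1 by simp
    moreover have "partition_sum g F = partition_sum g E + partition_sum g D"
      unfolding F_def using partition_sum_append[of g "es" t ds] eE eD by simp
    then have eq: "partition_sum g D - (J' - J) = (partition_sum g F - J') - (partition_sum g E - J)"
      by simp
    have "norm (partition_sum g D - (J' - J)) \<le> norm (partition_sum g F - J') + norm (partition_sum g E - J)"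
      unfolding eq by (rule norm_triangle_ineq4)
    ultimately show "norm (partition_sum g D - (J' - J)) < \<epsilon>" by linarith
  qed fact
qed

lemma partition_sum_mono:
  fixes f g :: "real \<Rightarrow> real \<Rightarrow> real"
  assumes "D \<in> partitions s t" "\<And>u v. s \<le> u \<Longrightarrow> u < v \<Longrightarrow> v \<le> t \<Longrightarrow> f u v \<le> g u v"
  shows "partition_sum f D \<le> partition_sum g D"
  using assms
proof (induction rule: partitions_induct)
  case (step s y r)
  have "partition_sum f (y # r) \<le> partition_sum g (y # r)" by (rule step.IH) (use step in auto)
  moreover have "f s y \<le> g s y" using step by simp
  ultimately show ?case by simp
qed simp

lemma partition_sum_cong:
  fixes f g :: "real \<Rightarrow> real \<Rightarrow> real"
  assumes "D \<in> partitions s t" "\<And>u v. s \<le> u \<Longrightarrow> u < v \<Longrightarrow> v \<le> t \<Longrightarrow> f u v = g u v"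
  shows "partition_sum f D = partition_sum g D"
  by (intro antisym partition_sum_mono[OF assms(1)]) (use assms(2) in auto)

lemma partition_sum_nonneg:
  fixes g :: "real \<Rightarrow> real \<Rightarrow> real"
  assumes "D \<in> partitions s t" "\<And>u v. s \<le> u \<Longrightarrow> u < v \<Longrightarrow> v \<le> t \<Longrightarrow> 0 \<le> g u v"
  shows "0 \<le> partition_sum g D"
  using partition_sum_mono[OF assms(1), of "\<lambda>_ _. 0" g] assms(2) by (simp add: partition_sum_def)

lemma partition_sum_add: "partition_sum (\<lambda>u v. f u v + g u v) D = partition_sum f D + partition_sum g D"
  by (simp add: partition_sum_def sum.distrib)

lemma partition_sum_diff:
  "partition_sum (\<lambda>u v. f u v - g u v :: 'v::ab_group_add) D = partition_sum f D - partition_sum g D"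
  by (simp add: partition_sum_def sum_subtractf)

lemma partition_sum_mult: "partition_sum (\<lambda>u v. c * f u v :: real) D = c * partition_sum f D"
  by (simp add: partition_sum_def sum_distrib_left)

lemma partition_sum_sum: "partition_sum (\<lambda>u v. \<Sum>i\<in>A. f i u v) D = (\<Sum>i\<in>A. partition_sum (f i) D)"
  unfolding partition_sum_def by (rule sum.swap)

section \<open>Superadditive controls and the sewing lemma\<close>

definition control :: "real \<Rightarrow> real \<Rightarrow> (real \<Rightarrow> real \<Rightarrow> real) \<Rightarrow> bool" where
  "control a b \<omega> \<longleftrightarrow> (\<forall>s t. a \<le> s \<and> s \<le> t \<and> t \<le> b \<longrightarrow> 0 \<le> \<omega> s t) \<and>
     (\<forall>s u t. a \<le> s \<and> s \<le> u \<and> u \<le> t \<and> t \<le> b \<longrightarrow> \<omega> s u + \<omega> u t \<le> \<omega> s t)"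

lemma control_nonneg: "control a b \<omega> \<Longrightarrow> a \<le> s \<Longrightarrow> s \<le> t \<Longrightarrow> t \<le> b \<Longrightarrow> 0 \<le> \<omega> s t"
  and control_add: "control a b \<omega> \<Longrightarrow> a \<le> s \<Longrightarrow> s \<le> u \<Longrightarrow> u \<le> t \<Longrightarrow> t \<le> b \<Longrightarrow> \<omega> s u + \<omega> u t \<le> \<omega> s t"
  by (auto simp: control_def)

lemma control_mono:
  assumes "control a b \<omega>" "a \<le> s'" "s' \<le> s" "s \<le> t" "t \<le> t'" "t' \<le> b"
  shows "\<omega> s t \<le> \<omega> s' t'"
proof -
  have "\<omega> s' s + \<omega> s t' \<le> \<omega> s' t'" "\<omega> s t + \<omega> t t' \<le> \<omega> s t'" "0 \<le> \<omega> s' s" "0 \<le> \<omega> t t'"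
    using assms by (auto intro!: control_nonneg[OF assms(1)] control_add[OF assms(1)])
  then show ?thesis by linarith
qed

lemma control_refl: "control a b \<omega> \<Longrightarrow> a \<le> s \<Longrightarrow> s \<le> b \<Longrightarrow> \<omega> s s = 0"
  using control_add[of a b \<omega> s s s] control_nonneg[of a b \<omega> s s] by simp

lemma control_subset: "control a b \<omega> \<Longrightarrow> a \<le> a' \<Longrightarrow> b' \<le> b \<Longrightarrow> control a' b' \<omega>"
  by (fastforce simp: control_def)

lemma control_plus: "control a b \<omega> \<Longrightarrow> control a b \<omega>' \<Longrightarrow> control a b (\<lambda>s t. \<omega> s t + \<omega>' s t)"
  (is "_ \<Longrightarrow> _ \<Longrightarrow> ?thesis")
proof -
  assume *: "control a b \<omega>" "control a b \<omega>'"
  show ?thesis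
    unfolding control_def
  proof (intro conjI allI impI; elim conjE)
    fix s t :: real assume "a \<le> s" "s \<le> t" "t \<le> b"
    then show "0 \<le> \<omega> s t + \<omega>' s t"
      using control_nonneg[OF *(1)] control_nonneg[OF *(2)] by (simp add: add_nonneg_nonneg)
  next
    fix s u t :: real assume "a \<le> s" "s \<le> u" "u \<le> t" "t \<le> b"
    then show "\<omega> s u + \<omega>' s u + (\<omega> u t + \<omega>' u t) \<le> \<omega> s t + \<omega>' s t"
      using control_add[OF *(1), of s u t] control_add[OF *(2), of s u t] by linarith
  qed
qed

lemma control_mult: "control a b \<omega> \<Longrightarrow> 0 \<le> c \<Longrightarrow> control a b (\<lambda>s t. c * \<omega> s t)"
  unfolding control_def by (auto simp: mult_left_mono simp flip: distrib_left)

lemma control_sum: "finite A \<Longrightarrow> (\<And>i. i \<in> A \<Longrightarrow> control a b (\<omega> i)) \<Longrightarrow> control a b (\<lambda>s t. \<Sum>i\<in>A. \<omega> i s t)"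
proof (induction A rule: finite_induct)
  case empty
  then show ?case by (simp add: control_def)
next
  case (insert x F)
  then show ?case by (simp add: control_plus)
qed

lemma control_partition_sum:
  assumes "control a b \<omega>" "D \<in> partitions s t" "a \<le> s" "t \<le> b"
  shows "partition_sum \<omega> D \<le> \<omega> s t"
  using assms(2,3)
proof (induction rule: partitions_induct)
  case single
  then show ?case using control_refl[OF assms(1)] assms(4) by simp
next
  case (step s y r)
  then show ?case using control_add[OF assms(1), of s y t] assms(4) by auto
qed

text \<open>A discrete intermediate value argument; it locates the interval of a partition in which
  a control passes a threshold.\<close>

lemma list_switch:
  "D \<noteq> [] \<Longrightarrow> P (hd D) \<Longrightarrow> \<not> P (last D) \<Longrightarrow> \<exists>xs u v ys. D = xs @ u # v # ys \<and> P u \<and> \<not> P v"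
proof (induction D)
  case (Cons x D)
  show ?case
  proof (cases D)
    case (Cons y r)
    show ?thesis
    proof (cases "P y")
      case True
      then obtain xs u v ys where "D = xs @ u # v # ys" "P u" "\<not> P v"
        using Cons.IH Cons.prems Cons by auto
      then show ?thesis by (intro exI[of _ "x # xs"]) auto
    next
      case False
      with Cons Cons.prems show ?thesis by (intro exI[of _ "[]"]) auto
    qed
  qed (use Cons.prems in simp)
qed simp

text \<open>The fixed point of \<open>C = 2 * (C * 2 powr (- \<theta>)) + 2\<close>: a sewing
  remainder is bounded by two remainders that carry half of the control each, and two
  defects.\<close>

definition sew_const :: "real \<Rightarrow> real" where
  "sew_const \<theta> = 2 / (1 - 2 powr (1 - \<theta>))"

lemma sew_const_pos: "1 < \<theta> \<Longrightarrow> 0 < sew_const \<theta>"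
  and sew_const_eq: "1 < \<theta> \<Longrightarrow> sew_const \<theta> * 2 powr (1 - \<theta>) + 2 = sew_const \<theta>"
proof -
  assume "1 < \<theta>"
  then have "2 powr (1 - \<theta>) < 2 powr (0::real)" by (intro powr_less_mono) auto
  then have *: "2 powr (1 - \<theta>) < (1::real)" by simp
  have aux: "2 / (1 - x) * x + 2 = 2 / (1 - x)" if "x < 1" for x :: real
    using that by (simp add: field_simps)
  show "0 < sew_const \<theta>" using * by (simp add: sew_const_def)
  show "sew_const \<theta> * 2 powr (1 - \<theta>) + 2 = sew_const \<theta>"
    unfolding sew_const_def using * by (rule aux)
qed

text \<open>The partition is split at the interval in which \<open>\<omega> s\<close> passes half of its final value, so that
  both remaining pieces carry at most half of the control.\<close>

lemma sewing_bound:
  assumes ctl: "control a b \<omega>" and \<theta>: "1 < \<theta>" and K: "0 \<le> K"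
    and defect: "\<And>s u t. a \<le> s \<Longrightarrow> s \<le> u \<Longrightarrow> u \<le> t \<Longrightarrow> t \<le> b \<Longrightarrow>
      \<bar>\<Xi> s t - \<Xi> s u - \<Xi> u t\<bar> \<le> K * \<omega> s t powr \<theta>"
    and D: "D \<in> partitions s t" "a \<le> s" "t \<le> b"
  shows "\<bar>partition_sum \<Xi> D - \<Xi> s t\<bar> \<le> sew_const \<theta> * K * \<omega> s t powr \<theta>"
  using D
proof (induction "length D" arbitrary: D s t rule: less_induct)
  case less
  note D = less.prems
  have st: "s \<le> t" using D(1) by (rule partitions_le)
  have w0: "0 \<le> \<omega> s t" using ctl D st by (intro control_nonneg[OF ctl]) auto
  let ?C = "sew_const \<theta>"
  have C0: "0 \<le> ?C" using sew_const_pos[OF \<theta>] by simp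
  consider "D = [s]" "s = t" | y r where "D = s # y # r" "s < y" "y \<le> t"
  proof (cases D)
    case (Cons x ys)
    then show ?thesis using that D(1) by (cases ys) (auto simp: partitions_Cons dest: partitions_le partitions_hd)
  qed (use D in simp)
  then show ?case
  proof cases
    case 1
    \<comment> \<open>The defect at three equal times forces \<Xi> to vanish on the
      diagonal.\<close>
    have "\<bar>\<Xi> s s - \<Xi> s s - \<Xi> s s\<bar> \<le> K * \<omega> s s powr \<theta>" using D 1 by (intro defect) auto
    then have "\<Xi> s s = 0" using control_refl[OF ctl, of s] D 1 \<theta> by simp
    then show ?thesis using 1 C0 K by simp
  next
    case 2
    have "\<exists>xs u v ys. D = xs @ u # v # ys \<and> \<omega> s u \<le> \<omega> s t / 2 \<and> \<omega> v t \<le> \<omega> s t / 2"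
    proof (cases "\<omega> s t = 0")
      case True
      \<comment> \<open>All controls vanish here, so the first interval serves.\<close>
      have "\<omega> y t \<le> \<omega> s t" using ctl D 2 by (intro control_mono[OF ctl]) auto
      moreover have "\<omega> s s = 0" using D st by (intro control_refl[OF ctl]) auto
      ultimately show ?thesis using True 2 by (intro exI[of _ "[]"]) auto
    next
      case False
      have "\<omega> s s = 0" using D st by (intro control_refl[OF ctl]) auto
      then have "\<exists>xs u v ys. D = xs @ u # v # ys \<and> \<omega> s u \<le> \<omega> s t / 2 \<and> \<not> \<omega> s v \<le> \<omega> s t / 2"
        using D(1) False w0 by (intro list_switch) (auto simp: partitions_def)
      then obtain xs u v ys where *: "D = xs @ u # v # ys" "\<omega> s u \<le> \<omega> s t / 2" "\<not> \<omega> s v \<le> \<omega> s t / 2"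
        by blast
      have "s \<le> v" "v \<le> t" using partitions_range[OF D(1), of v] * by auto
      then have "\<omega> s v + \<omega> v t \<le> \<omega> s t" using ctl D by (intro control_add[OF ctl]) auto
      with * show ?thesis by (intro exI[of _ xs] exI[of _ u] exI[of _ v] exI[of _ ys]) auto
    qed
    then obtain xs u v ys where sp: "D = xs @ u # v # ys" "\<omega> s u \<le> \<omega> s t / 2" "\<omega> v t \<le> \<omega> s t / 2"
      by blast
    have P: "xs @ [u] \<in> partitions s u" "u < v" "v # ys \<in> partitions v t"
      using iffD1[OF partitions_append D(1)[unfolded sp(1)]] by (auto simp: partitions_Cons)
    have le: "s \<le> u" "v \<le> t" using P by (auto dest: partitions_le)
    have pw: "x powr \<theta> \<le> 2 powr (- \<theta>) * \<omega> s t powr \<theta>" if "0 \<le> x" "x \<le> \<omega> s t / 2" for x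
    proof -
      have "x powr \<theta> \<le> (\<omega> s t / 2) powr \<theta>" using that \<theta> by (intro powr_mono2) auto
      also have "\<dots> = 2 powr (- \<theta>) * \<omega> s t powr \<theta>" using w0 by (simp add: powr_divide powr_minus field_simps)
      finally show ?thesis .
    qed
    have part: "\<bar>S\<bar> \<le> ?C * K * (2 powr (- \<theta>) * \<omega> s t powr \<theta>)"
      if "\<bar>S\<bar> \<le> ?C * K * x powr \<theta>" "0 \<le> x" "x \<le> \<omega> s t / 2" for S x
      using that(1) mult_left_mono[OF pw[OF that(2,3)], of "?C * K"] C0 K by simp
    have b1: "\<bar>partition_sum \<Xi> (xs @ [u]) - \<Xi> s u\<bar> \<le> ?C * K * (2 powr (- \<theta>) * \<omega> s t powr \<theta>)"
      using P le D sp ctl by (intro part[OF less.hyps] control_nonneg[OF ctl]) auto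
    have b2: "\<bar>partition_sum \<Xi> (v # ys) - \<Xi> v t\<bar> \<le> ?C * K * (2 powr (- \<theta>) * \<omega> s t powr \<theta>)"
      using P le D sp ctl by (intro part[OF less.hyps] control_nonneg[OF ctl]) auto
    have "\<bar>\<Xi> s t - \<Xi> s u - \<Xi> u t\<bar> \<le> K * \<omega> s t powr \<theta>" using P le D by (intro defect) auto
    moreover have "\<bar>\<Xi> u t - \<Xi> u v - \<Xi> v t\<bar> \<le> K * \<omega> u t powr \<theta>" using P le D by (intro defect) auto
    moreover have "K * \<omega> u t powr \<theta> \<le> K * \<omega> s t powr \<theta>"
      using P le D \<theta> K by (intro mult_left_mono powr_mono2 control_mono[OF ctl] control_nonneg[OF ctl]) auto
    moreover have "partition_sum \<Xi> D = partition_sum \<Xi> (xs @ [u]) + \<Xi> u v + partition_sum \<Xi> (v # ys)"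
      unfolding sp(1) by (subst partition_sum_append) simp
    \<comment> \<open>The points \<open>u\<close> and \<open>v\<close> are inserted into [s, t] one
      after the other, which costs two defects.\<close>
    ultimately have "\<bar>partition_sum \<Xi> D - \<Xi> s t\<bar> \<le>
        2 * (?C * K * (2 powr (- \<theta>) * \<omega> s t powr \<theta>)) + 2 * (K * \<omega> s t powr \<theta>)"
      using b1 b2 by linarith
    also have "\<dots> = (?C * 2 powr (1 - \<theta>) + 2) * K * \<omega> s t powr \<theta>"
      by (simp add: powr_diff powr_minus field_simps)
    finally show ?thesis by (simp add: sew_const_eq[OF \<theta>])
  qed
qed

lemma mesh_limit_bound:
  fixes J c :: real
  assumes "(partition_sum g \<longlongrightarrow> J) (mesh_to_zero t u)" "t \<le> u"
    and "\<And>D. D \<in> partitions t u \<Longrightarrow> \<bar>partition_sum g D - c\<bar> \<le> B"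
  shows "\<bar>J - c\<bar> \<le> B"
proof (rule tendsto_upperbound[OF _ _ mesh_to_zero_neq_bot[OF assms(2)]])
  show "((\<lambda>D. \<bar>partition_sum g D - c\<bar>) \<longlongrightarrow> \<bar>J - c\<bar>) (mesh_to_zero t u)"
    by (intro tendsto_intros assms(1))
  show "\<forall>\<^sub>F D in mesh_to_zero t u. \<bar>partition_sum g D - c\<bar> \<le> B"
    unfolding eventually_mesh using assms(3) by (intro exI[of _ 1]) auto
qed

text \<open>\<open>sewing_bound\<close> is applied on each interval of \<open>D\<close>. In the
  power \<theta> of \<omega> one factor \<omega> is kept, to be summed by superadditivity; the
  remaining power \<theta> - 1 is replaced by that of \<epsilon>, because the interval is
  short.\<close>

lemma sewing_refine:
  assumes ctl: "control a b \<omega>" and \<theta>: "1 < \<theta>" and K: "0 \<le> K" and e: "0 \<le> \<epsilon>"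
    and defect: "\<And>s u t. a \<le> s \<Longrightarrow> s \<le> u \<Longrightarrow> u \<le> t \<Longrightarrow> t \<le> b \<Longrightarrow>
      \<bar>\<Xi> s t - \<Xi> s u - \<Xi> u t\<bar> \<le> K * \<omega> s t powr \<theta>"
    and small: "\<And>u v. a \<le> u \<Longrightarrow> u \<le> v \<Longrightarrow> v \<le> b \<Longrightarrow> v - u < \<delta> \<Longrightarrow> \<omega> u v \<le> \<epsilon>"
    and "D \<in> partitions s t" "mesh D < \<delta>" "E \<in> partitions s t" "set D \<subseteq> set E" "a \<le> s" "t \<le> b"
  shows "\<bar>partition_sum \<Xi> E - partition_sum \<Xi> D\<bar> \<le> sew_const \<theta> * K * \<epsilon> powr (\<theta> - 1) * \<omega> s t"
  using assms(7-11)
proof (induction arbitrary: E rule: partitions_induct)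
  case single
  have "E = [t]" if "E \<in> partitions t t" for E
  proof (cases E)
    case (Cons x r)
    with that show ?thesis by (cases r) (auto simp: partitions_Cons dest: partitions_le)
  qed (use that in simp)
  with single show ?case using control_refl[OF ctl, of t] \<open>t \<le> b\<close> by auto
next
  case (step s y r)
  let ?C = "sew_const \<theta>"
  have "y \<in> set E" using step by auto
  then obtain E1 E2 where E: "E = E1 @ y # E2" by (meson split_list)
  have P: "E1 @ [y] \<in> partitions s y" "y # E2 \<in> partitions y t"
    using iffD1[OF partitions_append step.prems(2)[unfolded E]] by auto
  have sub: "set (y # r) \<subseteq> set (y # E2)"
  proof
    fix z assume z: "z \<in> set (y # r)"
    then have "y \<le> z" using partitions_range[OF step.hyps(3)] by auto
    moreover have "z \<in> set E1 \<Longrightarrow> z < y"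
      using P(1) by (auto simp: partitions_def sorted_wrt_append)
    ultimately show "z \<in> set (y # E2)" using z step.prems(3) E by fastforce
  qed
  have "y - s < \<delta>" using step.prems by simp
  then have wy: "\<omega> s y \<le> \<epsilon>" "0 \<le> \<omega> s y"
    using step \<open>t \<le> b\<close> small control_nonneg[OF ctl] by auto
  have "\<bar>partition_sum \<Xi> (E1 @ [y]) - \<Xi> s y\<bar> \<le> ?C * K * \<omega> s y powr \<theta>"
    using P step \<open>t \<le> b\<close> by (intro sewing_bound[OF ctl \<theta> K defect]) auto
  also have "\<omega> s y powr \<theta> \<le> \<epsilon> powr (\<theta> - 1) * \<omega> s y"
  proof (cases "\<omega> s y = 0")
    case False
    then have "\<omega> s y powr \<theta> = \<omega> s y powr (\<theta> - 1) * \<omega> s y" using wy by (simp add: powr_diff)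
    also have "\<dots> \<le> \<epsilon> powr (\<theta> - 1) * \<omega> s y" using wy \<theta> by (intro mult_right_mono powr_mono2) auto
    finally show ?thesis .
  qed (use \<theta> in simp)
  finally have 1: "\<bar>partition_sum \<Xi> (E1 @ [y]) - \<Xi> s y\<bar> \<le> ?C * K * (\<epsilon> powr (\<theta> - 1) * \<omega> s y)"
    using K sew_const_pos[OF \<theta>] by (simp add: mult_left_mono)
  have 2: "\<bar>partition_sum \<Xi> (y # E2) - partition_sum \<Xi> (y # r)\<bar> \<le> ?C * K * \<epsilon> powr (\<theta> - 1) * \<omega> y t"
    by (rule step.IH) (use P sub step in auto)
  have "\<bar>partition_sum \<Xi> E - partition_sum \<Xi> (s # y # r)\<bar> \<le>
      ?C * K * \<epsilon> powr (\<theta> - 1) * (\<omega> s y + \<omega> y t)"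
  proof -
    have "partition_sum \<Xi> E - partition_sum \<Xi> (s # y # r) =
        (partition_sum \<Xi> (E1 @ [y]) - \<Xi> s y) + (partition_sum \<Xi> (y # E2) - partition_sum \<Xi> (y # r))"
      by (simp add: E partition_sum_append[of \<Xi> E1 y E2])
    also have "\<bar>\<dots>\<bar> \<le> ?C * K * (\<epsilon> powr (\<theta> - 1) * \<omega> s y) + ?C * K * \<epsilon> powr (\<theta> - 1) * \<omega> y t"
      using 1 2 by linarith
    finally show ?thesis by (simp add: distrib_left mult.assoc)
  qed
  also have "\<dots> \<le> ?C * K * \<epsilon> powr (\<theta> - 1) * \<omega> s t"
    using step \<open>t \<le> b\<close> K sew_const_pos[OF \<theta>] by (intro mult_left_mono control_add[OF ctl]) auto
  finally show ?case .
qed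

text \<open>Two fine partitions are compared through their union. A \<open>control\<close> need not
  be continuous, so smallness of \<omega> on short intervals is a hypothesis of its own.\<close>

lemma sewing_limit:
  assumes ctl: "control a b \<omega>" and \<theta>: "1 < \<theta>" and K: "0 \<le> K"
    and defect: "\<And>s u t. a \<le> s \<Longrightarrow> s \<le> u \<Longrightarrow> u \<le> t \<Longrightarrow> t \<le> b \<Longrightarrow>
      \<bar>\<Xi> s t - \<Xi> s u - \<Xi> u t\<bar> \<le> K * \<omega> s t powr \<theta>"
    and small: "\<And>\<epsilon>. 0 < \<epsilon> \<Longrightarrow> \<exists>\<delta>>0. \<forall>u v. a \<le> u \<longrightarrow> u \<le> v \<longrightarrow> v \<le> b \<longrightarrow> v - u < \<delta> \<longrightarrow> \<omega> u v \<le> \<epsilon>"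
    and st: "a \<le> s" "s \<le> t" "t \<le> b"
  shows "\<exists>J. (partition_sum \<Xi> \<longlongrightarrow> J) (mesh_to_zero s t)"
proof -
  let ?C = "sew_const \<theta>"
  have C: "0 < ?C" using \<theta> by (rule sew_const_pos)
  have w0: "0 \<le> \<omega> s t" using ctl st by (intro control_nonneg[OF ctl]) auto
  have cau: "\<exists>\<delta>>0. \<forall>D\<in>partitions s t. \<forall>D'\<in>partitions s t. mesh D < \<delta> \<longrightarrow> mesh D' < \<delta> \<longrightarrow>
      \<bar>partition_sum \<Xi> D - partition_sum \<Xi> D'\<bar> < \<eta>" if "0 < \<eta>" for \<eta>
  proof -
    \<comment> \<open>The summand 1 keeps \<open>c\<close> positive and makes the last inequality
      strict.\<close>
    define c where "c = 2 * (?C * K * (\<omega> s t)) + 1"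
    have c: "0 < c" using C K w0 by (simp add: c_def add_nonneg_pos)
    define \<epsilon> where "\<epsilon> = (\<eta> / c) powr (1 / (\<theta> - 1))"
    have \<epsilon>: "0 < \<epsilon>" "\<epsilon> powr (\<theta> - 1) = \<eta> / c" using c that \<theta> by (auto simp: \<epsilon>_def powr_powr)
    obtain \<delta> where \<delta>: "0 < \<delta>" "\<And>u v. a \<le> u \<Longrightarrow> u \<le> v \<Longrightarrow> v \<le> b \<Longrightarrow> v - u < \<delta> \<Longrightarrow> \<omega> u v \<le> \<epsilon>"
      using small[OF \<epsilon>(1)] by blast
    have "\<bar>partition_sum \<Xi> D - partition_sum \<Xi> D'\<bar> < \<eta>"
      if D: "D \<in> partitions s t" "mesh D < \<delta>" and D': "D' \<in> partitions s t" "mesh D' < \<delta>" for D D'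
    proof -
      define E where "E = sorted_list_of_set (set D \<union> set D')"
      have setE: "set E = set D \<union> set D'" by (simp add: E_def)
      have sE: "s \<in> set E" "t \<in> set E"
        using D(1) unfolding setE by (auto simp: partitions_def)
      then have neE: "E \<noteq> []" by auto
      have srt: "sorted_wrt (<) E" by (simp add: E_def)
      have rng: "s \<le> z \<and> z \<le> t" if "z \<in> set E" for z
        using that partitions_range[OF D(1)] partitions_range[OF D'(1)] by (auto simp: setE)
      have "hd E = s"
      proof (rule antisym)
        show "hd E \<le> s"
          using srt neE sE(1) by (cases E) auto
        show "s \<le> hd E" using rng neE by simp
      qed
      moreover have "last E = t"
      proof (rule antisym)
        have "E = butlast E @ [last E]" using neE by simp
        then have "t \<in> set (butlast E @ [last E])" "sorted_wrt (<) (butlast E @ [last E])"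
          using sE(2) srt by simp_all
        then show "t \<le> last E" by (auto simp: sorted_wrt_append)
        show "last E \<le> t" using rng neE by simp
      qed
      ultimately have E: "E \<in> partitions s t" using srt neE by (simp add: partitions_def)
      have "\<bar>partition_sum \<Xi> E - partition_sum \<Xi> D\<bar> \<le> ?C * K * \<epsilon> powr (\<theta> - 1) * \<omega> s t"
        using D E st \<epsilon> setE by (intro sewing_refine[OF ctl \<theta> K _ defect \<delta>(2)]) auto
      note bD = this
      have bD': "\<bar>partition_sum \<Xi> E - partition_sum \<Xi> D'\<bar> \<le> ?C * K * \<epsilon> powr (\<theta> - 1) * \<omega> s t"
        using D' E st \<epsilon> setE by (intro sewing_refine[OF ctl \<theta> K _ defect \<delta>(2)]) auto
      have "\<bar>partition_sum \<Xi> D - partition_sum \<Xi> D'\<bar> \<le> (2 * (?C * K * \<omega> s t)) * (\<eta> / c)"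
      proof -
        have "2 * (?C * K * \<omega> s t) * (\<eta> / c) = 2 * (?C * K * \<epsilon> powr (\<theta> - 1) * \<omega> s t)"
          by (simp add: \<epsilon>(2))
        then show ?thesis using bD bD' by linarith
      qed
      also have "\<dots> < c * (\<eta> / c)" using c that \<open>0 < \<eta>\<close> by (intro mult_strict_right_mono) (auto simp: c_def)
      finally show ?thesis using c by simp
    qed
    then show ?thesis using \<delta>(1) by blast
  qed
  \<comment> \<open>Completeness is used along one sequence of partitions; the Cauchy estimate then
    carries the limit over to the whole filter.\<close>
  define D where "D m = (SOME D. D \<in> partitions s t \<and> mesh D < 1 / real (Suc m))" for m
  have D: "D m \<in> partitions s t \<and> mesh (D m) < 1 / real (Suc m)" for m
    unfolding D_def by (rule someI_ex) (use partition_exists[OF st(2), of "1 / real (Suc m)"] in auto)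
  have fine: "\<exists>N. \<forall>m\<ge>N. mesh (D m) < \<delta>" if \<delta>: "0 < \<delta>" for \<delta>
  proof -
    obtain N where "inverse (real (Suc N)) < \<delta>" using reals_Archimedean[OF \<delta>] by auto
    then have "mesh (D m) < \<delta>" if "N \<le> m" for m
    proof -
      have "1 / real (Suc m) \<le> 1 / real (Suc N)" using that by (simp add: frac_le)
      with D[of m] \<open>inverse (real (Suc N)) < \<delta>\<close> show ?thesis by (simp add: inverse_eq_divide)
    qed
    then show ?thesis by blast
  qed
  have "Cauchy (\<lambda>m. partition_sum \<Xi> (D m))"
  proof (rule CauchyI)
    fix \<eta> :: real assume "0 < \<eta>"
    then obtain \<delta> where \<delta>: "0 < \<delta>" "\<And>D D'. D \<in> partitions s t \<Longrightarrow> D' \<in> partitions s t \<Longrightarrow> mesh D < \<delta> \<Longrightarrow> mesh D' < \<delta> \<Longrightarrow>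
      \<bar>partition_sum \<Xi> D - partition_sum \<Xi> D'\<bar> < \<eta>" using cau by blast
    obtain N where "\<forall>m\<ge>N. mesh (D m) < \<delta>" using fine[OF \<delta>(1)] by blast
    then show "\<exists>M. \<forall>m\<ge>M. \<forall>k\<ge>M. norm (partition_sum \<Xi> (D m) - partition_sum \<Xi> (D k)) < \<eta>"
      using \<delta>(2) D by (intro exI[of _ N]) auto
  qed
  then obtain J where J: "(\<lambda>m. partition_sum \<Xi> (D m)) \<longlonglongrightarrow> J"
    using Cauchy_convergent convergent_def by blast
  have "(partition_sum \<Xi> \<longlongrightarrow> J) (mesh_to_zero s t)"
    unfolding mesh_limit_iff
  proof (intro allI impI)
    fix \<eta> :: real assume "0 < \<eta>"
    then have "0 < \<eta> / 2" by simp
    then obtain \<delta> where \<delta>: "0 < \<delta>" "\<And>D D'. D \<in> partitions s t \<Longrightarrow> D' \<in> partitions s t \<Longrightarrow> mesh D < \<delta> \<Longrightarrow> mesh D' < \<delta> \<Longrightarrow>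
      \<bar>partition_sum \<Xi> D - partition_sum \<Xi> D'\<bar> < \<eta> / 2" using cau by blast
    obtain N where N: "\<forall>m\<ge>N. mesh (D m) < \<delta>" using fine[OF \<delta>(1)] by blast
    obtain N' where N': "\<forall>m\<ge>N'. \<bar>partition_sum \<Xi> (D m) - J\<bar> < \<eta> / 2"
      using LIMSEQ_D[OF J \<open>0 < \<eta> / 2\<close>] by auto
    define m where "m = max N N'"
    have "norm (partition_sum \<Xi> E - J) < \<eta>" if "E \<in> partitions s t" "mesh E < \<delta>" for E
    proof -
      have "\<bar>partition_sum \<Xi> E - partition_sum \<Xi> (D m)\<bar> < \<eta> / 2"
        using that \<delta>(2) D N by (auto simp: m_def)
      moreover have "\<bar>partition_sum \<Xi> (D m) - J\<bar> < \<eta> / 2" using N' by (auto simp: m_def)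
      ultimately show ?thesis unfolding real_norm_def by linarith
    qed
    then show "\<exists>\<delta>>0. \<forall>D\<in>partitions s t. mesh D < \<delta> \<longrightarrow> norm (partition_sum \<Xi> D - J) < \<eta>"
      using \<delta>(1) by blast
  qed
  then show ?thesis ..
qed

section \<open>Functionals on forests\<close>

text \<open>Unlike \<open>forests n\<close>, this contains the empty forest, at which a functional
  stores its value.\<close>

definition fs :: "nat \<Rightarrow> 'l forest set" where
  "fs n = {\<rho>. deg \<rho> \<le> n}"

lemma fs_iff [simp]: "\<rho> \<in> fs n \<longleftrightarrow> deg \<rho> \<le> n"
  by (simp add: fs_def)

lemma fs_eq: "fs n = insert {#} (forests n)"
proof -
  have "\<rho> \<in> fs n \<longleftrightarrow> \<rho> \<in> insert {#} (forests n)" for \<rho> :: "'a forest"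
    using deg_eq_0_iff[of \<rho>] by (cases "deg \<rho>") (auto simp: forests_def)
  then show ?thesis by blast
qed

lemma finite_fs [simp]: "finite (fs n :: 'l::finite forest set)"
  unfolding fs_eq by (simp only: finite_insert finite_forests)

lemma sum_fs: "(\<Sum>\<rho>\<in>fs n. f \<rho>) = f {#} + (\<Sum>\<rho>\<in>forests n. f (\<rho> :: 'l::finite forest) :: real)"
  unfolding fs_eq by (subst sum.insert, rule finite_forests) (simp_all add: forests_def)

lemma sum_of_bool_eq:
  "finite A \<Longrightarrow> (\<Sum>i\<in>A. of_bool (y = i) * (f i :: real)) = of_bool (y \<in> A) * f y"
  "finite A \<Longrightarrow> (\<Sum>i\<in>A. of_bool (i = y) * (f i :: real)) = of_bool (y \<in> A) * f y"
  by (simp_all add: of_bool_def if_distrib[where f = "\<lambda>x. x * _"] cong: if_cong)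

definition pair :: "nat \<Rightarrow> ('l::finite forest \<Rightarrow> real) \<Rightarrow> ('l forest \<Rightarrow> real) \<Rightarrow> real" where
  "pair n \<phi> a = (\<Sum>\<rho>\<in>fs n. \<phi> \<rho> * a \<rho>)"

text \<open>The coefficients of the functional \<open>b \<mapsto> \<phi> (a b)\<close>.\<close>

definition Gam :: "nat \<Rightarrow> ('l::finite forest \<Rightarrow> real) \<Rightarrow> ('l forest \<Rightarrow> real) \<Rightarrow> 'l forest \<Rightarrow> real" where
  "Gam n a \<phi> \<tau> = (\<Sum>\<rho>\<in>fs n. \<phi> \<rho> * cop_sum \<rho> (\<lambda>x y. a x * of_bool (y = \<tau>)))"

lemma Gam_empty: "Gam n a \<phi> {#} = pair n \<phi> a"
  by (simp add: Gam_def pair_def cop_sum_counit_right)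

lemma pair_star: "pair n \<phi> (star n a b) = (\<Sum>\<tau>\<in>fs n. Gam n a \<phi> \<tau> * b \<tau>)"
proof -
  have "star n a b \<rho> = (\<Sum>\<tau>\<in>fs n. cop_sum \<rho> (\<lambda>x y. a x * of_bool (y = \<tau>)) * b \<tau>)" if "\<rho> \<in> fs n" for \<rho>
  proof -
    have "star n a b \<rho> = cop_sum \<rho> (\<lambda>x y. \<Sum>\<tau>\<in>fs n. a x * of_bool (y = \<tau>) * b \<tau>)"
      using that unfolding star_def
      by (auto intro!: cop_sum_cong dest: coproduct_snd_deg
          simp: mult.assoc sum_of_bool_eq simp flip: sum_distrib_left)
    then show ?thesis by (simp add: cop_sum_sum cop_sum_mult_right)
  qed
  then have "pair n \<phi> (star n a b) =
      (\<Sum>\<rho>\<in>fs n. \<Sum>\<tau>\<in>fs n. \<phi> \<rho> * cop_sum \<rho> (\<lambda>x y. a x * of_bool (y = \<tau>)) * b \<tau>)"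
    by (simp add: pair_def sum_distrib_left mult.assoc)
  also have "\<dots> = (\<Sum>\<tau>\<in>fs n. Gam n a \<phi> \<tau> * b \<tau>)"
    by (subst sum.swap) (simp add: Gam_def sum_distrib_right)
  finally show ?thesis .
qed

lemma sum_abs_le:
  fixes f :: "'a \<Rightarrow> real"
  assumes "\<And>i. i \<in> A \<Longrightarrow> \<bar>f i\<bar> \<le> K" "real (card A) \<le> M" "0 \<le> K"
  shows "\<bar>\<Sum>i\<in>A. f i\<bar> \<le> M * K"
proof -
  have "\<bar>\<Sum>i\<in>A. f i\<bar> \<le> (\<Sum>i\<in>A. \<bar>f i\<bar>)" by (rule sum_abs)
  also have "\<dots> \<le> real (card A) * K" using assms(1) by (rule sum_bounded_above)
  also have "\<dots> \<le> M * K" using assms by (intro mult_right_mono) auto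
  finally show ?thesis .
qed

section \<open>Convolutions along operations on forests\<close>

lemma sum_swap4:
  "(\<Sum>a\<in>A. \<Sum>b\<in>B. \<Sum>c\<in>C. \<Sum>d\<in>D. f a b c d) = (\<Sum>c\<in>C. \<Sum>d\<in>D. \<Sum>a\<in>A. \<Sum>b\<in>B. f a b c d)"
proof -
  have "(\<Sum>a\<in>A. \<Sum>b\<in>B. \<Sum>c\<in>C. \<Sum>d\<in>D. f a b c d) = (\<Sum>a\<in>A. \<Sum>c\<in>C. \<Sum>d\<in>D. \<Sum>b\<in>B. f a b c d)"
    by (rule sum.cong[OF refl], subst sum.swap, intro sum.cong refl sum.swap)
  also have "\<dots> = (\<Sum>c\<in>C. \<Sum>d\<in>D. \<Sum>a\<in>A. \<Sum>b\<in>B. f a b c d)"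
    by (subst sum.swap, intro sum.cong refl sum.swap)
  finally show ?thesis .
qed

text \<open>The bilinear extension of a partial operation on forests, cut off above degree
  \<open>n\<close>. With \<open>(+)\<close> it is the product of functionals; with
  \<open>graftf\<close> and \<open>V = single\<close> it grafts a functional on a one-form with tree
  components.\<close>

definition conv ::
    "nat \<Rightarrow> ('l::finite forest \<Rightarrow> 'l forest \<Rightarrow> 'l forest) \<Rightarrow> ('l forest \<Rightarrow> bool) \<Rightarrow>
     ('l forest \<Rightarrow> real) \<Rightarrow> ('l forest \<Rightarrow> real) \<Rightarrow> 'l forest \<Rightarrow> real" where
  "conv n opr V \<phi> \<psi> \<tau> = (\<Sum>\<rho>\<^sub>1\<in>fs n. \<Sum>\<rho>\<^sub>2\<in>fs n.
     of_bool (V \<rho>\<^sub>2 \<and> deg \<rho>\<^sub>1 + deg \<rho>\<^sub>2 \<le> n \<and> opr \<rho>\<^sub>1 \<rho>\<^sub>2 = \<tau>) * (\<phi> \<rho>\<^sub>1 * \<psi> \<rho>\<^sub>2))"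

lemma conv_cong:
  "(\<And>\<rho>. \<rho> \<in> fs n \<Longrightarrow> \<phi> \<rho> = \<phi>' \<rho>) \<Longrightarrow> (\<And>\<rho>. \<rho> \<in> fs n \<Longrightarrow> V \<rho> \<Longrightarrow> \<psi> \<rho> = \<psi>' \<rho>) \<Longrightarrow>
    conv n opr V \<phi> \<psi> \<tau> = conv n opr V \<phi>' \<psi>' \<tau>"
  unfolding conv_def by (intro sum.cong refl) auto

lemma conv_diff_left: "conv n opr V (\<lambda>\<rho>. \<phi> \<rho> - \<phi>' \<rho>) \<psi> \<tau> = conv n opr V \<phi> \<psi> \<tau> - conv n opr V \<phi>' \<psi> \<tau>"
  and conv_diff_right: "conv n opr V \<phi> (\<lambda>\<rho>. \<psi> \<rho> - \<psi>' \<rho>) \<tau> = conv n opr V \<phi> \<psi> \<tau> - conv n opr V \<phi> \<psi>' \<tau>"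
  unfolding conv_def sum_subtractf[symmetric] by (simp_all add: algebra_simps)

lemma conv_cop_sum_left:
  "conv n opr V (\<lambda>\<sigma>. cop_sum \<rho> (\<lambda>x y. F x y \<sigma>)) \<psi> \<tau> = cop_sum \<rho> (\<lambda>x y. conv n opr V (F x y) \<psi> \<tau>)"
  unfolding conv_def cop_sum_sum cop_sum_mult_left cop_sum_mult_right by simp

lemma conv_cop_sum_right:
  "conv n opr V \<phi> (\<lambda>\<sigma>. cop_sum \<rho> (\<lambda>x y. F x y \<sigma>)) \<tau> = cop_sum \<rho> (\<lambda>x y. conv n opr V \<phi> (F x y) \<tau>)"
  unfolding conv_def cop_sum_sum cop_sum_mult_left cop_sum_mult_right by simp

lemma conv_mult_left: "conv n opr V (\<lambda>\<sigma>. c * \<phi> \<sigma>) \<psi> \<tau> = c * conv n opr V \<phi> \<psi> \<tau>"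
  and conv_mult_right: "conv n opr V \<phi> (\<lambda>\<sigma>. c * \<psi> \<sigma>) \<tau> = c * conv n opr V \<phi> \<psi> \<tau>"
  unfolding conv_def sum_distrib_left by (simp_all add: algebra_simps)

lemma conv_abs_le:
  fixes \<phi> :: "'l::finite forest \<Rightarrow> real"
  assumes "\<And>\<rho>\<^sub>1 \<rho>\<^sub>2. \<rho>\<^sub>1 \<in> fs n \<Longrightarrow> \<rho>\<^sub>2 \<in> fs n \<Longrightarrow> V \<rho>\<^sub>2 \<Longrightarrow> opr \<rho>\<^sub>1 \<rho>\<^sub>2 = \<tau> \<Longrightarrow> \<bar>\<phi> \<rho>\<^sub>1 * \<psi> \<rho>\<^sub>2\<bar> \<le> K"
    and "real (card (fs n :: 'l forest set)) \<le> M" "0 \<le> K"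
  shows "\<bar>conv n opr V \<phi> \<psi> \<tau>\<bar> \<le> M * (M * K)"
proof -
  have "0 \<le> M" using assms(2) of_nat_0_le_iff order_trans by blast
  then show ?thesis unfolding conv_def
    by (intro sum_abs_le assms mult_nonneg_nonneg) (use assms in auto)
qed

text \<open>Cutting \<open>opr \<rho>\<^sub>1 \<rho>\<^sub>2\<close> amounts to cutting both
  arguments and applying \<open>opr\<close> to what remains. For grafting the exception is the cut
  that prunes the whole tree and leaves the empty forest; \<open>W\<close> excludes that
  remainder.\<close>

locale forest_op =
  fixes opr :: "'l::finite forest \<Rightarrow> 'l forest \<Rightarrow> 'l forest" and V W :: "'l forest \<Rightarrow> bool"
  assumes op_deg: "V \<rho>\<^sub>2 \<Longrightarrow> deg (opr \<rho>\<^sub>1 \<rho>\<^sub>2) = deg \<rho>\<^sub>1 + deg \<rho>\<^sub>2"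
    and op_cop: "V \<rho>\<^sub>2 \<Longrightarrow> W \<tau> \<Longrightarrow> cop_sum (opr \<rho>\<^sub>1 \<rho>\<^sub>2) (\<lambda>x y. a x * of_bool (y = \<tau>)) =
      cop_sum \<rho>\<^sub>1 (\<lambda>x\<^sub>1 y\<^sub>1. cop_sum \<rho>\<^sub>2 (\<lambda>x\<^sub>2 y\<^sub>2. a (x\<^sub>1 + x\<^sub>2) * of_bool (V y\<^sub>2 \<and> opr y\<^sub>1 y\<^sub>2 = \<tau>)))"
begin

text \<open>A character makes the transport multiplicative, but the cut-off at degree
  \<open>n\<close> acts after the transport in one expression and before it in the other. What
  remains are the pairs of total degree above \<open>n\<close>, and their pruned parts have total
  degree above \<open>n - deg \<tau>\<close>.\<close>

lemma Gam_conv: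
  assumes a: "a \<in> characters n" and \<tau>: "W \<tau>" "\<tau> \<in> fs n" and supp: "\<And>\<rho>. \<not> V \<rho> \<Longrightarrow> \<psi> \<rho> = 0"
  shows "conv n opr V (Gam n a \<phi>) (Gam n a \<psi>) \<tau> - Gam n a (conv n opr V \<phi> \<psi>) \<tau> =
    (\<Sum>\<rho>\<^sub>1\<in>fs n. \<Sum>\<rho>\<^sub>2\<in>fs n. of_bool (V \<rho>\<^sub>2 \<and> n < deg \<rho>\<^sub>1 + deg \<rho>\<^sub>2) * (\<phi> \<rho>\<^sub>1 * \<psi> \<rho>\<^sub>2 *
      cop_sum \<rho>\<^sub>1 (\<lambda>x\<^sub>1 y\<^sub>1. cop_sum \<rho>\<^sub>2 (\<lambda>x\<^sub>2 y\<^sub>2. a x\<^sub>1 * a x\<^sub>2 * of_bool (V y\<^sub>2 \<and> opr y\<^sub>1 y\<^sub>2 = \<tau>)))))"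
proof -
  define E where "E \<rho>\<^sub>1 \<rho>\<^sub>2 = cop_sum \<rho>\<^sub>1 (\<lambda>x\<^sub>1 y\<^sub>1. cop_sum \<rho>\<^sub>2 (\<lambda>x\<^sub>2 y\<^sub>2.
    a x\<^sub>1 * a x\<^sub>2 * of_bool (V y\<^sub>2 \<and> opr y\<^sub>1 y\<^sub>2 = \<tau>)))" for \<rho>\<^sub>1 \<rho>\<^sub>2
  let ?c = "\<lambda>\<rho> \<tau>. cop_sum \<rho> (\<lambda>x y. a x * of_bool (y = \<tau>))"
  \<comment> \<open>The sums over possible unpruned parts collapse to those that occur in the
    coproducts.\<close>
  have E: "(\<Sum>\<kappa>\<^sub>1\<in>fs n. \<Sum>\<kappa>\<^sub>2\<in>fs n. of_bool (V \<kappa>\<^sub>2 \<and> deg \<kappa>\<^sub>1 + deg \<kappa>\<^sub>2 \<le> n \<and> opr \<kappa>\<^sub>1 \<kappa>\<^sub>2 = \<tau>) * (?c \<rho>\<^sub>1 \<kappa>\<^sub>1 * ?c \<rho>\<^sub>2 \<kappa>\<^sub>2))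
      = E \<rho>\<^sub>1 \<rho>\<^sub>2" if "\<rho>\<^sub>1 \<in> fs n" "\<rho>\<^sub>2 \<in> fs n" for \<rho>\<^sub>1 \<rho>\<^sub>2
  proof -
    have "(\<Sum>\<kappa>\<^sub>1\<in>fs n. \<Sum>\<kappa>\<^sub>2\<in>fs n. of_bool (V \<kappa>\<^sub>2 \<and> deg \<kappa>\<^sub>1 + deg \<kappa>\<^sub>2 \<le> n \<and> opr \<kappa>\<^sub>1 \<kappa>\<^sub>2 = \<tau>) * (?c \<rho>\<^sub>1 \<kappa>\<^sub>1 * ?c \<rho>\<^sub>2 \<kappa>\<^sub>2))
      = (\<Sum>\<kappa>\<^sub>1\<in>fs n. \<Sum>\<kappa>\<^sub>2\<in>fs n. cop_sum \<rho>\<^sub>1 (\<lambda>x\<^sub>1 y\<^sub>1. cop_sum \<rho>\<^sub>2 (\<lambda>x\<^sub>2 y\<^sub>2.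
          of_bool (V \<kappa>\<^sub>2 \<and> deg \<kappa>\<^sub>1 + deg \<kappa>\<^sub>2 \<le> n \<and> opr \<kappa>\<^sub>1 \<kappa>\<^sub>2 = \<tau>) *
          ((a x\<^sub>1 * of_bool (y\<^sub>1 = \<kappa>\<^sub>1)) * (a x\<^sub>2 * of_bool (y\<^sub>2 = \<kappa>\<^sub>2))))))"
      by (simp only: cop_sum_mult_left cop_sum_mult_right)
    also have "\<dots> = cop_sum \<rho>\<^sub>1 (\<lambda>x\<^sub>1 y\<^sub>1. cop_sum \<rho>\<^sub>2 (\<lambda>x\<^sub>2 y\<^sub>2. \<Sum>\<kappa>\<^sub>1\<in>fs n. \<Sum>\<kappa>\<^sub>2\<in>fs n.
          of_bool (V \<kappa>\<^sub>2 \<and> deg \<kappa>\<^sub>1 + deg \<kappa>\<^sub>2 \<le> n \<and> opr \<kappa>\<^sub>1 \<kappa>\<^sub>2 = \<tau>) *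
          ((a x\<^sub>1 * of_bool (y\<^sub>1 = \<kappa>\<^sub>1)) * (a x\<^sub>2 * of_bool (y\<^sub>2 = \<kappa>\<^sub>2)))))"
      by (simp only: cop_sum_sum)
    also have "\<dots> = E \<rho>\<^sub>1 \<rho>\<^sub>2"
      unfolding E_def
    proof (intro cop_sum_cong)
      fix x\<^sub>1 y\<^sub>1 x\<^sub>2 y\<^sub>2 assume "(x\<^sub>1, y\<^sub>1) \<in># coproduct \<rho>\<^sub>1" "(x\<^sub>2, y\<^sub>2) \<in># coproduct \<rho>\<^sub>2"
      then have y: "y\<^sub>1 \<in> fs n" "y\<^sub>2 \<in> fs n"
        using that by (auto dest!: coproduct_snd_deg)
      have "(\<Sum>\<kappa>\<^sub>1\<in>fs n. \<Sum>\<kappa>\<^sub>2\<in>fs n.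
          of_bool (V \<kappa>\<^sub>2 \<and> deg \<kappa>\<^sub>1 + deg \<kappa>\<^sub>2 \<le> n \<and> opr \<kappa>\<^sub>1 \<kappa>\<^sub>2 = \<tau>) *
          ((a x\<^sub>1 * of_bool (y\<^sub>1 = \<kappa>\<^sub>1)) * (a x\<^sub>2 * of_bool (y\<^sub>2 = \<kappa>\<^sub>2)))) =
        (\<Sum>\<kappa>\<^sub>1\<in>fs n. of_bool (y\<^sub>1 = \<kappa>\<^sub>1) * (\<Sum>\<kappa>\<^sub>2\<in>fs n. of_bool (y\<^sub>2 = \<kappa>\<^sub>2) *
          (a x\<^sub>1 * a x\<^sub>2 * of_bool (V \<kappa>\<^sub>2 \<and> deg \<kappa>\<^sub>1 + deg \<kappa>\<^sub>2 \<le> n \<and> opr \<kappa>\<^sub>1 \<kappa>\<^sub>2 = \<tau>))))"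
        unfolding sum_distrib_left by (intro sum.cong refl) (simp only: mult_ac)
      also have "\<dots> = a x\<^sub>1 * a x\<^sub>2 * of_bool (V y\<^sub>2 \<and> deg y\<^sub>1 + deg y\<^sub>2 \<le> n \<and> opr y\<^sub>1 y\<^sub>2 = \<tau>)"
        using y by (simp only: sum_of_bool_eq finite_fs) simp
      also have "(V y\<^sub>2 \<and> deg y\<^sub>1 + deg y\<^sub>2 \<le> n \<and> opr y\<^sub>1 y\<^sub>2 = \<tau>) = (V y\<^sub>2 \<and> opr y\<^sub>1 y\<^sub>2 = \<tau>)"
        using \<tau>(2) op_deg[of y\<^sub>2 y\<^sub>1] by auto
      finally show "(\<Sum>\<kappa>\<^sub>1\<in>fs n. \<Sum>\<kappa>\<^sub>2\<in>fs n.
          of_bool (V \<kappa>\<^sub>2 \<and> deg \<kappa>\<^sub>1 + deg \<kappa>\<^sub>2 \<le> n \<and> opr \<kappa>\<^sub>1 \<kappa>\<^sub>2 = \<tau>) *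
          ((a x\<^sub>1 * of_bool (y\<^sub>1 = \<kappa>\<^sub>1)) * (a x\<^sub>2 * of_bool (y\<^sub>2 = \<kappa>\<^sub>2)))) =
          a x\<^sub>1 * a x\<^sub>2 * of_bool (V y\<^sub>2 \<and> opr y\<^sub>1 y\<^sub>2 = \<tau>)" .
    qed
    finally show ?thesis .
  qed
  have "conv n opr V (Gam n a \<phi>) (Gam n a \<psi>) \<tau> =
      (\<Sum>\<kappa>\<^sub>1\<in>fs n. \<Sum>\<kappa>\<^sub>2\<in>fs n. \<Sum>\<rho>\<^sub>1\<in>fs n. \<Sum>\<rho>\<^sub>2\<in>fs n. (\<phi> \<rho>\<^sub>1 * \<psi> \<rho>\<^sub>2) *
        (of_bool (V \<kappa>\<^sub>2 \<and> deg \<kappa>\<^sub>1 + deg \<kappa>\<^sub>2 \<le> n \<and> opr \<kappa>\<^sub>1 \<kappa>\<^sub>2 = \<tau>) * (?c \<rho>\<^sub>1 \<kappa>\<^sub>1 * ?c \<rho>\<^sub>2 \<kappa>\<^sub>2)))"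
    unfolding conv_def Gam_def sum_product unfolding sum_distrib_left
    by (intro sum.cong refl) (simp only: mult_ac)
  also have "\<dots> = (\<Sum>\<rho>\<^sub>1\<in>fs n. \<Sum>\<rho>\<^sub>2\<in>fs n. \<Sum>\<kappa>\<^sub>1\<in>fs n. \<Sum>\<kappa>\<^sub>2\<in>fs n. (\<phi> \<rho>\<^sub>1 * \<psi> \<rho>\<^sub>2) *
        (of_bool (V \<kappa>\<^sub>2 \<and> deg \<kappa>\<^sub>1 + deg \<kappa>\<^sub>2 \<le> n \<and> opr \<kappa>\<^sub>1 \<kappa>\<^sub>2 = \<tau>) * (?c \<rho>\<^sub>1 \<kappa>\<^sub>1 * ?c \<rho>\<^sub>2 \<kappa>\<^sub>2)))"
    by (rule sum_swap4)
  also have "\<dots> = (\<Sum>\<rho>\<^sub>1\<in>fs n. \<Sum>\<rho>\<^sub>2\<in>fs n. (\<phi> \<rho>\<^sub>1 * \<psi> \<rho>\<^sub>2) * E \<rho>\<^sub>1 \<rho>\<^sub>2)"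
    by (intro sum.cong refl) (simp only: sum_distrib_left[symmetric] E)
  finally have 1: "conv n opr V (Gam n a \<phi>) (Gam n a \<psi>) \<tau> =
    (\<Sum>\<rho>\<^sub>1\<in>fs n. \<Sum>\<rho>\<^sub>2\<in>fs n. (\<phi> \<rho>\<^sub>1 * \<psi> \<rho>\<^sub>2) * E \<rho>\<^sub>1 \<rho>\<^sub>2)" .
  have "Gam n a (conv n opr V \<phi> \<psi>) \<tau> = (\<Sum>\<rho>\<in>fs n. \<Sum>\<rho>\<^sub>1\<in>fs n. \<Sum>\<rho>\<^sub>2\<in>fs n.
      of_bool (V \<rho>\<^sub>2 \<and> deg \<rho>\<^sub>1 + deg \<rho>\<^sub>2 \<le> n \<and> opr \<rho>\<^sub>1 \<rho>\<^sub>2 = \<rho>) * (\<phi> \<rho>\<^sub>1 * \<psi> \<rho>\<^sub>2) * ?c \<rho> \<tau>)"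
    unfolding Gam_def conv_def sum_distrib_right ..
  also have "\<dots> = (\<Sum>\<rho>\<^sub>1\<in>fs n. \<Sum>\<rho>\<in>fs n. \<Sum>\<rho>\<^sub>2\<in>fs n.
      of_bool (V \<rho>\<^sub>2 \<and> deg \<rho>\<^sub>1 + deg \<rho>\<^sub>2 \<le> n \<and> opr \<rho>\<^sub>1 \<rho>\<^sub>2 = \<rho>) * (\<phi> \<rho>\<^sub>1 * \<psi> \<rho>\<^sub>2) * ?c \<rho> \<tau>)"
    by (rule sum.swap)
  also have "\<dots> = (\<Sum>\<rho>\<^sub>1\<in>fs n. \<Sum>\<rho>\<^sub>2\<in>fs n. \<Sum>\<rho>\<in>fs n.
      of_bool (V \<rho>\<^sub>2 \<and> deg \<rho>\<^sub>1 + deg \<rho>\<^sub>2 \<le> n \<and> opr \<rho>\<^sub>1 \<rho>\<^sub>2 = \<rho>) * (\<phi> \<rho>\<^sub>1 * \<psi> \<rho>\<^sub>2) * ?c \<rho> \<tau>)"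
    by (intro sum.cong refl sum.swap)
  also have "\<dots> = (\<Sum>\<rho>\<^sub>1\<in>fs n. \<Sum>\<rho>\<^sub>2\<in>fs n. of_bool (V \<rho>\<^sub>2 \<and> deg \<rho>\<^sub>1 + deg \<rho>\<^sub>2 \<le> n) * ((\<phi> \<rho>\<^sub>1 * \<psi> \<rho>\<^sub>2) * E \<rho>\<^sub>1 \<rho>\<^sub>2))"
  proof (intro sum.cong refl)
    fix \<rho>\<^sub>1 \<rho>\<^sub>2 :: "'l forest"
    have "(\<Sum>\<rho>\<in>fs n. of_bool (V \<rho>\<^sub>2 \<and> deg \<rho>\<^sub>1 + deg \<rho>\<^sub>2 \<le> n \<and> opr \<rho>\<^sub>1 \<rho>\<^sub>2 = \<rho>) * (\<phi> \<rho>\<^sub>1 * \<psi> \<rho>\<^sub>2) * ?c \<rho> \<tau>) =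
      (\<Sum>\<rho>\<in>fs n. of_bool (opr \<rho>\<^sub>1 \<rho>\<^sub>2 = \<rho>) * (of_bool (V \<rho>\<^sub>2 \<and> deg \<rho>\<^sub>1 + deg \<rho>\<^sub>2 \<le> n) * ((\<phi> \<rho>\<^sub>1 * \<psi> \<rho>\<^sub>2) * ?c \<rho> \<tau>)))"
      by (intro sum.cong refl) auto
    also have "\<dots> = of_bool (opr \<rho>\<^sub>1 \<rho>\<^sub>2 \<in> fs n) * (of_bool (V \<rho>\<^sub>2 \<and> deg \<rho>\<^sub>1 + deg \<rho>\<^sub>2 \<le> n) * ((\<phi> \<rho>\<^sub>1 * \<psi> \<rho>\<^sub>2) * ?c (opr \<rho>\<^sub>1 \<rho>\<^sub>2) \<tau>))"
      by (rule sum_of_bool_eq) simp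
    also have "\<dots> = of_bool (V \<rho>\<^sub>2 \<and> deg \<rho>\<^sub>1 + deg \<rho>\<^sub>2 \<le> n) * ((\<phi> \<rho>\<^sub>1 * \<psi> \<rho>\<^sub>2) * E \<rho>\<^sub>1 \<rho>\<^sub>2)"
    proof (cases "V \<rho>\<^sub>2 \<and> deg \<rho>\<^sub>1 + deg \<rho>\<^sub>2 \<le> n")
      case True
      then have "?c (opr \<rho>\<^sub>1 \<rho>\<^sub>2) \<tau> = E \<rho>\<^sub>1 \<rho>\<^sub>2"
        unfolding E_def op_cop[OF conjunct1[OF True] \<tau>(1)]
        by (intro cop_sum_cong) (auto dest!: coproduct_fst_deg simp: characters_plus[OF a])
      then show ?thesis using True op_deg[of \<rho>\<^sub>2 \<rho>\<^sub>1] by simp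
    qed simp
    finally show "(\<Sum>\<rho>\<in>fs n. of_bool (V \<rho>\<^sub>2 \<and> deg \<rho>\<^sub>1 + deg \<rho>\<^sub>2 \<le> n \<and> opr \<rho>\<^sub>1 \<rho>\<^sub>2 = \<rho>) * (\<phi> \<rho>\<^sub>1 * \<psi> \<rho>\<^sub>2) * ?c \<rho> \<tau>)
      = of_bool (V \<rho>\<^sub>2 \<and> deg \<rho>\<^sub>1 + deg \<rho>\<^sub>2 \<le> n) * ((\<phi> \<rho>\<^sub>1 * \<psi> \<rho>\<^sub>2) * E \<rho>\<^sub>1 \<rho>\<^sub>2)" .
  qed
  finally have 2: "Gam n a (conv n opr V \<phi> \<psi>) \<tau> =
    (\<Sum>\<rho>\<^sub>1\<in>fs n. \<Sum>\<rho>\<^sub>2\<in>fs n. of_bool (V \<rho>\<^sub>2 \<and> deg \<rho>\<^sub>1 + deg \<rho>\<^sub>2 \<le> n) * ((\<phi> \<rho>\<^sub>1 * \<psi> \<rho>\<^sub>2) * E \<rho>\<^sub>1 \<rho>\<^sub>2))" .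
  have "(\<phi> \<rho>\<^sub>1 * \<psi> \<rho>\<^sub>2) * E \<rho>\<^sub>1 \<rho>\<^sub>2 - of_bool (V \<rho>\<^sub>2 \<and> deg \<rho>\<^sub>1 + deg \<rho>\<^sub>2 \<le> n) * ((\<phi> \<rho>\<^sub>1 * \<psi> \<rho>\<^sub>2) * E \<rho>\<^sub>1 \<rho>\<^sub>2) =
    of_bool (V \<rho>\<^sub>2 \<and> n < deg \<rho>\<^sub>1 + deg \<rho>\<^sub>2) * (\<phi> \<rho>\<^sub>1 * \<psi> \<rho>\<^sub>2 * E \<rho>\<^sub>1 \<rho>\<^sub>2)" for \<rho>\<^sub>1 \<rho>\<^sub>2
    by (cases "V \<rho>\<^sub>2") (auto simp: supp not_le)
  then show ?thesis
    unfolding 1 2 sum_subtractf[symmetric] E_def[symmetric] by simp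
qed

end

interpretation plus_op: forest_op "(+)" "\<lambda>_. True" "\<lambda>_. True"
  by unfold_locales (auto simp: cop_sum_plus)

text \<open>Grafting is extended to forests so that it has the type of a binary operation; inside
  \<open>conv\<close> the predicate \<open>single\<close> restricts it to trees.\<close>

definition graftf :: "'l forest \<Rightarrow> 'l forest \<Rightarrow> 'l forest" where
  "graftf \<sigma> \<kappa> = image_mset (graft \<sigma>) \<kappa>"

lemma graftf_single [simp]: "graftf \<sigma> {#\<tau>#} = {#graft \<sigma> \<tau>#}"
  by (simp add: graftf_def)

lemma graft_Node [simp]: "graft \<sigma> (Node i c) = Node i (\<sigma> + c)"
  by (simp add: graft_def)

lemma graftf_Node: "graftf \<sigma> {#Node i c#} = {#Node i (\<sigma> + c)#}"
  by (simp add: graft_def)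

definition single :: "'l forest \<Rightarrow> bool" where
  "single \<rho> \<longleftrightarrow> (\<exists>i c. \<rho> = {#Node i c#})"

lemma single_Node [simp]: "single {#Node i c#}" "\<not> single {#}"
  by (auto simp: single_def)

lemma single_tree [simp]: "single {#\<tau>#}"
  by (cases \<tau>) simp

interpretation graft_op: forest_op graftf single "\<lambda>\<tau>. \<tau> \<noteq> {#}"
proof
  fix \<rho>\<^sub>2 \<rho>\<^sub>1 \<tau> :: "'l forest" and a :: "'l forest \<Rightarrow> real"
  assume "single \<rho>\<^sub>2"
  then obtain i c where \<rho>\<^sub>2: "\<rho>\<^sub>2 = {#Node i c#}" by (auto simp: single_def)
  show "deg (graftf \<rho>\<^sub>1 \<rho>\<^sub>2) = deg \<rho>\<^sub>1 + deg \<rho>\<^sub>2" by (simp add: \<rho>\<^sub>2 graftf_Node)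
  assume "\<tau> \<noteq> {#}"
  then show "cop_sum (graftf \<rho>\<^sub>1 \<rho>\<^sub>2) (\<lambda>x y. a x * of_bool (y = \<tau>)) =
      cop_sum \<rho>\<^sub>1 (\<lambda>x\<^sub>1 y\<^sub>1. cop_sum \<rho>\<^sub>2 (\<lambda>x\<^sub>2 y\<^sub>2. a (x\<^sub>1 + x\<^sub>2) * of_bool (single y\<^sub>2 \<and> graftf y\<^sub>1 y\<^sub>2 = \<tau>)))"
    by (simp add: \<rho>\<^sub>2 graftf_Node cop_sum_Node cop_sum_plus)
qed

lemma conv_plus_empty: "conv n (+) (\<lambda>_. True) \<phi> \<psi> {#} = \<phi> {#} * \<psi> {#}"
proof -
  have "conv n (+) (\<lambda>_. True) \<phi> \<psi> {#} =
      (\<Sum>\<rho>\<^sub>1\<in>fs n. of_bool (\<rho>\<^sub>1 = {#}) * (\<Sum>\<rho>\<^sub>2\<in>fs n. of_bool (\<rho>\<^sub>2 = {#}) * (\<phi> \<rho>\<^sub>1 * \<psi> \<rho>\<^sub>2)))"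
    unfolding conv_def sum_distrib_left by (intro sum.cong refl) auto
  then show ?thesis by (simp add: sum_of_bool_eq)
qed

section \<open>Controlled functionals\<close>

text \<open>The exponent \<open>p\<close> is a parameter: it is instantiated with the variation
  exponent and with larger exponents below \<open>N\<close>. With \<omega> at most 1 the powers of
  \<open>w\<close> can be compared, and \<open>H\<close> absorbs the rescaling that achieves this.
  \<open>M\<close> bounds the number of forests and the number of cuts.\<close>

locale rough_data =
  fixes n :: nat and p N H M a b :: real and \<omega> :: "real \<Rightarrow> real \<Rightarrow> real"
    and Z :: "real \<Rightarrow> real \<Rightarrow> 'd::finite forest \<Rightarrow> real"
  assumes ctl: "control a b \<omega>"
    and \<omega>_le1: "\<And>s t. a \<le> s \<Longrightarrow> s \<le> t \<Longrightarrow> t \<le> b \<Longrightarrow> \<omega> s t \<le> 1"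
    and N: "real n < N" "N \<le> real n + 1" and p: "0 < p" "p < N" and H: "1 \<le> H"
    and Zc: "\<And>s t. a \<le> s \<Longrightarrow> s \<le> t \<Longrightarrow> t \<le> b \<Longrightarrow> Z s t \<in> characters n"
    and Zchen: "\<And>s t u. a \<le> s \<Longrightarrow> s \<le> t \<Longrightarrow> t \<le> u \<Longrightarrow> u \<le> b \<Longrightarrow> star n (Z s t) (Z t u) = Z s u"
    and Zb: "\<And>s t \<rho>. a \<le> s \<Longrightarrow> s \<le> t \<Longrightarrow> t \<le> b \<Longrightarrow> deg \<rho> \<le> n \<Longrightarrow>
      \<bar>Z s t \<rho>\<bar> \<le> H * (\<omega> s t powr (1 / p)) ^ deg \<rho>"
    and M_card: "real (card (fs n :: 'd forest set)) \<le> M"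
    and M_cop: "\<And>\<rho> :: 'd forest. deg \<rho> \<le> n \<Longrightarrow> real (size (coproduct \<rho>)) \<le> M"
begin

definition w :: "real \<Rightarrow> real \<Rightarrow> real" where "w s t = \<omega> s t powr (1 / p)"

lemma M1: "1 \<le> M"
  using M_cop[of "{#}"] by (simp add: coproduct_empty)

lemma w_nonneg [simp]: "0 \<le> w s t"
  by (simp add: w_def)

lemma w_le1: "a \<le> s \<Longrightarrow> s \<le> t \<Longrightarrow> t \<le> b \<Longrightarrow> w s t \<le> 1"
  unfolding w_def using \<omega>_le1[of s t] control_nonneg[OF ctl, of s t] p by (simp add: powr_le1)

lemma w_mono: "a \<le> s' \<Longrightarrow> s' \<le> s \<Longrightarrow> s \<le> t \<Longrightarrow> t \<le> t' \<Longrightarrow> t' \<le> b \<Longrightarrow> w s t \<le> w s' t'"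
  unfolding w_def using control_mono[OF ctl, of s' s t t'] control_nonneg[OF ctl, of s t] p
  by (intro powr_mono2) auto

lemma w_N: "w s t powr N = \<omega> s t powr (N / p)"
  by (simp add: w_def powr_powr)

lemma theta: "1 < N / p"
  using p by simp

lemma Zw: "a \<le> s \<Longrightarrow> s \<le> t \<Longrightarrow> t \<le> b \<Longrightarrow> deg \<rho> \<le> n \<Longrightarrow> \<bar>Z s t \<rho>\<bar> \<le> H * w s t ^ deg \<rho>"
  unfolding w_def by (rule Zb)

lemma ZH: "a \<le> s \<Longrightarrow> s \<le> t \<Longrightarrow> t \<le> b \<Longrightarrow> deg \<rho> \<le> n \<Longrightarrow> \<bar>Z s t \<rho>\<bar> \<le> H"
proof -
  assume *: "a \<le> s" "s \<le> t" "t \<le> b" "deg \<rho> \<le> n"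
  have "H * w s t ^ deg \<rho> \<le> H * 1" using H w_le1[OF *(1-3)] by (intro mult_left_mono power_le_one) auto
  then show ?thesis using Zw[OF *] by simp
qed

lemma wt_mono:
  assumes "0 \<le> x" "x \<le> (1::real)" "k \<le> j"
  shows "x powr (N - real k) \<le> x powr (N - real j)"
  using assms by (intro powr_mono') auto

text \<open>Here \<open>N \<le> n + 1\<close> enters: an integer \<open>k\<close> above
  \<open>n - j\<close> is at least \<open>N - j\<close>.\<close>

lemma pow_le_wt:
  assumes "0 \<le> x" "x \<le> (1::real)" "n < k + j" "j \<le> n"
  shows "x ^ k \<le> x powr (N - real j)"
proof (cases "x = 0")
  case True
  then show ?thesis using assms by (cases k) auto
next
  case False
  then have "x ^ k = x powr real k" using assms by (simp add: powr_realpow)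
  also have "\<dots> \<le> x powr (N - real j)" using assms N by (intro powr_mono') auto
  finally show ?thesis .
qed

lemma Gam_abs_le:
  assumes "a \<le> s" "s \<le> t" "t \<le> b" "\<And>\<rho>. \<rho> \<in> fs n \<Longrightarrow> \<bar>\<phi> \<rho>\<bar> \<le> A" "0 \<le> A"
  shows "\<bar>Gam n (Z s t) \<phi> \<tau>\<bar> \<le> M * (A * (M * H))"
  unfolding Gam_def
proof (rule sum_abs_le[OF _ M_card])
  fix \<rho> :: "'d forest" assume \<rho>: "\<rho> \<in> fs n"
  have "\<bar>cop_sum \<rho> (\<lambda>x y. Z s t x * of_bool (y = \<tau>))\<bar> \<le> real (size (coproduct \<rho>)) * H"
  proof (rule cop_sum_abs_le)
    fix x y assume "(x, y) \<in># coproduct \<rho>"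
    from coproduct_fst_deg[OF this] show "\<bar>Z s t x * of_bool (y = \<tau>)\<bar> \<le> H"
      using ZH[OF assms(1-3), of x] \<rho> H by auto
  qed
  also have "\<dots> \<le> M * H" using M_cop[of \<rho>] \<rho> H by (intro mult_right_mono) auto
  finally show "\<bar>\<phi> \<rho> * cop_sum \<rho> (\<lambda>x y. Z s t x * of_bool (y = \<tau>))\<bar> \<le> A * (M * H)"
    unfolding abs_mult using assms(4)[OF \<rho>] assms(5) by (intro mult_mono) auto
qed (use assms(5) M1 H in auto)

text \<open>\<open>V\<close> limits the forests at which the increment is estimated. A bare one-form
  has coefficient 0 at the empty forest, whereas its transport there is the pairing with the
  increment of the path, which is not of order \<open>N\<close>; hence \<open>V = single\<close> for
  the one-form of \<open>f\<close>. One constant serves for size and increment, so that a product is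
  again described by one constant.\<close>

definition controlled :: "('d forest \<Rightarrow> bool) \<Rightarrow> real \<Rightarrow> real \<Rightarrow> (real \<Rightarrow> 'd forest \<Rightarrow> real) \<Rightarrow> bool" where
  "controlled V K s \<phi> \<longleftrightarrow>
     (\<forall>t \<tau>. s \<le> t \<and> t \<le> b \<and> deg \<tau> \<le> n \<longrightarrow> \<bar>\<phi> t \<tau>\<bar> \<le> K) \<and>
     (\<forall>t u \<tau>. s \<le> t \<and> t \<le> u \<and> u \<le> b \<and> deg \<tau> \<le> n \<and> V \<tau> \<longrightarrow>
        \<bar>\<phi> u \<tau> - Gam n (Z t u) (\<phi> t) \<tau>\<bar> \<le> K * w t u powr (N - real (deg \<tau>)))"

lemma controlled_bd: "controlled V K s \<phi> \<Longrightarrow> s \<le> t \<Longrightarrow> t \<le> b \<Longrightarrow> deg \<tau> \<le> n \<Longrightarrow> \<bar>\<phi> t \<tau>\<bar> \<le> K"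
  and controlled_diff: "controlled V K s \<phi> \<Longrightarrow> s \<le> t \<Longrightarrow> t \<le> u \<Longrightarrow> u \<le> b \<Longrightarrow> deg \<tau> \<le> n \<Longrightarrow> V \<tau> \<Longrightarrow>
    \<bar>\<phi> u \<tau> - Gam n (Z t u) (\<phi> t) \<tau>\<bar> \<le> K * w t u powr (N - real (deg \<tau>))"
  by (auto simp: controlled_def)

lemma controlled_mono:
  assumes "controlled V K s \<phi>" "K \<le> K'"
  shows "controlled V K' s \<phi>"
  unfolding controlled_def
proof (intro conjI allI impI; elim conjE)
  fix t :: real and \<tau> :: "'d forest" assume "s \<le> t" "t \<le> b" "deg \<tau> \<le> n"
  then show "\<bar>\<phi> t \<tau>\<bar> \<le> K'" using controlled_bd[OF assms(1)] assms(2) by (meson order_trans)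
next
  fix t u :: real and \<tau> :: "'d forest" assume "s \<le> t" "t \<le> u" "u \<le> b" "deg \<tau> \<le> n" "V \<tau>"
  then have "\<bar>\<phi> u \<tau> - Gam n (Z t u) (\<phi> t) \<tau>\<bar> \<le> K * w t u powr (N - real (deg \<tau>))"
    by (rule controlled_diff[OF assms(1)])
  also have "\<dots> \<le> K' * w t u powr (N - real (deg \<tau>))" using assms(2) by (intro mult_right_mono) auto
  finally show "\<bar>\<phi> u \<tau> - Gam n (Z t u) (\<phi> t) \<tau>\<bar> \<le> K' * w t u powr (N - real (deg \<tau>))" .
qed

lemma controlled_subset: "controlled V K s \<phi> \<Longrightarrow> s \<le> s' \<Longrightarrow> controlled V K s' \<phi>"
  unfolding controlled_def by (meson order_trans)

lemma controlled_nonneg: "controlled V K s \<phi> \<Longrightarrow> s \<le> b \<Longrightarrow> 0 \<le> K"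
  using controlled_bd[of V K s \<phi> s "{#}"] by fastforce

lemma controlled_conv:
  assumes opr: "forest_op opr V W"
    and \<phi>: "controlled (\<lambda>_. True) A s \<phi>" and \<psi>: "controlled V B s \<psi>"
    and supp: "\<And>t \<rho>. \<not> V \<rho> \<Longrightarrow> \<psi> t \<rho> = 0"
    and t: "a \<le> s" "s \<le> t" "t \<le> u" "u \<le> b" and \<tau>: "deg \<tau> \<le> n" "W \<tau>"
  shows "\<bar>conv n opr V (\<phi> u) (\<psi> u) \<tau> - Gam n (Z t u) (conv n opr V (\<phi> t) (\<psi> t)) \<tau>\<bar>
    \<le> 3 * M ^ 4 * H ^ 2 * A * B * w t u powr (N - real (deg \<tau>))"
proof -
  interpret forest_op opr V W by (rule opr)
  let ?x = "w t u" and ?G = "Gam n (Z t u)"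
  let ?k = "?x powr (N - real (deg \<tau>))"
  have x: "0 \<le> ?x" "?x \<le> 1" using t by (auto intro: w_le1)
  have A: "0 \<le> A" and B: "0 \<le> B"
    using controlled_nonneg[OF \<phi>] controlled_nonneg[OF \<psi>] t by auto
  note M = M1 and M0 = order_trans[OF zero_le_one M1] and H0 = order_trans[OF zero_le_one H]
  \<comment> \<open>Change of the first factor, change of the second, and the failure of
    multiplicativity of the transport. Each costs at most \<open>M ^ 4 * H ^ 2 * A * B\<close> times
    the weight.\<close>
  have dec: "conv n opr V (\<phi> u) (\<psi> u) \<tau> - ?G (conv n opr V (\<phi> t) (\<psi> t)) \<tau> =
     conv n opr V (\<lambda>\<rho>. \<phi> u \<rho> - ?G (\<phi> t) \<rho>) (\<psi> u) \<tau> +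
     conv n opr V (?G (\<phi> t)) (\<lambda>\<rho>. \<psi> u \<rho> - ?G (\<psi> t) \<rho>) \<tau> +
     (conv n opr V (?G (\<phi> t)) (?G (\<psi> t)) \<tau> - ?G (conv n opr V (\<phi> t) (\<psi> t)) \<tau>)"
    by (simp add: conv_diff_left conv_diff_right)
  have wt: "?x powr (N - real (deg \<rho>\<^sub>1)) \<le> ?k" "?x powr (N - real (deg \<rho>\<^sub>2)) \<le> ?k"
    if "V \<rho>\<^sub>2" "opr \<rho>\<^sub>1 \<rho>\<^sub>2 = \<tau>" for \<rho>\<^sub>1 \<rho>\<^sub>2
  proof -
    have "deg \<rho>\<^sub>1 \<le> deg \<tau>" "deg \<rho>\<^sub>2 \<le> deg \<tau>" using op_deg[OF that(1), of \<rho>\<^sub>1] that(2) by auto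
    then show "?x powr (N - real (deg \<rho>\<^sub>1)) \<le> ?k" "?x powr (N - real (deg \<rho>\<^sub>2)) \<le> ?k"
      using x by (auto intro: wt_mono)
  qed
  have "\<bar>conv n opr V (\<lambda>\<rho>. \<phi> u \<rho> - ?G (\<phi> t) \<rho>) (\<psi> u) \<tau>\<bar> \<le> M * (M * (A * ?k * B))"
  proof (rule conv_abs_le[OF _ M_card])
    fix \<rho>\<^sub>1 \<rho>\<^sub>2 :: "'d forest" assume *: "\<rho>\<^sub>1 \<in> fs n" "\<rho>\<^sub>2 \<in> fs n" "V \<rho>\<^sub>2" "opr \<rho>\<^sub>1 \<rho>\<^sub>2 = \<tau>"
    have "\<bar>\<phi> u \<rho>\<^sub>1 - ?G (\<phi> t) \<rho>\<^sub>1\<bar> \<le> A * ?x powr (N - real (deg \<rho>\<^sub>1))"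
      using controlled_diff[OF \<phi>, of t u \<rho>\<^sub>1] t * by simp
    also have "\<dots> \<le> A * ?k" using wt(1)[OF *(3,4)] A by (intro mult_left_mono)
    finally show "\<bar>(\<phi> u \<rho>\<^sub>1 - ?G (\<phi> t) \<rho>\<^sub>1) * \<psi> u \<rho>\<^sub>2\<bar> \<le> A * ?k * B"
      unfolding abs_mult using controlled_bd[OF \<psi>, of u \<rho>\<^sub>2] t * A by (intro mult_mono) auto
  qed (use A B in simp)
  also have "\<dots> \<le> M ^ 4 * H ^ 2 * (A * B * ?k)"
  proof -
    have "M * M \<le> M ^ 4 * H ^ 2"
    proof -
      have "M * M * 1 \<le> M ^ 4 * H ^ 2"
        using M one_le_power[OF H, of 2] power_increasing[of 2 4 M] unfolding power2_eq_square[of M]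
        by (intro mult_mono) auto
      then show ?thesis by simp
    qed
    then have "M * M * (A * B * ?k) \<le> M ^ 4 * H ^ 2 * (A * B * ?k)" using A B by (intro mult_right_mono) auto
    then show ?thesis by (simp add: algebra_simps)
  qed
  finally have 1: "\<bar>conv n opr V (\<lambda>\<rho>. \<phi> u \<rho> - ?G (\<phi> t) \<rho>) (\<psi> u) \<tau>\<bar> \<le> M ^ 4 * H ^ 2 * (A * B * ?k)" .
  have "\<bar>conv n opr V (?G (\<phi> t)) (\<lambda>\<rho>. \<psi> u \<rho> - ?G (\<psi> t) \<rho>) \<tau>\<bar> \<le> M * (M * (M * (A * (M * H)) * (B * ?k)))"
  proof (rule conv_abs_le[OF _ M_card])
    fix \<rho>\<^sub>1 \<rho>\<^sub>2 :: "'d forest" assume *: "\<rho>\<^sub>1 \<in> fs n" "\<rho>\<^sub>2 \<in> fs n" "V \<rho>\<^sub>2" "opr \<rho>\<^sub>1 \<rho>\<^sub>2 = \<tau>"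
    have "\<bar>\<psi> u \<rho>\<^sub>2 - ?G (\<psi> t) \<rho>\<^sub>2\<bar> \<le> B * ?x powr (N - real (deg \<rho>\<^sub>2))"
      using controlled_diff[OF \<psi>, of t u \<rho>\<^sub>2] t * by simp
    also have "\<dots> \<le> B * ?k" using wt(2)[OF *(3,4)] B by (intro mult_left_mono)
    finally have "\<bar>\<psi> u \<rho>\<^sub>2 - ?G (\<psi> t) \<rho>\<^sub>2\<bar> \<le> B * ?k" .
    moreover have "\<bar>?G (\<phi> t) \<rho>\<^sub>1\<bar> \<le> M * (A * (M * H))"
      using t controlled_bd[OF \<phi>, of t] A by (intro Gam_abs_le) auto
    ultimately show "\<bar>?G (\<phi> t) \<rho>\<^sub>1 * (\<psi> u \<rho>\<^sub>2 - ?G (\<psi> t) \<rho>\<^sub>2)\<bar> \<le> M * (A * (M * H)) * (B * ?k)"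
      unfolding abs_mult using A B M0 H0 by (intro mult_mono) auto
  qed (use A B M0 H0 in simp)
  also have "\<dots> \<le> M ^ 4 * H ^ 2 * (A * B * ?k)"
  proof -
    have "M ^ 4 * H \<le> M ^ 4 * H ^ 2"
      using H M0 by (intro mult_left_mono) (auto simp: self_le_power)
    then have "M ^ 4 * H * (A * B * ?k) \<le> M ^ 4 * H ^ 2 * (A * B * ?k)" using A B by (intro mult_right_mono) auto
    then show ?thesis by (simp add: algebra_simps eval_nat_numeral)
  qed
  finally have 2: "\<bar>conv n opr V (?G (\<phi> t)) (\<lambda>\<rho>. \<psi> u \<rho> - ?G (\<psi> t) \<rho>) \<tau>\<bar> \<le> M ^ 4 * H ^ 2 * (A * B * ?k)" .
  have "\<bar>conv n opr V (?G (\<phi> t)) (?G (\<psi> t)) \<tau> - ?G (conv n opr V (\<phi> t) (\<psi> t)) \<tau>\<bar>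
      \<le> M * (M * (A * B * (M * (M * (H * H * ?k)))))"
  proof (subst Gam_conv)
    show "Z t u \<in> characters n" using t by (intro Zc) auto
    show "\<bar>\<Sum>\<rho>\<^sub>1\<in>fs n. \<Sum>\<rho>\<^sub>2\<in>fs n. of_bool (V \<rho>\<^sub>2 \<and> n < deg \<rho>\<^sub>1 + deg \<rho>\<^sub>2) * (\<phi> t \<rho>\<^sub>1 * \<psi> t \<rho>\<^sub>2 *
      cop_sum \<rho>\<^sub>1 (\<lambda>x\<^sub>1 y\<^sub>1. cop_sum \<rho>\<^sub>2 (\<lambda>x\<^sub>2 y\<^sub>2. Z t u x\<^sub>1 * Z t u x\<^sub>2 * of_bool (V y\<^sub>2 \<and> opr y\<^sub>1 y\<^sub>2 = \<tau>))))\<bar>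
      \<le> M * (M * (A * B * (M * (M * (H * H * ?k)))))"
    proof (intro sum_abs_le[OF _ M_card])
      fix \<rho>\<^sub>1 \<rho>\<^sub>2 :: "'d forest" assume \<rho>: "\<rho>\<^sub>1 \<in> fs n" "\<rho>\<^sub>2 \<in> fs n"
      have "\<bar>cop_sum \<rho>\<^sub>1 (\<lambda>x\<^sub>1 y\<^sub>1. cop_sum \<rho>\<^sub>2 (\<lambda>x\<^sub>2 y\<^sub>2. Z t u x\<^sub>1 * Z t u x\<^sub>2 * of_bool (V y\<^sub>2 \<and> opr y\<^sub>1 y\<^sub>2 = \<tau>)))\<bar>
          \<le> real (size (coproduct \<rho>\<^sub>1)) * (real (size (coproduct \<rho>\<^sub>2)) * (H * H * ?k))"
        if big: "n < deg \<rho>\<^sub>1 + deg \<rho>\<^sub>2"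
      proof (intro cop_sum_abs_le)
        fix x\<^sub>1 y\<^sub>1 x\<^sub>2 y\<^sub>2 assume c: "(x\<^sub>1, y\<^sub>1) \<in># coproduct \<rho>\<^sub>1" "(x\<^sub>2, y\<^sub>2) \<in># coproduct \<rho>\<^sub>2"
        show "\<bar>Z t u x\<^sub>1 * Z t u x\<^sub>2 * of_bool (V y\<^sub>2 \<and> opr y\<^sub>1 y\<^sub>2 = \<tau>)\<bar> \<le> H * H * ?k"
        proof (cases "V y\<^sub>2 \<and> opr y\<^sub>1 y\<^sub>2 = \<tau>")
          case True
          have d: "deg x\<^sub>1 + deg y\<^sub>1 = deg \<rho>\<^sub>1" "deg x\<^sub>2 + deg y\<^sub>2 = deg \<rho>\<^sub>2" using c[THEN coproduct_deg] by auto
          have "deg \<tau> = deg y\<^sub>1 + deg y\<^sub>2" using True op_deg[of y\<^sub>2 y\<^sub>1] by auto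
          \<comment> \<open>The pruned parts carry the degree that \<tau> does not, and this exceeds
            \<open>n - deg \<tau>\<close>.\<close>
          then have dd: "n < (deg x\<^sub>1 + deg x\<^sub>2) + deg \<tau>" using d big by linarith
          have "\<bar>Z t u x\<^sub>1\<bar> * \<bar>Z t u x\<^sub>2\<bar> \<le> (H * ?x ^ deg x\<^sub>1) * (H * ?x ^ deg x\<^sub>2)"
            using Zw[of t u x\<^sub>1] Zw[of t u x\<^sub>2] t d \<rho> H0 x by (intro mult_mono) auto
          also have "\<dots> = H * H * ?x ^ (deg x\<^sub>1 + deg x\<^sub>2)" by (simp add: power_add)
          also have "\<dots> \<le> H * H * ?k"
            using pow_le_wt[OF x dd \<tau>(1)] H0 by (intro mult_left_mono) auto
          finally show ?thesis using True by (simp add: abs_mult)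
        qed (use H0 in auto)
      qed
      also have "real (size (coproduct \<rho>\<^sub>1)) * (real (size (coproduct \<rho>\<^sub>2)) * (H * H * ?k)) \<le> M * (M * (H * H * ?k))"
        using M_cop[of \<rho>\<^sub>1] M_cop[of \<rho>\<^sub>2] \<rho> M0 H0 by (intro mult_mono) auto
      finally have c: "\<bar>cop_sum \<rho>\<^sub>1 (\<lambda>x\<^sub>1 y\<^sub>1. cop_sum \<rho>\<^sub>2 (\<lambda>x\<^sub>2 y\<^sub>2. Z t u x\<^sub>1 * Z t u x\<^sub>2 * of_bool (V y\<^sub>2 \<and> opr y\<^sub>1 y\<^sub>2 = \<tau>)))\<bar>
          \<le> M * (M * (H * H * ?k))" if "n < deg \<rho>\<^sub>1 + deg \<rho>\<^sub>2" using that by blast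
      have ab: "\<bar>\<phi> t \<rho>\<^sub>1 * \<psi> t \<rho>\<^sub>2\<bar> \<le> A * B"
        unfolding abs_mult using controlled_bd[OF \<phi>, of t \<rho>\<^sub>1] controlled_bd[OF \<psi>, of t \<rho>\<^sub>2] t \<rho> A B
        by (intro mult_mono) auto
      show "\<bar>of_bool (V \<rho>\<^sub>2 \<and> n < deg \<rho>\<^sub>1 + deg \<rho>\<^sub>2) * (\<phi> t \<rho>\<^sub>1 * \<psi> t \<rho>\<^sub>2 *
        cop_sum \<rho>\<^sub>1 (\<lambda>x\<^sub>1 y\<^sub>1. cop_sum \<rho>\<^sub>2 (\<lambda>x\<^sub>2 y\<^sub>2. Z t u x\<^sub>1 * Z t u x\<^sub>2 * of_bool (V y\<^sub>2 \<and> opr y\<^sub>1 y\<^sub>2 = \<tau>))))\<bar>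
        \<le> A * B * (M * (M * (H * H * ?k)))"
      proof (cases "V \<rho>\<^sub>2 \<and> n < deg \<rho>\<^sub>1 + deg \<rho>\<^sub>2")
        case True
        show ?thesis using True unfolding abs_mult[of "of_bool _"] abs_mult[of "_ * _" "cop_sum _ _"]
          using mult_mono[OF ab c] A B by simp
      qed (use A B M0 H0 in auto)
    qed (use A B M0 H0 in auto)
  qed (use \<tau> supp in auto)
  also have "\<dots> = M ^ 4 * H ^ 2 * (A * B * ?k)"
    by (simp add: algebra_simps eval_nat_numeral)
  finally have 3: "\<bar>conv n opr V (?G (\<phi> t)) (?G (\<psi> t)) \<tau> - ?G (conv n opr V (\<phi> t) (\<psi> t)) \<tau>\<bar>
      \<le> M ^ 4 * H ^ 2 * (A * B * ?k)" .
  have "\<bar>conv n opr V (\<phi> u) (\<psi> u) \<tau> - ?G (conv n opr V (\<phi> t) (\<psi> t)) \<tau>\<bar> \<le> 3 * (M ^ 4 * H ^ 2 * (A * B * ?k))"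
    unfolding dec using 1 2 3 by linarith
  then show ?thesis by (simp add: mult.assoc)
qed

text \<open>A cruder constant than the argument gives, chosen equal to that of
  \<open>controlled_conv\<close>.\<close>

lemma conv_bd:
  assumes \<phi>: "controlled V' A s \<phi>" and \<psi>: "controlled V B s \<psi>" and t: "a \<le> s" "s \<le> t" "t \<le> b"
  shows "\<bar>conv n opr V (\<phi> t) (\<psi> t) \<tau>\<bar> \<le> 3 * M ^ 4 * H ^ 2 * A * B"
proof -
  have A: "0 \<le> A" and B: "0 \<le> B"
    using controlled_nonneg[OF \<phi>] controlled_nonneg[OF \<psi>] t by auto
  have "\<bar>conv n opr V (\<phi> t) (\<psi> t) \<tau>\<bar> \<le> M * (M * (A * B))"
    using controlled_bd[OF \<phi>, of t] controlled_bd[OF \<psi>, of t] t A B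
    by (intro conv_abs_le M_card) (auto simp: abs_mult intro!: mult_mono)
  also have "\<dots> \<le> 3 * M ^ 4 * H ^ 2 * (A * B)"
  proof -
    have "1 * M ^ 2 * 1 \<le> 3 * M ^ 4 * H ^ 2"
      using M1 one_le_power[OF H, of 2] power_increasing[of 2 4 M] by (intro mult_mono) auto
    then have "M ^ 2 * (A * B) \<le> 3 * M ^ 4 * H ^ 2 * (A * B)" using A B by (intro mult_right_mono) auto
    then show ?thesis by (simp add: power2_eq_square algebra_simps)
  qed
  finally show ?thesis by (simp add: mult.assoc)
qed

end

text \<open>The summand of a Riemann sum: a one-form does not act on the empty forest, so the value
  stored there is left out.\<close>

definition pair0 :: "nat \<Rightarrow> ('l::finite forest \<Rightarrow> real) \<Rightarrow> ('l forest \<Rightarrow> real) \<Rightarrow> real" where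
  "pair0 n \<phi> a = (\<Sum>\<rho>\<in>forests n. \<phi> \<rho> * a \<rho>)"

lemma pair_pair0: "a {#} = 1 \<Longrightarrow> pair n \<phi> a = \<phi> {#} + pair0 n \<phi> a"
  by (simp add: pair_def pair0_def sum_fs)

lemma card_forests_le: "card (forests n :: 'l::finite forest set) \<le> card (fs n :: 'l forest set)"
  by (rule card_mono) (auto simp: forests_def)

context rough_data
begin

text \<open>The empty forest has only the trivial cut, so its coefficient reaches no other
  coefficient under the transport. An integral can thus be transported at nonempty forests before
  its values are known.\<close>

lemma Gam_cong_nonempty:
  assumes "a \<le> s" "s \<le> t" "t \<le> b" "\<And>\<rho>. \<rho> \<noteq> {#} \<Longrightarrow> deg \<rho> \<le> n \<Longrightarrow> \<phi> \<rho> = \<psi> \<rho>" "\<tau> \<noteq> {#}"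
  shows "Gam n (Z s t) \<phi> \<tau> = Gam n (Z s t) \<psi> \<tau>"
  unfolding Gam_def
proof (intro sum.cong refl)
  fix \<rho> :: "'d forest" assume "\<rho> \<in> fs n"
  with assms show "\<phi> \<rho> * cop_sum \<rho> (\<lambda>x y. Z s t x * of_bool (y = \<tau>)) = \<psi> \<rho> * cop_sum \<rho> (\<lambda>x y. Z s t x * of_bool (y = \<tau>))"
    by (cases "\<rho> = {#}") auto
qed

text \<open>By Chen's relation the increment over [s, u] is a product, so pairing with it means
  transporting over [s, t] and pairing with the increment over [t, u]. The coefficients at the empty
  forest cancel.\<close>

lemma pair0_defect:
  assumes t: "a \<le> s" "s \<le> t" "t \<le> u" "u \<le> b"
  shows "pair0 n (\<psi> s) (Z s u) - pair0 n (\<psi> s) (Z s t) - pair0 n (\<psi> t) (Z t u) =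
    (\<Sum>\<tau>\<in>forests n. (Gam n (Z s t) (\<psi> s) \<tau> - \<psi> t \<tau>) * Z t u \<tau>)"
proof -
  have Z1: "Z s u {#} = 1" "Z s t {#} = 1" "Z t u {#} = 1"
    using t by (auto intro!: characters_empty Zc)
  have "\<psi> s {#} + pair0 n (\<psi> s) (Z s u) = pair n (\<psi> s) (star n (Z s t) (Z t u))"
    using t by (simp add: Zchen pair_pair0[of "Z s u" n "\<psi> s", OF Z1(1)])
  also have "\<dots> = Gam n (Z s t) (\<psi> s) {#} + (\<Sum>\<tau>\<in>forests n. Gam n (Z s t) (\<psi> s) \<tau> * Z t u \<tau>)"
    unfolding pair_star sum_fs Z1 by simp
  also have "Gam n (Z s t) (\<psi> s) {#} = \<psi> s {#} + pair0 n (\<psi> s) (Z s t)"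
    unfolding Gam_empty by (rule pair_pair0[of "Z s t", OF Z1(2)])
  finally show ?thesis
    by (simp add: pair0_def[of n "\<psi> t"] left_diff_distrib sum_subtractf)
qed

text \<open>The weights are complementary: the power \<open>N - deg \<tau>\<close> of
  \<open>w\<close> from the functional and the power \<open>deg \<tau>\<close> from the increment
  combine to the power \<open>N / p\<close> of \<omega>, whatever \<tau> is.\<close>

lemma pair0_defect_bound:
  assumes t: "a \<le> s" "s \<le> t" "t \<le> u" "u \<le> b" and C: "0 \<le> C"
    and d: "\<And>\<tau>. \<tau> \<noteq> {#} \<Longrightarrow> deg \<tau> \<le> n \<Longrightarrow> \<bar>\<psi> t \<tau> - Gam n (Z s t) (\<psi> s) \<tau>\<bar> \<le> C * w s t powr (N - real (deg \<tau>))"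
  shows "\<bar>pair0 n (\<psi> s) (Z s u) - pair0 n (\<psi> s) (Z s t) - pair0 n (\<psi> t) (Z t u)\<bar>
    \<le> M * C * H * \<omega> s u powr (N / p)"
proof -
  have H0: "0 \<le> H" using H by simp
  have "\<bar>\<Sum>\<tau>\<in>forests n. (Gam n (Z s t) (\<psi> s) \<tau> - \<psi> t \<tau>) * Z t u \<tau>\<bar> \<le> M * (C * H * w s u powr N)"
  proof (rule sum_abs_le)
    fix \<tau> :: "'d forest" assume "\<tau> \<in> forests n"
    then have \<tau>: "\<tau> \<noteq> {#}" "deg \<tau> \<le> n" "1 \<le> deg \<tau>" by (auto simp: forests_def)
    have x: "0 \<le> w s u" "w s u \<le> 1" using t by (auto intro: w_le1)
    have "\<bar>Gam n (Z s t) (\<psi> s) \<tau> - \<psi> t \<tau>\<bar> \<le> C * w s u powr (N - real (deg \<tau>))"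
    proof -
      have "w s t powr (N - real (deg \<tau>)) \<le> w s u powr (N - real (deg \<tau>))"
        using t \<tau> N by (intro powr_mono2 w_mono) auto
      then have "C * w s t powr (N - real (deg \<tau>)) \<le> C * w s u powr (N - real (deg \<tau>))"
        using C by (rule mult_left_mono)
      with d[OF \<tau>(1,2)] show ?thesis by (simp add: abs_minus_commute)
    qed
    moreover have "\<bar>Z t u \<tau>\<bar> \<le> H * w s u ^ deg \<tau>"
    proof -
      have "H * w t u ^ deg \<tau> \<le> H * w s u ^ deg \<tau>"
        using t H0 by (intro mult_left_mono power_mono w_mono) auto
      with Zw[of t u \<tau>] t \<tau> show ?thesis by simp
    qed
    ultimately have "\<bar>Gam n (Z s t) (\<psi> s) \<tau> - \<psi> t \<tau>\<bar> * \<bar>Z t u \<tau>\<bar>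
        \<le> (C * w s u powr (N - real (deg \<tau>))) * (H * w s u ^ deg \<tau>)"
      using C H0 by (intro mult_mono) auto
    also have "\<dots> = C * H * (w s u powr (N - real (deg \<tau>)) * w s u ^ deg \<tau>)" by simp
    also have "w s u powr (N - real (deg \<tau>)) * w s u ^ deg \<tau> = w s u powr N"
    proof (cases "w s u = 0")
      case True
      then show ?thesis using \<tau> by simp
    next
      case False
      have "0 < w s u" using False by (simp add: order_less_le)
      then have pw: "w s u ^ deg \<tau> = w s u powr real (deg \<tau>)" by (simp add: powr_realpow)
      show ?thesis unfolding pw powr_add[symmetric] by simp
    qed
    finally show "\<bar>(Gam n (Z s t) (\<psi> s) \<tau> - \<psi> t \<tau>) * Z t u \<tau>\<bar> \<le> C * H * w s u powr N"
      by (simp add: abs_mult)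
  qed (use C H0 card_forests_le[of n, where 'l = 'd] M_card in auto)
  then show ?thesis unfolding pair0_defect[OF t] w_N by (simp add: mult.assoc)
qed

text \<open>The factor by which a product, or a grafting followed by integration, may enlarge the
  constant of a controlled functional: \<open>3 * M ^ 4 * H ^ 2\<close> from
  \<open>controlled_conv\<close>, \<open>M * H\<close> from pairing with an increment, and
  \<open>1 + sew_const (N / p)\<close> from the Riemann summand and the sewing remainder.\<close>

definition Q :: real where
  "Q = 3 * M ^ 5 * H ^ 3 * (1 + sew_const (N / p))"

lemma Q_ge: "3 * M ^ 4 * H ^ 2 \<le> Q" "1 \<le> Q"
proof -
  have s: "0 < sew_const (N / p)" using theta by (rule sew_const_pos)
  have "3 * M ^ 4 * H ^ 2 * 1 \<le> 3 * M ^ 5 * H ^ 3 * (1 + sew_const (N / p))"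
    using M1 H s by (intro mult_mono power_increasing) auto
  then show "3 * M ^ 4 * H ^ 2 \<le> Q" by (simp add: Q_def)
  have "1 * 1 \<le> 3 * M ^ 4 * H ^ 2"
    using one_le_power[OF M1, of 4] one_le_power[OF H, of 2] by (intro mult_mono) auto
  with \<open>3 * M ^ 4 * H ^ 2 \<le> Q\<close> show "1 \<le> Q" by simp
qed

lemma controlled_cong:
  assumes "controlled V K s \<phi>" "\<And>t \<rho>. s \<le> t \<Longrightarrow> t \<le> b \<Longrightarrow> deg \<rho> \<le> n \<Longrightarrow> \<psi> t \<rho> = \<phi> t \<rho>"
  shows "controlled V K s \<psi>"
proof -
  have "Gam n (Z t u) (\<psi> t) \<tau> = Gam n (Z t u) (\<phi> t) \<tau>" if "s \<le> t" "t \<le> b" for t u \<tau>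
    unfolding Gam_def using that assms(2) by (intro sum.cong) auto
  then show ?thesis using assms unfolding controlled_def by (simp add: order_trans)
qed

lemma controlled_plus:
  assumes \<phi>: "controlled (\<lambda>_. True) A s \<phi>" and \<psi>: "controlled (\<lambda>_. True) B s \<psi>" and s: "a \<le> s"
  shows "controlled (\<lambda>_. True) (3 * M ^ 4 * H ^ 2 * A * B) s (\<lambda>t. conv n (+) (\<lambda>_. True) (\<phi> t) (\<psi> t))"
  unfolding controlled_def
  using conv_bd[OF \<phi> \<psi> s, where opr = "(+)"] controlled_conv[OF plus_op.forest_op_axioms \<phi> \<psi> _ s] by blast

section \<open>Grafting a controlled functional and integrating it\<close>

context
  fixes \<phi> \<psi> \<beta> :: "real \<Rightarrow> 'd forest \<Rightarrow> real" and K L s :: real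
  assumes \<phi>: "controlled (\<lambda>_. True) K s \<phi>" and \<beta>: "controlled single L s \<beta>"
    and supp: "\<And>t \<rho>. \<not> single \<rho> \<Longrightarrow> \<beta> t \<rho> = 0" and s: "a \<le> s" "s \<le> b"
    and \<psi>: "\<And>t \<tau>. s \<le> t \<Longrightarrow> t \<le> b \<Longrightarrow> deg \<tau> \<le> n \<Longrightarrow> \<tau> \<noteq> {#} \<Longrightarrow> \<psi> t \<tau> = conv n graftf single (\<phi> t) (\<beta> t) \<tau>"
begin

lemma node_diff:
  assumes t: "s \<le> t" "t \<le> u" "u \<le> b" and \<tau>: "\<tau> \<noteq> {#}" "deg \<tau> \<le> n"
  shows "\<bar>\<psi> u \<tau> - Gam n (Z t u) (\<psi> t) \<tau>\<bar> \<le> 3 * M ^ 4 * H ^ 2 * K * L * w t u powr (N - real (deg \<tau>))"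
proof -
  have "Gam n (Z t u) (\<psi> t) \<tau> = Gam n (Z t u) (conv n graftf single (\<phi> t) (\<beta> t)) \<tau>"
    using t s \<tau> by (intro Gam_cong_nonempty) (auto simp: \<psi>)
  moreover have "\<psi> u \<tau> = conv n graftf single (\<phi> u) (\<beta> u) \<tau>" using t \<tau> by (intro \<psi>) auto
  ultimately show ?thesis
    using controlled_conv[OF graft_op.forest_op_axioms \<phi> \<beta> supp s(1) t \<tau>(2,1)] by simp
qed

lemma node_KL: "0 \<le> K" "0 \<le> L"
  using controlled_nonneg[OF \<phi>] controlled_nonneg[OF \<beta>] s by auto

lemma node_defect:
  assumes t: "s \<le> r" "r \<le> t" "t \<le> u" "u \<le> b"
  shows "\<bar>pair0 n (\<psi> r) (Z r u) - pair0 n (\<psi> r) (Z r t) - pair0 n (\<psi> t) (Z t u)\<bar>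
    \<le> M * (3 * M ^ 4 * H ^ 2 * K * L) * H * \<omega> r u powr (N / p)"
  by (rule pair0_defect_bound) (use t s node_KL M1 H node_diff in auto)

lemma node_limit_exists:
  assumes small: "\<And>\<epsilon>. 0 < \<epsilon> \<Longrightarrow> \<exists>\<delta>>0. \<forall>u v. a \<le> u \<longrightarrow> u \<le> v \<longrightarrow> v \<le> b \<longrightarrow> v - u < \<delta> \<longrightarrow> \<omega> u v \<le> \<epsilon>"
    and t: "s \<le> t" "t \<le> u" "u \<le> b"
  shows "\<exists>J. (partition_sum (\<lambda>x y. pair0 n (\<psi> x) (Z x y)) \<longlongrightarrow> J) (mesh_to_zero t u)"
proof (rule sewing_limit[where a = s and b = b])
  show "control s b \<omega>" using control_subset[OF ctl s(1)] by simp
  show "\<bar>pair0 n (\<psi> r) (Z r u) - pair0 n (\<psi> r) (Z r t) - pair0 n (\<psi> t) (Z t u)\<bar>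
    \<le> M * (3 * M ^ 4 * H ^ 2 * K * L) * H * \<omega> r u powr (N / p)" if "s \<le> r" "r \<le> t" "t \<le> u" "u \<le> b" for r t u
    using that by (rule node_defect)
  show "\<exists>\<delta>>0. \<forall>u v. s \<le> u \<longrightarrow> u \<le> v \<longrightarrow> v \<le> b \<longrightarrow> v - u < \<delta> \<longrightarrow> \<omega> u v \<le> \<epsilon>" if "0 < \<epsilon>" for \<epsilon>
    using small[OF that] s(1) by (meson order_trans)
qed (use t theta node_KL M1 H in auto)

text \<open>At the empty forest the transport of \<psi> over [t, u] is its value plus the Riemann
  summand, so the increment estimate there is exactly the sewing bound for the limit. At the other
  forests it is \<open>node_diff\<close>.\<close>

lemma node_controlled:
  assumes lim: "\<And>t u. s \<le> t \<Longrightarrow> t \<le> u \<Longrightarrow> u \<le> b \<Longrightarrow>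
      (partition_sum (\<lambda>x y. pair0 n (\<psi> x) (Z x y)) \<longlongrightarrow> \<psi> u {#} - \<psi> t {#}) (mesh_to_zero t u)"
    and z: "\<psi> s {#} = 0"
  shows "controlled (\<lambda>_. True) (Q * K * L) s \<psi>"
proof -
  let ?C = "3 * M ^ 4 * H ^ 2 * K * L" and ?S = "sew_const (N / p)"
  have S: "0 < ?S" using theta by (rule sew_const_pos)
  have KL: "0 \<le> K * L" using node_KL by simp
  have C0: "0 \<le> ?C" using node_KL M1 H by simp
  have CQ: "?C \<le> Q * K * L"
    using mult_right_mono[OF Q_ge(1) KL] by (simp add: mult.assoc)
  have QQ: "M * ?C * H + ?S * (M * ?C * H) = Q * K * L"
    by (simp add: Q_def eval_nat_numeral algebra_simps)
  \<comment> \<open>\<open>E\<close> bounds the Riemann summand and also, up to the power of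
    \<omega>, its defect; together with the sewing constant this adds up to
    \<open>Q * K * L\<close>.\<close>
  define E where "E = M * ?C * H"
  have E0: "0 \<le> E" using C0 M1 H by (simp add: E_def)
  have QE: "E + ?S * E = Q * K * L" unfolding E_def by (rule QQ)
  have SE: "?S * E \<le> Q * K * L" using QE E0 by simp
  have inc: "\<bar>\<psi> u {#} - \<psi> t {#} - pair0 n (\<psi> t) (Z t u)\<bar> \<le> ?S * E * w t u powr N"
    if t: "s \<le> t" "t \<le> u" "u \<le> b" for t u
    unfolding w_N
  proof (rule mesh_limit_bound[OF lim[OF t] t(2)])
    fix D assume "D \<in> partitions t u"
    show "\<bar>partition_sum (\<lambda>x y. pair0 n (\<psi> x) (Z x y)) D - pair0 n (\<psi> t) (Z t u)\<bar> \<le> ?S * E * \<omega> t u powr (N / p)"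
      by (rule sewing_bound[where a = s and b = b])
        (use \<open>D \<in> partitions t u\<close> t E0 theta node_defect[folded E_def] control_subset[OF ctl s(1)] in auto)
  qed
  have pb: "\<bar>pair0 n (\<psi> t) (Z t u)\<bar> \<le> E" if t: "s \<le> t" "t \<le> u" "u \<le> b" for t u
    unfolding pair0_def E_def mult.assoc[of M]
  proof (rule sum_abs_le)
    fix \<rho> :: "'d forest" assume "\<rho> \<in> forests n"
    then have \<rho>: "\<rho> \<noteq> {#}" "deg \<rho> \<le> n" by (auto simp: forests_def)
    have "\<bar>\<psi> t \<rho>\<bar> \<le> ?C" unfolding \<psi>[OF t(1) order_trans[OF t(2,3)] \<rho>(2,1)]
      using s t by (intro conv_bd[OF \<phi> \<beta>]) auto
    moreover have "\<bar>Z t u \<rho>\<bar> \<le> H" using s t \<rho> by (intro ZH) auto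
    ultimately show "\<bar>\<psi> t \<rho> * Z t u \<rho>\<bar> \<le> ?C * H" unfolding abs_mult using C0 by (intro mult_mono) auto
  qed (use C0 H card_forests_le[of n, where 'l = 'd] M_card in auto)
  show ?thesis
    unfolding controlled_def
  proof (intro conjI allI impI; elim conjE)
    fix t :: real and \<tau> :: "'d forest" assume t: "s \<le> t" "t \<le> b" and \<tau>: "deg \<tau> \<le> n"
    show "\<bar>\<psi> t \<tau>\<bar> \<le> Q * K * L"
    proof (cases "\<tau> = {#}")
      case True
      have "w s t powr N \<le> 1" using w_le1[of s t] s t N by (intro powr_le1) auto
      then have "?S * E * w s t powr N \<le> ?S * E * 1"
        using S E0 by (intro mult_left_mono) auto
      then show ?thesis using inc[of s t] pb[of s t] t z QE True by simp
    next
      case False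
      have "\<bar>\<psi> t \<tau>\<bar> \<le> ?C" unfolding \<psi>[OF t \<tau> False]
        using s t by (intro conv_bd[OF \<phi> \<beta>]) auto
      with CQ show ?thesis by simp
    qed
  next
    fix t u :: real and \<tau> :: "'d forest" assume t: "s \<le> t" "t \<le> u" "u \<le> b" and \<tau>: "deg \<tau> \<le> n"
    show "\<bar>\<psi> u \<tau> - Gam n (Z t u) (\<psi> t) \<tau>\<bar> \<le> Q * K * L * w t u powr (N - real (deg \<tau>))"
    proof (cases "\<tau> = {#}")
      case True
      have "Z t u {#} = 1" using s t by (intro characters_empty[of _ n] Zc) auto
      then have "Gam n (Z t u) (\<psi> t) {#} = \<psi> t {#} + pair0 n (\<psi> t) (Z t u)"
        unfolding Gam_empty by (rule pair_pair0)
      then have "\<bar>\<psi> u \<tau> - Gam n (Z t u) (\<psi> t) \<tau>\<bar> \<le> ?S * E * w t u powr N"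
        using inc[OF t] True by (simp add: algebra_simps)
      also have "\<dots> \<le> Q * K * L * w t u powr N"
        using SE by (rule mult_right_mono) simp
      finally show ?thesis using True by simp
    next
      case False
      have "?C * w t u powr (N - real (deg \<tau>)) \<le> Q * K * L * w t u powr (N - real (deg \<tau>))"
        using CQ by (rule mult_right_mono) simp
      with node_diff[OF t False \<tau>] show ?thesis by linarith
    qed
  qed
qed

end

end

section \<open>Lifts of the integral\<close>

text \<open>\<open>\<Phi> s t \<rho>\<close> collects the one-form associated with \<open>r \<mapsto> Y s r \<rho>\<close> at time \<open>t\<close>
  together with the value \<open>Y s t \<rho>\<close>, which is its coefficient at the empty forest.\<close>

locale lift =
  fixes n :: nat and a b :: real and Z :: "real \<Rightarrow> real \<Rightarrow> 'd::finite forest \<Rightarrow> real"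
    and \<beta> :: "'e::finite \<Rightarrow> real \<Rightarrow> 'd forest \<Rightarrow> real"
    and \<Phi> :: "real \<Rightarrow> real \<Rightarrow> 'e forest \<Rightarrow> 'd forest \<Rightarrow> real"
  assumes lift_empty: "\<And>s t \<sigma>. a \<le> s \<Longrightarrow> s \<le> t \<Longrightarrow> t \<le> b \<Longrightarrow> deg \<sigma> \<le> n \<Longrightarrow> \<Phi> s t {#} \<sigma> = of_bool (\<sigma> = {#})"
    and lift_plus: "\<And>s t \<rho>\<^sub>1 \<rho>\<^sub>2 \<sigma>. a \<le> s \<Longrightarrow> s \<le> t \<Longrightarrow> t \<le> b \<Longrightarrow> deg \<rho>\<^sub>1 + deg \<rho>\<^sub>2 \<le> n \<Longrightarrow> deg \<sigma> \<le> n \<Longrightarrow>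
      \<Phi> s t (\<rho>\<^sub>1 + \<rho>\<^sub>2) \<sigma> = conv n (+) (\<lambda>_. True) (\<Phi> s t \<rho>\<^sub>1) (\<Phi> s t \<rho>\<^sub>2) \<sigma>"
    and lift_node: "\<And>s t j \<rho> \<sigma>. a \<le> s \<Longrightarrow> s \<le> t \<Longrightarrow> t \<le> b \<Longrightarrow> deg \<rho> < n \<Longrightarrow> deg \<sigma> \<le> n \<Longrightarrow> \<sigma> \<noteq> {#} \<Longrightarrow>
      \<Phi> s t {#Node j \<rho>#} \<sigma> = conv n graftf single (\<Phi> s t \<rho>) (\<beta> j t) \<sigma>"
    and lift_limit: "\<And>s t u j \<rho>. a \<le> s \<Longrightarrow> s \<le> t \<Longrightarrow> t \<le> u \<Longrightarrow> u \<le> b \<Longrightarrow> deg \<rho> < n \<Longrightarrow>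
      (partition_sum (\<lambda>x y. pair0 n (\<Phi> s x {#Node j \<rho>#}) (Z x y)) \<longlongrightarrow>
        \<Phi> s u {#Node j \<rho>#} {#} - \<Phi> s t {#Node j \<rho>#} {#}) (mesh_to_zero t u)"
    and lift_start: "\<And>s j \<rho>. a \<le> s \<Longrightarrow> s \<le> b \<Longrightarrow> deg \<rho> < n \<Longrightarrow> \<Phi> s s {#Node j \<rho>#} {#} = 0"
begin

lemma lift_plus_value:
  "a \<le> s \<Longrightarrow> s \<le> t \<Longrightarrow> t \<le> b \<Longrightarrow> deg \<rho>\<^sub>1 + deg \<rho>\<^sub>2 \<le> n \<Longrightarrow> \<Phi> s t (\<rho>\<^sub>1 + \<rho>\<^sub>2) {#} = \<Phi> s t \<rho>\<^sub>1 {#} * \<Phi> s t \<rho>\<^sub>2 {#}"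
  by (simp add: lift_plus conv_plus_empty)

text \<open>Chen's relation. At a node both sides are limits of the same Riemann sums over \<open>[u, r]\<close>.\<close>

lemma lift_chen:
  assumes t: "a \<le> s" "s \<le> u" "u \<le> r" "r \<le> b" and "deg \<rho> \<le> n" "deg \<sigma> \<le> n"
  shows "\<Phi> s r \<rho> \<sigma> = cop_sum \<rho> (\<lambda>x y. \<Phi> s u x {#} * \<Phi> u r y \<sigma>)"
  using assms
proof (induction \<rho> arbitrary: r \<sigma> rule: forest_induct)
  case empty
  then show ?case by (simp add: lift_empty)
next
  case (plus \<rho>\<^sub>1 \<rho>\<^sub>2)
  have d: "deg \<rho>\<^sub>1 + deg \<rho>\<^sub>2 \<le> n" "deg \<rho>\<^sub>1 \<le> n" "deg \<rho>\<^sub>2 \<le> n" using plus.prems by auto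
  note t = plus.prems(1-4)
  have "\<Phi> s r (\<rho>\<^sub>1 + \<rho>\<^sub>2) \<sigma> = conv n (+) (\<lambda>_. True)
      (\<lambda>\<sigma>. cop_sum \<rho>\<^sub>1 (\<lambda>x y. \<Phi> s u x {#} * \<Phi> u r y \<sigma>)) (\<lambda>\<sigma>. cop_sum \<rho>\<^sub>2 (\<lambda>x y. \<Phi> s u x {#} * \<Phi> u r y \<sigma>)) \<sigma>"
    unfolding lift_plus[OF t(1) order_trans[OF t(2,3)] t(4) d(1) plus.prems(6)]
    using plus.IH d t by (intro conv_cong) auto
  also have "\<dots> = cop_sum \<rho>\<^sub>1 (\<lambda>x y. cop_sum \<rho>\<^sub>2 (\<lambda>x' y'. \<Phi> s u x {#} * (\<Phi> s u x' {#} *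
      conv n (+) (\<lambda>_. True) (\<Phi> u r y) (\<Phi> u r y') \<sigma>)))"
    by (simp only: conv_cop_sum_left conv_cop_sum_right conv_mult_left conv_mult_right cop_sum_mult_left)
  also have "\<dots> = cop_sum (\<rho>\<^sub>1 + \<rho>\<^sub>2) (\<lambda>x y. \<Phi> s u x {#} * \<Phi> u r y \<sigma>)"
    unfolding cop_sum_plus
  proof (intro cop_sum_cong)
    fix x y x' y' assume "(x, y) \<in># coproduct \<rho>\<^sub>1" "(x', y') \<in># coproduct \<rho>\<^sub>2"
    from this[THEN coproduct_deg] d(1) have "deg x + deg x' \<le> n" "deg y + deg y' \<le> n" by auto
    then show "\<Phi> s u x {#} * (\<Phi> s u x' {#} * conv n (+) (\<lambda>_. True) (\<Phi> u r y) (\<Phi> u r y') \<sigma>) =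
        \<Phi> s u (x + x') {#} * \<Phi> u r (y + y') \<sigma>"
      using t plus.prems by (simp add: lift_plus_value[of s u x x'] lift_plus[of u r y y' \<sigma>])
  qed
  finally show ?case .
next
  case (node j \<rho>)
  have d: "deg \<rho> < n" "deg \<rho> \<le> n" using node.prems by auto
  \<comment> \<open>Coefficients at nonempty forests involve no limit, so the hypothesis for the
    forest below the root suffices. The claim is kept for all later times because the Riemann sums
    need it at every partition point.\<close>
  have ne: "\<Phi> s r {#Node j \<rho>#} \<sigma> = cop_sum \<rho> (\<lambda>x y. \<Phi> s u x {#} * \<Phi> u r {#Node j y#} \<sigma>)"
    if "\<sigma> \<noteq> {#}" "deg \<sigma> \<le> n" "u \<le> r" "r \<le> b" for r \<sigma>
  proof -
    have "\<Phi> s r {#Node j \<rho>#} \<sigma> = conv n graftf single (\<lambda>\<sigma>. cop_sum \<rho> (\<lambda>x y. \<Phi> s u x {#} * \<Phi> u r y \<sigma>)) (\<beta> j r) \<sigma>"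
      using node.IH node.prems(1,2) d that by (simp add: lift_node) (intro conv_cong; simp)
    also have "\<dots> = cop_sum \<rho> (\<lambda>x y. \<Phi> s u x {#} * conv n graftf single (\<Phi> u r y) (\<beta> j r) \<sigma>)"
      by (simp only: conv_cop_sum_left conv_mult_left)
    also have "\<dots> = cop_sum \<rho> (\<lambda>x y. \<Phi> s u x {#} * \<Phi> u r {#Node j y#} \<sigma>)"
    proof (intro cop_sum_cong)
      fix x y assume "(x, y) \<in># coproduct \<rho>"
      from coproduct_snd_deg[OF this] d have "deg y < n" by simp
      then show "\<Phi> s u x {#} * conv n graftf single (\<Phi> u r y) (\<beta> j r) \<sigma> = \<Phi> s u x {#} * \<Phi> u r {#Node j y#} \<sigma>"
        using node.prems(1,2) that by (simp add: lift_node)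
    qed
    finally show ?thesis .
  qed
  note t = node.prems(1-4)
  show ?case
  proof (cases "\<sigma> = {#}")
    case False
    then show ?thesis using ne[OF False node.prems(6) t(3,4)] t node.prems(6) by (simp add: cop_sum_Node lift_empty)
  next
    case True
    let ?g = "\<lambda>y'. \<lambda>x y. pair0 n (\<Phi> u x {#Node j y'#}) (Z x y)"
    have yn: "deg y < n" if "(x, y) \<in># coproduct \<rho>" for x y
      using coproduct_snd_deg[OF that] d by simp
    have eq: "partition_sum (\<lambda>x y. pair0 n (\<Phi> s x {#Node j \<rho>#}) (Z x y)) D =
        cop_sum \<rho> (\<lambda>x' y'. \<Phi> s u x' {#} * partition_sum (?g y') D)" if D: "D \<in> partitions u r" for D
    proof -
      have "partition_sum (\<lambda>x y. pair0 n (\<Phi> s x {#Node j \<rho>#}) (Z x y)) D =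
          partition_sum (\<lambda>x y. cop_sum \<rho> (\<lambda>x' y'. \<Phi> s u x' {#} * ?g y' x y)) D"
      proof (rule partition_sum_cong[OF D])
        fix v v' assume v: "u \<le> v" "v < v'" "v' \<le> r"
        have "pair0 n (\<Phi> s v {#Node j \<rho>#}) (Z v v') =
            (\<Sum>\<tau>\<in>forests n. cop_sum \<rho> (\<lambda>x y. \<Phi> s u x {#} * \<Phi> u v {#Node j y#} \<tau>) * Z v v' \<tau>)"
          unfolding pair0_def using v t by (intro sum.cong refl arg_cong2[where f = "(*)"] ne) (auto simp: forests_def)
        then show "pair0 n (\<Phi> s v {#Node j \<rho>#}) (Z v v') = cop_sum \<rho> (\<lambda>x' y'. \<Phi> s u x' {#} * ?g y' v v')"
          by (simp only: pair0_def sum_distrib_left cop_sum_sum cop_sum_mult_right mult.assoc[symmetric])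
      qed
      also have "\<dots> = cop_sum \<rho> (\<lambda>x' y'. \<Phi> s u x' {#} * partition_sum (?g y') D)"
        by (simp only: partition_sum_def cop_sum_sum sum_distrib_left)
      finally show ?thesis .
    qed
    have "((\<lambda>D. cop_sum \<rho> (\<lambda>x' y'. \<Phi> s u x' {#} * partition_sum (?g y') D)) \<longlongrightarrow>
        cop_sum \<rho> (\<lambda>x' y'. \<Phi> s u x' {#} * \<Phi> u r {#Node j y'#} {#})) (mesh_to_zero u r)"
      unfolding cop_sum_def
    proof -
      have "((\<lambda>D. \<Sum>(x', y')\<in>#A. \<Phi> s u x' {#} * partition_sum (?g y') D) \<longlongrightarrow>
        (\<Sum>(x', y')\<in>#A. \<Phi> s u x' {#} * \<Phi> u r {#Node j y'#} {#})) (mesh_to_zero u r)"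
        if "\<And>x y. (x, y) \<in># A \<Longrightarrow> deg y < n" for A
        using that
      proof (induction A)
        case (add z A)
        obtain x' y' where z: "z = (x', y')" by (cases z)
        have "deg y' < n" using add.prems[of x' y'] z by simp
        then have "(partition_sum (?g y') \<longlongrightarrow> \<Phi> u r {#Node j y'#} {#}) (mesh_to_zero u r)"
          using lift_limit[of u u r y' j] lift_start[of u y' j] t by simp
        moreover have "((\<lambda>D. \<Sum>(x', y')\<in>#A. \<Phi> s u x' {#} * partition_sum (?g y') D) \<longlongrightarrow>
          (\<Sum>(x', y')\<in>#A. \<Phi> s u x' {#} * \<Phi> u r {#Node j y'#} {#})) (mesh_to_zero u r)"
          by (rule add.IH) (use add.prems in auto)
        ultimately show ?case unfolding z by (simp, intro tendsto_intros)
      qed simp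
      then show "((\<lambda>D. \<Sum>(x', y')\<in>#coproduct \<rho>. \<Phi> s u x' {#} * partition_sum (?g y') D) \<longlongrightarrow>
        (\<Sum>(x', y')\<in>#coproduct \<rho>. \<Phi> s u x' {#} * \<Phi> u r {#Node j y'#} {#})) (mesh_to_zero u r)"
        using yn by blast
    qed
    then have "(partition_sum (\<lambda>x y. pair0 n (\<Phi> s x {#Node j \<rho>#}) (Z x y)) \<longlongrightarrow>
        cop_sum \<rho> (\<lambda>x' y'. \<Phi> s u x' {#} * \<Phi> u r {#Node j y'#} {#})) (mesh_to_zero u r)"
      by (rule Lim_transform_eventually) (auto simp: eventually_mesh eq intro!: exI[of _ 1])
    moreover have "(partition_sum (\<lambda>x y. pair0 n (\<Phi> s x {#Node j \<rho>#}) (Z x y)) \<longlongrightarrow>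
        \<Phi> s r {#Node j \<rho>#} {#} - \<Phi> s u {#Node j \<rho>#} {#}) (mesh_to_zero u r)"
      using t d by (intro lift_limit) auto
    ultimately have "\<Phi> s r {#Node j \<rho>#} {#} - \<Phi> s u {#Node j \<rho>#} {#} =
        cop_sum \<rho> (\<lambda>x' y'. \<Phi> s u x' {#} * \<Phi> u r {#Node j y'#} {#})"
      using t(3) mesh_limit_unique by blast
    \<comment> \<open>The term \<open>\<Phi> s u {#Node j \<rho>#} {#}\<close> is the contribution
      of the cut that prunes the whole tree.\<close>
    then show ?thesis using True t by (simp add: cop_sum_Node lift_empty)
  qed
qed

text \<open>Each vertex of \<rho> grafts on a nonempty tree, so at the starting time nothing of
  degree below \<open>deg \<rho>\<close> is present. This makes the integral at \<rho> of order
  \<open>w ^ deg \<rho>\<close>.\<close>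

lemma lift_start_zero:
  assumes "a \<le> s" "s \<le> b" "deg \<rho> \<le> n" "deg \<sigma> < deg \<rho>"
  shows "\<Phi> s s \<rho> \<sigma> = 0"
  using assms(3,4)
proof (induction \<rho> arbitrary: \<sigma> rule: forest_induct)
  case (node j \<rho>)
  show ?case
  proof (cases "\<sigma> = {#}")
    case True
    then show ?thesis using node.prems assms by (simp add: lift_start)
  next
    case False
    have "\<Phi> s s {#Node j \<rho>#} \<sigma> = conv n graftf single (\<Phi> s s \<rho>) (\<beta> j s) \<sigma>"
      using node.prems assms False by (intro lift_node) auto
    also have "\<dots> = 0"
      unfolding conv_def
    proof (intro sum.neutral ballI)
      fix \<rho>\<^sub>1 \<rho>\<^sub>2 :: "'d forest" assume \<rho>: "\<rho>\<^sub>1 \<in> fs n" "\<rho>\<^sub>2 \<in> fs n"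
      show "of_bool (single \<rho>\<^sub>2 \<and> deg \<rho>\<^sub>1 + deg \<rho>\<^sub>2 \<le> n \<and> graftf \<rho>\<^sub>1 \<rho>\<^sub>2 = \<sigma>) * (\<Phi> s s \<rho> \<rho>\<^sub>1 * \<beta> j s \<rho>\<^sub>2) = 0"
      proof (cases "single \<rho>\<^sub>2 \<and> graftf \<rho>\<^sub>1 \<rho>\<^sub>2 = \<sigma>")
        case True
        then have "deg \<sigma> = deg \<rho>\<^sub>1 + deg \<rho>\<^sub>2" "1 \<le> deg \<rho>\<^sub>2"
          using graft_op.op_deg[of \<rho>\<^sub>2 \<rho>\<^sub>1] by (auto simp: single_def)
        then have "deg \<rho>\<^sub>1 < deg \<rho>" using node.prems by simp
        then show ?thesis using node.IH[of \<rho>\<^sub>1] node.prems by simp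
      qed auto
    qed
    finally show ?thesis .
  qed
next
  case (plus \<rho>\<^sub>1 \<rho>\<^sub>2)
  have "\<Phi> s s (\<rho>\<^sub>1 + \<rho>\<^sub>2) \<sigma> = conv n (+) (\<lambda>_. True) (\<Phi> s s \<rho>\<^sub>1) (\<Phi> s s \<rho>\<^sub>2) \<sigma>"
    using plus.prems assms by (intro lift_plus) auto
  also have "\<dots> = 0"
    unfolding conv_def
  proof (intro sum.neutral ballI)
    fix \<kappa>\<^sub>1 \<kappa>\<^sub>2 :: "'d forest"
    show "of_bool (True \<and> deg \<kappa>\<^sub>1 + deg \<kappa>\<^sub>2 \<le> n \<and> \<kappa>\<^sub>1 + \<kappa>\<^sub>2 = \<sigma>) * (\<Phi> s s \<rho>\<^sub>1 \<kappa>\<^sub>1 * \<Phi> s s \<rho>\<^sub>2 \<kappa>\<^sub>2) = 0"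
    proof (cases "\<kappa>\<^sub>1 + \<kappa>\<^sub>2 = \<sigma>")
      case True
      then have "deg \<kappa>\<^sub>1 < deg \<rho>\<^sub>1 \<or> deg \<kappa>\<^sub>2 < deg \<rho>\<^sub>2" using plus.prems by auto
      then show ?thesis using plus.IH plus.prems by auto
    qed simp
  qed
  finally show ?case .
qed simp

end

locale rough_lift = rough_data n p N H M a b \<omega> Z + lift n a b Z \<beta> \<Phi>
  for n p N H M a b \<omega> and Z :: "real \<Rightarrow> real \<Rightarrow> 'd::finite forest \<Rightarrow> real"
    and \<beta> :: "'e::finite \<Rightarrow> real \<Rightarrow> 'd forest \<Rightarrow> real" and \<Phi> +
  fixes L :: real
  assumes \<beta>_controlled: "\<And>j. controlled single L a (\<beta> j)"
    and \<beta>_supp: "\<And>j t \<rho>. \<not> single \<rho> \<Longrightarrow> \<beta> j t \<rho> = 0"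
    and L0: "0 \<le> L"
begin

text \<open>A nonempty \<rho> is built by \<open>deg \<rho>\<close> graftings, with a factor
  \<open>Q * L\<close> each, and at most \<open>deg \<rho> - 1\<close> products, with a factor
  \<open>Q\<close> each.\<close>

definition KK :: "'e forest \<Rightarrow> real" where
  "KK \<rho> = (if \<rho> = {#} then 1 else Q ^ (2 * deg \<rho> - 1) * L ^ deg \<rho>)"

lemma KK_nonneg: "0 \<le> KK \<rho>"
  using Q_ge L0 by (simp add: KK_def)

lemma lift_controlled:
  assumes "deg \<rho> \<le> n" "a \<le> s" "s \<le> b"
  shows "controlled (\<lambda>_. True) (KK \<rho>) s (\<lambda>t. \<Phi> s t \<rho>)"
  using assms(1)
proof (induction \<rho> rule: forest_induct)
  case empty
  have "Gam n (Z t u) (\<Phi> s t {#}) \<tau> = of_bool (\<tau> = {#})" if "s \<le> t" "t \<le> u" "u \<le> b" for t u \<tau>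
  proof -
    have "Gam n (Z t u) (\<Phi> s t {#}) \<tau> = (\<Sum>\<rho>\<in>fs n. of_bool (\<rho> = {#}) * cop_sum \<rho> (\<lambda>x y. Z t u x * of_bool (y = \<tau>)))"
      unfolding Gam_def using that assms by (intro sum.cong refl) (simp add: lift_empty)
    also have "\<dots> = Z t u {#} * of_bool ({#} = \<tau>)" by (simp add: sum_of_bool_eq)
    also have "Z t u {#} = 1" using that assms by (intro characters_empty[of _ n] Zc) auto
    finally show ?thesis by (cases "\<tau> = {#}") auto
  qed
  then show ?case using assms by (auto simp: controlled_def KK_def lift_empty)
next
  case (node j \<rho>)
  have "controlled (\<lambda>_. True) (Q * KK \<rho> * L) s (\<lambda>t. \<Phi> s t {#Node j \<rho>#})"
  proof (rule node_controlled)
    show "controlled (\<lambda>_. True) (KK \<rho>) s (\<lambda>t. \<Phi> s t \<rho>)" using node by simp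
    show "controlled single L s (\<beta> j)" using \<beta>_controlled assms(2) by (rule controlled_subset)
  qed (use node.prems assms \<beta>_supp lift_node lift_limit lift_start in auto)
  moreover have "Q * KK \<rho> * L \<le> KK {#Node j \<rho>#}"
  proof (cases "\<rho> = {#}")
    case False
    then have "0 < deg \<rho>" by (metis deg_eq_0_iff gr0I)
    have "Q ^ Suc (2 * deg \<rho> - 1) \<le> Q ^ (2 * Suc (deg \<rho>) - 1)"
      using Q_ge \<open>0 < deg \<rho>\<close> by (intro power_increasing) auto
    then have "Q * Q ^ (2 * deg \<rho> - 1) \<le> Q ^ (2 * Suc (deg \<rho>) - 1)" by (simp only: power_Suc)
    then have "Q * Q ^ (2 * deg \<rho> - 1) * (L ^ deg \<rho> * L) \<le> Q ^ (2 * Suc (deg \<rho>) - 1) * (L ^ deg \<rho> * L)"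
      using L0 by (intro mult_right_mono) auto
    then show ?thesis using False by (simp add: KK_def mult_ac)
  qed (simp add: KK_def)
  ultimately show ?case by (rule controlled_mono)
next
  case (plus \<rho>\<^sub>1 \<rho>\<^sub>2)
  show ?case
  proof (cases "\<rho>\<^sub>1 = {#} \<or> \<rho>\<^sub>2 = {#}")
    case True
    then show ?thesis using plus by auto
  next
    case False
    have c: "controlled (\<lambda>_. True) (KK \<rho>\<^sub>1) s (\<lambda>t. \<Phi> s t \<rho>\<^sub>1)" "controlled (\<lambda>_. True) (KK \<rho>\<^sub>2) s (\<lambda>t. \<Phi> s t \<rho>\<^sub>2)"
      using plus by auto
    have eq: "\<Phi> s t (\<rho>\<^sub>1 + \<rho>\<^sub>2) \<tau> = conv n (+) (\<lambda>_. True) (\<Phi> s t \<rho>\<^sub>1) (\<Phi> s t \<rho>\<^sub>2) \<tau>"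
      if "s \<le> t" "t \<le> b" "deg \<tau> \<le> n" for t \<tau>
      using that assms plus.prems by (intro lift_plus) auto
    have K0: "0 \<le> KK \<rho>\<^sub>1 * KK \<rho>\<^sub>2" using KK_nonneg by simp
    have "controlled (\<lambda>_. True) (3 * M ^ 4 * H ^ 2 * KK \<rho>\<^sub>1 * KK \<rho>\<^sub>2) s (\<lambda>t. \<Phi> s t (\<rho>\<^sub>1 + \<rho>\<^sub>2))"
      by (rule controlled_cong[OF controlled_plus[OF c assms(2)]]) (simp add: eq)
    moreover have "3 * M ^ 4 * H ^ 2 * KK \<rho>\<^sub>1 * KK \<rho>\<^sub>2 \<le> KK (\<rho>\<^sub>1 + \<rho>\<^sub>2)"
    proof -
      have pos: "0 < deg \<rho>\<^sub>1" "0 < deg \<rho>\<^sub>2" using False by (metis deg_eq_0_iff gr0I)+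
      have "3 * M ^ 4 * H ^ 2 * (KK \<rho>\<^sub>1 * KK \<rho>\<^sub>2) \<le> Q * (KK \<rho>\<^sub>1 * KK \<rho>\<^sub>2)"
        using Q_ge(1) K0 by (rule mult_right_mono)
      also have "\<dots> = Q ^ (1 + (2 * deg \<rho>\<^sub>1 - 1) + (2 * deg \<rho>\<^sub>2 - 1)) * L ^ (deg \<rho>\<^sub>1 + deg \<rho>\<^sub>2)"
        using False by (simp add: KK_def power_add)
      also have "1 + (2 * deg \<rho>\<^sub>1 - 1) + (2 * deg \<rho>\<^sub>2 - 1) = 2 * deg (\<rho>\<^sub>1 + \<rho>\<^sub>2) - 1" using pos by simp
      finally show ?thesis using False by (simp add: KK_def mult.assoc)
    qed
    ultimately show ?thesis by (rule controlled_mono)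
  qed
qed

lemma KK_le: "deg \<rho> \<le> n \<Longrightarrow> KK \<rho> \<le> Q ^ (2 * n) * L ^ deg \<rho>"
  using Q_ge L0 by (auto simp: KK_def one_le_power intro!: mult_right_mono power_increasing)

text \<open>The value at \<open>t\<close> is the transport from the starting time, of order
  \<open>deg \<rho>\<close> by \<open>lift_start_zero\<close>, up to an error of order
  \<open>N\<close>, which exceeds \<open>deg \<rho>\<close>.\<close>

lemma lift_bound:
  assumes "deg \<rho> \<le> n" "a \<le> s" "s \<le> t" "t \<le> b"
  shows "\<bar>\<Phi> s t \<rho> {#}\<bar> \<le> (M * H + 1) * Q ^ (2 * n) * L ^ deg \<rho> * w s t ^ deg \<rho>"
proof -
  note c = lift_controlled[OF assms(1,2) order_trans[OF assms(3,4)]]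
  let ?k = "deg \<rho>"
  have x: "0 \<le> w s t" "w s t \<le> 1" using assms by (auto intro: w_le1)
  have "\<bar>\<Phi> s t \<rho> {#} - Gam n (Z s t) (\<Phi> s s \<rho>) {#}\<bar> \<le> KK \<rho> * w s t powr (N - real (deg ({#} :: 'd forest)))"
    using controlled_diff[OF c, of s t "{#}"] assms by simp
  also have "\<dots> \<le> KK \<rho> * w s t ^ ?k"
  proof (rule mult_left_mono)
    show "w s t powr (N - real (deg ({#} :: 'd forest))) \<le> w s t ^ ?k"
    proof (cases "w s t = 0")
      case False
      have "0 < w s t" using False by (simp add: order_less_le)
      then have "w s t ^ ?k = w s t powr real ?k" by (simp add: powr_realpow)
      then show ?thesis using x N assms(1) by (simp add: powr_mono')
    qed simp
  qed (rule KK_nonneg)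
  finally have 1: "\<bar>\<Phi> s t \<rho> {#} - Gam n (Z s t) (\<Phi> s s \<rho>) {#}\<bar> \<le> KK \<rho> * w s t ^ ?k" .
  have "\<bar>Gam n (Z s t) (\<Phi> s s \<rho>) {#}\<bar> \<le> M * (KK \<rho> * (H * w s t ^ ?k))"
    unfolding Gam_empty pair_def
  proof (rule sum_abs_le[OF _ M_card])
    fix \<sigma> :: "'d forest" assume \<sigma>: "\<sigma> \<in> fs n"
    show "\<bar>\<Phi> s s \<rho> \<sigma> * Z s t \<sigma>\<bar> \<le> KK \<rho> * (H * w s t ^ ?k)"
    proof (cases "deg \<sigma> < ?k")
      case True
      then show ?thesis using lift_start_zero[OF assms(2) _ assms(1) True] assms KK_nonneg H by simp
    next
      case False
      have "\<bar>Z s t \<sigma>\<bar> \<le> H * w s t ^ deg \<sigma>" using Zw[of s t \<sigma>] assms \<sigma> by simp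
      also have "\<dots> \<le> H * w s t ^ ?k" using False x H by (intro mult_left_mono power_decreasing) auto
      finally show ?thesis
        unfolding abs_mult using controlled_bd[OF c, of s \<sigma>] assms \<sigma> KK_nonneg by (intro mult_mono) auto
    qed
  qed (use KK_nonneg H in auto)
  with 1 have "\<bar>\<Phi> s t \<rho> {#}\<bar> \<le> (M * H + 1) * (KK \<rho> * w s t ^ ?k)" by (simp add: algebra_simps)
  also have "\<dots> \<le> (M * H + 1) * (Q ^ (2 * n) * L ^ deg \<rho> * w s t ^ ?k)"
    using KK_le[OF assms(1)] M1 H by (intro mult_left_mono mult_right_mono) auto
  finally show ?thesis by (simp add: mult.assoc)
qed

end

section \<open>Taylor expansion along iterated directional derivatives\<close>

lemma iter_deriv_bounded_linear:
  fixes f :: "'a::euclidean_space \<Rightarrow> 'b::real_normed_vector"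
  assumes B: "bounded_linear B" and f: "times_differentiable k f" and "length vs \<le> k"
  shows "iter_deriv (\<lambda>z. B (f z)) vs = (\<lambda>x. B (iter_deriv f vs x))"
  using assms(3)
proof (induction vs)
  case (Cons v vs)
  have "((\<lambda>x. B (iter_deriv f vs x)) has_derivative (\<lambda>h. B (frechet_derivative (iter_deriv f vs) (at x) h))) (at x)" for x
    using f Cons.prems
    by (intro bounded_linear.has_derivative[OF B]) (simp add: times_differentiable_def frechet_derivative_works[symmetric])
  from frechet_derivative_at[OF this] Cons show ?case by simp metis
qed simp

text \<open>The mean value theorem is applied along \<open>v\<close> to a difference in direction
  \<open>w\<close>, and then along \<open>w\<close> to the derivative in direction
  \<open>v\<close>.\<close>

lemma second_difference:
  fixes h :: "'a::euclidean_space \<Rightarrow> real"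
  assumes h: "\<And>x. h differentiable at x" and hv: "\<And>x. (\<lambda>x. frechet_derivative h (at x) v) differentiable at x"
    and s: "0 < s"
  shows "\<exists>\<xi> \<eta>. 0 < \<xi> \<and> \<xi> < s \<and> 0 < \<eta> \<and> \<eta> < s \<and>
    h (x + s *\<^sub>R v + s *\<^sub>R w) - h (x + s *\<^sub>R v) - h (x + s *\<^sub>R w) + h x =
    s * (s * frechet_derivative (\<lambda>x. frechet_derivative h (at x) v) (at (x + \<xi> *\<^sub>R v + \<eta> *\<^sub>R w)) w)"
proof -
  have line: "((\<lambda>r. g (y + r *\<^sub>R u)) has_real_derivative frechet_derivative g (at (y + r *\<^sub>R u)) u) (at r)"
    if "\<And>x. g differentiable at x" for g :: "'a \<Rightarrow> real" and y u r
  proof -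
    have g: "(g has_derivative frechet_derivative g (at (y + r *\<^sub>R u))) (at (y + r *\<^sub>R u))"
      using that frechet_derivative_works by blast
    have "((\<lambda>r. g (y + r *\<^sub>R u)) has_derivative (\<lambda>d. frechet_derivative g (at (y + r *\<^sub>R u)) (d *\<^sub>R u))) (at r)"
      by (rule has_derivative_compose[where f = "\<lambda>r. y + r *\<^sub>R u" and g = g, OF _ g]) (auto intro!: derivative_eq_intros)
    also have "(\<lambda>d. frechet_derivative g (at (y + r *\<^sub>R u)) (d *\<^sub>R u)) = (\<lambda>d. d * frechet_derivative g (at (y + r *\<^sub>R u)) u)"
      using has_derivative_bounded_linear[OF g] by (simp add: linear_simps)
    finally show ?thesis by (rule has_derivative_imp_has_field_derivative) simp
  qed
  let ?D = "\<lambda>x. frechet_derivative h (at x) v"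
  define \<phi> where "\<phi> r = h ((x + s *\<^sub>R w) + r *\<^sub>R v) - h (x + r *\<^sub>R v)" for r
  have d: "(\<phi> has_real_derivative ?D ((x + s *\<^sub>R w) + r *\<^sub>R v) - ?D (x + r *\<^sub>R v)) (at r)" for r
    unfolding \<phi>_def by (intro DERIV_diff line h)
  obtain \<xi> where \<xi>: "0 < \<xi>" "\<xi> < s" "\<phi> s - \<phi> 0 = (s - 0) * (?D ((x + s *\<^sub>R w) + \<xi> *\<^sub>R v) - ?D (x + \<xi> *\<^sub>R v))"
    using MVT2[OF s d] by blast
  obtain \<eta> where \<eta>: "0 < \<eta>" "\<eta> < s" "?D ((x + \<xi> *\<^sub>R v) + s *\<^sub>R w) - ?D ((x + \<xi> *\<^sub>R v) + 0 *\<^sub>R w)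
      = (s - 0) * frechet_derivative ?D (at ((x + \<xi> *\<^sub>R v) + \<eta> *\<^sub>R w)) w"
    using MVT2[OF s line[OF hv, of "x + \<xi> *\<^sub>R v" w]] by blast
  have "h (x + s *\<^sub>R v + s *\<^sub>R w) - h (x + s *\<^sub>R v) - h (x + s *\<^sub>R w) + h x = \<phi> s - \<phi> 0"
    by (simp add: \<phi>_def algebra_simps)
  also have "\<dots> = s * (s * frechet_derivative ?D (at (x + \<xi> *\<^sub>R v + \<eta> *\<^sub>R w)) w)"
    using \<xi>(3) \<eta>(3) by (simp add: add.commute add.left_commute)
  finally show ?thesis using \<xi> \<eta> by blast
qed

text \<open>Both mixed derivatives, taken at points near \<open>x\<close>, equal the same second
  difference quotient, and both are continuous at \<open>x\<close>. Symmetry matters because the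
  coefficients of the one-form take the labels in an unspecified order.\<close>

lemma second_derivative_symmetric:
  fixes h :: "'a::euclidean_space \<Rightarrow> real"
  defines "D \<equiv> \<lambda>u x. frechet_derivative h (at x) u"
  assumes h: "\<And>x. h differentiable at x"
    and hv: "\<And>x. D v differentiable at x" and hw: "\<And>x. D w differentiable at x"
    and c1: "isCont (\<lambda>x. frechet_derivative (D v) (at x) w) x"
    and c2: "isCont (\<lambda>x. frechet_derivative (D w) (at x) v) x"
  shows "frechet_derivative (D v) (at x) w = frechet_derivative (D w) (at x) v"
proof (rule ccontr)
  let ?F = "\<lambda>x. frechet_derivative (D v) (at x) w" and ?G = "\<lambda>x. frechet_derivative (D w) (at x) v"
  assume "?F x \<noteq> ?G x"
  define \<epsilon> where "\<epsilon> = \<bar>?F x - ?G x\<bar> / 2"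
  have \<epsilon>: "0 < \<epsilon>" using \<open>?F x \<noteq> ?G x\<close> by (simp add: \<epsilon>_def)
  obtain \<delta>1 where \<delta>1: "0 < \<delta>1" "\<And>y. dist y x < \<delta>1 \<Longrightarrow> dist (?F y) (?F x) < \<epsilon>"
    using c1 \<epsilon> unfolding continuous_at_eps_delta by (metis dist_commute)
  obtain \<delta>2 where \<delta>2: "0 < \<delta>2" "\<And>y. dist y x < \<delta>2 \<Longrightarrow> dist (?G y) (?G x) < \<epsilon>"
    using c2 \<epsilon> unfolding continuous_at_eps_delta by (metis dist_commute)
  \<comment> \<open>Small enough for the parallelogram at \<open>x\<close> spanned by
    \<open>s *\<^sub>R v\<close> and \<open>s *\<^sub>R w\<close> to lie in both neighbourhoods; the
    1 keeps the denominator positive.\<close>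
  define s where "s = min \<delta>1 \<delta>2 / (norm v + norm w + 1)"
  have nn: "0 < norm v + norm w + 1" by (simp add: add_nonneg_pos)
  have s: "0 < s" using \<delta>1 \<delta>2 nn by (simp add: s_def)
  have near: "dist (x + \<xi> *\<^sub>R v + \<eta> *\<^sub>R w) x < min \<delta>1 \<delta>2"
    if "0 < \<xi>" "\<xi> < s" "0 < \<eta>" "\<eta> < s" for \<xi> \<eta>
  proof -
    have "dist (x + \<xi> *\<^sub>R v + \<eta> *\<^sub>R w) x = norm (\<xi> *\<^sub>R v + \<eta> *\<^sub>R w)"
      by (simp add: dist_norm algebra_simps)
    also have "\<dots> \<le> \<xi> * norm v + \<eta> * norm w"
      using norm_triangle_ineq[of "\<xi> *\<^sub>R v" "\<eta> *\<^sub>R w"] that by simp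
    also have "\<dots> \<le> s * norm v + s * norm w" using that by (intro add_mono mult_right_mono) auto
    also have "\<dots> < s * (norm v + norm w + 1)" using s by (simp add: algebra_simps)
    also have "\<dots> = min \<delta>1 \<delta>2" using nn by (simp add: s_def)
    finally show ?thesis .
  qed
  obtain \<xi> \<eta> where 1: "0 < \<xi>" "\<xi> < s" "0 < \<eta>" "\<eta> < s"
    "h (x + s *\<^sub>R v + s *\<^sub>R w) - h (x + s *\<^sub>R v) - h (x + s *\<^sub>R w) + h x = s * (s * ?F (x + \<xi> *\<^sub>R v + \<eta> *\<^sub>R w))"
    using second_difference[OF h hv[unfolded D_def] s, of x w] unfolding D_def by blast
  obtain \<xi>' \<eta>' where 2: "0 < \<xi>'" "\<xi>' < s" "0 < \<eta>'" "\<eta>' < s"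
    "h (x + s *\<^sub>R w + s *\<^sub>R v) - h (x + s *\<^sub>R w) - h (x + s *\<^sub>R v) + h x = s * (s * ?G (x + \<xi>' *\<^sub>R w + \<eta>' *\<^sub>R v))"
    using second_difference[OF h hw[unfolded D_def] s, of x v] unfolding D_def by blast
  have eqs: "x + \<xi>' *\<^sub>R w + \<eta>' *\<^sub>R v = x + \<eta>' *\<^sub>R v + \<xi>' *\<^sub>R w" "x + s *\<^sub>R w + s *\<^sub>R v = x + s *\<^sub>R v + s *\<^sub>R w"
    by simp_all
  have "s * (s * ?F (x + \<xi> *\<^sub>R v + \<eta> *\<^sub>R w)) = s * (s * ?G (x + \<eta>' *\<^sub>R v + \<xi>' *\<^sub>R w))"
    using 1(5) 2(5)[unfolded eqs] by linarith
  then have "?F (x + \<xi> *\<^sub>R v + \<eta> *\<^sub>R w) = ?G (x + \<eta>' *\<^sub>R v + \<xi>' *\<^sub>R w)" using s by simp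
  moreover have "dist (?F (x + \<xi> *\<^sub>R v + \<eta> *\<^sub>R w)) (?F x) < \<epsilon>" using near[OF 1(1-4)] by (intro \<delta>1) auto
  moreover have "dist (?G (x + \<eta>' *\<^sub>R v + \<xi>' *\<^sub>R w)) (?G x) < \<epsilon>" using near[OF 2(3,4,1,2)] by (intro \<delta>2) auto
  ultimately show False by (simp add: dist_real_def \<epsilon>_def abs_if split: if_splits)
qed

section \<open>Multi-indices and Taylor's formula with Hoelder remainder\<close>

definition ms :: "nat \<Rightarrow> 'i multiset set" where
  "ms k = {r. size r \<le> k}"

lemma ms_iff [simp]: "r \<in> ms k \<longleftrightarrow> size r \<le> k"
  by (simp add: ms_def)

lemma finite_ms [simp]: "finite (ms k :: 'i::finite multiset set)"
proof (rule finite_subset)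
  show "ms k \<subseteq> mset ` {xs :: 'i list. set xs \<subseteq> UNIV \<and> length xs \<le> k}"
  proof
    fix r :: "'i multiset" assume "r \<in> ms k"
    moreover obtain xs where "mset xs = r" using ex_mset by blast
    ultimately show "r \<in> mset ` {xs. set xs \<subseteq> UNIV \<and> length xs \<le> k}" by (auto intro!: image_eqI[of _ _ xs])
  qed
qed (intro finite_imageI finite_lists_length_le finite)

text \<open>Multisets of labels serve as multi-indices: this is their factorial, and
  \<open>mpow\<close> is the monomial.\<close>

definition mfact :: "'i::finite multiset \<Rightarrow> real" where
  "mfact r = (\<Prod>i\<in>UNIV. fact (count r i))"

lemma mfact_empty [simp]: "mfact {#} = 1"
  by (simp add: mfact_def)

lemma mfact_add [simp]: "mfact (add_mset i r) = (real (count r i) + 1) * mfact r"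
proof -
  have "mfact (add_mset i r) = fact (Suc (count r i)) * (\<Prod>k\<in>UNIV - {i}. fact (count (add_mset i r) k))"
    unfolding mfact_def by (subst prod.remove[of _ i]) auto
  also have "(\<Prod>k\<in>UNIV - {i}. fact (count (add_mset i r) k)) = (\<Prod>k\<in>UNIV - {i}. fact (count r k) :: real)"
    by (intro prod.cong) auto
  also have "fact (Suc (count r i)) * (\<Prod>k\<in>UNIV - {i}. fact (count r k)) = (real (count r i) + 1) * mfact r"
    unfolding mfact_def by (subst prod.remove[of _ i]) (auto simp: algebra_simps)
  finally show ?thesis .
qed

lemma mfact_ge1: "1 \<le> mfact r"
  by (simp add: mfact_def prod_ge_1)

lemma mfact_pos [simp]: "0 < mfact r" "mfact r \<noteq> 0"
  using mfact_ge1[of r] by auto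

definition mpow :: "real ^ 'i \<Rightarrow> 'i::finite multiset \<Rightarrow> real" where
  "mpow h r = (\<Prod>i\<in>#r. h $ i)"

lemma mpow_simps [simp]: "mpow h {#} = 1" "mpow h (add_mset i r) = h $ i * mpow h r"
  by (simp_all add: mpow_def)

lemma mpow_scale: "mpow (s *\<^sub>R h) r = s ^ size r * mpow h r"
  by (induction r) auto

lemma mpow_zero: "mpow 0 r = of_bool (r = {#})"
  by (cases r) auto

lemma size_sum_count: "real (size r) = (\<Sum>i\<in>UNIV. real (count r (i :: 'i::finite)))"
proof (induction r)
  case (add x r)
  have "(\<Sum>i\<in>UNIV. real (count (add_mset x r) i)) = (\<Sum>i\<in>UNIV. of_bool (x = i) * 1 + real (count r i))"
    by (intro sum.cong) auto
  also have "\<dots> = 1 + real (size r)" unfolding sum.distrib by (subst sum_of_bool_eq) (auto simp: add)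
  finally show ?case by simp
qed simp

text \<open>Differentiating a Taylor polynomial along a ray multiplies each term by its order, which
  is the sum of the counts of the labels. Each count cancels against the factorial and lowers the
  multi-index by one label.\<close>

lemma sum_ms_shift:
  fixes F :: "'i::finite multiset \<Rightarrow> real"
  shows "(\<Sum>r\<in>ms (Suc k). real (size r) * F r / mfact r) = (\<Sum>i\<in>UNIV. \<Sum>r\<in>ms k. F (add_mset i r) / mfact r)"
proof -
  have "(\<Sum>r\<in>ms (Suc k). real (size r) * F r / mfact r) =
      (\<Sum>i\<in>UNIV. \<Sum>r\<in>ms (Suc k). real (count r i) * F r / mfact r)"
    by (subst sum.swap) (simp add: size_sum_count sum_distrib_right sum_divide_distrib)
  also have "\<dots> = (\<Sum>i\<in>UNIV. \<Sum>r\<in>ms k. F (add_mset i r) / mfact r)"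
  proof (rule sum.cong[OF refl])
    fix i :: 'i
    have "(\<Sum>r\<in>ms (Suc k). real (count r i) * F r / mfact r) = (\<Sum>r\<in>add_mset i ` ms k. real (count r i) * F r / mfact r)"
    proof (rule sum.mono_neutral_right)
      show "\<forall>r\<in>ms (Suc k) - add_mset i ` ms k. real (count r i) * F r / mfact r = 0"
      proof
        fix r assume r: "r \<in> ms (Suc k) - add_mset i ` ms k"
        have "i \<notin># r"
        proof
          assume "i \<in># r"
          then obtain r' where r': "r = add_mset i r'" by (metis mset_add)
          then have "r' \<in> ms k" using r by simp
          then show False using r r' by blast
        qed
        then show "real (count r i) * F r / mfact r = 0" by (simp add: not_in_iff)
      qed
    qed auto
    also have "\<dots> = (\<Sum>r\<in>ms k. real (count (add_mset i r) i) * F (add_mset i r) / mfact (add_mset i r))"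
      by (rule sum.reindex_cong[of "add_mset i"]) (auto intro: inj_onI)
    also have "\<dots> = (\<Sum>r\<in>ms k. F (add_mset i r) / mfact r)"
      by (intro sum.cong refl) (simp add: add.commute add_nonneg_eq_0_iff)
    finally show "(\<Sum>r\<in>ms (Suc k). real (count r i) * F r / mfact r) = (\<Sum>r\<in>ms k. F (add_mset i r) / mfact r)" .
  qed
  finally show ?thesis .
qed

text \<open>The partial derivative at a multi-index, with the same choice of order as in
  \<open>tree_coeff\<close>.\<close>

definition Dm :: "(real ^ 'i \<Rightarrow> real) \<Rightarrow> 'i::finite multiset \<Rightarrow> real ^ 'i \<Rightarrow> real" where
  "Dm g q = iter_deriv g (map (\<lambda>i. axis i 1) (SOME is. mset is = q))"

lemma mset_some_list: "mset (SOME is. mset is = q) = q"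
  by (rule someI_ex) (rule ex_mset)

text \<open>The derivatives of top order are only continuous, in directions of the unit ball, where
  the Lipschitz norm controls them. The coordinate directions are among these.\<close>

locale smooth_function =
  fixes g :: "real ^ 'i::finite \<Rightarrow> real" and N0 :: nat
  assumes diff: "times_differentiable N0 g"
    and cont: "\<And>vs x. length vs = N0 \<Longrightarrow> (\<forall>v\<in>set vs. norm v \<le> 1) \<Longrightarrow> isCont (iter_deriv g vs) x"
begin

lemma cont_le: "length vs \<le> N0 \<Longrightarrow> (\<forall>v\<in>set vs. norm v \<le> 1) \<Longrightarrow> isCont (iter_deriv g vs) x"
  using diff cont differentiable_imp_continuous_within[of "iter_deriv g vs" x UNIV]
  by (cases "length vs = N0") (auto simp: times_differentiable_def)

lemma iter_deriv_swap:
  assumes "Suc (Suc (length vs)) \<le> N0" "\<forall>w\<in>set (v # u # vs). norm w \<le> 1"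
  shows "iter_deriv g (v # u # vs) = iter_deriv g (u # v # vs)"
proof
  fix x
  have d: "iter_deriv g us differentiable at y" if "length us < N0" for us y
    using diff that by (auto simp: times_differentiable_def)
  show "iter_deriv g (v # u # vs) x = iter_deriv g (u # v # vs) x"
    unfolding iter_deriv.simps
  proof (rule second_derivative_symmetric)
    show "isCont (\<lambda>x. frechet_derivative (\<lambda>x. frechet_derivative (iter_deriv g vs) (at x) u) (at x) v) x"
      using cont_le[of "v # u # vs" x] assms by simp
    show "isCont (\<lambda>x. frechet_derivative (\<lambda>x. frechet_derivative (iter_deriv g vs) (at x) v) (at x) u) x"
      using cont_le[of "u # v # vs" x] assms by simp
  qed (use d[of vs] d[of "u # vs"] d[of "v # vs"] assms in auto)
qed

lemma iter_deriv_move: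
  "Suc (length as + length bs) \<le> N0 \<Longrightarrow> (\<forall>w\<in>set (v # as @ bs). norm w \<le> 1) \<Longrightarrow> iter_deriv g (v # as @ bs) = iter_deriv g (as @ v # bs)"
proof (induction as)
  case (Cons a as)
  have "iter_deriv g (v # a # as @ bs) = iter_deriv g (a # v # as @ bs)"
    using Cons.prems by (intro iter_deriv_swap) auto
  also have "\<dots> = iter_deriv g (a # as @ v # bs)"
    using Cons by (simp only: iter_deriv.simps) simp
  finally show ?case by simp
qed simp

lemma iter_deriv_perm:
  "mset vs = mset us \<Longrightarrow> length vs \<le> N0 \<Longrightarrow> (\<forall>v\<in>set vs. norm v \<le> 1) \<Longrightarrow> iter_deriv g vs = iter_deriv g us"
proof (induction vs arbitrary: us)
  case (Cons v vs)
  then have "v \<in> set us" by (metis list.set_intros(1) set_mset_mset)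
  then obtain as bs where us: "us = as @ v # bs" by (meson split_list)
  have m: "mset vs = mset (as @ bs)" using Cons.prems us by simp
  then have l: "length vs = length as + length bs" by (metis length_append mset_eq_length)
  have "iter_deriv g (v # vs) = iter_deriv g (v # as @ bs)"
    using Cons.IH[OF m] Cons.prems by simp
  also have "\<dots> = iter_deriv g us" unfolding us using Cons.prems l us mset_eq_setD[OF Cons.prems(1)] by (intro iter_deriv_move) auto
  finally show ?case .
qed simp

lemma Dm_list: "length is \<le> N0 \<Longrightarrow> iter_deriv g (map (\<lambda>i. axis i 1) is) = Dm g (mset is)"
  unfolding Dm_def by (rule iter_deriv_perm) (auto simp: mset_some_list norm_axis_1)

lemma Dm_derivative:
  assumes "size q < N0"
  shows "(Dm g q has_derivative (\<lambda>h. \<Sum>i\<in>UNIV. h $ i * Dm g (add_mset i q) x)) (at x)"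
proof -
  let ?is = "SOME is. mset is = q"
  have len: "length ?is = size q" by (metis mset_some_list size_mset)
  have "Dm g q differentiable at x"
    unfolding Dm_def using diff assms len by (auto simp: times_differentiable_def)
  then have D: "(Dm g q has_derivative frechet_derivative (Dm g q) (at x)) (at x)"
    using frechet_derivative_works by blast
  have ax: "frechet_derivative (Dm g q) (at x) (axis i 1) = Dm g (add_mset i q) x" for i
    using fun_cong[OF Dm_list[of "i # ?is"], of x] len assms by (simp add: mset_some_list flip: Dm_def)
  have "frechet_derivative (Dm g q) (at x) h = (\<Sum>i\<in>UNIV. h $ i * Dm g (add_mset i q) x)" for h
  proof -
    have l: "linear (frechet_derivative (Dm g q) (at x))" using D by (rule has_derivative_linear)
    have "frechet_derivative (Dm g q) (at x) h = frechet_derivative (Dm g q) (at x) (\<Sum>i\<in>UNIV. h $ i *\<^sub>R axis i 1)"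
      using basis_expansion[of h] by (simp add: scalar_mult_eq_scaleR)
    also have "\<dots> = (\<Sum>i\<in>UNIV. h $ i * Dm g (add_mset i q) x)"
      unfolding linear_sum[OF l] using linear_cmul[OF l] by (simp add: ax)
    finally show ?thesis .
  qed
  then show ?thesis using D by presburger
qed

definition remainder :: "'i multiset \<Rightarrow> real ^ 'i \<Rightarrow> real ^ 'i \<Rightarrow> real" where
  "remainder q x h = Dm g q (x + h) - (\<Sum>r\<in>ms (N0 - size q). Dm g (q + r) x * mpow h r / mfact r)"

text \<open>Along the segment, the derivative of a remainder is a combination of the remainders of the
  next order, so the Hoelder bound at the top order propagates down by the mean value theorem.\<close>

lemma remainder_bound:
  assumes hoelder: "\<And>q x y. size q = N0 \<Longrightarrow> \<bar>Dm g q x - Dm g q y\<bar> \<le> K * norm (x - y) powr \<alpha>"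
    and K: "0 \<le> K" and \<alpha>: "0 < \<alpha>"
  shows "size q + k = N0 \<Longrightarrow> \<bar>remainder q x h\<bar> \<le> real CARD('i) ^ k * K * norm h powr (real k + \<alpha>)"
proof (induction k arbitrary: q h)
  case 0
  have "ms 0 = {{#} :: 'i multiset}" by auto
  then show ?case using hoelder[of q "x + h" x] 0 by (simp add: remainder_def)
next
  case (Suc k)
  define \<phi> where "\<phi> s = remainder q x (s *\<^sub>R h)" for s
  have der: "(\<phi> has_real_derivative (\<Sum>i\<in>UNIV. h $ i * remainder (add_mset i q) x (s *\<^sub>R h))) (at s)" for s
  proof -
    have Nq: "N0 - size q = Suc k" "N0 - size (add_mset i q) = k" for i using Suc.prems by auto
    have 1: "((\<lambda>s. Dm g q (x + s *\<^sub>R h)) has_real_derivative (\<Sum>i\<in>UNIV. h $ i * Dm g (add_mset i q) (x + s *\<^sub>R h))) (at s)"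
    proof -
      have "((\<lambda>s. Dm g q (x + s *\<^sub>R h)) has_derivative (\<lambda>d. \<Sum>i\<in>UNIV. (d *\<^sub>R h) $ i * Dm g (add_mset i q) (x + s *\<^sub>R h))) (at s)"
        by (rule has_derivative_compose[OF _ Dm_derivative]) (use Suc.prems in \<open>auto intro!: derivative_eq_intros\<close>)
      then show ?thesis
        by (rule has_derivative_imp_has_field_derivative) (simp add: sum_distrib_left mult_ac)
    qed
    have 2: "((\<lambda>s. \<Sum>r\<in>ms (Suc k). Dm g (q + r) x * mpow (s *\<^sub>R h) r / mfact r) has_real_derivative
        (\<Sum>r\<in>ms (Suc k). real (size r) * (Dm g (q + r) x * s ^ (size r - 1) * mpow h r) / mfact r)) (at s)"
      unfolding mpow_scale
      by (auto intro!: derivative_eq_intros sum.cong simp: mult_ac)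
    have 3: "(\<Sum>r\<in>ms (Suc k). real (size r) * (Dm g (q + r) x * s ^ (size r - 1) * mpow h r) / mfact r) =
       (\<Sum>i\<in>UNIV. h $ i * (\<Sum>r\<in>ms k. Dm g (add_mset i q + r) x * mpow (s *\<^sub>R h) r / mfact r))"
      unfolding sum_ms_shift sum_distrib_left mpow_scale
      by (intro sum.cong refl) (simp add: mult_ac)
    have "\<phi> = (\<lambda>s. Dm g q (x + s *\<^sub>R h) - (\<Sum>r\<in>ms (Suc k). Dm g (q + r) x * mpow (s *\<^sub>R h) r / mfact r))"
      by (simp add: \<phi>_def remainder_def Nq(1) fun_eq_iff)
    moreover have "(\<Sum>i\<in>UNIV. h $ i * remainder (add_mset i q) x (s *\<^sub>R h)) =
      (\<Sum>i\<in>UNIV. h $ i * Dm g (add_mset i q) (x + s *\<^sub>R h)) -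
      (\<Sum>i\<in>UNIV. h $ i * (\<Sum>r\<in>ms k. Dm g (add_mset i q + r) x * mpow (s *\<^sub>R h) r / mfact r))"
      unfolding remainder_def Nq(2) by (simp add: right_diff_distrib sum_subtractf)
    ultimately show ?thesis using DERIV_diff[OF 1 2] unfolding 3 by simp
  qed
  obtain \<xi> where \<xi>: "0 < \<xi>" "\<xi> < 1" "\<phi> 1 - \<phi> 0 = (1 - 0) * (\<Sum>i\<in>UNIV. h $ i * remainder (add_mset i q) x (\<xi> *\<^sub>R h))"
    using MVT2[OF zero_less_one der] by blast
  have "(\<Sum>r\<in>ms (N0 - size q). Dm g (q + r) x * mpow (0 *\<^sub>R h) r / mfact r) =
      (\<Sum>r\<in>ms (N0 - size q). of_bool (r = {#}) * Dm g (q + r) x)"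
    by (intro sum.cong refl) (auto simp: mpow_zero)
  also have "\<dots> = Dm g q x" by (subst sum_of_bool_eq) auto
  finally have "\<phi> 0 = 0" by (simp add: \<phi>_def remainder_def)
  then have "\<bar>remainder q x h\<bar> = \<bar>\<Sum>i\<in>UNIV. h $ i * remainder (add_mset i q) x (\<xi> *\<^sub>R h)\<bar>"
    using \<xi>(3) by (simp add: \<phi>_def)
  also have "\<dots> \<le> real CARD('i) * (norm h * (real CARD('i) ^ k * K * norm h powr (real k + \<alpha>)))"
  proof (rule sum_abs_le)
    fix i :: 'i
    have "\<bar>remainder (add_mset i q) x (\<xi> *\<^sub>R h)\<bar> \<le> real CARD('i) ^ k * K * norm (\<xi> *\<^sub>R h) powr (real k + \<alpha>)"
      using Suc.prems by (intro Suc.IH) auto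
    also have "\<dots> \<le> real CARD('i) ^ k * K * norm h powr (real k + \<alpha>)"
    proof -
      have "norm (\<xi> *\<^sub>R h) \<le> norm h" using \<xi> by (simp add: mult_left_le_one_le)
      then show ?thesis using K \<alpha> by (intro mult_left_mono powr_mono2) auto
    qed
    finally show "\<bar>h $ i * remainder (add_mset i q) x (\<xi> *\<^sub>R h)\<bar> \<le> norm h * (real CARD('i) ^ k * K * norm h powr (real k + \<alpha>))"
      unfolding abs_mult using component_le_norm_cart[of h i] by (intro mult_mono) auto
  qed (use K in auto)
  also have "\<dots> = real CARD('i) ^ Suc k * K * norm h powr (real (Suc k) + \<alpha>)"
  proof (cases "norm h = 0")
    case False
    then have "norm h * norm h powr (real k + \<alpha>) = norm h powr (1 + (real k + \<alpha>))" by (simp add: powr_add)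
    then show ?thesis by (simp add: algebra_simps)
  qed simp
  finally show ?case .
qed

end

section \<open>The one-form of a Lipschitz function\<close>

definition leaves :: "'l multiset \<Rightarrow> 'l forest" where
  "leaves q = image_mset (\<lambda>i. Node i {#}) q"

lemma leaves_simps [simp]: "leaves {#} = {#}" "leaves (add_mset i q) = add_mset (Node i {#}) (leaves q)"
  by (simp_all add: leaves_def)

lemma deg_leaves [simp]: "deg (leaves q) = size q"
  by (induction q) (simp_all add: deg_def)

lemma label_leaves [simp]: "image_mset label (leaves q) = q"
  by (induction q) simp_all

lemma leaves_inj [simp]: "leaves q = leaves r \<longleftrightarrow> q = r"
  using label_leaves by metis

lemma depth_le_1: "depth (Node i c) \<le> 1 \<longleftrightarrow> c = {#}"
proof -
  have "\<not> depth (Node i c) \<le> 1" if ne: "c \<noteq> {#}"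
  proof -
    obtain \<tau> where \<tau>: "\<tau> \<in># c" using ne by blast
    have "1 \<le> depth \<tau>" by (cases \<tau>) simp
    also have "depth \<tau> \<le> Max (insert 0 (depth ` set_mset c))" using \<tau> by (intro Max_ge) auto
    finally show ?thesis by simp
  qed
  moreover have "depth (Node i {#}) \<le> 1" by simp
  ultimately show ?thesis by blast
qed

text \<open>The trees that may carry a coefficient of the one-form are a root with leaves, that is,
  a label together with a multi-index.\<close>

lemma depth_le_2: "depth (Node i c) \<le> 2 \<longleftrightarrow> c = leaves (image_mset label c)"
proof -
  have "depth (Node i c) \<le> 2 \<longleftrightarrow> (\<forall>\<tau>\<in>#c. depth \<tau> \<le> 1)"
    by (auto simp: Max_le_iff)
  also have "\<dots> \<longleftrightarrow> (\<forall>\<tau>\<in>#c. \<tau> = Node (label \<tau>) {#})"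
  proof -
    have "depth \<tau> \<le> 1 \<longleftrightarrow> \<tau> = Node (label \<tau>) {#}" for \<tau> :: "'a tree"
      by (cases \<tau>) (use depth_le_1 in auto)
    then show ?thesis by simp
  qed
  also have "\<dots> \<longleftrightarrow> c = leaves (image_mset label c)"
  proof
    assume *: "\<forall>\<tau>\<in>#c. \<tau> = Node (label \<tau>) {#}"
    have "image_mset (\<lambda>\<tau>. Node (label \<tau>) {#}) c = image_mset (\<lambda>\<tau>. \<tau>) c"
      by (rule image_mset_cong) (use * in auto)
    then show "c = leaves (image_mset label c)" by (simp add: leaves_def multiset.map_comp comp_def)
  next
    assume "c = leaves (image_mset label c)"
    then obtain q where "c = leaves q" by blast
    then show "\<forall>\<tau>\<in>#c. \<tau> = Node (label \<tau>) {#}" by (auto simp: leaves_def)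
  qed
  finally show ?thesis .
qed

text \<open>The symmetry factor is the factorial of the multi-index, so the coefficients of the
  one-form are Taylor coefficients.\<close>

lemma sym_factor_leaves: "real (sym_factor (Node i (leaves q))) = mfact q"
proof -
  have inj: "inj (\<lambda>i. Node i {#})" by (auto intro: injI)
  have "count (leaves q) (Node k {#}) = count q k" for k
    by (induction q) auto
  then have "(\<Prod>\<tau>\<in>set_mset (leaves q). fact (count (leaves q) \<tau>)) = (\<Prod>k\<in>set_mset q. fact (count q k) :: nat)"
    unfolding leaves_def set_image_mset by (subst prod.reindex) (auto simp: inj_on_def leaves_def)
  also have "\<dots> = (\<Prod>k\<in>UNIV. fact (count q k))"
    by (rule prod.mono_neutral_left) (auto simp: not_in_iff)
  finally have "(\<Prod>\<tau>\<in>set_mset (leaves q). fact (count (leaves q) \<tau>)) = (\<Prod>k\<in>UNIV. fact (count q k) :: nat)" .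
  moreover have "\<Prod>\<^sub># (image_mset sym_factor (leaves q)) = 1"
    by (induction q) auto
  ultimately show ?thesis by (simp add: mfact_def)
qed

lemma coproduct_leaves:
  assumes "(x, y) \<in># coproduct (leaves q)"
  shows "\<exists>m. y = leaves m"
proof -
  have l1: "coproduct (leaves (add_mset i q)) = tensor_times (coproduct {#Node i {#}#}) (coproduct (leaves q))" for i q
    using coproduct_plus[of "{#Node i {#}#}" "leaves q"] by simp
  show ?thesis using assms
  proof (induction q arbitrary: x y)
    case empty
    then show ?case by (auto simp: coproduct_empty intro: exI[of _ "{#}"])
  next
    case (add i q)
    then obtain c d where "(c, d) \<in># coproduct (leaves q)" "y = d \<or> y = {#Node i {#}#} + d"
      unfolding l1 by (auto simp: coproduct_Node coproduct_empty)
    with add.IH obtain m where "y = leaves m \<or> y = {#Node i {#}#} + leaves m" by blast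
    then have "y = leaves m \<or> y = leaves (add_mset i m)" by simp
    then show ?case by blast
  qed
qed

lemma character_leaves:
  assumes "a \<in> characters n" "size r \<le> n"
  shows "a (leaves r) = mpow (\<chi> i. a {#Node i {#}#}) r"
  using assms(2)
proof (induction r)
  case empty
  then show ?case using assms(1) by simp
next
  case (add i r)
  have "a ({#Node i {#}#} + leaves r) = a {#Node i {#}#} * a (leaves r)"
    using add.prems by (intro characters_plus[OF assms(1)]) simp
  then show ?case using add by simp
qed

text \<open>The number of cuts that leave \<open>leaves m\<close> is a binomial coefficient of
  multi-indices. The induction adds one leaf, which is either pruned or kept, and so amounts to
  Pascal's rule.\<close>

lemma cop_sum_leaves:
  assumes a: "a \<in> characters n" and "size q \<le> n"
  shows "cop_sum (leaves q) (\<lambda>x y. a x * of_bool (y = leaves m)) =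
    of_bool (m \<subseteq># q) * (mfact q / (mfact m * mfact (q - m))) * a (leaves (q - m))"
  using assms(2)
proof (induction q arbitrary: m)
  case empty
  have "({#} = leaves m) = (m = {#})" by (cases m) auto
  then show ?case by simp
next
  case (add i q)
  let ?T = "\<lambda>q m. cop_sum (leaves q) (\<lambda>x y. a x * of_bool (y = leaves m))"
  have IH: "?T q m = of_bool (m \<subseteq># q) * (mfact q / (mfact m * mfact (q - m))) * a (leaves (q - m))" for m
    using add by simp
  have plus: "a {#Node i {#}#} * a (leaves r) = a (leaves (add_mset i r))" if "r \<subseteq># q" for r
  proof -
    have "size r \<le> size q" using that by (rule size_mset_mono)
    then show ?thesis using characters_plus[OF a, of "{#Node i {#}#}" "leaves r"] add.prems by simp
  qed
  have cancel1: "c \<noteq> 0 \<Longrightarrow> c * A / (B * (c * C)) = A / (B * C)"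
    and cancel2: "c \<noteq> 0 \<Longrightarrow> c * A / (c * B * C) = A / (B * C)" for c A B C :: real
    by simp_all
  have yi: "(add_mset (Node i {#}) y = leaves m) = (i \<in># m \<and> y = leaves (m - {#i#}))" for y
  proof (cases "i \<in># m")
    case True
    then obtain m' where "m = add_mset i m'" by (metis mset_add)
    then show ?thesis by simp
  next
    case False
    then have "Node i {#} \<notin># leaves m" by (auto simp: leaves_def)
    then show ?thesis using False by (metis union_single_eq_member)
  qed
  have "?T (add_mset i q) m = cop_sum (leaves q) (\<lambda>x y. a ({#Node i {#}#} + x) * of_bool (y = leaves m)
      + a x * of_bool (add_mset (Node i {#}) y = leaves m))"
    using cop_sum_plus[of "{#Node i {#}#}" "leaves q" "\<lambda>x y. a x * of_bool (y = leaves m)"]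
    by (simp add: cop_sum_Node cop_sum_add)
  also have "\<dots> = cop_sum (leaves q) (\<lambda>x y. a {#Node i {#}#} * (a x * of_bool (y = leaves m))
      + of_bool (i \<in># m) * (a x * of_bool (y = leaves (m - {#i#}))))"
  proof (rule cop_sum_cong)
    fix x y assume "(x, y) \<in># coproduct (leaves q)"
    from coproduct_fst_deg[OF this] have "a ({#Node i {#}#} + x) = a {#Node i {#}#} * a x"
      using add.prems by (intro characters_plus[OF a]) simp
    then show "a ({#Node i {#}#} + x) * of_bool (y = leaves m) + a x * of_bool (add_mset (Node i {#}) y = leaves m) =
      a {#Node i {#}#} * (a x * of_bool (y = leaves m)) + of_bool (i \<in># m) * (a x * of_bool (y = leaves (m - {#i#})))"
      by (simp add: yi)
  qed
  also have "\<dots> = a {#Node i {#}#} * ?T q m + of_bool (i \<in># m) * ?T q (m - {#i#})"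
    by (simp only: cop_sum_add cop_sum_mult_left)
  finally have rec: "?T (add_mset i q) m = a {#Node i {#}#} * ?T q m + of_bool (i \<in># m) * ?T q (m - {#i#})" .
  show ?case
  proof (cases "i \<in># m")
    case False
    have sub: "m \<subseteq># add_mset i q \<longleftrightarrow> m \<subseteq># q"
      using False by (metis diff_single_trivial subset_eq_diff_conv add_mset_add_single union_commute)
    show ?thesis
    proof (cases "m \<subseteq># q")
      case True
      then obtain r where r: "q = m + r" by (metis subset_mset.add_diff_inverse)
      have "count q i = count r i" using False r by (simp add: not_in_iff)
      moreover have "add_mset i q - m = add_mset i r" using r by simp
      ultimately show ?thesis unfolding rec IH using False True sub plus[of r] r
          cancel1[of "real (count r i) + 1" "mfact q" "mfact m" "mfact r"]
        by (simp add: add_nonneg_eq_0_iff mult.commute[of "a {#Node i {#}#}"] mult.assoc)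
    next
      case f: False
      then show ?thesis unfolding rec IH using False sub by simp
    qed
  next
    case True
    then obtain m' where m: "m = add_mset i m'" by (metis mset_add)
    show ?thesis
    proof (cases "m' \<subseteq># q")
      case s: True
      then obtain r where r: "q = m' + r" by (metis subset_mset.add_diff_inverse)
      show ?thesis
      proof (cases "i \<in># r")
        case True
        then obtain r' where r': "r = add_mset i r'" by (metis mset_add)
        have q: "q = m + r'" using r r' m by simp
        have 1: "m \<subseteq># q" "q - m = r'" using q by auto
        have 2: "m \<subseteq># add_mset i q" "add_mset i q - m = r" using r m by auto
        have 3: "m - {#i#} = m'" "q - m' = r" using m r by auto
        have A: "a {#Node i {#}#} * a (leaves r') = a (leaves r)" using plus[of r'] q r' by simp
        have c: "real (count q i) = real (count m' i) + 1 + real (count r' i)" using q m by simp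
        have "a {#Node i {#}#} * (mfact q / (mfact m * mfact r') * a (leaves r')) + mfact q / (mfact m' * mfact r) * a (leaves r)
            = a (leaves r) * (mfact q / (mfact m * mfact r') + mfact q / (mfact m' * mfact r))"
          using A by (simp add: algebra_simps)
        also have "mfact q / (mfact m * mfact r') + mfact q / (mfact m' * mfact r) = mfact (add_mset i q) / (mfact m * mfact r)"
        proof -
          have ne: "real (count m' i) + 1 \<noteq> 0" "real (count r' i) + 1 \<noteq> 0" by linarith+
          show ?thesis unfolding m r' mfact_add c using ne mfact_pos(2)[of m'] mfact_pos(2)[of r']
            by (simp add: divide_simps) (simp add: algebra_simps)
        qed
        finally show ?thesis unfolding rec IH using 1 2 3 True m s by (simp add: algebra_simps)
      next
        case False
        \<comment> \<open>No copy of \<open>i\<close> is left over for pruning, so only the term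
          that keeps the new leaf contributes.\<close>
        have "count q i < count m i" using False m r by (simp add: not_in_iff)
        then have "\<not> m \<subseteq># q" by (metis mset_subset_eq_count not_less)
        moreover have 2: "m \<subseteq># add_mset i q" "add_mset i q - m = r" using r m by auto
        moreover have 3: "m - {#i#} = m'" "q - m' = r" using m r by auto
        moreover have "count q i = count m' i" using False r by (simp add: not_in_iff)
        ultimately show ?thesis unfolding rec IH using True m s
            cancel2[of "real (count m' i) + 1" "mfact q" "mfact m'" "mfact r"]
          by (simp add: add_nonneg_eq_0_iff)
      qed
    next
      case f: False
      then have "\<not> m \<subseteq># q" "\<not> m \<subseteq># add_mset i q" using m
        by (auto dest: mset_subset_eq_insertD subset_mset.less_imp_le)
      then show ?thesis unfolding rec IH using f m by simp
    qed
  qed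
qed

text \<open>Taylor coefficients placed on trees: the label of the root selects the function, the
  leaves the multi-index. The orders stop at \<open>n - 1\<close> because the root counts towards
  the degree.\<close>

definition bc :: "nat \<Rightarrow> ('d::finite \<Rightarrow> real ^ 'd \<Rightarrow> real) \<Rightarrow> real ^ 'd \<Rightarrow> 'd forest \<Rightarrow> real" where
  "bc n G x \<rho> = (\<Sum>i\<in>UNIV. \<Sum>q\<in>ms (n - 1). of_bool (\<rho> = {#Node i (leaves q)#}) * (Dm (G i) q x / mfact q))"

lemma bc_leaves:
  assumes "size q \<le> n - 1"
  shows "bc n G x {#Node i (leaves q)#} = Dm (G i) q x / mfact q"
proof -
  have "bc n G x {#Node i (leaves q)#} =
     (\<Sum>k\<in>UNIV. of_bool (i = k) * (\<Sum>r\<in>ms (n - 1). of_bool (q = r) * (Dm (G k) r x / mfact r)))"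
    unfolding bc_def sum_distrib_left by (intro sum.cong refl) auto
  then show ?thesis unfolding sum_of_bool_eq(1)[OF finite_ms] sum_of_bool_eq(1)[OF finite] using assms by simp
qed

lemma bc_zero: "(\<And>i q. \<rho> \<noteq> {#Node i (leaves q)#}) \<Longrightarrow> bc n G x \<rho> = 0"
  unfolding bc_def by (intro sum.neutral ballI) auto

lemma bc_not_single: "\<not> single \<rho> \<Longrightarrow> bc n G x \<rho> = 0"
  by (rule bc_zero) auto

lemma Gam_bc:
  assumes n: "1 \<le> n"
  shows "Gam n a (bc n G x) \<tau> = (\<Sum>i\<in>UNIV. \<Sum>q\<in>ms (n - 1). Dm (G i) q x / mfact q *
    cop_sum {#Node i (leaves q)#} (\<lambda>x y. a x * of_bool (y = \<tau>)))"
proof -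
  let ?c = "\<lambda>\<rho>. cop_sum \<rho> (\<lambda>x y. a x * of_bool (y = \<tau>))"
  have "Gam n a (bc n G x) \<tau> = (\<Sum>\<rho>\<in>fs n. \<Sum>i\<in>UNIV. \<Sum>q\<in>ms (n - 1).
      of_bool (\<rho> = {#Node i (leaves q)#}) * (Dm (G i) q x / mfact q * ?c \<rho>))"
    by (simp add: Gam_def bc_def sum_distrib_right mult.assoc)
  also have "\<dots> = (\<Sum>i\<in>UNIV. \<Sum>\<rho>\<in>fs n. \<Sum>q\<in>ms (n - 1).
      of_bool (\<rho> = {#Node i (leaves q)#}) * (Dm (G i) q x / mfact q * ?c \<rho>))"
    by (rule sum.swap)
  also have "\<dots> = (\<Sum>i\<in>UNIV. \<Sum>q\<in>ms (n - 1). \<Sum>\<rho>\<in>fs n.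
      of_bool (\<rho> = {#Node i (leaves q)#}) * (Dm (G i) q x / mfact q * ?c \<rho>))"
    by (intro sum.cong refl sum.swap)
  also have "\<dots> = (\<Sum>i\<in>UNIV. \<Sum>q\<in>ms (n - 1). Dm (G i) q x / mfact q * ?c {#Node i (leaves q)#})"
    by (intro sum.cong refl) (subst sum_of_bool_eq(2), use n in auto)
  finally show ?thesis .
qed

lemma cop_sum_Node_leaves_zero:
  assumes "\<tau> \<noteq> {#}" "\<And>i q. \<tau> \<noteq> {#Node i (leaves q)#}"
  shows "cop_sum {#Node i (leaves q)#} (\<lambda>x y. a x * of_bool (y = \<tau>)) = 0"
proof -
  have "cop_sum (leaves q) (\<lambda>x y. a x * of_bool ({#Node i y#} = \<tau>)) = cop_sum (leaves q) (\<lambda>x y. 0)"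
  proof (rule cop_sum_cong)
    fix x y assume "(x, y) \<in># coproduct (leaves q)"
    then obtain m where "y = leaves m" using coproduct_leaves by blast
    then show "a x * of_bool ({#Node i y#} = \<tau>) = 0" using assms(2)[of i m] by auto
  qed
  then show ?thesis using assms(1) by (simp add: cop_sum_Node)
qed

lemma sum_ms_superset:
  fixes F :: "'i::finite multiset \<Rightarrow> real"
  assumes "size m \<le> k"
  shows "(\<Sum>q\<in>ms k. of_bool (m \<subseteq># q) * F q) = (\<Sum>r\<in>ms (k - size m). F (m + r))"
proof -
  have "(\<Sum>q\<in>ms k. of_bool (m \<subseteq># q) * F q) = (\<Sum>q\<in>(+) m ` ms (k - size m). of_bool (m \<subseteq># q) * F q)"
  proof (rule sum.mono_neutral_right)
    show "\<forall>q\<in>ms k - (+) m ` ms (k - size m). of_bool (m \<subseteq># q) * F q = 0"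
    proof
      fix q assume q: "q \<in> ms k - (+) m ` ms (k - size m)"
      have "\<not> m \<subseteq># q"
      proof
        assume "m \<subseteq># q"
        then obtain r where r: "q = m + r" by (metis subset_mset.add_diff_inverse)
        moreover have "size q \<le> k" using q by simp
        ultimately have "r \<in> ms (k - size m)" by simp
        then show False using q r by blast
      qed
      then show "of_bool (m \<subseteq># q) * F q = 0" by simp
    qed
  qed (use assms in auto)
  also have "\<dots> = (\<Sum>r\<in>ms (k - size m). F (m + r))"
    by (rule sum.reindex_cong[of "(+) m"]) (auto intro: inj_onI)
  finally show ?thesis .
qed

text \<open>The binomial coefficients, and the values of \<open>a\<close> on leaves as monomials of
  its degree-one part, assemble the Taylor polynomial of \<open>Dm (G i) m\<close>. That the
  one-form is controlled is therefore Taylor's formula.\<close>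

lemma Gam_bc_leaves:
  assumes n: "1 \<le> n" and a: "a \<in> characters n" and m: "size m \<le> n - 1"
  shows "Gam n a (bc n G x) {#Node i (leaves m)#} =
    (\<Sum>r\<in>ms (n - 1 - size m). Dm (G i) (m + r) x * mpow (\<chi> i. a {#Node i {#}#}) r / mfact r) / mfact m"
proof -
  have "cop_sum {#Node k (leaves q)#} (\<lambda>x y. a x * of_bool (y = {#Node i (leaves m)#})) =
      of_bool (i = k) * (of_bool (m \<subseteq># q) * (mfact q / (mfact m * mfact (q - m))) * a (leaves (q - m)))"
    if "size q \<le> n - 1" for k q
  proof (cases "i = k")
    case True
    have "cop_sum (leaves q) (\<lambda>x y. a x * of_bool ({#Node k y#} = {#Node i (leaves m)#})) =
        cop_sum (leaves q) (\<lambda>x y. a x * of_bool (y = leaves m))"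
      using True by simp
    also have "\<dots> = of_bool (m \<subseteq># q) * (mfact q / (mfact m * mfact (q - m))) * a (leaves (q - m))"
      using that by (intro cop_sum_leaves[OF a]) simp
    finally show ?thesis using True by (simp add: cop_sum_Node)
  qed (simp add: cop_sum_Node)
  then have "Gam n a (bc n G x) {#Node i (leaves m)#} = (\<Sum>k\<in>UNIV. of_bool (i = k) * (\<Sum>q\<in>ms (n - 1). of_bool (m \<subseteq># q) *
      (Dm (G k) q x / mfact q * (mfact q / (mfact m * mfact (q - m)) * a (leaves (q - m))))))"
    unfolding Gam_bc[OF n] sum_distrib_left by (intro sum.cong refl) (simp add: mult_ac)
  also have "\<dots> = (\<Sum>q\<in>ms (n - 1). of_bool (m \<subseteq># q) *
      (Dm (G i) q x / mfact q * (mfact q / (mfact m * mfact (q - m)) * a (leaves (q - m)))))"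
    by (subst sum_of_bool_eq) auto
  also have "\<dots> = (\<Sum>r\<in>ms (n - 1 - size m). Dm (G i) (m + r) x * mpow (\<chi> i. a {#Node i {#}#}) r / mfact r / mfact m)"
    unfolding sum_ms_superset[OF m]
    by (intro sum.cong refl) (simp add: character_leaves[OF a] mult_ac)
  finally show ?thesis by (simp add: sum_divide_distrib)
qed

text \<open>On trees that are not a root with leaves both the form and its transport vanish;
  elsewhere the difference is a Taylor remainder. The constant combines the dimension factors of
  \<open>remainder_bound\<close> with the bound \<open>real CARD('d) * H * w t u\<close> for the
  displacement.\<close>

lemma (in rough_data) bc_controlled:
  fixes G :: "'d \<Rightarrow> real ^ 'd \<Rightarrow> real" and x :: "real \<Rightarrow> real ^ 'd"
  assumes n: "1 \<le> n" and L: "0 \<le> L"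
    and sm: "\<And>i. smooth_function (G i) (n - 1)"
    and bd: "\<And>i q x. size q \<le> n - 1 \<Longrightarrow> \<bar>Dm (G i) q x\<bar> \<le> L"
    and hoelder: "\<And>i q x y. size q = n - 1 \<Longrightarrow> \<bar>Dm (G i) q x - Dm (G i) q y\<bar> \<le> L * norm (x - y) powr (N - real n)"
    and x: "\<And>t u i. a \<le> t \<Longrightarrow> t \<le> u \<Longrightarrow> u \<le> b \<Longrightarrow> x u $ i - x t $ i = Z t u {#Node i {#}#}"
  shows "controlled single (real CARD('d) ^ n * (real CARD('d) * H) powr N * L) a (\<lambda>t. bc n G (x t))"
proof -
  let ?d = "real CARD('d)"
  have d1: "1 \<le> ?d" by (simp add: Suc_le_eq)
  have dH: "1 \<le> ?d * H" using mult_mono[OF d1 H] by simp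
  have A1: "1 \<le> ?d ^ n * (?d * H) powr N"
    using mult_mono[OF one_le_power[OF d1, of n] ge_one_powr_ge_zero[OF dH, of N]] N by simp
  have bd': "\<bar>bc n G y \<rho>\<bar> \<le> ?d ^ n * (?d * H) powr N * L" if "deg \<rho> \<le> n" for y \<rho>
  proof (cases "\<exists>i q. \<rho> = {#Node i (leaves q)#}")
    case True
    then obtain i q where q: "\<rho> = {#Node i (leaves q)#}" by blast
    then have "size q \<le> n - 1" using that by simp
    then have "\<bar>bc n G y \<rho>\<bar> \<le> L / 1"
      unfolding q bc_leaves[OF \<open>size q \<le> n - 1\<close>] abs_divide
      using bd mfact_ge1[of q] L by (intro frac_le) auto
    also have "\<dots> \<le> ?d ^ n * (?d * H) powr N * L" using mult_right_mono[OF A1 L] by simp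
    finally show ?thesis .
  next
    case False
    then show ?thesis using A1 L by (subst bc_zero) auto
  qed
  have df: "\<bar>bc n G (x u) \<tau> - Gam n (Z t u) (bc n G (x t)) \<tau>\<bar>
      \<le> ?d ^ n * (?d * H) powr N * L * w t u powr (N - real (deg \<tau>))"
    if t: "a \<le> t" "t \<le> u" "u \<le> b" and \<tau>: "deg \<tau> \<le> n" "single \<tau>" for t u \<tau>
  proof (cases "\<exists>i m. \<tau> = {#Node i (leaves m)#}")
    case False
    have "bc n G (x u) \<tau> = 0" using False by (intro bc_zero) auto
    moreover have "Gam n (Z t u) (bc n G (x t)) \<tau> = 0"
      unfolding Gam_bc[OF n] using False \<tau>(2)
      by (intro sum.neutral ballI) (auto intro!: cop_sum_Node_leaves_zero)
    ultimately show ?thesis using A1 L by simp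
  next
    case True
    then obtain i m where m: "\<tau> = {#Node i (leaves m)#}" by blast
    have sz: "size m \<le> n - 1" using \<tau>(1) m by simp
    interpret smooth_function "G i" "n - 1" by (rule sm)
    have ch: "Z t u \<in> characters n" using t by (rule Zc)
    define h where "h = (\<chi> i. Z t u {#Node i {#}#})"
    have xu: "x u = x t + h" using x[OF t] by (simp add: vec_eq_iff h_def algebra_simps)
    define k where "k = n - 1 - size m"
    have "bc n G (x u) \<tau> - Gam n (Z t u) (bc n G (x t)) \<tau> = remainder m (x t) h / mfact m"
      unfolding m bc_leaves[OF sz] Gam_bc_leaves[OF n ch sz] remainder_def xu h_def
      by (simp add: diff_divide_distrib)
    then have "\<bar>bc n G (x u) \<tau> - Gam n (Z t u) (bc n G (x t)) \<tau>\<bar> \<le> \<bar>remainder m (x t) h\<bar>"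
      using mfact_ge1[of m] mult_left_mono[OF mfact_ge1[of m] abs_ge_zero[of "remainder m (x t) h"]]
      by (simp add: abs_divide divide_le_eq)
    also have "\<dots> \<le> ?d ^ k * L * norm h powr (real k + (N - real n))"
      using N sz L hoelder by (intro remainder_bound) (auto simp: k_def)
    also have "\<dots> \<le> ?d ^ n * L * ((?d * H) powr N * w t u powr (N - real (deg \<tau>)))"
    proof (intro mult_mono)
      show "?d ^ k \<le> ?d ^ n" using d1 by (intro power_increasing) (auto simp: k_def)
      have "norm h \<le> (\<Sum>i\<in>UNIV. \<bar>h $ i\<bar>)" by (rule norm_le_l1_cart)
      also have "\<dots> \<le> (\<Sum>i\<in>(UNIV::'d set). H * w t u)"
        using Zw[OF t, of "{#Node i {#}#}" for i] n by (intro sum_mono) (auto simp: h_def)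
      finally have nh: "norm h \<le> ?d * H * w t u" by simp
      \<comment> \<open>Here \<open>deg \<tau> = size m + 1\<close>, with the root counted.\<close>
      have e: "real k + (N - real n) = N - real (deg \<tau>)" using sz n by (simp add: m k_def)
      have e0: "0 \<le> N - real (deg \<tau>)" using \<tau>(1) N by simp
      have "norm h powr (real k + (N - real n)) \<le> (?d * H * w t u) powr (N - real (deg \<tau>))"
        unfolding e using nh e0 by (intro powr_mono2) auto
      also have "\<dots> = (?d * H) powr (N - real (deg \<tau>)) * w t u powr (N - real (deg \<tau>))"
        by (rule powr_mult)
      also have "\<dots> \<le> (?d * H) powr N * w t u powr (N - real (deg \<tau>))"
        using dH by (intro mult_right_mono powr_mono) auto
      finally show "norm h powr (real k + (N - real n)) \<le> (?d * H) powr N * w t u powr (N - real (deg \<tau>))" .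
    qed (use L in auto)
    finally show ?thesis by (simp add: mult_ac)
  qed
  show ?thesis unfolding controlled_def using bd' df by blast
qed

section \<open>Lipschitz bounds\<close>

context
  fixes f :: "real ^ 'd::finite \<Rightarrow> (real ^ 'd) \<Rightarrow>\<^sub>L (real ^ 'e::finite)" and \<gamma> :: real
  assumes f: "Lip \<gamma> f"
begin

lemma Lip_norm_ennreal: "ennreal (enn2real (Lip_norm \<gamma> f)) = Lip_norm \<gamma> f"
  using f by (simp add: Lip_def less_top)

lemma Lip_bound:
  assumes "length vs \<le> strict_floor \<gamma>" "\<And>v. v \<in> set vs \<Longrightarrow> norm v \<le> 1"
  shows "norm (iter_deriv f vs x) \<le> enn2real (Lip_norm \<gamma> f)"
proof -
  let ?F = "\<lambda>k. SUP x. multilinear_norm k (\<lambda>vs. iter_deriv f vs x)"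
  have "ennreal (norm (iter_deriv f vs x)) \<le> multilinear_norm (length vs) (\<lambda>vs. iter_deriv f vs x)"
    unfolding multilinear_norm_def using assms(2) by (intro SUP_upper) auto
  also have "\<dots> \<le> ?F (length vs)" by (intro SUP_upper) auto
  also have "\<dots> \<le> Max (?F ` {0..strict_floor \<gamma>})" using assms(1) by (intro Max_ge) auto
  also have "\<dots> \<le> Lip_norm \<gamma> f" unfolding Lip_norm_def
    by (rule add_increasing2) (simp, rule order_refl)
  finally show ?thesis
    using Lip_norm_ennreal by (metis ennreal_le_iff enn2real_nonneg)
qed

lemma Lip_hoelder:
  assumes "length vs = strict_floor \<gamma>" "\<And>v. v \<in> set vs \<Longrightarrow> norm v \<le> 1"
  shows "norm (iter_deriv f vs x - iter_deriv f vs y) \<le>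
    enn2real (Lip_norm \<gamma> f) * norm (x - y) powr (\<gamma> - real (strict_floor \<gamma>))"
proof (cases "x = y")
  case False
  let ?r = "norm (x - y) powr (\<gamma> - real (strict_floor \<gamma>))"
  have r: "0 < ?r" using False by simp
  have "ennreal (norm (iter_deriv f vs x - iter_deriv f vs y) / ?r) =
      ennreal (norm (iter_deriv f vs x - iter_deriv f vs y)) / ennreal ?r"
    using r by (intro divide_ennreal[symmetric]) auto
  also have "\<dots> \<le> multilinear_norm (strict_floor \<gamma>) (\<lambda>vs. iter_deriv f vs x - iter_deriv f vs y) / ennreal ?r"
    unfolding multilinear_norm_def using assms by (intro divide_right_mono_ennreal SUP_upper) auto
  also have "\<dots> \<le> (SUP (x, y)\<in>{(x, y). x \<noteq> y}.
       multilinear_norm (strict_floor \<gamma>) (\<lambda>vs. iter_deriv f vs x - iter_deriv f vs y) /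
       ennreal (norm (x - y) powr (\<gamma> - real (strict_floor \<gamma>))))"
    using False by (intro SUP_upper2[of "(x, y)"]) auto
  also have "\<dots> \<le> Lip_norm \<gamma> f" unfolding Lip_norm_def
    by (rule add_increasing) (simp, rule order_refl)
  finally have "norm (iter_deriv f vs x - iter_deriv f vs y) / ?r \<le> enn2real (Lip_norm \<gamma> f)"
    using Lip_norm_ennreal by (metis ennreal_le_iff enn2real_nonneg)
  then show ?thesis using r by (simp add: divide_le_eq)
qed simp

text \<open>Below the top order the next derivative is bounded by the same norm, and the mean value
  inequality applies.\<close>

lemma Lip_lipschitz:
  assumes "length vs < strict_floor \<gamma>" "\<And>v. v \<in> set vs \<Longrightarrow> norm v \<le> 1"
  shows "norm (iter_deriv f vs x - iter_deriv f vs y) \<le> enn2real (Lip_norm \<gamma> f) * norm (x - y)"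
proof (rule differentiable_bound[of UNIV "iter_deriv f vs"])
  fix z
  have D: "(iter_deriv f vs has_derivative frechet_derivative (iter_deriv f vs) (at z)) (at z)"
    using f assms(1) unfolding Lip_def times_differentiable_def frechet_derivative_works by blast
  then show "(iter_deriv f vs has_derivative frechet_derivative (iter_deriv f vs) (at z)) (at z within UNIV)" by simp
  show "onorm (frechet_derivative (iter_deriv f vs) (at z)) \<le> enn2real (Lip_norm \<gamma> f)"
  proof (rule onorm_le)
    fix v
    show "norm (frechet_derivative (iter_deriv f vs) (at z) v) \<le> enn2real (Lip_norm \<gamma> f) * norm v"
    proof (cases "v = 0")
      case True
      then show ?thesis using linear_0[OF has_derivative_linear[OF D]] by simp
    next
      case False
      define u where "u = v /\<^sub>R norm v"
      have v: "v = norm v *\<^sub>R u" "norm u \<le> 1" using False by (simp_all add: u_def)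
      have "norm (iter_deriv f (u # vs) z) \<le> enn2real (Lip_norm \<gamma> f)"
        using assms v by (intro Lip_bound) auto
      moreover have "frechet_derivative (iter_deriv f vs) (at z) v = norm v *\<^sub>R iter_deriv f (u # vs) z"
        by (subst v(1)) (simp add: linear_cmul[OF has_derivative_linear[OF D]])
      ultimately show ?thesis by (simp add: mult.commute mult_left_mono)
    qed
  qed
qed auto

definition comp_fun :: "'e \<Rightarrow> 'd \<Rightarrow> real ^ 'd \<Rightarrow> real" where
  "comp_fun j i z = blinfun_apply (f z) (axis i 1) $ j"

lemma comp_fun_deriv:
  assumes "length vs \<le> strict_floor \<gamma>"
  shows "iter_deriv (comp_fun j i) vs x = blinfun_apply (iter_deriv f vs x) (axis i 1) $ j"
    and "iter_deriv (\<lambda>z. blinfun_apply (f z) (axis i 1)) vs x $ j = blinfun_apply (iter_deriv f vs x) (axis i 1) $ j"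
proof -
  have f': "times_differentiable (strict_floor \<gamma>) f" using f by (simp add: Lip_def)
  have B1: "bounded_linear (\<lambda>A::(real ^ 'd) \<Rightarrow>\<^sub>L (real ^ 'e). blinfun_apply A (axis i 1))"
    by (rule blinfun.bounded_linear_left)
  have B2: "bounded_linear (\<lambda>A::(real ^ 'd) \<Rightarrow>\<^sub>L (real ^ 'e). blinfun_apply A (axis i 1) $ j)"
    by (rule bounded_linear_compose[OF bounded_linear_vec_nth B1])
  show "iter_deriv (comp_fun j i) vs x = blinfun_apply (iter_deriv f vs x) (axis i 1) $ j"
    using iter_deriv_bounded_linear[OF B2 f' assms] by (simp add: comp_fun_def[abs_def])
  show "iter_deriv (\<lambda>z. blinfun_apply (f z) (axis i 1)) vs x $ j = blinfun_apply (iter_deriv f vs x) (axis i 1) $ j"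
    using iter_deriv_bounded_linear[OF B1 f' assms] by simp
qed

lemma blinfun_component_le: "\<bar>blinfun_apply A (axis i 1) $ j\<bar> \<le> norm (A :: (real ^ 'd) \<Rightarrow>\<^sub>L (real ^ 'e))"
proof -
  have "\<bar>blinfun_apply A (axis i 1) $ j\<bar> \<le> norm (blinfun_apply A (axis i 1))" by (rule component_le_norm_cart)
  also have "\<dots> \<le> norm A * norm (axis i (1::real))" by (rule norm_blinfun)
  finally show ?thesis by (simp add: norm_axis_1)
qed

lemma comp_fun_bound:
  "length vs \<le> strict_floor \<gamma> \<Longrightarrow> (\<And>v. v \<in> set vs \<Longrightarrow> norm v \<le> 1) \<Longrightarrow>
    \<bar>iter_deriv (comp_fun j i) vs x\<bar> \<le> enn2real (Lip_norm \<gamma> f)"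
  using Lip_bound[of vs x] blinfun_component_le[of "iter_deriv f vs x" i j] by (simp add: comp_fun_deriv)

lemma comp_fun_diff:
  assumes "length vs \<le> strict_floor \<gamma>"
  shows "\<bar>iter_deriv (comp_fun j i) vs x - iter_deriv (comp_fun j i) vs y\<bar> \<le> norm (iter_deriv f vs x - iter_deriv f vs y)"
  using blinfun_component_le[of "iter_deriv f vs x - iter_deriv f vs y" i j] assms
  by (simp add: comp_fun_deriv blinfun.diff_left)

text \<open>The expansion stops at order \<open>n - 1\<close> even when more derivatives exist; then
  the derivative of that order is Lipschitz, and the exponent is capped at 1. Here \<gamma> is the
  Lipschitz index of \<open>f\<close>.\<close>

lemma comp_fun_hoelder:
  assumes n: "1 \<le> n" "real n < \<gamma> + 1" and "length vs = n - 1" "\<And>v. v \<in> set vs \<Longrightarrow> norm v \<le> 1"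
  shows "\<bar>iter_deriv (comp_fun j i) vs x - iter_deriv (comp_fun j i) vs y\<bar> \<le>
    enn2real (Lip_norm \<gamma> f) * norm (x - y) powr (min 1 (\<gamma> + 1 - real n))"
proof (cases "strict_floor \<gamma> = n - 1")
  case True
  have "\<gamma> \<le> real n" using True n(1) unfolding strict_floor_def by linarith
  then have "min 1 (\<gamma> + 1 - real n) = \<gamma> - real (strict_floor \<gamma>)" using True n by (simp add: of_nat_diff)
  then show ?thesis using comp_fun_diff[of vs j i x y] Lip_hoelder[of vs x y] assms True by simp
next
  case False
  have "n - 1 \<le> strict_floor \<gamma>" using n unfolding strict_floor_def by linarith
  then have lt: "n - 1 < strict_floor \<gamma>" using False by simp
  then have "real n < \<gamma>" using n(1) unfolding strict_floor_def by linarith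
  then have "min 1 (\<gamma> + 1 - real n) = 1" by simp
  then show ?thesis using comp_fun_diff[of vs j i x y] Lip_lipschitz[of vs x y] assms lt by simp
qed

end

section \<open>The rough integral as a lift\<close>

lemma conv_split:
  "conv n opr V \<phi> \<psi> \<sigma> =
    (\<Sum>\<rho>\<^sub>2\<in>fs n. of_bool (V \<rho>\<^sub>2 \<and> opr {#} \<rho>\<^sub>2 = \<sigma>) * (\<phi> {#} * \<psi> \<rho>\<^sub>2)) +
    (\<Sum>\<rho>\<^sub>1\<in>forests n. \<Sum>\<rho>\<^sub>2\<in>fs n. of_bool (V \<rho>\<^sub>2 \<and> deg \<rho>\<^sub>1 + deg \<rho>\<^sub>2 \<le> n \<and> opr \<rho>\<^sub>1 \<rho>\<^sub>2 = \<sigma>) * (\<phi> \<rho>\<^sub>1 * \<psi> \<rho>\<^sub>2))"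
  unfolding conv_def
  by (subst sum_fs) (intro arg_cong2[where f = "(+)"] sum.cong refl, simp)

lemma form_times_sum:
  "form_times n \<phi> \<psi> \<sigma> = (\<Sum>\<rho>\<^sub>1\<in>forests n. \<Sum>\<rho>\<^sub>2\<in>forests n.
     of_bool (deg \<rho>\<^sub>1 + deg \<rho>\<^sub>2 \<le> n \<and> \<rho>\<^sub>1 + \<rho>\<^sub>2 = \<sigma>) * (\<phi> \<rho>\<^sub>1 * \<psi> \<rho>\<^sub>2))"
  unfolding form_times_def sum.cartesian_product
  by (rule sum.mono_neutral_cong_left) (auto simp: finite_forests)

text \<open>Splitting off the empty forest in either argument produces the two terms with values in
  the product rule for one-forms.\<close>

lemma conv_plus_form_times:
  assumes "deg \<sigma> \<le> n" "\<sigma> \<noteq> {#}"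
  shows "conv n (+) (\<lambda>_. True) \<phi> \<psi> \<sigma> = \<phi> {#} * \<psi> \<sigma> + \<psi> {#} * \<phi> \<sigma> + form_times n \<phi> \<psi> \<sigma>"
proof -
  have 1: "(\<Sum>\<rho>\<^sub>2\<in>fs n. of_bool (True \<and> {#} + \<rho>\<^sub>2 = \<sigma>) * (\<phi> {#} * \<psi> \<rho>\<^sub>2)) = \<phi> {#} * \<psi> \<sigma>"
    using assms by (simp add: sum_of_bool_eq(2))
  have "(\<Sum>\<rho>\<^sub>2\<in>fs n. of_bool (True \<and> deg \<rho>\<^sub>1 + deg \<rho>\<^sub>2 \<le> n \<and> \<rho>\<^sub>1 + \<rho>\<^sub>2 = \<sigma>) * (\<phi> \<rho>\<^sub>1 * \<psi> \<rho>\<^sub>2)) =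
      of_bool (\<rho>\<^sub>1 = \<sigma>) * (\<phi> \<rho>\<^sub>1 * \<psi> {#}) +
      (\<Sum>\<rho>\<^sub>2\<in>forests n. of_bool (deg \<rho>\<^sub>1 + deg \<rho>\<^sub>2 \<le> n \<and> \<rho>\<^sub>1 + \<rho>\<^sub>2 = \<sigma>) * (\<phi> \<rho>\<^sub>1 * \<psi> \<rho>\<^sub>2))"
    if "\<rho>\<^sub>1 \<in> forests n" for \<rho>\<^sub>1
    using that by (subst sum_fs) (auto simp: forests_def)
  then have 2: "(\<Sum>\<rho>\<^sub>1\<in>forests n. \<Sum>\<rho>\<^sub>2\<in>fs n. of_bool (True \<and> deg \<rho>\<^sub>1 + deg \<rho>\<^sub>2 \<le> n \<and> \<rho>\<^sub>1 + \<rho>\<^sub>2 = \<sigma>) * (\<phi> \<rho>\<^sub>1 * \<psi> \<rho>\<^sub>2))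
      = (\<Sum>\<rho>\<^sub>1\<in>forests n. of_bool (\<rho>\<^sub>1 = \<sigma>) * (\<phi> \<rho>\<^sub>1 * \<psi> {#})) + form_times n \<phi> \<psi> \<sigma>"
    unfolding form_times_sum sum.distrib[symmetric] by (intro sum.cong refl) blast
  have "\<sigma> \<in> forests n" using assms deg_eq_0_iff[of \<sigma>] by (cases "deg \<sigma>") (auto simp: forests_def)
  then have 3: "(\<Sum>\<rho>\<^sub>1\<in>forests n. of_bool (\<rho>\<^sub>1 = \<sigma>) * (\<phi> \<rho>\<^sub>1 * \<psi> {#})) = \<phi> \<sigma> * \<psi> {#}"
    using finite_forests by (subst sum_of_bool_eq(2)) auto
  show ?thesis unfolding conv_split 1 2 3 by simp
qed

lemma single_iff: "single \<kappa> \<longleftrightarrow> (\<exists>\<tau>. \<kappa> = {#\<tau>#})"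
  using single_tree by (auto simp: single_def)

lemma form_graft_sum:
  "form_graft n \<phi> \<psi> \<sigma> = (\<Sum>\<rho>\<in>forests n. \<Sum>\<kappa>\<in>fs n.
     of_bool (single \<kappa> \<and> deg \<rho> + deg \<kappa> \<le> n \<and> graftf \<rho> \<kappa> = \<sigma>) * (\<phi> \<rho> * \<psi> \<kappa>))"
proof -
  have td: "deg {#\<tau>#} = tree_deg \<tau>" for \<tau> :: "'a tree" by (simp add: deg_def)
  have "form_graft n \<phi> \<psi> \<sigma> = (\<Sum>(\<rho>, \<tau>)\<in>forests n \<times> trees n.
      of_bool (deg \<rho> + tree_deg \<tau> \<le> n \<and> {#graft \<rho> \<tau>#} = \<sigma>) * (\<phi> \<rho> * \<psi> {#\<tau>#}))"
    unfolding form_graft_def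
    by (rule sum.mono_neutral_cong_left) (auto simp: finite_forests finite_trees)
  also have "\<dots> = (\<Sum>\<rho>\<in>forests n. \<Sum>\<tau>\<in>trees n.
      of_bool (deg \<rho> + tree_deg \<tau> \<le> n \<and> {#graft \<rho> \<tau>#} = \<sigma>) * (\<phi> \<rho> * \<psi> {#\<tau>#}))"
    by (simp only: sum.cartesian_product)
  also have "\<dots> = (\<Sum>\<rho>\<in>forests n. \<Sum>\<kappa>\<in>fs n.
     of_bool (single \<kappa> \<and> deg \<rho> + deg \<kappa> \<le> n \<and> graftf \<rho> \<kappa> = \<sigma>) * (\<phi> \<rho> * \<psi> \<kappa>))"
  proof (rule sum.cong[OF refl])
    fix \<rho> :: "'a forest"
    have "(\<Sum>\<tau>\<in>trees n. of_bool (deg \<rho> + tree_deg \<tau> \<le> n \<and> {#graft \<rho> \<tau>#} = \<sigma>) * (\<phi> \<rho> * \<psi> {#\<tau>#})) =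
        (\<Sum>\<kappa>\<in>(\<lambda>\<tau>. {#\<tau>#}) ` trees n. of_bool (deg \<rho> + deg \<kappa> \<le> n \<and> graftf \<rho> \<kappa> = \<sigma>) * (\<phi> \<rho> * \<psi> \<kappa>))"
      by (subst sum.reindex) (auto simp: inj_on_def td)
    also have "\<dots> = (\<Sum>\<kappa>\<in>fs n. of_bool (single \<kappa> \<and> deg \<rho> + deg \<kappa> \<le> n \<and> graftf \<rho> \<kappa> = \<sigma>) * (\<phi> \<rho> * \<psi> \<kappa>))"
      by (rule sum.mono_neutral_cong_left) (auto simp: single_iff td trees_def)
    finally show "(\<Sum>\<tau>\<in>trees n. of_bool (deg \<rho> + tree_deg \<tau> \<le> n \<and> {#graft \<rho> \<tau>#} = \<sigma>) * (\<phi> \<rho> * \<psi> {#\<tau>#})) =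
      (\<Sum>\<kappa>\<in>fs n. of_bool (single \<kappa> \<and> deg \<rho> + deg \<kappa> \<le> n \<and> graftf \<rho> \<kappa> = \<sigma>) * (\<phi> \<rho> * \<psi> \<kappa>))" .
  qed
  finally show ?thesis .
qed

lemma graftf_empty [simp]: "graftf {#} \<kappa> = \<kappa>"
proof -
  have "graft {#} \<tau> = \<tau>" for \<tau> :: "'a tree" by (cases \<tau>) simp
  then have "graft {#} = (\<lambda>\<tau> :: 'a tree. \<tau>)" by blast
  then show ?thesis by (simp add: graftf_def)
qed

text \<open>As for products, but only the first argument has a term at the empty forest, which
  yields the value times \<psi>.\<close>

lemma conv_graft_form_graft:
  assumes "deg \<sigma> \<le> n" "\<And>\<rho>. \<not> single \<rho> \<Longrightarrow> \<psi> \<rho> = 0"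
  shows "conv n graftf single \<phi> \<psi> \<sigma> = \<phi> {#} * \<psi> \<sigma> + form_graft n \<phi> \<psi> \<sigma>"
proof -
  have "(\<Sum>\<rho>\<^sub>2\<in>fs n. of_bool (single \<rho>\<^sub>2 \<and> graftf {#} \<rho>\<^sub>2 = \<sigma>) * (\<phi> {#} * \<psi> \<rho>\<^sub>2)) =
      (\<Sum>\<rho>\<^sub>2\<in>fs n. of_bool (\<rho>\<^sub>2 = \<sigma>) * (\<phi> {#} * \<psi> \<rho>\<^sub>2))"
    using assms(2) by (intro sum.cong refl) (auto simp: of_bool_def)
  also have "\<dots> = \<phi> {#} * \<psi> \<sigma>" using assms by (subst sum_of_bool_eq(2)) auto
  finally show ?thesis unfolding conv_split form_graft_sum by simp
qed

lemma form_times_cong: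
  "(\<And>\<rho>. \<rho> \<in> forests n \<Longrightarrow> \<phi> \<rho> = \<phi>' \<rho>) \<Longrightarrow> (\<And>\<rho>. \<rho> \<in> forests n \<Longrightarrow> \<psi> \<rho> = \<psi>' \<rho>) \<Longrightarrow>
    form_times n \<phi> \<psi> \<sigma> = form_times n \<phi>' \<psi>' \<sigma>"
  unfolding form_times_sum by (intro sum.cong refl) auto

lemma form_graft_cong:
  "(\<And>\<rho>. \<rho> \<in> forests n \<Longrightarrow> \<phi> \<rho> = \<phi>' \<rho>) \<Longrightarrow> form_graft n \<phi> \<psi> \<sigma> = form_graft n \<phi>' \<psi> \<sigma>"
  unfolding form_graft_sum by (intro sum.cong refl) auto

section \<open>Construction of the canonical lift\<close>

definition conv_unit :: "'l forest \<Rightarrow> real" where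
  "conv_unit \<sigma> = of_bool (\<sigma> = {#})"

lemma conv_unit_left: "deg \<sigma> \<le> n \<Longrightarrow> conv n (+) (\<lambda>_. True) conv_unit \<psi> \<sigma> = \<psi> \<sigma>"
proof -
  assume \<sigma>: "deg \<sigma> \<le> n"
  have 1: "conv_unit \<rho>\<^sub>1 = 0" if "\<rho>\<^sub>1 \<in> forests n" for \<rho>\<^sub>1 :: "'a forest"
    using that by (auto simp: conv_unit_def forests_def)
  have 2: "(\<Sum>\<rho>\<^sub>2\<in>fs n. of_bool (True \<and> {#} + \<rho>\<^sub>2 = \<sigma>) * (conv_unit {#} * \<psi> \<rho>\<^sub>2)) = \<psi> \<sigma>"
    using \<sigma> by (simp add: sum_of_bool_eq(2) conv_unit_def)
  show ?thesis
    unfolding conv_split 2 by (simp add: 1)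
qed

lemma conv_plus_commute: "conv n (+) (\<lambda>_. True) \<phi> \<psi> \<sigma> = conv n (+) (\<lambda>_. True) \<psi> \<phi> \<sigma>"
  unfolding conv_def by (subst sum.swap) (intro sum.cong refl, simp add: add.commute mult.commute)

lemma conv_unit_right: "deg \<sigma> \<le> n \<Longrightarrow> conv n (+) (\<lambda>_. True) \<psi> conv_unit \<sigma> = \<psi> \<sigma>"
  using conv_unit_left conv_plus_commute by metis

text \<open>The inner cut-off is implied by the outer one, which leaves a triple sum symmetric in
  the first two arguments. The resulting left commutativity allows folding over a multiset of
  trees.\<close>

lemma conv_conv:
  "conv n (+) (\<lambda>_. True) \<phi> (conv n (+) (\<lambda>_. True) \<psi> \<eta>) \<sigma> =
    (\<Sum>\<rho>\<^sub>1\<in>fs n. \<Sum>\<rho>\<^sub>2\<in>fs n. \<Sum>\<rho>\<^sub>3\<in>fs n. of_bool (deg \<rho>\<^sub>1 + deg \<rho>\<^sub>2 + deg \<rho>\<^sub>3 \<le> n \<and> \<rho>\<^sub>1 + \<rho>\<^sub>2 + \<rho>\<^sub>3 = \<sigma>) *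
      (\<phi> \<rho>\<^sub>1 * (\<psi> \<rho>\<^sub>2 * \<eta> \<rho>\<^sub>3)))"
proof -
  have "conv n (+) (\<lambda>_. True) \<phi> (conv n (+) (\<lambda>_. True) \<psi> \<eta>) \<sigma> =
     (\<Sum>\<rho>\<^sub>1\<in>fs n. \<Sum>\<kappa>\<in>fs n. \<Sum>\<rho>\<^sub>2\<in>fs n. \<Sum>\<rho>\<^sub>3\<in>fs n. of_bool (\<rho>\<^sub>2 + \<rho>\<^sub>3 = \<kappa>) *
       (of_bool (deg \<rho>\<^sub>1 + deg \<rho>\<^sub>2 + deg \<rho>\<^sub>3 \<le> n \<and> \<rho>\<^sub>1 + \<rho>\<^sub>2 + \<rho>\<^sub>3 = \<sigma>) * (\<phi> \<rho>\<^sub>1 * (\<psi> \<rho>\<^sub>2 * \<eta> \<rho>\<^sub>3))))"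
    unfolding conv_def sum_distrib_left by (intro sum.cong refl) (auto simp: add.assoc)
  also have "\<dots> = (\<Sum>\<rho>\<^sub>1\<in>fs n. \<Sum>\<rho>\<^sub>2\<in>fs n. \<Sum>\<rho>\<^sub>3\<in>fs n. \<Sum>\<kappa>\<in>fs n. of_bool (\<rho>\<^sub>2 + \<rho>\<^sub>3 = \<kappa>) *
       (of_bool (deg \<rho>\<^sub>1 + deg \<rho>\<^sub>2 + deg \<rho>\<^sub>3 \<le> n \<and> \<rho>\<^sub>1 + \<rho>\<^sub>2 + \<rho>\<^sub>3 = \<sigma>) * (\<phi> \<rho>\<^sub>1 * (\<psi> \<rho>\<^sub>2 * \<eta> \<rho>\<^sub>3))))"
    by (rule sum.cong[OF refl], subst sum.swap, intro sum.cong refl sum.swap)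
  also have "\<dots> = (\<Sum>\<rho>\<^sub>1\<in>fs n. \<Sum>\<rho>\<^sub>2\<in>fs n. \<Sum>\<rho>\<^sub>3\<in>fs n. of_bool (deg \<rho>\<^sub>1 + deg \<rho>\<^sub>2 + deg \<rho>\<^sub>3 \<le> n \<and> \<rho>\<^sub>1 + \<rho>\<^sub>2 + \<rho>\<^sub>3 = \<sigma>) *
      (\<phi> \<rho>\<^sub>1 * (\<psi> \<rho>\<^sub>2 * \<eta> \<rho>\<^sub>3)))"
    by (intro sum.cong refl) (subst sum_of_bool_eq(1), auto)
  finally show ?thesis .
qed

lemma conv_left_commute:
  "conv n (+) (\<lambda>_. True) \<phi> (conv n (+) (\<lambda>_. True) \<psi> \<eta>) = conv n (+) (\<lambda>_. True) \<psi> (conv n (+) (\<lambda>_. True) \<phi> \<eta>)"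
proof
  fix \<sigma>
  show "conv n (+) (\<lambda>_. True) \<phi> (conv n (+) (\<lambda>_. True) \<psi> \<eta>) \<sigma> = conv n (+) (\<lambda>_. True) \<psi> (conv n (+) (\<lambda>_. True) \<phi> \<eta>) \<sigma>"
    unfolding conv_conv by (subst sum.swap) (intro sum.cong refl, simp add: ac_simps)
qed

text \<open>Convolution at all pairs of times at once: the recursion over trees has to return whole
  paths, because a value is a limit of sums over other times.\<close>

definition conv_path :: "nat \<Rightarrow> (real \<Rightarrow> real \<Rightarrow> 'd::finite forest \<Rightarrow> real) \<Rightarrow> (real \<Rightarrow> real \<Rightarrow> 'd forest \<Rightarrow> real)
    \<Rightarrow> real \<Rightarrow> real \<Rightarrow> 'd forest \<Rightarrow> real" where
  "conv_path n \<phi> \<psi> s t = conv n (+) (\<lambda>_. True) (\<phi> s t) (\<psi> s t)"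

interpretation conv_path: comp_fun_commute "conv_path n"
  by unfold_locales (simp add: fun_eq_iff conv_path_def conv_left_commute)

text \<open>\<open>Lim\<close> is meaningful only where the sums converge, which
  \<open>can_lift_is_lift\<close> establishes afterwards.\<close>

definition node_lift :: "nat \<Rightarrow> (real \<Rightarrow> real \<Rightarrow> 'd::finite forest \<Rightarrow> real) \<Rightarrow> (real \<Rightarrow> 'd forest \<Rightarrow> real)
    \<Rightarrow> (real \<Rightarrow> real \<Rightarrow> 'd forest \<Rightarrow> real) \<Rightarrow> real \<Rightarrow> real \<Rightarrow> 'd forest \<Rightarrow> real" where
  "node_lift n Z \<beta> \<phi> s t \<sigma> = (if \<sigma> = {#}
     then Lim (mesh_to_zero s t) (partition_sum (\<lambda>x y. pair0 n (conv n graftf single (\<phi> s x) (\<beta> x)) (Z x y)))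
     else conv n graftf single (\<phi> s t) (\<beta> t) \<sigma>)"

primrec tree_lift :: "nat \<Rightarrow> (real \<Rightarrow> real \<Rightarrow> 'd::finite forest \<Rightarrow> real) \<Rightarrow> ('e \<Rightarrow> real \<Rightarrow> 'd forest \<Rightarrow> real)
    \<Rightarrow> 'e tree \<Rightarrow> real \<Rightarrow> real \<Rightarrow> 'd forest \<Rightarrow> real" where
  "tree_lift n Z \<beta> (Node j \<rho>) = node_lift n Z (\<beta> j)
     (fold_mset (conv_path n) (\<lambda>_ _. conv_unit) (image_mset (tree_lift n Z \<beta>) \<rho>))"

definition can_lift :: "nat \<Rightarrow> (real \<Rightarrow> real \<Rightarrow> 'd::finite forest \<Rightarrow> real) \<Rightarrow> ('e \<Rightarrow> real \<Rightarrow> 'd forest \<Rightarrow> real)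
    \<Rightarrow> real \<Rightarrow> real \<Rightarrow> 'e forest \<Rightarrow> 'd forest \<Rightarrow> real" where
  "can_lift n Z \<beta> s t \<rho> = fold_mset (conv_path n) (\<lambda>_ _. conv_unit) (image_mset (tree_lift n Z \<beta>) \<rho>) s t"

lemma can_lift_empty: "can_lift n Z \<beta> s t {#} = conv_unit"
  by (simp add: can_lift_def)

lemma can_lift_add: "can_lift n Z \<beta> s t (add_mset \<tau> \<rho>) = conv n (+) (\<lambda>_. True) (tree_lift n Z \<beta> \<tau> s t) (can_lift n Z \<beta> s t \<rho>)"
  by (simp add: can_lift_def conv_path_def)

lemma can_lift_plus:
  assumes "deg \<sigma> \<le> n"
  shows "can_lift n Z \<beta> s t (\<rho>\<^sub>1 + \<rho>\<^sub>2) \<sigma> = conv n (+) (\<lambda>_. True) (can_lift n Z \<beta> s t \<rho>\<^sub>1) (can_lift n Z \<beta> s t \<rho>\<^sub>2) \<sigma>"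
  using assms
proof (induction \<rho>\<^sub>1 arbitrary: \<sigma>)
  case empty
  then show ?case by (simp add: can_lift_empty conv_unit_left)
next
  case (add \<tau> \<rho>\<^sub>1)
  let ?c = "conv n (+) (\<lambda>_. True)" and ?\<Phi> = "can_lift n Z \<beta> s t" and ?T = "tree_lift n Z \<beta> \<tau> s t"
  have "?\<Phi> (add_mset \<tau> \<rho>\<^sub>1 + \<rho>\<^sub>2) \<sigma> = ?c ?T (?c (?\<Phi> \<rho>\<^sub>1) (?\<Phi> \<rho>\<^sub>2)) \<sigma>"
    using add.IH by (simp add: can_lift_add) (intro conv_cong; simp)
  also have "?c (?\<Phi> \<rho>\<^sub>1) (?\<Phi> \<rho>\<^sub>2) = ?c (?\<Phi> \<rho>\<^sub>2) (?\<Phi> \<rho>\<^sub>1)" by (rule ext) (rule conv_plus_commute)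
  also have "?c ?T (?c (?\<Phi> \<rho>\<^sub>2) (?\<Phi> \<rho>\<^sub>1)) \<sigma> = ?c (?\<Phi> \<rho>\<^sub>2) (?c ?T (?\<Phi> \<rho>\<^sub>1)) \<sigma>" by (rule fun_cong[OF conv_left_commute])
  also have "\<dots> = ?c (?\<Phi> (add_mset \<tau> \<rho>\<^sub>1)) (?\<Phi> \<rho>\<^sub>2) \<sigma>" unfolding can_lift_add by (rule conv_plus_commute)
  finally show ?case .
qed

lemma can_lift_node:
  assumes "deg \<sigma> \<le> n"
  shows "can_lift n Z \<beta> s t {#Node j \<rho>#} \<sigma> = node_lift n Z (\<beta> j) (\<lambda>s t. can_lift n Z \<beta> s t \<rho>) s t \<sigma>"
proof -
  have "can_lift n Z \<beta> s t {#Node j \<rho>#} \<sigma> = tree_lift n Z \<beta> (Node j \<rho>) s t \<sigma>"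
    using assms by (simp add: can_lift_add can_lift_empty conv_unit_right)
  then show ?thesis by (simp add: can_lift_def[abs_def])
qed

context rough_data
begin

text \<open>Convergence at a node requires the forest below it to be controlled, and the control of
  the node requires this convergence. One induction over forests therefore alternates between the
  two.\<close>

lemma can_lift_is_lift:
  fixes \<beta> :: "'e::finite \<Rightarrow> real \<Rightarrow> 'd forest \<Rightarrow> real"
  assumes \<beta>: "\<And>j. controlled single L a (\<beta> j)" and supp: "\<And>j t \<rho>. \<not> single \<rho> \<Longrightarrow> \<beta> j t \<rho> = 0"
    and small: "\<And>\<epsilon>. 0 < \<epsilon> \<Longrightarrow> \<exists>\<delta>>0. \<forall>u v. a \<le> u \<longrightarrow> u \<le> v \<longrightarrow> v \<le> b \<longrightarrow> v - u < \<delta> \<longrightarrow> \<omega> u v \<le> \<epsilon>"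
  shows "lift n a b Z \<beta> (can_lift n Z \<beta>)"
proof -
  let ?\<Phi> = "can_lift n Z \<beta>"
  define lim where "lim j \<rho> s \<longleftrightarrow> (\<forall>t u. s \<le> t \<longrightarrow> t \<le> u \<longrightarrow> u \<le> b \<longrightarrow>
    (partition_sum (\<lambda>x y. pair0 n (?\<Phi> s x {#Node j \<rho>#}) (Z x y)) \<longlongrightarrow>
        ?\<Phi> s u {#Node j \<rho>#} {#} - ?\<Phi> s t {#Node j \<rho>#} {#}) (mesh_to_zero t u)) \<and> ?\<Phi> s s {#Node j \<rho>#} {#} = 0" for j \<rho> s
  have ne: "?\<Phi> s t {#Node j \<rho>#} \<sigma> = conv n graftf single (?\<Phi> s t \<rho>) (\<beta> j t) \<sigma>"
    if "\<sigma> \<noteq> {#}" "deg \<sigma> \<le> n" for s t j \<rho> \<sigma>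
    using that by (simp add: can_lift_node node_lift_def)
  have step: "lim j \<rho> s"
    if c: "controlled (\<lambda>_. True) K s (\<lambda>t. ?\<Phi> s t \<rho>)" and s: "a \<le> s" "s \<le> b" for j \<rho> s K
  proof -
    let ?\<Xi> = "\<lambda>x y. pair0 n (?\<Phi> s x {#Node j \<rho>#}) (Z x y)"
    have \<Xi>: "?\<Xi> = (\<lambda>x y. pair0 n (conv n graftf single (?\<Phi> s x \<rho>) (\<beta> j x)) (Z x y))"
      unfolding pair0_def by (intro ext sum.cong refl arg_cong2[where f = "(*)"] ne) (auto simp: forests_def)
    have lim0: "(partition_sum ?\<Xi> \<longlongrightarrow> ?\<Phi> s t {#Node j \<rho>#} {#}) (mesh_to_zero s t)" if t: "s \<le> t" "t \<le> b" for t
    proof -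
      have "\<exists>J. (partition_sum ?\<Xi> \<longlongrightarrow> J) (mesh_to_zero s t)"
        by (rule node_limit_exists[OF c controlled_subset[OF \<beta>[of j] s(1)]]) (use supp s ne small t in auto)
      then obtain J where J: "(partition_sum ?\<Xi> \<longlongrightarrow> J) (mesh_to_zero s t)" ..
      have "?\<Phi> s t {#Node j \<rho>#} {#} = Lim (mesh_to_zero s t) (partition_sum ?\<Xi>)"
        unfolding \<Xi> by (simp add: can_lift_node node_lift_def)
      also have "\<dots> = J" by (rule tendsto_Lim[OF mesh_to_zero_neq_bot[OF t(1)] J])
      finally show ?thesis using J by simp
    qed
    have z: "?\<Phi> s s {#Node j \<rho>#} {#} = 0"
      using mesh_limit_unique[OF lim0[of s] mesh_limit_refl] s by simp
    show ?thesis
      unfolding lim_def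
    proof (intro conjI allI impI z)
      fix t u assume "s \<le> t" "t \<le> u" "u \<le> b"
      then show "(partition_sum ?\<Xi> \<longlongrightarrow> ?\<Phi> s u {#Node j \<rho>#} {#} - ?\<Phi> s t {#Node j \<rho>#} {#}) (mesh_to_zero t u)"
        by (intro mesh_limit_diff[OF lim0 lim0]) auto
    qed
  qed
  have ctl: "\<exists>K. controlled (\<lambda>_. True) K s (\<lambda>t. ?\<Phi> s t \<rho>)" if s: "a \<le> s" "s \<le> b" for s \<rho>
  proof (induction \<rho> rule: forest_induct)
    case empty
    have "Gam n (Z t u) conv_unit \<tau> = conv_unit \<tau>" if "s \<le> t" "t \<le> u" "u \<le> b" for t u \<tau>
    proof -
      have "Gam n (Z t u) conv_unit \<tau> = Z t u {#} * of_bool ({#} = \<tau>)"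
        unfolding Gam_def conv_unit_def by (subst sum_of_bool_eq(2)) auto
      also have "Z t u {#} = 1" using that s by (intro characters_empty[of _ n] Zc) auto
      also have "1 * of_bool ({#} = \<tau>) = conv_unit \<tau>" by (auto simp: conv_unit_def)
      finally show ?thesis .
    qed
    then have "controlled (\<lambda>_. True) 1 s (\<lambda>t. ?\<Phi> s t {#})"
      unfolding controlled_def can_lift_empty by (simp add: conv_unit_def[of "_ :: 'd forest"])
    then show ?case ..
  next
    case (node j \<rho>)
    then obtain K where K: "controlled (\<lambda>_. True) K s (\<lambda>t. ?\<Phi> s t \<rho>)" ..
    have "controlled (\<lambda>_. True) (Q * K * L) s (\<lambda>t. ?\<Phi> s t {#Node j \<rho>#})"
      by (rule node_controlled[OF K controlled_subset[OF \<beta>[of j] s(1)]])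
        (use step[OF K s, of j] supp s ne in \<open>auto simp: lim_def\<close>)
    then show ?case ..
  next
    case (plus \<rho>\<^sub>1 \<rho>\<^sub>2)
    then obtain K K' where "controlled (\<lambda>_. True) K s (\<lambda>t. ?\<Phi> s t \<rho>\<^sub>1)" "controlled (\<lambda>_. True) K' s (\<lambda>t. ?\<Phi> s t \<rho>\<^sub>2)"
      by blast
    from controlled_plus[OF this s(1)]
    have "controlled (\<lambda>_. True) (3 * M ^ 4 * H ^ 2 * K * K') s (\<lambda>t. ?\<Phi> s t (\<rho>\<^sub>1 + \<rho>\<^sub>2))"
      by (rule controlled_cong) (simp add: can_lift_plus)
    then show ?case ..
  qed
  show ?thesis
  proof
    show "?\<Phi> s t {#} \<sigma> = of_bool (\<sigma> = {#})" for s t \<sigma> by (simp add: can_lift_empty conv_unit_def)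
    fix s t u j and \<rho> :: "'e forest" assume "a \<le> s" "s \<le> t" "t \<le> u" "u \<le> b"
    moreover have "s \<le> b" using calculation by simp
    ultimately show "(partition_sum (\<lambda>x y. pair0 n (?\<Phi> s x {#Node j \<rho>#}) (Z x y)) \<longlongrightarrow>
        ?\<Phi> s u {#Node j \<rho>#} {#} - ?\<Phi> s t {#Node j \<rho>#} {#}) (mesh_to_zero t u)"
      using ctl[of s \<rho>] step[of _ s \<rho> j] unfolding lim_def by blast
  next
    fix s j and \<rho> :: "'e forest" assume "a \<le> s" "s \<le> b"
    then show "?\<Phi> s s {#Node j \<rho>#} {#} = 0" using ctl[of s \<rho>] step[of _ s \<rho> j] unfolding lim_def by blast
  qed (simp_all add: can_lift_plus ne)
qed

end

section \<open>Rough integrals and lifts correspond to each other\<close>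

lemma form_apply_pair0: "form_apply n \<phi> a = pair0 n \<phi> a"
  by (simp add: form_apply_def pair0_def mult.commute)

lemma pair0_cong: "(\<And>\<rho>. \<rho> \<noteq> {#} \<Longrightarrow> deg \<rho> \<le> n \<Longrightarrow> \<phi> \<rho> = \<psi> \<rho>) \<Longrightarrow> pair0 n \<phi> a = pair0 n \<psi> a"
proof -
  assume *: "\<And>\<rho>. \<rho> \<noteq> {#} \<Longrightarrow> deg \<rho> \<le> n \<Longrightarrow> \<phi> \<rho> = \<psi> \<rho>"
  have "\<phi> \<rho> = \<psi> \<rho>" if "\<rho> \<in> forests n" for \<rho>
    using that by (intro *) (auto simp: forests_def)
  then show ?thesis unfolding pair0_def by (intro sum.cong) auto
qed

lemma partition_sum_nth: "partition_sum g D $ j = partition_sum (\<lambda>u v. g u v $ j) D"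
  by (simp add: partition_sum_def)

lemma mesh_limit_cong:
  fixes f g :: "real \<Rightarrow> real \<Rightarrow> real"
  assumes "(partition_sum f \<longlongrightarrow> J) (mesh_to_zero s t)"
    and "\<And>u v. s \<le> u \<Longrightarrow> u < v \<Longrightarrow> v \<le> t \<Longrightarrow> f u v = g u v"
  shows "(partition_sum g \<longlongrightarrow> J) (mesh_to_zero s t)"
  by (rule Lim_transform_eventually[OF assms(1)])
    (auto simp: eventually_mesh intro!: exI[of _ 1] partition_sum_cong assms(2))

lemma integrand_not_single: "\<not> single \<rho> \<Longrightarrow> integrand n f X t \<rho> = 0"
  unfolding integrand_def by (rule sum.neutral) (auto simp: single_iff)

lemma integrand_high: "n < deg \<rho> \<Longrightarrow> integrand n f X t \<rho> = 0"
  unfolding integrand_def by (rule sum.neutral) (auto simp: trees_def deg_def)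

lemma form_times_zero: "\<sigma> = {#} \<or> n < deg \<sigma> \<Longrightarrow> form_times n \<phi> \<psi> \<sigma> = 0"
  unfolding form_times_sum by (intro sum.neutral ballI) (auto simp: forests_def)

lemma deg_graft: "deg {#graft \<sigma> \<tau>#} = deg \<sigma> + deg {#\<tau>#}"
  by (cases \<tau>) simp

lemma form_graft_zero: "\<sigma> = {#} \<or> n < deg \<sigma> \<Longrightarrow> form_graft n \<phi> \<psi> \<sigma> = 0"
  unfolding form_graft_sum by (intro sum.neutral ballI) (auto simp: forests_def single_iff deg_graft)

text \<open>Both sides vanish off the trees of depth at most 2. On these the point is that iterated
  derivatives commute with evaluation at a basis vector and with taking a component.\<close>

lemma integrand_bc:
  assumes f: "Lip \<gamma> f" and n: "1 \<le> n" "n - 1 \<le> strict_floor \<gamma>"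
  shows "integrand n f X t \<rho> $ j = bc n (comp_fun f j) (proj1 (X t)) \<rho>"
proof (cases "single \<rho> \<and> deg \<rho> \<le> n")
  case False
  have "bc n (comp_fun f j) (proj1 (X t)) \<rho> = 0"
    unfolding bc_def using False n by (intro sum.neutral ballI) auto
  moreover have "integrand n f X t \<rho> = 0" using False integrand_not_single integrand_high by (metis not_le)
  ultimately show ?thesis by simp
next
  case True
  then obtain i c where \<rho>: "\<rho> = {#Node i c#}" by (auto simp: single_def)
  have c: "deg c \<le> n - 1" using True by (simp add: \<rho>)
  have td: "tree_deg (Node i c) \<le> n" using True by (simp add: \<rho> deg_def)
  have "{\<tau> \<in> trees n. {#\<tau>#} = \<rho>} = {Node i c}" using td by (auto simp: \<rho> trees_def)
  then have I: "integrand n f X t \<rho> $ j = (1 / real (sym_factor (Node i c))) * tree_coeff f (Node i c) (proj1 (X t)) $ j"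
    unfolding integrand_def by simp
  show ?thesis
  proof (cases "depth (Node i c) \<le> 2")
    case True
    then have cl: "c = leaves (image_mset label c)" by (simp only: depth_le_2)
    define q where "q = image_mset label c"
    have cq: "c = leaves q" using cl by (simp add: q_def)
    have sz: "size q \<le> n - 1" using c by (simp add: cq)
    let ?vs = "map (\<lambda>i. axis i (1::real)) (SOME is. mset is = q)"
    have len: "length ?vs \<le> strict_floor \<gamma>" using sz n(2) by simp (metis le_trans mset_some_list size_mset)
    have "tree_coeff f (Node i c) (proj1 (X t)) $ j = Dm (comp_fun f j i) q (proj1 (X t))"
      unfolding tree_coeff_def using True
      by (simp add: comp_fun_deriv[OF f len] Dm_def flip: q_def)
    moreover have "real (sym_factor (Node i c)) = mfact q" unfolding cq by (rule sym_factor_leaves)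
    moreover have "bc n (comp_fun f j) (proj1 (X t)) \<rho> = Dm (comp_fun f j i) q (proj1 (X t)) / mfact q"
      unfolding \<rho> cq by (rule bc_leaves[OF sz])
    ultimately show ?thesis unfolding I by simp
  next
    case False
    then have "bc n (comp_fun f j) (proj1 (X t)) \<rho> = 0"
      by (intro bc_zero) (use depth_le_2[of i c] label_leaves in \<open>auto simp: \<rho>\<close>)
    moreover have "tree_coeff f (Node i c) (proj1 (X t)) = 0" using False by (simp only: tree_coeff_def if_False)
    ultimately show ?thesis unfolding I by simp
  qed
qed

text \<open>The clauses of \<open>is_rough_integral\<close> for one pair of times, with the one-form
  as a parameter.\<close>

definition rough_step ::
    "nat \<Rightarrow> (real \<Rightarrow> 'd::finite forest \<Rightarrow> real) \<Rightarrow> ('e::finite \<Rightarrow> real \<Rightarrow> 'd forest \<Rightarrow> real) \<Rightarrow>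
     (real \<Rightarrow> real \<Rightarrow> 'e forest \<Rightarrow> real) \<Rightarrow> (real \<Rightarrow> real ^ 'e) \<Rightarrow>
     (real \<Rightarrow> 'e forest \<Rightarrow> real \<Rightarrow> 'd forest \<Rightarrow> real) \<Rightarrow> real \<Rightarrow> real \<Rightarrow> bool" where
  "rough_step n X \<beta> Y y B s t \<longleftrightarrow> Y s t \<in> characters n \<and>
          (\<forall>j. Y s t {#bullet j#} = y t $ j - y s $ j) \<and>
          (\<forall>j \<rho>. 1 \<le> deg \<rho> \<and> deg \<rho> \<le> n - 1 \<longrightarrow>
             has_form_integral n X (B s {#Node j \<rho>#}) s t (Y s t {#Node j \<rho>#})) \<and>
          (\<forall>j. B s {#bullet j#} t = \<beta> j t) \<and>
          (\<forall>\<rho>\<^sub>1 \<rho>\<^sub>2. 1 \<le> deg \<rho>\<^sub>1 \<and> 1 \<le> deg \<rho>\<^sub>2 \<and> deg \<rho>\<^sub>1 + deg \<rho>\<^sub>2 \<le> n \<longrightarrow>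
             B s (\<rho>\<^sub>1 + \<rho>\<^sub>2) t = (\<lambda>\<rho>. Y s t \<rho>\<^sub>1 * B s \<rho>\<^sub>2 t \<rho> + Y s t \<rho>\<^sub>2 * B s \<rho>\<^sub>1 t \<rho> +
               form_times n (B s \<rho>\<^sub>1 t) (B s \<rho>\<^sub>2 t) \<rho>)) \<and>
          (\<forall>j \<rho>. 1 \<le> deg \<rho> \<and> deg \<rho> \<le> n - 1 \<longrightarrow>
             B s {#Node j \<rho>#} t = (\<lambda>\<rho>'. Y s t \<rho> * \<beta> j t \<rho>' +
               form_graft n (B s \<rho> t) (\<beta> j t) \<rho>'))"

lemma is_rough_integral_iff:
  "is_rough_integral p T f X Y \<longleftrightarrow> (\<exists>y B.
     (\<forall>t. 0 \<le> t \<and> t \<le> T \<longrightarrow> has_form_integral (level p) X (integrand (level p) f X) 0 t (y t)) \<and>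
     (\<forall>s t. 0 \<le> s \<and> s \<le> t \<and> t \<le> T \<longrightarrow>
        rough_step (level p) X (\<lambda>j t \<rho>. integrand (level p) f X t \<rho> $ j) Y y B s t))"
  unfolding is_rough_integral_def Let_def rough_step_def char_group_simps ..

text \<open>Any \<open>Y\<close> and \<open>B\<close> that satisfy the construction form a lift, so
  the estimates apply to every rough integral and not only to the constructed one.\<close>

lemma lift_of_integral:
  fixes f :: "real ^ 'd::finite \<Rightarrow> (real ^ 'd) \<Rightarrow>\<^sub>L (real ^ 'e::finite)"
  assumes n: "1 \<le> level p" and I: "is_rough_integral p T f X Y"
  defines "n \<equiv> level p"
  defines "\<beta> \<equiv> (\<lambda>j t \<rho>. integrand n f X t \<rho> $ j)"
  shows "\<exists>\<Phi>. lift n 0 T (increment n X) \<beta> \<Phi> \<and>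
    (\<forall>s t. 0 \<le> s \<and> s \<le> t \<and> t \<le> T \<longrightarrow> Y s t \<in> characters n \<and> (\<forall>\<rho>. \<Phi> s t \<rho> {#} = Y s t \<rho>))"
proof -
  let ?Z = "increment n X"
  have b: "integrand n f X t \<rho> $ j = \<beta> j t \<rho>" for j t \<rho> by (simp add: \<beta>_def)
  obtain y B where y': "\<forall>t. 0 \<le> t \<and> t \<le> T \<longrightarrow> has_form_integral n X (integrand n f X) 0 t (y t)"
    and step': "\<forall>s t. 0 \<le> s \<and> s \<le> t \<and> t \<le> T \<longrightarrow> rough_step n X \<beta> Y y B s t"
    using I unfolding is_rough_integral_iff n_def[symmetric] b by (elim exE conjE) (rule that)
  have y: "has_form_integral n X (integrand n f X) 0 t (y t)" if "0 \<le> t" "t \<le> T" for t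
    using y' that by blast
  have step: "rough_step n X \<beta> Y y B s t" if "0 \<le> s" "s \<le> t" "t \<le> T" for s t
    using step' that by blast
  have Yc: "\<And>s t. 0 \<le> s \<Longrightarrow> s \<le> t \<Longrightarrow> t \<le> T \<Longrightarrow> Y s t \<in> characters n"
    using step unfolding rough_step_def by blast
  have Yb: "\<And>s t j. 0 \<le> s \<Longrightarrow> s \<le> t \<Longrightarrow> t \<le> T \<Longrightarrow> Y s t {#bullet j#} = y t $ j - y s $ j"
    using step unfolding rough_step_def by blast
  have Yn: "\<And>s t j \<rho>. 0 \<le> s \<Longrightarrow> s \<le> t \<Longrightarrow> t \<le> T \<Longrightarrow> 1 \<le> deg \<rho> \<Longrightarrow> deg \<rho> \<le> n - 1 \<Longrightarrow>
      has_form_integral n X (B s {#Node j \<rho>#}) s t (Y s t {#Node j \<rho>#})"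
    using step unfolding rough_step_def by blast
  have Bb: "\<And>s t j. 0 \<le> s \<Longrightarrow> s \<le> t \<Longrightarrow> t \<le> T \<Longrightarrow> B s {#bullet j#} t = \<beta> j t"
    using step unfolding rough_step_def by blast
  have Bp: "\<And>s t \<rho>\<^sub>1 \<rho>\<^sub>2. 0 \<le> s \<Longrightarrow> s \<le> t \<Longrightarrow> t \<le> T \<Longrightarrow> 1 \<le> deg \<rho>\<^sub>1 \<Longrightarrow> 1 \<le> deg \<rho>\<^sub>2 \<Longrightarrow> deg \<rho>\<^sub>1 + deg \<rho>\<^sub>2 \<le> n \<Longrightarrow>
      B s (\<rho>\<^sub>1 + \<rho>\<^sub>2) t = (\<lambda>\<rho>. Y s t \<rho>\<^sub>1 * B s \<rho>\<^sub>2 t \<rho> + Y s t \<rho>\<^sub>2 * B s \<rho>\<^sub>1 t \<rho> + form_times n (B s \<rho>\<^sub>1 t) (B s \<rho>\<^sub>2 t) \<rho>)"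
    using step unfolding rough_step_def by blast
  have Bn: "\<And>s t j \<rho>. 0 \<le> s \<Longrightarrow> s \<le> t \<Longrightarrow> t \<le> T \<Longrightarrow> 1 \<le> deg \<rho> \<Longrightarrow> deg \<rho> \<le> n - 1 \<Longrightarrow>
      B s {#Node j \<rho>#} t = (\<lambda>\<rho>'. Y s t \<rho> * \<beta> j t \<rho>' + form_graft n (B s \<rho> t) (\<beta> j t) \<rho>')"
    using step unfolding rough_step_def by blast
  \<comment> \<open>No clause determines \<open>B\<close> at \<open>\<rho> = {#}\<close>; the 0
    there makes \<Phi> at the empty forest the unit of \<open>conv\<close>.\<close>
  define \<Phi> where "\<Phi> s t \<rho> \<sigma> = (if \<sigma> = {#} then Y s t \<rho> else if \<rho> = {#} then 0 else B s \<rho> t \<sigma>)" for s t \<rho> \<sigma>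
  have pos: "1 \<le> deg \<rho>" if "\<rho> \<noteq> {#}" for \<rho> :: "'e forest"
    using that deg_eq_0_iff[of \<rho>] by linarith
  have \<beta>0: "\<beta> j t \<rho> = 0" if "\<not> single \<rho>" for j t \<rho> using that by (simp add: \<beta>_def integrand_not_single)
  have \<beta>lim: "(partition_sum (\<lambda>x z. pair0 n (\<beta> j x) (?Z x z)) \<longlongrightarrow> y t $ j) (mesh_to_zero 0 t)"
    if t: "0 \<le> t" "t \<le> T" for t j
  proof -
    have "((\<lambda>D. partition_sum (\<lambda>u v. form_apply n (integrand n f X u) (?Z u v)) D $ j) \<longlongrightarrow> y t $ j) (mesh_to_zero 0 t)"
      using y[OF t] unfolding has_form_integral_def by (rule tendsto_vec_nth)
    then show ?thesis by (simp add: partition_sum_nth form_apply_def pair0_def \<beta>_def mult.commute)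
  qed
  have emp: "\<Phi> s t {#} \<sigma> = of_bool (\<sigma> = {#})" if "0 \<le> s" "s \<le> t" "t \<le> T" for s t \<sigma>
    using Yc[OF that] by (simp add: \<Phi>_def)
  have node: "\<Phi> s t {#Node j \<rho>#} \<sigma> = conv n graftf single (\<Phi> s t \<rho>) (\<beta> j t) \<sigma>"
    if st: "0 \<le> s" "s \<le> t" "t \<le> T" and d: "deg \<rho> < n" "deg \<sigma> \<le> n" "\<sigma> \<noteq> {#}" for s t j \<rho> \<sigma>
  proof -
    have c: "conv n graftf single (\<Phi> s t \<rho>) (\<beta> j t) \<sigma> = Y s t \<rho> * \<beta> j t \<sigma> + form_graft n (\<Phi> s t \<rho>) (\<beta> j t) \<sigma>"
      using conv_graft_form_graft[of \<sigma> n "\<beta> j t" "\<Phi> s t \<rho>"] d(2) \<beta>0 by (simp add: \<Phi>_def)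
    show ?thesis
    proof (cases "\<rho> = {#}")
      case True
      have "form_graft n (\<Phi> s t \<rho>) (\<beta> j t) \<sigma> = form_graft n (\<lambda>_. 0) (\<beta> j t) \<sigma>"
        using True by (intro form_graft_cong) (auto simp: \<Phi>_def forests_def)
      also have "\<dots> = 0" by (simp add: form_graft_sum)
      finally show ?thesis unfolding c using True Yc[OF st] Bb[OF st, of j] d by (simp add: \<Phi>_def)
    next
      case False
      have "form_graft n (\<Phi> s t \<rho>) (\<beta> j t) \<sigma> = form_graft n (B s \<rho> t) (\<beta> j t) \<sigma>"
        using False by (intro form_graft_cong) (auto simp: \<Phi>_def forests_def)
      moreover have "\<Phi> s t {#Node j \<rho>#} \<sigma> = B s {#Node j \<rho>#} t \<sigma>" using d by (simp add: \<Phi>_def)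
      moreover have "deg \<rho> \<le> n - 1" using d by simp
      ultimately show ?thesis unfolding c using Bn[OF st pos[OF False]] by simp
    qed
  qed
  have "lift n 0 T ?Z \<beta> \<Phi>"
  proof
    fix s t :: real and \<rho>\<^sub>1 \<rho>\<^sub>2 :: "'e forest" and \<sigma> :: "'d forest"
    assume st: "0 \<le> s" "s \<le> t" "t \<le> T" and d: "deg \<rho>\<^sub>1 + deg \<rho>\<^sub>2 \<le> n" "deg \<sigma> \<le> n"
    show "\<Phi> s t (\<rho>\<^sub>1 + \<rho>\<^sub>2) \<sigma> = conv n (+) (\<lambda>_. True) (\<Phi> s t \<rho>\<^sub>1) (\<Phi> s t \<rho>\<^sub>2) \<sigma>"
    proof (cases "\<sigma> = {#}")
      case True
      then show ?thesis by (simp add: conv_plus_empty) (simp add: \<Phi>_def characters_plus[OF Yc[OF st] d(1)])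
    next
      case False
      have unit: "\<Phi> s t {#} = conv_unit" using emp[OF st] by (simp add: fun_eq_iff conv_unit_def)
      consider "\<rho>\<^sub>1 = {#}" | "\<rho>\<^sub>2 = {#}" | "\<rho>\<^sub>1 \<noteq> {#}" "\<rho>\<^sub>2 \<noteq> {#}" by blast
      then show ?thesis
      proof cases
        case 1
        then show ?thesis using d by (simp add: unit conv_unit_left)
      next
        case 2
        then show ?thesis using d by (simp add: unit conv_unit_right)
      next
        case 3
        have "form_times n (\<Phi> s t \<rho>\<^sub>1) (\<Phi> s t \<rho>\<^sub>2) \<sigma> = form_times n (B s \<rho>\<^sub>1 t) (B s \<rho>\<^sub>2 t) \<sigma>"
          using 3 by (intro form_times_cong) (auto simp: \<Phi>_def forests_def)
        then show ?thesis
          unfolding conv_plus_form_times[OF d(2) False]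
          using 3 False Bp[OF st pos pos d(1)] by (simp add: \<Phi>_def)
      qed
    qed
  next
    fix s t u j and \<rho> :: "'e forest" assume st: "0 \<le> s" "s \<le> t" "t \<le> u" "u \<le> T" and d: "deg \<rho> < n"
    show "(partition_sum (\<lambda>x z. pair0 n (\<Phi> s x {#Node j \<rho>#}) (?Z x z)) \<longlongrightarrow>
        \<Phi> s u {#Node j \<rho>#} {#} - \<Phi> s t {#Node j \<rho>#} {#}) (mesh_to_zero t u)"
    proof (cases "\<rho> = {#}")
      case True
      have "(partition_sum (\<lambda>x z. pair0 n (\<beta> j x) (?Z x z)) \<longlongrightarrow> y u $ j - y t $ j) (mesh_to_zero t u)"
        by (rule mesh_limit_diff[OF \<beta>lim[of t j] \<beta>lim[of u j]]) (use st in auto)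
      then have "(partition_sum (\<lambda>x z. pair0 n (\<Phi> s x {#Node j \<rho>#}) (?Z x z)) \<longlongrightarrow> y u $ j - y t $ j) (mesh_to_zero t u)"
        by (rule mesh_limit_cong) (use True st Bb in \<open>auto intro!: pair0_cong simp: \<Phi>_def\<close>)
      then show ?thesis using True st by (simp add: \<Phi>_def Yb)
    next
      case False
      have l: "(partition_sum (\<lambda>x z. pair0 n (\<Phi> s x {#Node j \<rho>#}) (?Z x z)) \<longlongrightarrow> Y s t {#Node j \<rho>#}) (mesh_to_zero s t)"
        if "s \<le> t" "t \<le> T" for t
      proof -
        have "deg \<rho> \<le> n - 1" using d by simp
        then have "(partition_sum (\<lambda>x z. pair0 n (B s {#Node j \<rho>#} x) (?Z x z)) \<longlongrightarrow> Y s t {#Node j \<rho>#}) (mesh_to_zero s t)"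
          using Yn[OF st(1) that pos[OF False]] unfolding has_form_integral_def form_apply_pair0 by simp
        then show ?thesis
          by (rule mesh_limit_cong) (auto intro!: pair0_cong simp: \<Phi>_def)
      qed
      show ?thesis using mesh_limit_diff[OF l[of t] l[of u]] st by (simp add: \<Phi>_def)
    qed
  next
    fix s j and \<rho> :: "'e forest" assume s: "0 \<le> s" "s \<le> T" and d: "deg \<rho> < n"
    show "\<Phi> s s {#Node j \<rho>#} {#} = 0"
    proof (cases "\<rho> = {#}")
      case True
      then show ?thesis using s by (simp add: \<Phi>_def Yb)
    next
      case False
      have "deg \<rho> \<le> n - 1" using d by simp
      then show ?thesis
        using Yn[OF s(1) order_refl s(2) pos[OF False]] mesh_limit_unique[OF _ mesh_limit_refl]
        unfolding has_form_integral_def by (auto simp: \<Phi>_def)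
    qed
  qed (use emp node in auto)
  moreover have "\<forall>s t. 0 \<le> s \<and> s \<le> t \<and> t \<le> T \<longrightarrow> Y s t \<in> characters n \<and> (\<forall>\<rho>. \<Phi> s t \<rho> {#} = Y s t \<rho>)"
    using Yc by (auto simp: \<Phi>_def)
  ultimately show ?thesis by blast
qed

text \<open>Existence of the rough integral is thereby reduced to \<open>can_lift_is_lift\<close>:
  values and one-forms are read off from a lift.\<close>

lemma integral_of_lift:
  fixes f :: "real ^ 'd::finite \<Rightarrow> (real ^ 'd) \<Rightarrow>\<^sub>L (real ^ 'e::finite)"
    and X :: "real \<Rightarrow> 'd forest \<Rightarrow> real"
  assumes n1: "1 \<le> level p" and T: "0 < T"
  defines "n \<equiv> level p"
  defines "\<beta> \<equiv> (\<lambda>j t \<rho>. integrand n f X t \<rho> $ j)"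
  assumes "lift n 0 T (increment n X) \<beta> \<Phi>"
  shows "\<exists>Y. is_rough_integral p T f X Y"
proof -
  let ?Z = "increment n X"
  interpret lift n 0 T ?Z \<beta> \<Phi> by fact
  define Y where "Y s t \<rho> = (if deg \<rho> \<le> n then \<Phi> s t \<rho> {#} else 0)" for s t \<rho>
  \<comment> \<open>The clauses for \<open>B\<close> are equations between functions on all forests.
    Cutting \<open>B\<close> off outside the nonempty forests of degree at most \<open>n\<close>
    makes both sides vanish there.\<close>
  define B where "B s \<rho> t \<sigma> = (if \<sigma> = {#} \<or> n < deg \<sigma> then 0 else \<Phi> s t \<rho> \<sigma>)" for s t \<rho> \<sigma>
  define y where "y t = (\<chi> j. \<Phi> 0 t {#bullet j#} {#})" for t
  have n: "1 \<le> n" using n1 by (simp add: n_def)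
  have \<beta>0: "\<beta> j t \<rho> = 0" if "\<not> single \<rho>" for j t \<rho> using that by (simp add: \<beta>_def integrand_not_single)
  have \<beta>1: "\<beta> j t \<rho> = 0" if "n < deg \<rho>" for j t \<rho> using that by (simp add: \<beta>_def integrand_high)
  have bul: "\<Phi> s t {#bullet j#} \<sigma> = \<beta> j t \<sigma>" if st: "0 \<le> s" "s \<le> t" "t \<le> T" and "\<sigma> \<noteq> {#}" "deg \<sigma> \<le> n" for s t j \<sigma>
  proof -
    have "\<Phi> s t {#bullet j#} \<sigma> = conv n graftf single (\<Phi> s t {#}) (\<beta> j t) \<sigma>" using that n by (intro lift_node) auto
    also have "\<dots> = \<Phi> s t {#} {#} * \<beta> j t \<sigma> + form_graft n (\<Phi> s t {#}) (\<beta> j t) \<sigma>"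
      by (rule conv_graft_form_graft[OF that(5) \<beta>0])
    also have "form_graft n (\<Phi> s t {#}) (\<beta> j t) \<sigma> = form_graft n (\<lambda>_. 0) (\<beta> j t) \<sigma>"
      using st by (intro form_graft_cong) (auto simp: lift_empty forests_def)
    also have "\<dots> = 0" by (simp add: form_graft_sum)
    finally show ?thesis using st by (simp add: lift_empty)
  qed
  have blim: "(partition_sum (\<lambda>x z. pair0 n (\<beta> j x) (?Z x z)) \<longlongrightarrow> \<Phi> s u {#bullet j#} {#} - \<Phi> s t {#bullet j#} {#}) (mesh_to_zero t u)"
    if "0 \<le> s" "s \<le> t" "t \<le> u" "u \<le> T" for s t u j
    by (rule mesh_limit_cong[OF lift_limit[OF that]]) (use n that bul in \<open>auto intro!: pair0_cong\<close>)
  have ylim: "has_form_integral n X (integrand n f X) 0 t (y t)" if "0 \<le> t" "t \<le> T" for t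
    unfolding has_form_integral_def
  proof (rule vec_tendstoI)
    fix j
    show "((\<lambda>D. partition_sum (\<lambda>u v. form_apply n (integrand n f X u) (?Z u v)) D $ j) \<longlongrightarrow> y t $ j) (mesh_to_zero 0 t)"
      using blim[of 0 0 t j] that n lift_start[of 0 "{#}" j]
      by (simp add: partition_sum_nth form_apply_def pair0_def \<beta>_def mult.commute y_def)
  qed
  have main: "rough_step n X \<beta> Y y B s t"
    if st: "0 \<le> s" "s \<le> t" "t \<le> T" for s t
    unfolding rough_step_def
  proof (intro conjI allI impI)
    show "Y s t \<in> characters n"
      by (rule charactersI) (use st in \<open>auto simp: Y_def lift_empty lift_plus_value\<close>)
    fix j
    \<comment> \<open>The integrals of \<beta> from the starting times \<open>s\<close> and 0 have
      the same increment, since both are limits of the same sums over [s, t].\<close>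
    have "\<Phi> s t {#bullet j#} {#} - \<Phi> s s {#bullet j#} {#} = \<Phi> 0 t {#bullet j#} {#} - \<Phi> 0 s {#bullet j#} {#}"
      using mesh_limit_unique[OF blim[of s s t j] blim[of 0 s t j]] st by simp
    then show "Y s t {#bullet j#} = y t $ j - y s $ j"
      using n st lift_start[of s "{#}" j] by (simp add: Y_def y_def)
    show "B s {#bullet j#} t = \<beta> j t"
      using st by (auto simp: B_def bul \<beta>0 \<beta>1 fun_eq_iff)
  next
    fix j and \<rho> :: "'e forest" assume "1 \<le> deg \<rho> \<and> deg \<rho> \<le> n - 1"
    then have d: "deg \<rho> < n" using n by linarith
    have "(partition_sum (\<lambda>x z. pair0 n (\<Phi> s x {#Node j \<rho>#}) (?Z x z)) \<longlongrightarrow> Y s t {#Node j \<rho>#}) (mesh_to_zero s t)"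
      using lift_limit[OF st(1) order_refl st(2,3) d, of j] lift_start[of s \<rho> j] st d by (simp add: Y_def)
    then show "has_form_integral n X (B s {#Node j \<rho>#}) s t (Y s t {#Node j \<rho>#})"
      unfolding has_form_integral_def form_apply_pair0
      by (rule mesh_limit_cong) (auto intro!: pair0_cong simp: B_def)
    show "B s {#Node j \<rho>#} t = (\<lambda>\<rho>'. Y s t \<rho> * \<beta> j t \<rho>' + form_graft n (B s \<rho> t) (\<beta> j t) \<rho>')"
    proof
      fix \<sigma> :: "'d forest"
      show "B s {#Node j \<rho>#} t \<sigma> = Y s t \<rho> * \<beta> j t \<sigma> + form_graft n (B s \<rho> t) (\<beta> j t) \<sigma>"
      proof (cases "\<sigma> = {#} \<or> n < deg \<sigma>")
        case True
        have "B s {#Node j \<rho>#} t \<sigma> = 0" "\<beta> j t \<sigma> = 0" using True \<beta>0 \<beta>1 by (auto simp: B_def)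
        then show ?thesis by (simp add: form_graft_zero[OF True])
      next
        case False
        have "form_graft n (B s \<rho> t) (\<beta> j t) \<sigma> = form_graft n (\<Phi> s t \<rho>) (\<beta> j t) \<sigma>"
          by (intro form_graft_cong) (auto simp: B_def forests_def)
        moreover have "B s {#Node j \<rho>#} t \<sigma> = conv n graftf single (\<Phi> s t \<rho>) (\<beta> j t) \<sigma>"
          using False st d by (simp add: B_def lift_node)
        ultimately show ?thesis using False d conv_graft_form_graft[of \<sigma> n "\<beta> j t" "\<Phi> s t \<rho>"] \<beta>0 by (simp add: Y_def)
      qed
    qed
  next
    fix \<rho>\<^sub>1 \<rho>\<^sub>2 :: "'e forest" assume d: "1 \<le> deg \<rho>\<^sub>1 \<and> 1 \<le> deg \<rho>\<^sub>2 \<and> deg \<rho>\<^sub>1 + deg \<rho>\<^sub>2 \<le> n"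
    show "B s (\<rho>\<^sub>1 + \<rho>\<^sub>2) t = (\<lambda>\<rho>. Y s t \<rho>\<^sub>1 * B s \<rho>\<^sub>2 t \<rho> + Y s t \<rho>\<^sub>2 * B s \<rho>\<^sub>1 t \<rho> +
               form_times n (B s \<rho>\<^sub>1 t) (B s \<rho>\<^sub>2 t) \<rho>)"
    proof
      fix \<sigma> :: "'d forest"
      show "B s (\<rho>\<^sub>1 + \<rho>\<^sub>2) t \<sigma> = Y s t \<rho>\<^sub>1 * B s \<rho>\<^sub>2 t \<sigma> + Y s t \<rho>\<^sub>2 * B s \<rho>\<^sub>1 t \<sigma> + form_times n (B s \<rho>\<^sub>1 t) (B s \<rho>\<^sub>2 t) \<sigma>"
      proof (cases "\<sigma> = {#} \<or> n < deg \<sigma>")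
        case True
        then have "B s \<kappa> t \<sigma> = 0" for \<kappa> by (auto simp: B_def)
        then show ?thesis by (simp add: form_times_zero[OF True])
      next
        case False
        have "form_times n (B s \<rho>\<^sub>1 t) (B s \<rho>\<^sub>2 t) \<sigma> = form_times n (\<Phi> s t \<rho>\<^sub>1) (\<Phi> s t \<rho>\<^sub>2) \<sigma>"
          by (intro form_times_cong) (auto simp: B_def forests_def)
        then show ?thesis using False d st conv_plus_form_times[of \<sigma> n "\<Phi> s t \<rho>\<^sub>1" "\<Phi> s t \<rho>\<^sub>2"]
          by (simp add: B_def Y_def lift_plus)
      qed
    qed
  qed
  have "is_rough_integral p T f X Y"
    unfolding is_rough_integral_iff n_def[symmetric] \<beta>_def[symmetric]
    by (rule exI[of _ y], rule exI[of _ B]) (use ylim main in blast)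
  then show ?thesis by blast
qed

section \<open>Variation as a control\<close>

lemma partitions_exist: "s \<le> t \<Longrightarrow> partitions s t \<noteq> {}"
  using partition_exists[of s t 1] by auto

lemma partitions_join:
  assumes "D \<in> partitions s u" "E \<in> partitions u t"
  shows "\<exists>F\<in>partitions s t. partition_sum g F = partition_sum g D + (partition_sum g E :: real)"
proof -
  have "D \<noteq> []" "last D = u" using assms(1) by (auto simp: partitions_def)
  then obtain es where D: "D = es @ [u]" by (metis append_butlast_last_id)
  obtain ds where E: "E = u # ds" using assms(2) by (cases E) (auto dest: partitions_hd)
  show ?thesis
  proof
    show "es @ u # ds \<in> partitions s t" by (rule iffD2[OF partitions_append]) (use assms D E in simp)
    show "partition_sum g (es @ u # ds) = partition_sum g D + partition_sum g E"
      using partition_sum_append[of g es u ds] D E by simp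
  qed
qed

lemma partitions_trivial: "s \<le> t \<Longrightarrow> (if s = t then [s] else [s, t]) \<in> partitions s t"
  by (simp add: partitions_Cons)

lemma partitions_extend:
  fixes g :: "real \<Rightarrow> real \<Rightarrow> real"
  assumes g: "\<And>u v. a \<le> u \<Longrightarrow> u \<le> v \<Longrightarrow> v \<le> b \<Longrightarrow> 0 \<le> g u v"
    and D: "D \<in> partitions s t" "a \<le> s" "t \<le> b"
  shows "\<exists>E\<in>partitions a b. partition_sum g D \<le> partition_sum g E"
proof -
  have st: "s \<le> t" using D(1) by (rule partitions_le)
  let ?A = "if a = s then [a] else [a, s]" and ?B = "if t = b then [t] else [t, b]"
  have A: "?A \<in> partitions a s" and B: "?B \<in> partitions t b" using D by (intro partitions_trivial; simp)+
  obtain F where F: "F \<in> partitions a t" "partition_sum g F = partition_sum g ?A + partition_sum g D"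
    using partitions_join[OF A D(1)] by blast
  obtain E where E: "E \<in> partitions a b" "partition_sum g E = partition_sum g F + partition_sum g ?B"
    using partitions_join[OF F(1) B] by blast
  have "0 \<le> partition_sum g ?A" "0 \<le> partition_sum g ?B"
    using A B D st by (auto intro!: partition_sum_nonneg g)
  then show ?thesis using E F by (intro bexI[of _ E]) auto
qed

text \<open>A real supremum, meaningful under the bounds of the next locale. Unlike in
  \<open>p_var\<close> no root is taken, which is what makes it superadditive.\<close>

definition var_ctl :: "(real \<Rightarrow> real \<Rightarrow> real) \<Rightarrow> real \<Rightarrow> real \<Rightarrow> real" where
  "var_ctl g s t = (SUP D\<in>partitions s t. partition_sum g D)"

locale bounded_variation =
  fixes g :: "real \<Rightarrow> real \<Rightarrow> real" and a b K :: real
  assumes g_nonneg: "\<And>u v. a \<le> u \<Longrightarrow> u \<le> v \<Longrightarrow> v \<le> b \<Longrightarrow> 0 \<le> g u v"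
    and g_bounded: "\<And>D. D \<in> partitions a b \<Longrightarrow> partition_sum g D \<le> K"
begin

lemma sub_bounded: "D \<in> partitions s t \<Longrightarrow> a \<le> s \<Longrightarrow> t \<le> b \<Longrightarrow> partition_sum g D \<le> K"
proof -
  assume D: "D \<in> partitions s t" "a \<le> s" "t \<le> b"
  obtain E where "E \<in> partitions a b" "partition_sum g D \<le> partition_sum g E"
    using partitions_extend[where a = a and b = b and g = g and D = D and s = s and t = t] g_nonneg D by blast
  then show ?thesis using g_bounded[of E] by linarith
qed

lemma var_upper: "D \<in> partitions s t \<Longrightarrow> a \<le> s \<Longrightarrow> t \<le> b \<Longrightarrow> partition_sum g D \<le> var_ctl g s t"
  unfolding var_ctl_def by (rule cSUP_upper) (auto intro!: bdd_aboveI2[where M = K] sub_bounded)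

lemma var_least: "s \<le> t \<Longrightarrow> (\<And>D. D \<in> partitions s t \<Longrightarrow> partition_sum g D \<le> C) \<Longrightarrow> var_ctl g s t \<le> C"
  unfolding var_ctl_def using partitions_exist by (intro cSUP_least) auto

lemma var_le_K: "a \<le> s \<Longrightarrow> s \<le> t \<Longrightarrow> t \<le> b \<Longrightarrow> var_ctl g s t \<le> K"
  by (rule var_least) (auto intro: sub_bounded)

lemma var_ge: "a \<le> s \<Longrightarrow> s < t \<Longrightarrow> t \<le> b \<Longrightarrow> g s t \<le> var_ctl g s t"
  using var_upper[of "[s, t]" s t] by (simp add: partitions_Cons)

lemma var_control: "control a b (var_ctl g)"
  unfolding control_def
proof (intro conjI allI impI; elim conjE)
  fix s t assume st: "a \<le> s" "s \<le> t" "t \<le> b"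
  obtain D where D: "D \<in> partitions s t" using partitions_exist[OF st(2)] by blast
  have "0 \<le> partition_sum g D" using st by (intro partition_sum_nonneg[OF D] g_nonneg) auto
  also have "\<dots> \<le> var_ctl g s t" using var_upper[OF D] st by simp
  finally show "0 \<le> var_ctl g s t" .
next
  fix s u t assume st: "a \<le> s" "s \<le> u" "u \<le> t" "t \<le> b"
  have *: "partition_sum g D + partition_sum g E \<le> var_ctl g s t" if "D \<in> partitions s u" "E \<in> partitions u t" for D E
    using partitions_join[OF that, of g] var_upper st by force
  have "var_ctl g u t \<le> var_ctl g s t - partition_sum g D" if D: "D \<in> partitions s u" for D
  proof (rule var_least[OF st(3)])
    fix E assume "E \<in> partitions u t"
    from *[OF D this] show "partition_sum g E \<le> var_ctl g s t - partition_sum g D" by simp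
  qed
  note ** = this
  have "var_ctl g s u \<le> var_ctl g s t - var_ctl g u t"
  proof (rule var_least[OF st(2)])
    fix D assume "D \<in> partitions s u"
    from **[OF this] show "partition_sum g D \<le> var_ctl g s t - var_ctl g u t" by simp
  qed
  then show "var_ctl g s u + var_ctl g u t \<le> var_ctl g s t" by simp
qed

end

section \<open>Homogeneous norms\<close>

lemma forests_nonempty: "1 \<le> n \<Longrightarrow> (forests n :: 'l forest set) \<noteq> {}"
proof -
  assume "1 \<le> n"
  then have "{#bullet undefined#} \<in> (forests n :: 'l forest set)" by (simp add: forests_def)
  then show ?thesis by blast
qed

lemma char_norm_nonneg: "1 \<le> n \<Longrightarrow> 0 \<le> char_norm n a"
proof -
  assume n: "1 \<le> n"
  obtain \<rho> :: "'a forest" where \<rho>: "\<rho> \<in> forests n" using forests_nonempty[OF n] by blast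
  have "0 \<le> \<bar>a \<rho>\<bar> powr (1 / real (deg \<rho>))" by simp
  also have "\<dots> \<le> char_norm n a" unfolding char_norm_def using \<rho> finite_forests by (intro Max_ge) auto
  finally show ?thesis .
qed

lemma char_norm_ge:
  assumes "\<rho> \<in> forests n"
  shows "\<bar>a \<rho>\<bar> \<le> char_norm n a ^ deg \<rho>"
proof -
  have d: "0 < deg \<rho>" using assms by (simp add: forests_def)
  have "(\<bar>a \<rho>\<bar> powr (1 / real (deg \<rho>))) ^ deg \<rho> \<le> char_norm n a ^ deg \<rho>"
    unfolding char_norm_def using assms finite_forests by (intro power_mono Max_ge) auto
  moreover have "(\<bar>a \<rho>\<bar> powr (1 / real (deg \<rho>))) ^ deg \<rho> = \<bar>a \<rho>\<bar>"
  proof (cases "a \<rho> = 0")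
    case False
    then have "(\<bar>a \<rho>\<bar> powr (1 / real (deg \<rho>))) ^ deg \<rho> = (\<bar>a \<rho>\<bar> powr (1 / real (deg \<rho>))) powr real (deg \<rho>)"
      by (simp add: powr_realpow)
    also have "\<dots> = \<bar>a \<rho>\<bar>" using False d by (simp add: powr_powr del: deg_eq_0_iff)
    finally show ?thesis .
  qed (use d in simp)
  ultimately show ?thesis by simp
qed

lemma char_norm_le:
  assumes n: "1 \<le> n" and C: "0 \<le> C" and le: "\<And>\<rho>. \<rho> \<in> forests n \<Longrightarrow> \<bar>a \<rho>\<bar> \<le> C ^ deg \<rho>"
  shows "char_norm n a \<le> C"
  unfolding char_norm_def
proof (rule Max.boundedI)
  fix x assume "x \<in> (\<lambda>\<rho>. \<bar>a \<rho>\<bar> powr (1 / real (deg \<rho>))) ` forests n"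
  then obtain \<rho> where \<rho>: "\<rho> \<in> forests n" "x = \<bar>a \<rho>\<bar> powr (1 / real (deg \<rho>))" by blast
  have d: "0 < deg \<rho>" using \<rho> by (simp add: forests_def)
  have "x \<le> (C ^ deg \<rho>) powr (1 / real (deg \<rho>))" unfolding \<rho>(2) using le[OF \<rho>(1)] by (intro powr_mono2) auto
  also have "\<dots> = C"
  proof (cases "C = 0")
    case False
    then have "C ^ deg \<rho> = C powr real (deg \<rho>)" using C by (simp add: powr_realpow)
    then show ?thesis using False C d by (simp add: powr_powr del: deg_eq_0_iff)
  qed (use d in simp)
  finally show "x \<le> C" .
qed (use finite_forests forests_nonempty[OF n] in auto)

lemma powr_le_imp_le_powr:
  fixes x y r :: real
  assumes "0 \<le> x" "x powr (1 / r) \<le> y" "0 < r"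
  shows "x \<le> y powr r"
proof -
  have "(x powr (1 / r)) powr r \<le> y powr r" using assms by (intro powr_mono2) auto
  then show ?thesis using assms by (simp add: powr_powr)
qed

lemma p_var_sum_le:
  assumes p: "0 < p" and fin: "p_var p Z s t < \<infinity>" and D: "D \<in> partitions s t"
  shows "partition_sum (\<lambda>u v. char_norm (level p) (Z u v) powr p) D \<le> enn2real (p_var p Z s t) powr p"
proof -
  let ?S = "partition_sum (\<lambda>u v. char_norm (level p) (Z u v) powr p) D"
  have "0 \<le> ?S" using D by (rule partition_sum_nonneg) simp
  moreover have "ennreal (?S powr (1 / p)) \<le> p_var p Z s t"
    unfolding p_var_def using D by (rule SUP_upper)
  then have "?S powr (1 / p) \<le> enn2real (p_var p Z s t)"
    using fin by (metis ennreal_enn2real ennreal_le_iff enn2real_nonneg infinity_ennreal_def)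
  ultimately show ?thesis using p by (rule powr_le_imp_le_powr)
qed

lemma p_var_mono:
  assumes "a \<le> s" "t \<le> b" and p: "0 < p"
  shows "p_var p Z s t \<le> p_var p Z a b"
  unfolding p_var_def
proof (rule SUP_mono)
  let ?g = "\<lambda>u v. char_norm (level p) (Z u v) powr p"
  fix D assume D: "D \<in> partitions s t"
  have "0 \<le> partition_sum ?g D" using D by (rule partition_sum_nonneg) simp
  moreover obtain E where "E \<in> partitions a b" "partition_sum ?g D \<le> partition_sum ?g E"
    using partitions_extend[OF _ D assms(1,2), of ?g] by auto
  ultimately show "\<exists>E\<in>partitions a b. ennreal (partition_sum ?g D powr (1 / p)) \<le> ennreal (partition_sum ?g E powr (1 / p))"
    using p by (intro bexI[of _ E] ennreal_leI powr_mono2) auto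
qed

lemma level_ge1: "1 \<le> p \<Longrightarrow> 1 \<le> level p"
  and level_le: "1 \<le> p \<Longrightarrow> real (level p) \<le> p"
  and level_gt: "1 \<le> p \<Longrightarrow> p < real (level p) + 1"
  unfolding level_def by linarith+

text \<open>The bound depends only on \<open>n\<close> and the label type, so the constants built
  from it involve neither the path nor the function.\<close>

lemma ex_forest_bound:
  "\<exists>M. real (card (fs n :: 'l::finite forest set)) \<le> M \<and> (\<forall>\<rho> :: 'l forest. deg \<rho> \<le> n \<longrightarrow> real (size (coproduct \<rho>)) \<le> M)"
proof -
  let ?S = "\<Sum>\<rho>\<in>(fs n :: 'l forest set). real (size (coproduct \<rho>))"
  have "real (size (coproduct \<rho>)) \<le> ?S" if "deg \<rho> \<le> n" for \<rho> :: "'l forest"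
    using that by (intro member_le_sum) auto
  moreover have "0 \<le> ?S" by (intro sum_nonneg) auto
  ultimately show ?thesis
    by (intro exI[of _ "real (card (fs n :: 'l forest set)) + ?S"]) (auto intro: add_increasing)
qed

section \<open>Increments of branched rough paths\<close>

lemma continuous_on_cop_sum:
  assumes "\<And>x y. (x, y) \<in># coproduct \<rho> \<Longrightarrow> continuous_on S (\<lambda>z. F z x y)"
  shows "continuous_on S (\<lambda>z. cop_sum \<rho> (F z))"
proof -
  have "continuous_on S (\<lambda>z. \<Sum>(x, y)\<in>#A. F z x y)" if "\<And>x y. (x, y) \<in># A \<Longrightarrow> continuous_on S (\<lambda>z. F z x y)" for A
    using that
  proof (induction A)
    case (add c A)
    obtain x y where c: "c = (x, y)" by (cases c)
    have "continuous_on S (\<lambda>z. \<Sum>(x, y)\<in>#A. F z x y)" by (rule add.IH) (use add.prems in auto)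
    moreover have "continuous_on S (\<lambda>z. F z x y)" by (rule add.prems) (simp add: c)
    ultimately show ?case unfolding c by (simp add: continuous_on_add)
  qed simp
  then show ?thesis unfolding cop_sum_def using assms by blast
qed

locale rough_path =
  fixes p T :: real and X :: "real \<Rightarrow> 'd::finite forest \<Rightarrow> real"
  assumes p1: "1 \<le> p" and T0: "0 < T" and rp: "branched_rough_path p T X"
begin

abbreviation "n \<equiv> level p"
abbreviation "Z \<equiv> increment n X"

lemma Xc: "X ` {0..T} \<subseteq> characters n"
  using rp by (simp add: branched_rough_path_def)

lemma Z_in: "0 \<le> s \<Longrightarrow> s \<le> t \<Longrightarrow> t \<le> T \<Longrightarrow> Z s t \<in> characters n"
  by (rule increment_in[OF Xc]) auto

lemma Z_chen: "0 \<le> s \<Longrightarrow> s \<le> t \<Longrightarrow> t \<le> u \<Longrightarrow> u \<le> T \<Longrightarrow> star n (Z s t) (Z t u) = Z s u"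
  by (rule increment_chen[OF Xc]) auto

lemma Z_refl: "0 \<le> s \<Longrightarrow> s \<le> T \<Longrightarrow> Z s s = (\<lambda>\<rho>. if \<rho> = {#} then 1 else 0)"
  by (rule increment_self[OF Xc]) auto

lemma X_continuous: "continuous_on {0..T} (\<lambda>s. X s \<kappa>)"
proof -
  have "continuous_on {0..T} X" using rp by (simp add: branched_rough_path_def)
  then show ?thesis by (rule continuous_on_product_then_coordinatewise)
qed

lemma star_inv_continuous: "continuous_on {0..T} (\<lambda>s. star_inv (X s) \<rho>)"
proof (induction "deg \<rho>" arbitrary: \<rho> rule: less_induct)
  case less
  show ?case
  proof (cases "\<rho> = {#}")
    case False
    show ?thesis
      unfolding star_inv_rec[OF False]
    proof (intro continuous_on_minus continuous_on_cop_sum)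
      fix x y assume "(x, y) \<in># coproduct \<rho>"
      note d = coproduct_deg[OF this]
      show "continuous_on {0..T} (\<lambda>s. of_bool (y \<noteq> {#}) * (star_inv (X s) x * X s y))"
      proof (cases "y = {#}")
        case False
        then have "0 < deg y" using deg_eq_0_iff[of y] by linarith
        then have "deg x < deg \<rho>" using d by simp
        then show ?thesis using less X_continuous by (intro continuous_on_mult continuous_on_const) auto
      qed simp
    qed
  qed simp
qed

text \<open>An increment is a polynomial in the coordinates of two path values. It is uniformly
  continuous on the square of times and vanishes on the diagonal.\<close>

lemma Z_uniform:
  assumes \<rho>: "\<rho> \<noteq> {#}" "deg \<rho> \<le> n" and \<epsilon>: "0 < \<epsilon>"
  shows "\<exists>\<delta>>0. \<forall>u v. 0 \<le> u \<longrightarrow> u \<le> v \<longrightarrow> v \<le> T \<longrightarrow> v - u < \<delta> \<longrightarrow> \<bar>Z u v \<rho>\<bar> < \<epsilon>"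
proof -
  let ?S = "{0..T} \<times> {0..T}"
  let ?F = "\<lambda>z. cop_sum \<rho> (\<lambda>x y. star_inv (X (fst z)) x * X (snd z) y)"
  have eq: "Z u v \<rho> = ?F (u, v)" if "0 \<le> u" "u \<le> T" "0 \<le> v" "v \<le> T" for u v
  proof -
    have "X u \<in> characters n" using Xc that by auto
    then show ?thesis
      unfolding increment_def char_group_simps star_def using \<rho>(2)
      by (auto intro!: cop_sum_cong simp: inv_char_group dest!: coproduct_fst_deg)
  qed
  have "continuous_on ?S ?F"
  proof (intro continuous_on_cop_sum continuous_on_mult)
    fix x y :: "'d forest"
    show "continuous_on ?S (\<lambda>z. X (snd z) y)"
      by (rule continuous_on_compose2[OF X_continuous]) (auto intro: continuous_intros)
    show "continuous_on ?S (\<lambda>z. star_inv (X (fst z)) x)"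
      by (rule continuous_on_compose2[OF star_inv_continuous]) (auto intro: continuous_intros)
  qed
  then have "uniformly_continuous_on ?S ?F"
    by (intro compact_uniformly_continuous compact_Times) auto
  then obtain \<delta> where \<delta>: "0 < \<delta>" "\<And>z z'. z \<in> ?S \<Longrightarrow> z' \<in> ?S \<Longrightarrow> dist z' z < \<delta> \<Longrightarrow> dist (?F z') (?F z) < \<epsilon>"
    unfolding uniformly_continuous_on_def using \<epsilon> by meson
  have "\<bar>Z u v \<rho>\<bar> < \<epsilon>" if "0 \<le> u" "u \<le> v" "v \<le> T" "v - u < \<delta>" for u v
  proof -
    have "dist (?F (u, v)) (?F (u, u)) < \<epsilon>"
      using that by (intro \<delta>(2)) (auto simp: dist_Pair_Pair dist_real_def)
    moreover have "?F (u, v) = Z u v \<rho>" "?F (u, u) = 0"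
      using eq[of u v] eq[of u u] that Z_refl[of u] \<rho>(1) by auto
    ultimately show ?thesis by (simp add: dist_real_def)
  qed
  then show ?thesis using \<delta>(1) by blast
qed

lemma char_norm_uniform:
  assumes \<epsilon>: "0 < \<epsilon>"
  shows "\<exists>\<delta>>0. \<forall>u v. 0 \<le> u \<longrightarrow> u \<le> v \<longrightarrow> v \<le> T \<longrightarrow> v - u < \<delta> \<longrightarrow> char_norm n (Z u v) \<le> \<epsilon>"
proof -
  have "\<exists>\<delta>>0. \<forall>u v. 0 \<le> u \<longrightarrow> u \<le> v \<longrightarrow> v \<le> T \<longrightarrow> v - u < \<delta> \<longrightarrow> \<bar>Z u v \<rho>\<bar> < \<epsilon> ^ deg \<rho>" if "\<rho> \<in> forests n" for \<rho>
    using that \<epsilon> by (intro Z_uniform) (auto simp: forests_def)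
  then obtain d where d: "\<And>\<rho>. \<rho> \<in> forests n \<Longrightarrow> 0 < d \<rho>"
    "\<And>\<rho> u v. \<rho> \<in> forests n \<Longrightarrow> 0 \<le> u \<Longrightarrow> u \<le> v \<Longrightarrow> v \<le> T \<Longrightarrow> v - u < d \<rho> \<Longrightarrow> \<bar>Z u v \<rho>\<bar> < \<epsilon> ^ deg \<rho>"
    by metis
  define \<delta> where "\<delta> = Min (d ` forests n)"
  have ne: "(forests n :: 'd forest set) \<noteq> {}" using level_ge1[OF p1] by (rule forests_nonempty)
  have \<delta>: "0 < \<delta>" "\<And>\<rho>. \<rho> \<in> forests n \<Longrightarrow> \<delta> \<le> d \<rho>"
  proof -
    have fin: "finite (d ` (forests n :: 'd forest set))" by (rule finite_imageI[OF finite_forests])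
    show "0 < \<delta>" unfolding \<delta>_def using d(1) ne by (subst Min_gr_iff[OF fin]) auto
    show "\<delta> \<le> d \<rho>" if "\<rho> \<in> forests n" for \<rho> unfolding \<delta>_def using that by (intro Min_le[OF fin]) auto
  qed
  have "char_norm n (Z u v) \<le> \<epsilon>" if "0 \<le> u" "u \<le> v" "v \<le> T" "v - u < \<delta>" for u v
  proof (rule char_norm_le[OF level_ge1[OF p1]])
    fix \<rho> :: "'d forest" assume \<rho>: "\<rho> \<in> forests n"
    have "v - u < d \<rho>" using that(4) \<delta>(2)[OF \<rho>] by linarith
    from d(2)[OF \<rho> that(1-3) this] show "\<bar>Z u v \<rho>\<bar> \<le> \<epsilon> ^ deg \<rho>" by simp
  qed (use \<epsilon> in simp)
  then show ?thesis using \<delta>(1) by blast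
qed

definition c0 :: "real \<Rightarrow> real \<Rightarrow> real" where "c0 u v = char_norm n (Z u v)"

text \<open>The variation exponent \<open>r\<close> is separate from the truncation level:
  \<open>r = p\<close> carries the quantitative bound, and any \<open>r\<close> above
  \<open>p\<close> gives a control that is small on short intervals.\<close>

definition \<omega> :: "real \<Rightarrow> real \<Rightarrow> real \<Rightarrow> real" where "\<omega> r = var_ctl (\<lambda>u v. c0 u v powr r)"

lemma c0_nonneg: "0 \<le> c0 u v"
  unfolding c0_def using level_ge1[OF p1] by (rule char_norm_nonneg)

lemma bv_p: "bounded_variation (\<lambda>u v. c0 u v powr p) 0 T (enn2real (p_var p Z 0 T) powr p)"
  using p_var_sum_le[of p Z 0 T] p1 rp by unfold_locales (auto simp: c0_def branched_rough_path_def)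

lemma bv_q:
  assumes "p \<le> q"
  shows "\<exists>K. bounded_variation (\<lambda>u v. c0 u v powr q) 0 T K"
proof -
  interpret P: bounded_variation "\<lambda>u v. c0 u v powr p" 0 T "enn2real (p_var p Z 0 T) powr p" by (rule bv_p)
  let ?B = "enn2real (p_var p Z 0 T)"
  have c: "c0 u v \<le> ?B" if "0 \<le> u" "u < v" "v \<le> T" for u v
  proof -
    have "c0 u v powr p \<le> ?B powr p" using P.var_ge[of u v] P.var_le_K[of u v] that by simp
    then have "\<not> ?B < c0 u v" using powr_less_mono2[of p ?B "c0 u v"] p1 by auto
    then show ?thesis by simp
  qed
  have "bounded_variation (\<lambda>u v. c0 u v powr q) 0 T (?B powr (q - p) * ?B powr p)"
  proof
    fix D assume D: "D \<in> partitions 0 T"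
    have "partition_sum (\<lambda>u v. c0 u v powr q) D \<le> partition_sum (\<lambda>u v. ?B powr (q - p) * c0 u v powr p) D"
    proof (rule partition_sum_mono[OF D])
      fix u v assume uv: "0 \<le> u" "u < v" "v \<le> T"
      have "c0 u v powr q = c0 u v powr (q - p) * c0 u v powr p" by (simp flip: powr_add)
      also have "\<dots> \<le> ?B powr (q - p) * c0 u v powr p"
        using c[OF uv] c0_nonneg assms by (intro mult_right_mono powr_mono2) auto
      finally show "c0 u v powr q \<le> ?B powr (q - p) * c0 u v powr p" .
    qed
    also have "\<dots> \<le> ?B powr (q - p) * ?B powr p"
      unfolding partition_sum_mult by (intro mult_left_mono P.g_bounded D) auto
    finally show "partition_sum (\<lambda>u v. c0 u v powr q) D \<le> ?B powr (q - p) * ?B powr p" .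
  qed auto
  then show ?thesis ..
qed

lemma \<omega>_control: "p \<le> q \<Longrightarrow> control 0 T (\<omega> q)"
  unfolding \<omega>_def using bv_q bounded_variation.var_control by blast

text \<open>The surplus power \<open>q - p\<close> of an increment, small on short intervals by
  uniform continuity, is taken out of the sum; what remains is bounded by the
  \<open>p\<close>-variation.\<close>

lemma \<omega>_small:
  assumes q: "p < q" and \<epsilon>: "0 < \<epsilon>"
  shows "\<exists>\<delta>>0. \<forall>u v. 0 \<le> u \<longrightarrow> u \<le> v \<longrightarrow> v \<le> T \<longrightarrow> v - u < \<delta> \<longrightarrow> \<omega> q u v \<le> \<epsilon>"
proof -
  interpret P: bounded_variation "\<lambda>u v. c0 u v powr p" 0 T "enn2real (p_var p Z 0 T) powr p" by (rule bv_p)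
  obtain K where "bounded_variation (\<lambda>u v. c0 u v powr q) 0 T K" using bv_q[of q] q by auto
  then interpret Q: bounded_variation "\<lambda>u v. c0 u v powr q" 0 T K .
  define B where "B = enn2real (p_var p Z 0 T) powr p + 1"
  have B: "0 < B" by (simp add: B_def add_nonneg_pos)
  \<comment> \<open>Chosen so that \<open>\<eta> powr (q - p) * B = \<epsilon>\<close>.\<close>
  define \<eta> where "\<eta> = (\<epsilon> / B) powr (1 / (q - p))"
  have \<eta>: "0 < \<eta>" "\<eta> powr (q - p) = \<epsilon> / B" using B \<epsilon> q by (auto simp: \<eta>_def powr_powr)
  obtain \<delta> where \<delta>: "0 < \<delta>" "\<And>u v. 0 \<le> u \<Longrightarrow> u \<le> v \<Longrightarrow> v \<le> T \<Longrightarrow> v - u < \<delta> \<Longrightarrow> c0 u v \<le> \<eta>"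
    using char_norm_uniform[OF \<eta>(1)] unfolding c0_def by blast
  have "\<omega> q u v \<le> \<epsilon>" if uv: "0 \<le> u" "u \<le> v" "v \<le> T" "v - u < \<delta>" for u v
    unfolding \<omega>_def
  proof (rule Q.var_least[OF uv(2)])
    fix D assume D: "D \<in> partitions u v"
    have "partition_sum (\<lambda>u v. c0 u v powr q) D \<le> partition_sum (\<lambda>u v. \<eta> powr (q - p) * c0 u v powr p) D"
    proof (rule partition_sum_mono[OF D])
      fix x y assume xy: "u \<le> x" "x < y" "y \<le> v"
      have "c0 x y powr q = c0 x y powr (q - p) * c0 x y powr p" by (simp flip: powr_add)
      also have "\<dots> \<le> \<eta> powr (q - p) * c0 x y powr p"
        using \<delta>(2)[of x y] xy uv c0_nonneg q by (intro mult_right_mono powr_mono2) auto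
      finally show "c0 x y powr q \<le> \<eta> powr (q - p) * c0 x y powr p" .
    qed
    also have "\<dots> \<le> \<epsilon> / B * B"
      unfolding partition_sum_mult \<eta>(2) using P.sub_bounded[OF D] uv \<epsilon> B by (intro mult_left_mono) (auto simp: B_def)
    finally show "partition_sum (\<lambda>u v. c0 u v powr q) D \<le> \<epsilon>" using B by simp
  qed
  then show ?thesis using \<delta>(1) by blast
qed

lemma Z_bound:
  assumes q: "p \<le> q" and st: "0 \<le> s" "s \<le> t" "t \<le> T" and \<rho>: "deg \<rho> \<le> n"
  shows "\<bar>Z s t \<rho>\<bar> \<le> (\<omega> q s t powr (1 / q)) ^ deg \<rho>"
proof (cases "\<rho> = {#}")
  case True
  then show ?thesis using Z_in[OF st] by simp
next
  case False
  then have f: "\<rho> \<in> forests n" using \<rho> deg_eq_0_iff[of \<rho>] unfolding forests_def by (cases "deg \<rho>") auto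
  show ?thesis
  proof (cases "s = t")
    case True
    then show ?thesis using Z_refl[of t] st False by simp
  next
    case ne: False
    obtain K where "bounded_variation (\<lambda>u v. c0 u v powr q) 0 T K" using bv_q[of q] q by auto
    then interpret Q: bounded_variation "\<lambda>u v. c0 u v powr q" 0 T K .
    have "c0 s t powr q \<le> \<omega> q s t" unfolding \<omega>_def using ne st by (intro Q.var_ge) auto
    then have "(c0 s t powr q) powr (1 / q) \<le> \<omega> q s t powr (1 / q)" using q p1 by (intro powr_mono2) auto
    then have "c0 s t \<le> \<omega> q s t powr (1 / q)" using q p1 c0_nonneg by (simp add: powr_powr)
    then have "c0 s t ^ deg \<rho> \<le> (\<omega> q s t powr (1 / q)) ^ deg \<rho>" using c0_nonneg by (rule power_mono)
    then show ?thesis using char_norm_ge[OF f, of "Z s t"] by (simp add: c0_def)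
  qed
qed

end

lemma smooth_comp_fun:
  fixes f :: "real ^ 'd::finite \<Rightarrow> (real ^ 'd) \<Rightarrow>\<^sub>L (real ^ 'e::finite)"
  assumes f: "Lip \<gamma> f" and n: "1 \<le> n" "real n < \<gamma> + 1"
  shows "smooth_function (comp_fun f j i) (n - 1)"
    and "size q \<le> n - 1 \<Longrightarrow> \<bar>Dm (comp_fun f j i) q x\<bar> \<le> enn2real (Lip_norm \<gamma> f)"
    and "size q = n - 1 \<Longrightarrow> \<bar>Dm (comp_fun f j i) q x - Dm (comp_fun f j i) q y\<bar> \<le>
      enn2real (Lip_norm \<gamma> f) * norm (x - y) powr (min 1 (\<gamma> + 1 - real n))"
    and "n - 1 \<le> strict_floor \<gamma>"
proof -
  show sf: "n - 1 \<le> strict_floor \<gamma>" using n unfolding strict_floor_def by linarith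
  have vs: "\<forall>v\<in>set (map (\<lambda>i. axis i (1::real)) (SOME is. mset is = q)). norm v \<le> 1" for q :: "'d multiset"
    by (auto simp: norm_axis_1)
  have len: "length (SOME is. mset is = q) = size q" for q :: "'d multiset" by (metis mset_some_list size_mset)
  show "size q \<le> n - 1 \<Longrightarrow> \<bar>Dm (comp_fun f j i) q x\<bar> \<le> enn2real (Lip_norm \<gamma> f)"
    unfolding Dm_def using sf vs[of q] by (intro comp_fun_bound[OF f]) (auto simp: len)
  show "size q = n - 1 \<Longrightarrow> \<bar>Dm (comp_fun f j i) q x - Dm (comp_fun f j i) q y\<bar> \<le>
      enn2real (Lip_norm \<gamma> f) * norm (x - y) powr (min 1 (\<gamma> + 1 - real n))"
    unfolding Dm_def using vs[of q] by (intro comp_fun_hoelder[OF f n]) (auto simp: len)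
  show "smooth_function (comp_fun f j i) (n - 1)"
  proof
    show "times_differentiable (n - 1) (comp_fun f j i)"
      unfolding times_differentiable_def
    proof (intro allI impI)
      fix vs :: "(real ^ 'd) list" and x assume l: "length vs < n - 1"
      have le: "length vs \<le> strict_floor \<gamma>" using l sf by simp
      have "iter_deriv f vs differentiable at x"
        using f l sf unfolding Lip_def times_differentiable_def by (meson less_le_trans)
      then have D: "(iter_deriv f vs has_derivative frechet_derivative (iter_deriv f vs) (at x)) (at x)"
        by (simp add: frechet_derivative_works)
      have B: "bounded_linear (\<lambda>A::(real ^ 'd) \<Rightarrow>\<^sub>L (real ^ 'e). blinfun_apply A (axis i 1) $ j)"
        by (rule bounded_linear_compose[OF bounded_linear_vec_nth blinfun.bounded_linear_left])
      have "iter_deriv (comp_fun f j i) vs = (\<lambda>y. blinfun_apply (iter_deriv f vs y) (axis i 1) $ j)"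
        using comp_fun_deriv(1)[OF f le] by blast
      then show "iter_deriv (comp_fun f j i) vs differentiable at x"
        using bounded_linear.has_derivative[OF B D] unfolding differentiable_def by auto
    qed
  next
    fix vs :: "(real ^ 'd) list" and x
    assume l: "length vs = n - 1" "\<forall>v\<in>set vs. norm v \<le> 1"
    let ?\<alpha> = "min 1 (\<gamma> + 1 - real n)" and ?L = "enn2real (Lip_norm \<gamma> f)"
    let ?F = "iter_deriv (comp_fun f j i) vs"
    have \<alpha>: "0 < ?\<alpha>" using n by simp
    have "(\<lambda>y. ?F y - ?F x) \<midarrow>x\<rightarrow> 0"
    proof (rule Lim_null_comparison)
      show "\<forall>\<^sub>F y in at x. norm (?F y - ?F x) \<le> ?L * norm (y - x) powr ?\<alpha>"
        using comp_fun_hoelder[OF f n l(1)] l(2) by (intro always_eventually) auto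
      have "((\<lambda>y. ?L * norm (y - x) powr ?\<alpha>) \<longlongrightarrow> ?L * norm (x - x) powr ?\<alpha>) (at x)"
        using \<alpha> by (intro tendsto_intros tendsto_powr') auto
      then show "((\<lambda>y. ?L * norm (y - x) powr ?\<alpha>) \<longlongrightarrow> 0) (at x)" by simp
    qed
    then show "isCont ?F x" by (simp add: isCont_def LIM_zero_iff)
  qed
qed

section \<open>Lipschitz one-forms along a rough path: constants and existence\<close>

lemma lift_subset: "lift n a b Z \<beta> \<Phi> \<Longrightarrow> a \<le> a' \<Longrightarrow> b' \<le> b \<Longrightarrow> lift n a' b' Z \<beta> \<Phi>"
  unfolding lift_def by (meson order_trans)

locale rough_setting = rough_path p T X
  for p T and X :: "real \<Rightarrow> 'd::finite forest \<Rightarrow> real" +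
  fixes \<gamma> :: real and f :: "real ^ 'd \<Rightarrow> (real ^ 'd) \<Rightarrow>\<^sub>L (real ^ 'e::finite)"
  assumes \<gamma>: "p < \<gamma>" and Lipf: "Lip (\<gamma> - 1) f"
begin

definition \<beta> :: "'e \<Rightarrow> real \<Rightarrow> 'd forest \<Rightarrow> real" where "\<beta> j t \<rho> = integrand n f X t \<rho> $ j"

text \<open>\<open>n\<close> plus the Hoelder exponent of the derivatives of order
  \<open>n - 1\<close>, capped at 1. It exceeds \<open>p\<close> because both \<gamma> and
  \<open>n + 1\<close> do.\<close>

definition N :: real where "N = real n + min 1 (\<gamma> - real n)"

definition L :: real where "L = enn2real (Lip_norm (\<gamma> - 1) f)"

lemma n1: "1 \<le> n" and n_le: "real n \<le> p" and n_lt_\<gamma>: "real n < (\<gamma> - 1) + 1"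
  using level_ge1[OF p1] level_le[OF p1] \<gamma> by simp_all

lemma N_bounds: "real n < N" "N \<le> real n + 1" "p < N"
  using n_lt_\<gamma> level_gt[OF p1] \<gamma> by (auto simp: N_def min_def)

lemma L_nonneg: "0 \<le> L"
  by (simp add: L_def)

lemma \<beta>_bc: "\<beta> j t = bc n (comp_fun f j) (proj1 (X t))"
  unfolding \<beta>_def using integrand_bc[OF Lipf n1 smooth_comp_fun(4)[OF Lipf n1 n_lt_\<gamma>]] by blast

lemma \<beta>_supp: "\<not> single \<rho> \<Longrightarrow> \<beta> j t \<rho> = 0"
  by (simp add: \<beta>_bc bc_not_single)

definition A :: "real \<Rightarrow> real" where "A H = real CARD('d) ^ n * (real CARD('d) * H) powr N"

lemma A_ge1: "1 \<le> H \<Longrightarrow> 1 \<le> A H"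
proof -
  assume H: "1 \<le> H"
  have d1: "1 \<le> real CARD('d)" by (simp add: Suc_le_eq)
  have dH: "1 \<le> real CARD('d) * H" using mult_mono[OF d1 H] by simp
  show ?thesis
    using mult_mono[OF one_le_power[OF d1, of n] ge_one_powr_ge_zero[OF dH, of N]] N_bounds(1) by (simp add: A_def)
qed

lemma rough_dataI:
  assumes ab: "0 \<le> a" "b \<le> T" and ctl: "control a b w" "\<And>s t. a \<le> s \<Longrightarrow> s \<le> t \<Longrightarrow> t \<le> b \<Longrightarrow> w s t \<le> 1"
    and q: "0 < q" "q < N" and H: "1 \<le> H"
    and Zb: "\<And>s t \<rho>. a \<le> s \<Longrightarrow> s \<le> t \<Longrightarrow> t \<le> b \<Longrightarrow> deg \<rho> \<le> n \<Longrightarrow> \<bar>Z s t \<rho>\<bar> \<le> H * (w s t powr (1 / q)) ^ deg \<rho>"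
    and M: "real (card (fs n :: 'd forest set)) \<le> M" "\<forall>\<rho> :: 'd forest. deg \<rho> \<le> n \<longrightarrow> real (size (coproduct \<rho>)) \<le> M"
  shows "rough_data n q N H M a b w Z"
  using assms N_bounds Z_in Z_chen by unfold_locales auto

lemma \<beta>_controlled:
  assumes "rough_data n q N H M a b w Z" "0 \<le> a" "b \<le> T"
  shows "rough_data.controlled n q N b w Z single (A H * L) a (\<beta> j)"
proof -
  interpret rough_data n q N H M a b w Z by fact
  have Ne: "N - real n = min 1 (\<gamma> - 1 + 1 - real n)" by (simp add: N_def)
  have "controlled single (A H * L) a (\<lambda>t. bc n (comp_fun f j) (proj1 (X t)))"
    unfolding A_def
  proof (rule bc_controlled[OF n1 L_nonneg])
    show "smooth_function (comp_fun f j i) (n - 1)" for i by (rule smooth_comp_fun(1)[OF Lipf n1 n_lt_\<gamma>])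
    show "size q \<le> n - 1 \<Longrightarrow> \<bar>Dm (comp_fun f j i) q x\<bar> \<le> L" for i q x
      unfolding L_def by (rule smooth_comp_fun(2)[OF Lipf n1 n_lt_\<gamma>])
    show "size q = n - 1 \<Longrightarrow> \<bar>Dm (comp_fun f j i) q x - Dm (comp_fun f j i) q y\<bar> \<le> L * norm (x - y) powr (N - real n)" for i q x y
      unfolding L_def Ne by (rule smooth_comp_fun(3)[OF Lipf n1 n_lt_\<gamma>])
    show "proj1 (X u) $ i - proj1 (X t) $ i = Z t u {#bullet i#}" if "a \<le> t" "t \<le> u" "u \<le> b" for t u i
      using that assms(2,3) by (intro proj1_increment[OF Xc _ _ n1]) auto
  qed
  then show ?thesis by (simp add: \<beta>_bc[abs_def])
qed

lemma rough_liftI: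
  assumes "rough_data n q N H M a b w Z" "0 \<le> a" "b \<le> T" "lift n 0 T Z \<beta> \<Phi>"
  shows "rough_lift n q N H M a b w Z \<beta> \<Phi> (A H * L)"
proof -
  interpret D: rough_data n q N H M a b w Z by fact
  have "0 \<le> A H" using A_ge1[OF D.H] by simp
  then show ?thesis
    using assms \<beta>_supp \<beta>_controlled[OF assms(1-3)] L_nonneg
    by (intro rough_lift.intro rough_lift_axioms.intro) (auto intro: lift_subset)
qed

text \<open>Dividing \<omega> by \<open>m\<close> costs a factor \<open>m powr (1 / q)\<close> per
  degree, collected in \<open>H\<close>. This constant depends on the path, which is harmless for
  existence.\<close>

lemma control_normalize:
  assumes q: "p \<le> q" "q < N"
    and M: "real (card (fs n :: 'd forest set)) \<le> M" "\<forall>\<rho> :: 'd forest. deg \<rho> \<le> n \<longrightarrow> real (size (coproduct \<rho>)) \<le> M"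
  defines "m \<equiv> max 1 (\<omega> q 0 T)"
  shows "rough_data n q N ((m powr (1 / q)) ^ n) M 0 T (\<lambda>s t. \<omega> q s t / m) Z"
proof (rule rough_dataI)
  have m: "1 \<le> m" by (simp add: m_def)
  have q0: "0 < q" using q p1 by simp
  have c: "control 0 T (\<omega> q)" using q by (intro \<omega>_control)
  show "control 0 T (\<lambda>s t. \<omega> q s t / m)"
    using control_mult[OF c, of "1 / m"] m by simp
  have g1: "1 \<le> m powr (1 / q)" using m q0 by (simp add: ge_one_powr_ge_zero)
  then show "1 \<le> (m powr (1 / q)) ^ n" by (rule one_le_power)
  fix s t assume st: "0 \<le> s" "s \<le> t" "t \<le> T"
  have le: "\<omega> q s t \<le> \<omega> q 0 T" "0 \<le> \<omega> q s t" using control_mono[OF c, of 0 s t T] control_nonneg[OF c] st by auto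
  then show "\<omega> q s t / m \<le> 1" using m by (simp add: m_def)
  fix \<rho> :: "'d forest" assume \<rho>: "deg \<rho> \<le> n"
  have "\<omega> q s t powr (1 / q) = (m * (\<omega> q s t / m)) powr (1 / q)" using m by simp
  also have "\<dots> = m powr (1 / q) * (\<omega> q s t / m) powr (1 / q)" by (rule powr_mult)
  finally have eq: "\<omega> q s t powr (1 / q) = m powr (1 / q) * (\<omega> q s t / m) powr (1 / q)" .
  have "\<bar>Z s t \<rho>\<bar> \<le> (\<omega> q s t powr (1 / q)) ^ deg \<rho>" using Z_bound[OF q(1) st \<rho>] .
  also have "\<dots> = (m powr (1 / q)) ^ deg \<rho> * ((\<omega> q s t / m) powr (1 / q)) ^ deg \<rho>"
    unfolding eq by (rule power_mult_distrib)
  also have "\<dots> \<le> (m powr (1 / q)) ^ n * ((\<omega> q s t / m) powr (1 / q)) ^ deg \<rho>"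
    using g1 \<rho> by (intro mult_right_mono power_increasing) auto
  finally show "\<bar>Z s t \<rho>\<bar> \<le> (m powr (1 / q)) ^ n * ((\<omega> q s t / m) powr (1 / q)) ^ deg \<rho>" .
qed (use q p1 M in auto)

text \<open>The exponent \<open>q\<close> halfway between \<open>p\<close> and \<open>N\<close> has
  a variation that is small on short intervals, as convergence over all meshes requires, and still
  lies below the order \<open>N\<close> of the remainders.\<close>

lemma integral_exists: "\<exists>Y. is_rough_integral p T f X Y"
proof -
  define q where "q = (p + N) / 2"
  have q: "p < q" "q < N" using N_bounds(3) by (auto simp: q_def)
  obtain M where M: "real (card (fs n :: 'd forest set)) \<le> M" "\<forall>\<rho> :: 'd forest. deg \<rho> \<le> n \<longrightarrow> real (size (coproduct \<rho>)) \<le> M"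
    using ex_forest_bound by blast
  define m where "m = max 1 (\<omega> q 0 T)"
  have m: "1 \<le> m" by (simp add: m_def)
  have rd: "rough_data n q N ((m powr (1 / q)) ^ n) M 0 T (\<lambda>s t. \<omega> q s t / m) Z"
    unfolding m_def using q M by (intro control_normalize) auto
  interpret rough_data n q N "(m powr (1 / q)) ^ n" M 0 T "\<lambda>s t. \<omega> q s t / m" Z by (rule rd)
  have "lift n 0 T Z \<beta> (can_lift n Z \<beta>)"
  proof (rule can_lift_is_lift)
    show "controlled single (A ((m powr (1 / q)) ^ n) * L) 0 (\<beta> j)" for j
      by (rule \<beta>_controlled[OF rd]) auto
    fix \<epsilon> :: real assume "0 < \<epsilon>"
    from \<omega>_small[OF q(1) this] obtain \<delta> where \<delta>: "0 < \<delta>"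
      "\<And>u v. 0 \<le> u \<Longrightarrow> u \<le> v \<Longrightarrow> v \<le> T \<Longrightarrow> v - u < \<delta> \<Longrightarrow> \<omega> q u v \<le> \<epsilon>" by blast
    have "\<omega> q u v / m \<le> \<epsilon>" if "0 \<le> u" "u \<le> v" "v \<le> T" "v - u < \<delta>" for u v
    proof -
      have "\<omega> q u v \<le> \<epsilon> * 1" using \<delta>(2) that by simp
      also have "\<dots> \<le> \<epsilon> * m" using m \<open>0 < \<epsilon>\<close> by (intro mult_left_mono) auto
      finally show ?thesis using m by (simp add: divide_le_eq)
    qed
    then show "\<exists>\<delta>>0. \<forall>u v. 0 \<le> u \<longrightarrow> u \<le> v \<longrightarrow> v \<le> T \<longrightarrow> v - u < \<delta> \<longrightarrow> \<omega> q u v / m \<le> \<epsilon>"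
      using \<delta>(1) by blast
  qed (rule \<beta>_supp)
  then show ?thesis
    unfolding \<beta>_def[abs_def] by (rule integral_of_lift[OF n1 T0])
qed

end

section \<open>The bound on the integral\<close>

text \<open>In Chen's relation a mixed term has size
  \<open>\<alpha> ^ i * \<beta> ^ (k - i)\<close>; the inequality lets it be absorbed when the sizes
  of adjacent intervals are added.\<close>

lemma binomial_three_terms:
  fixes \<alpha> \<beta> :: real
  assumes "0 \<le> \<alpha>" "0 \<le> \<beta>" "1 \<le> i" "i < k"
  shows "\<alpha> ^ k + \<beta> ^ k + \<alpha> ^ i * \<beta> ^ (k - i) \<le> (\<alpha> + \<beta>) ^ k"
proof -
  let ?f = "\<lambda>j. real (k choose j) * \<alpha> ^ j * \<beta> ^ (k - j)"
  have "\<alpha> ^ k + \<beta> ^ k + \<alpha> ^ i * \<beta> ^ (k - i) \<le> \<alpha> ^ k + \<beta> ^ k + ?f i"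
  proof -
    have "1 \<le> k choose i" using assms by (simp add: Suc_le_eq)
    then have "1 * (\<alpha> ^ i * \<beta> ^ (k - i)) \<le> real (k choose i) * (\<alpha> ^ i * \<beta> ^ (k - i))"
      using assms by (intro mult_right_mono) auto
    then show ?thesis by (simp add: mult.assoc)
  qed
  also have "\<dots> = (\<Sum>j\<in>{0, i, k}. ?f j)" using assms by simp
  also have "\<dots> \<le> (\<Sum>j\<le>k. ?f j)" using assms by (intro sum_mono2) auto
  also have "\<dots> = (\<alpha> + \<beta>) ^ k" by (simp add: binomial_ring)
  finally show ?thesis .
qed

lemma control_powr_sum:
  assumes ctl: "control a b w" and p: "1 \<le> p" and D: "D \<in> partitions s t" "a \<le> s" "t \<le> b"
  shows "partition_sum (\<lambda>u v. w u v powr p) D \<le> w s t powr p"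
proof -
  have st: "s \<le> t" using D(1) by (rule partitions_le)
  have "partition_sum (\<lambda>u v. w u v powr p) D \<le> partition_sum (\<lambda>u v. w s t powr (p - 1) * w u v) D"
  proof (rule partition_sum_mono[OF D(1)])
    fix u v assume uv: "s \<le> u" "u < v" "v \<le> t"
    have w: "0 \<le> w u v" "w u v \<le> w s t"
      using control_nonneg[OF ctl, of u v] control_mono[OF ctl, of s u v t] D uv by auto
    have "w u v powr p = w u v powr (p - 1) * w u v"
    proof (cases "w u v = 0")
      case False
      then show ?thesis using powr_add[of "w u v" "p - 1" 1] w by simp
    qed (use p in simp)
    also have "\<dots> \<le> w s t powr (p - 1) * w u v" using w p by (intro mult_right_mono powr_mono2) auto
    finally show "w u v powr p \<le> w s t powr (p - 1) * w u v" .
  qed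
  also have "\<dots> \<le> w s t powr (p - 1) * w s t"
    unfolding partition_sum_mult using control_partition_sum[OF ctl D] by (rule mult_left_mono) simp
  also have "\<dots> = w s t powr p"
  proof (cases "w s t = 0")
    case False
    then show ?thesis using powr_add[of "w s t" "p - 1" 1] control_nonneg[OF ctl D(2) st D(3)] by simp
  qed (use p in simp)
  finally show ?thesis .
qed

context rough_setting
begin

text \<open>The factor \<open>(M * H + 1) * Q ^ (2 * n)\<close> of \<open>lift_bound\<close> at
  \<open>H = 1\<close>; it involves neither the path nor the function.\<close>

definition KQ :: "real \<Rightarrow> real \<Rightarrow> real" where
  "KQ M r = (M + 1) * (3 * M ^ 5 * (1 + sew_const (N / r))) ^ (2 * n)"

lemma integral_lift:
  assumes "is_rough_integral p T f X Y"
  shows "\<exists>\<Phi>. lift n 0 T Z \<beta> \<Phi> \<and> (\<forall>s t \<rho>. 0 \<le> s \<and> s \<le> t \<and> t \<le> T \<longrightarrow> \<Phi> s t \<rho> {#} = Y s t \<rho>)"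
  using lift_of_integral[OF n1 assms] unfolding \<beta>_def[abs_def] by blast

lemma integral_in:
  assumes "is_rough_integral p T f X Y" "0 \<le> s" "s \<le> t" "t \<le> T"
  shows "Y s t \<in> characters n"
  using lift_of_integral[OF n1 assms(1)] assms(2-4) by blast

lemma integral_chen:
  assumes Y: "is_rough_integral p T f X Y" and "0 \<le> s" "s \<le> u" "u \<le> t" "t \<le> T" "deg \<rho> \<le> n"
  shows "Y s t \<rho> = cop_sum \<rho> (\<lambda>x y. Y s u x * Y u t y)"
proof -
  obtain \<Phi> where \<Phi>1: "lift n 0 T Z \<beta> \<Phi>"
    and \<Phi>2: "\<forall>s t \<rho>. 0 \<le> s \<and> s \<le> t \<and> t \<le> T \<longrightarrow> \<Phi> s t \<rho> {#} = Y s t \<rho>"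
    using integral_lift[OF Y] by (elim exE conjE)
  show ?thesis using lift.lift_chen[OF \<Phi>1 assms(2-6), of "{#}"] assms by (simp add: \<Phi>2)
qed

lemma local_bound:
  assumes Y: "is_rough_integral p T f X Y" and r: "p \<le> r" "r < N"
    and M: "real (card (fs n :: 'd forest set)) \<le> M" "\<forall>\<rho> :: 'd forest. deg \<rho> \<le> n \<longrightarrow> real (size (coproduct \<rho>)) \<le> M"
    and C1: "A 1 * KQ M r \<le> C1"
    and uv: "0 \<le> u" "u \<le> v" "v \<le> T" "\<omega> r u v \<le> 1" and \<rho>: "1 \<le> deg \<rho>" "deg \<rho> \<le> n"
  shows "\<bar>Y u v \<rho>\<bar> \<le> (C1 * L * \<omega> r u v powr (1 / r)) ^ deg \<rho>"
proof -
  obtain \<Phi> where \<Phi>1: "lift n 0 T Z \<beta> \<Phi>"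
    and \<Phi>2: "\<forall>s t \<rho>. 0 \<le> s \<and> s \<le> t \<and> t \<le> T \<longrightarrow> \<Phi> s t \<rho> {#} = Y s t \<rho>"
    using integral_lift[OF Y] by (elim exE conjE)
  have c: "control u v (\<omega> r)" using control_subset[OF \<omega>_control[OF r(1)]] uv by simp
  have rd: "rough_data n r N 1 M u v (\<omega> r) Z"
  proof (rule rough_dataI[OF uv(1,3) c])
    fix s t assume st: "u \<le> s" "s \<le> t" "t \<le> v"
    show "\<omega> r s t \<le> 1" using control_mono[OF c, of u s t v] st uv by simp
    show "\<bar>Z s t \<rho>\<bar> \<le> 1 * (\<omega> r s t powr (1 / r)) ^ deg \<rho>" if "deg \<rho> \<le> n" for \<rho>
      using Z_bound[OF r(1) _ st(2) _ that] st uv by simp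
  qed (use r p1 M in auto)
  interpret rough_lift n r N 1 M u v "\<omega> r" Z \<beta> \<Phi> "A 1 * L"
    by (rule rough_liftI[OF rd uv(1,3) \<Phi>1])
  have KQ: "(M * 1 + 1) * Q ^ (2 * n) = KQ M r" by (simp add: KQ_def Q_def)
  have "1 * 1 \<le> (M * 1 + 1) * Q ^ (2 * n)" using M1 one_le_power[OF Q_ge(2), of "2 * n"] by (intro mult_mono) auto
  then have KQ1: "1 \<le> KQ M r" unfolding KQ by simp
  have "\<bar>Y u v \<rho>\<bar> \<le> KQ M r * (A 1 * L) ^ deg \<rho> * w u v ^ deg \<rho>"
    using lift_bound[OF \<rho>(2) order_refl uv(2) order_refl] \<Phi>2 uv(1-3) unfolding KQ[symmetric] by simp
  also have "\<dots> \<le> KQ M r ^ deg \<rho> * (A 1 * L) ^ deg \<rho> * w u v ^ deg \<rho>"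
    using KQ1 \<rho> L0 by (intro mult_right_mono self_le_power) auto
  also have "\<dots> = (A 1 * KQ M r * L * w u v) ^ deg \<rho>" by (simp add: power_mult_distrib mult_ac)
  also have "\<dots> \<le> (C1 * L * w u v) ^ deg \<rho>"
    using C1 L_nonneg KQ1 A_ge1[of 1] by (intro power_mono mult_right_mono) auto
  finally show ?thesis by (simp add: w_def)
qed

text \<open>For \<open>\<omega> p u v \<le> 1\<close> the local bound is linear in the
  \<open>p\<close>-variation. Otherwise at most \<open>1 + 2 * \<omega> p u v\<close> pieces cover
  the interval, and Chen's relation adds their bounds to one proportional to \<omega>, hence to the
  \<open>p\<close>-th power of the variation. Of the factor 6, the 3 comes from
  \<open>1 + 2 * \<omega> \<le> 3 * \<omega>\<close> and the 2 from adding the two regimes.\<close>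

lemma integral_bound:
  assumes Y: "is_rough_integral p T f X Y"
    and M: "real (card (fs n :: 'd forest set)) \<le> M" "\<forall>\<rho> :: 'd forest. deg \<rho> \<le> n \<longrightarrow> real (size (coproduct \<rho>)) \<le> M"
    and G: "1 \<le> G" "\<forall>\<rho> :: 'e forest. deg \<rho> \<le> n \<longrightarrow> real (size (coproduct \<rho>)) \<le> G"
    and C1: "A 1 * KQ M p \<le> C1" "A 1 * KQ M ((p + N) / 2) \<le> C1" "0 \<le> C1"
    and st: "0 \<le> s" "s < t" "t \<le> T"
  defines "x \<equiv> enn2real (p_var p Z s t)"
  shows "p_var p Y s t \<le> ennreal (6 * G * C1 * L * max x (x powr p))"
proof -
  define q where "q = (p + N) / 2"
  have q: "p < q" "q < N" using N_bounds(3) by (auto simp: q_def)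
  have ctl: "control 0 T (\<omega> p)" by (rule \<omega>_control) simp
  let ?c = "C1 * L"
  have c0: "0 \<le> ?c" using C1(3) L_nonneg by simp
  have G0: "0 \<le> G" using G by simp
  \<comment> \<open>A bound of size \<alpha>. Sizes add under concatenation, because a mixed term
    has one factor \<open>G\<close> less, which pays for the number of cuts.\<close>
  define R where "R u v \<alpha> \<longleftrightarrow> (\<forall>\<rho>. 1 \<le> deg \<rho> \<and> deg \<rho> \<le> n \<longrightarrow> \<bar>Y u v \<rho>\<bar> \<le> G ^ (deg \<rho> - 1) * (?c * \<alpha>) ^ deg \<rho>)" for u v \<alpha>
  have Ye: "Y u v {#} = 1" if "0 \<le> u" "u \<le> v" "v \<le> T" for u v
  proof -
    have "Y u v \<in> characters n" using that by (rule integral_in[OF Y])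
    then show ?thesis by simp
  qed
  have R_mono: "R u v \<beta>'" if "R u v \<alpha>" "0 \<le> \<alpha>" "\<alpha> \<le> \<beta>'" for u v \<alpha> \<beta>'
    unfolding R_def
  proof (intro allI impI)
    fix \<rho> :: "'e forest" assume \<rho>: "1 \<le> deg \<rho> \<and> deg \<rho> \<le> n"
    then have "\<bar>Y u v \<rho>\<bar> \<le> G ^ (deg \<rho> - 1) * (?c * \<alpha>) ^ deg \<rho>" using that(1) unfolding R_def by blast
    also have "\<dots> \<le> G ^ (deg \<rho> - 1) * (?c * \<beta>') ^ deg \<rho>"
      using that c0 G0 by (intro mult_left_mono power_mono) auto
    finally show "\<bar>Y u v \<rho>\<bar> \<le> G ^ (deg \<rho> - 1) * (?c * \<beta>') ^ deg \<rho>" .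
  qed
  have R_add: "R u z (\<alpha> + \<beta>')"
    if R: "R u v \<alpha>" "R v z \<beta>'" and nn: "0 \<le> \<alpha>" "0 \<le> \<beta>'" and uv: "0 \<le> u" "u \<le> v" "v \<le> z" "z \<le> T" for u v z \<alpha> \<beta>'
    unfolding R_def
  proof (intro allI impI; elim conjE)
    fix \<rho> :: "'e forest" assume \<rho>: "1 \<le> deg \<rho>" "deg \<rho> \<le> n"
    define k where "k = deg \<rho>"
    define D where "D = (\<alpha> + \<beta>') ^ k - \<alpha> ^ k - \<beta>' ^ k"
    have \<rho>0: "\<rho> \<noteq> {#}" using \<rho> by auto
    let ?F = "\<lambda>x y. of_bool (x \<noteq> {#} \<and> y \<noteq> {#}) * (Y u v x * Y v z y)"
    have "Y u z \<rho> = cop_sum \<rho> (\<lambda>x y. (Y u v x * of_bool (y = {#}) + of_bool (x = {#}) * Y v z y) + ?F x y)"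
      unfolding integral_chen[OF Y uv \<rho>(2)]
    proof (rule cop_sum_cong)
      fix x y assume "(x, y) \<in># coproduct \<rho>"
      from coproduct_deg[OF this] \<rho> have "\<not> (x = {#} \<and> y = {#})" by auto
      then show "Y u v x * Y v z y = (Y u v x * of_bool (y = {#}) + of_bool (x = {#}) * Y v z y) + ?F x y"
        using Ye uv by auto
    qed
    also have "\<dots> = Y u v \<rho> + Y v z \<rho> + cop_sum \<rho> ?F"
      by (simp only: cop_sum_add cop_sum_counit_left cop_sum_counit_right)
    finally have eq: "Y u z \<rho> = Y u v \<rho> + Y v z \<rho> + cop_sum \<rho> ?F" .
    have D0: "0 \<le> D"
    proof (cases "k = 1")
      case False
      then have "1 < k" using \<rho> by (simp add: k_def)
      then show ?thesis using binomial_three_terms[OF nn order_refl, of k] nn unfolding D_def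
        by (smt (verit) mult_nonneg_nonneg zero_le_power)
    qed (simp add: D_def)
    have "\<bar>cop_sum \<rho> ?F\<bar> \<le> real (size (coproduct \<rho>)) * (G ^ (k - 2) * (?c ^ k * D))"
    proof (rule cop_sum_abs_le)
      fix x y assume xy: "(x, y) \<in># coproduct \<rho>"
      note d = coproduct_deg[OF xy]
      show "\<bar>?F x y\<bar> \<le> G ^ (k - 2) * (?c ^ k * D)"
      proof (cases "x \<noteq> {#} \<and> y \<noteq> {#}")
        case True
        then have dx: "1 \<le> deg x" "1 \<le> deg y" using deg_eq_0_iff[of x] deg_eq_0_iff[of y] by linarith+
        have "\<bar>Y u v x\<bar> * \<bar>Y v z y\<bar> \<le> (G ^ (deg x - 1) * (?c * \<alpha>) ^ deg x) * (G ^ (deg y - 1) * (?c * \<beta>') ^ deg y)"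
          using R dx d \<rho> unfolding R_def by (intro mult_mono) auto
        also have "\<dots> = G ^ ((deg x - 1) + (deg y - 1)) * (?c ^ (deg x + deg y) * (\<alpha> ^ deg x * \<beta>' ^ deg y))"
          by (simp add: power_add power_mult_distrib mult_ac)
        also have "(deg x - 1) + (deg y - 1) = k - 2" using dx d by (simp add: k_def)
        also have "deg x + deg y = k" using d by (simp add: k_def)
        also have "G ^ (k - 2) * (?c ^ k * (\<alpha> ^ deg x * \<beta>' ^ deg y)) \<le> G ^ (k - 2) * (?c ^ k * D)"
        proof -
          have yk: "deg y = k - deg x" "deg x < k" using d dx unfolding k_def by linarith+
          have "\<alpha> ^ deg x * \<beta>' ^ deg y \<le> D"
            unfolding D_def yk(1) using binomial_three_terms[OF nn dx(1) yk(2)] by linarith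
          then show ?thesis using c0 G0 by (intro mult_left_mono) auto
        qed
        finally show ?thesis using True by (simp add: abs_mult)
      qed (use G0 c0 D0 in auto)
    qed
    also have "\<dots> \<le> G * (G ^ (k - 2) * (?c ^ k * D))"
      using G(2) \<rho> G0 c0 D0 by (intro mult_right_mono) auto
    also have "\<dots> = G ^ (k - 1) * (?c ^ k * D)"
    proof (cases "k = 1")
      case False
      then have "k - 1 = Suc (k - 2)" using \<rho> by (simp add: k_def)
      then show ?thesis by simp
    qed (simp add: D_def)
    finally have "\<bar>cop_sum \<rho> ?F\<bar> \<le> G ^ (k - 1) * (?c ^ k * D)" .
    moreover have "\<bar>Y u v \<rho>\<bar> \<le> G ^ (k - 1) * (?c ^ k * \<alpha> ^ k)" "\<bar>Y v z \<rho>\<bar> \<le> G ^ (k - 1) * (?c ^ k * \<beta>' ^ k)"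
      using R \<rho> unfolding R_def k_def power_mult_distrib[symmetric] by blast+
    ultimately have "\<bar>Y u z \<rho>\<bar> \<le> G ^ (k - 1) * (?c ^ k * \<alpha> ^ k) + G ^ (k - 1) * (?c ^ k * \<beta>' ^ k) + G ^ (k - 1) * (?c ^ k * D)"
      unfolding eq by linarith
    also have "\<dots> = G ^ (k - 1) * (?c ^ k * (\<alpha> + \<beta>') ^ k)" unfolding D_def by (simp add: algebra_simps)
    finally show "\<bar>Y u z \<rho>\<bar> \<le> G ^ (deg \<rho> - 1) * (?c * (\<alpha> + \<beta>')) ^ deg \<rho>"
      unfolding k_def power_mult_distrib .
  qed
  have R_piece: "R u v 1" if uv: "0 \<le> u" "u \<le> v" "v \<le> T" and r: "r = p \<or> r = q" "\<omega> r u v \<le> 1" for u v r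
    unfolding R_def
  proof (intro allI impI; elim conjE)
    fix \<rho> :: "'e forest" assume \<rho>: "1 \<le> deg \<rho>" "deg \<rho> \<le> n"
    have r': "p \<le> r" "r < N" "A 1 * KQ M r \<le> C1" using r(1) q C1(1) C1(2)[folded q_def] N_bounds(3) by auto
    have w: "0 \<le> \<omega> r u v" using control_nonneg[OF \<omega>_control[OF r'(1)] uv] .
    have "\<bar>Y u v \<rho>\<bar> \<le> (?c * \<omega> r u v powr (1 / r)) ^ deg \<rho>" by (rule local_bound[OF Y r'(1,2) M r'(3) uv r(2) \<rho>])
    also have "\<dots> \<le> (?c * 1) ^ deg \<rho>"
      using w r(2) c0 p1 r' by (intro power_mono mult_left_mono powr_le1) auto
    also have "\<dots> \<le> G ^ (deg \<rho> - 1) * (?c * 1) ^ deg \<rho>"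
      using mult_right_mono[OF one_le_power[OF G(1), of "deg \<rho> - 1"], of "(?c * 1) ^ deg \<rho>"] c0 by simp
    finally show "\<bar>Y u v \<rho>\<bar> \<le> G ^ (deg \<rho> - 1) * (?c * 1) ^ deg \<rho>" .
  qed
  obtain \<delta> where \<delta>: "0 < \<delta>" "\<And>u v. 0 \<le> u \<Longrightarrow> u \<le> v \<Longrightarrow> v \<le> T \<Longrightarrow> v - u < \<delta> \<Longrightarrow> \<omega> q u v \<le> 1"
    using \<omega>_small[OF q(1), of 1] by auto
  \<comment> \<open>Consecutive intervals of a fine partition are merged greedily as long as \<open>\<omega> p\<close> stays below 1;
    the intervals at which this stops are short, and are controlled by \<open>\<omega> q\<close>.\<close>
  have greedy: "R u v (1 + 2 * \<omega> p u v)" if "D \<in> partitions u v" "mesh D < \<delta>" "0 \<le> u" "v \<le> T" for D u v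
    using that
  proof (induction "length D" arbitrary: D u rule: less_induct)
    case less
    note D = less.prems
    have uv: "u \<le> v" using D(1) by (rule partitions_le)
    show ?case
    proof (cases "\<omega> p u v \<le> 1")
      case True
      have "R u v 1" using True uv D by (intro R_piece[of _ _ p]) auto
      then show ?thesis by (rule R_mono) (use control_nonneg[OF ctl, of u v] uv D in auto)
    next
      case False
      have "\<omega> p u u \<le> 1" using control_refl[OF ctl, of u] uv D by simp
      then have "\<exists>xs c d ys. D = xs @ c # d # ys \<and> \<omega> p u c \<le> 1 \<and> \<not> \<omega> p u d \<le> 1"
        using D(1) False by (intro list_switch) (auto simp: partitions_def)
      then obtain xs c d ys where sp: "D = xs @ c # d # ys" "\<omega> p u c \<le> 1" "\<not> \<omega> p u d \<le> 1" by blast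
      have P: "xs @ [c] \<in> partitions u c" "c # d # ys \<in> partitions c v"
        using iffD1[OF partitions_append D(1)[unfolded sp(1)]] by auto
      then have P': "c < d" "d # ys \<in> partitions d v" by (auto simp: partitions_Cons)
      have le: "u \<le> c" "d \<le> v" using P P' by (auto dest: partitions_le)
      have "mesh D = (if xs = [] then mesh (c # d # ys) else max (mesh (xs @ [c])) (mesh (c # d # ys)))"
        unfolding sp(1) by (rule mesh_append[OF D(1)[unfolded sp(1)]])
      then have "mesh (c # d # ys) \<le> mesh D" by (auto simp: le_max_iff_disj)
      then have "mesh (d # ys) < \<delta>" "d - c < \<delta>" using D(2) by auto
      have "R u c 1" using le P' D sp by (intro R_piece[of _ _ p]) auto
      moreover have "R c d 1" using le P' D \<open>d - c < \<delta>\<close> by (intro R_piece[of _ _ q] \<delta>(2)) auto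
      moreover have "R d v (1 + 2 * \<omega> p d v)"
        using \<open>mesh (d # ys) < \<delta>\<close> P' le D sp(1) by (intro less.hyps) auto
      moreover have wd: "0 \<le> \<omega> p d v" using le P' D by (intro control_nonneg[OF ctl]) auto
      ultimately have "R u v ((1 + 1) + (1 + 2 * \<omega> p d v))"
        using le P' D by (intro R_add[of u d "1 + 1" v "1 + 2 * \<omega> p d v"] R_add[of u c 1 d 1]) auto
      then show ?thesis
      proof (rule R_mono)
        \<comment> \<open>The pieces [u, c] and [c, d] add 2 to the size, and
          \<open>\<omega> p u d > 1\<close> pays for them.\<close>
        have "\<omega> p u d + \<omega> p d v \<le> \<omega> p u v" using le P' D by (intro control_add[OF ctl]) auto
        then show "(1 + 1) + (1 + 2 * \<omega> p d v) \<le> 1 + 2 * \<omega> p u v" using sp(3) by linarith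
      qed (use wd in simp)
    qed
  qed
  let ?C = "3 * G * ?c"
  have C0: "0 \<le> ?C" using G0 c0 by simp
  \<comment> \<open>Both regimes in one bound, each summand of which can be summed over a partition
    by superadditivity.\<close>
  have nrm: "char_norm n (Y u v) powr p \<le> ?C powr p * (\<omega> p u v + \<omega> p u v powr p)"
    if uv: "0 \<le> u" "u \<le> v" "v \<le> T" for u v
  proof -
    have w: "0 \<le> \<omega> p u v" using control_nonneg[OF ctl uv] .
    have p0: "0 < p" using p1 by simp
    show ?thesis
    proof (cases "\<omega> p u v \<le> 1")
      case True
      have "char_norm n (Y u v) \<le> ?c * \<omega> p u v powr (1 / p)"
        using c0 N_bounds(3) by (intro char_norm_le[OF n1] local_bound[OF Y _ _ M C1(1) uv True]) (auto simp: forests_def)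
      also have "\<dots> \<le> ?C * \<omega> p u v powr (1 / p)"
        using mult_right_mono[of 1 "3 * G" ?c] G c0 by (intro mult_right_mono) auto
      finally have "char_norm n (Y u v) powr p \<le> (?C * \<omega> p u v powr (1 / p)) powr p"
        using p0 char_norm_nonneg[OF n1] by (intro powr_mono2) auto
      also have "\<dots> = ?C powr p * \<omega> p u v" using w p0 by (simp add: powr_mult powr_powr)
      also have "\<dots> \<le> ?C powr p * (\<omega> p u v + \<omega> p u v powr p)" by (intro mult_left_mono) auto
      finally show ?thesis .
    next
      case False
      obtain D where "D \<in> partitions u v" "mesh D < \<delta>" using partition_exists[OF uv(2) \<delta>(1)] by blast
      then have "R u v (1 + 2 * \<omega> p u v)" using uv by (intro greedy) auto
      then have "R u v (3 * \<omega> p u v)" by (rule R_mono) (use False w in auto)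
      then have "\<bar>Y u v \<rho>\<bar> \<le> (?C * \<omega> p u v) ^ deg \<rho>" if "\<rho> \<in> forests n" for \<rho>
      proof -
        have \<rho>: "1 \<le> deg \<rho>" "deg \<rho> \<le> n" using that by (auto simp: forests_def)
        have "\<bar>Y u v \<rho>\<bar> \<le> G ^ (deg \<rho> - 1) * (?c * (3 * \<omega> p u v)) ^ deg \<rho>"
          using \<open>R u v (3 * \<omega> p u v)\<close> \<rho> unfolding R_def by blast
        also have "\<dots> \<le> G ^ deg \<rho> * (?c * (3 * \<omega> p u v)) ^ deg \<rho>"
          using G c0 w by (intro mult_right_mono power_increasing) auto
        also have "\<dots> = (?C * \<omega> p u v) ^ deg \<rho>" by (simp add: power_mult_distrib mult_ac)
        finally show ?thesis .
      qed
      then have "char_norm n (Y u v) \<le> ?C * \<omega> p u v" using C0 w by (intro char_norm_le[OF n1]) auto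
      then have "char_norm n (Y u v) powr p \<le> (?C * \<omega> p u v) powr p"
        using p0 char_norm_nonneg[OF n1] by (intro powr_mono2) auto
      also have "\<dots> = ?C powr p * \<omega> p u v powr p" by (rule powr_mult)
      also have "\<dots> \<le> ?C powr p * (\<omega> p u v + \<omega> p u v powr p)" using w by (intro mult_left_mono) auto
      finally show ?thesis .
    qed
  qed
  have p0: "0 < p" using p1 by simp
  have x0: "0 \<le> x" by (simp add: x_def)
  have fin: "p_var p Z s t < \<infinity>"
    using p_var_mono[of 0 s t T p Z] st p0 rp unfolding branched_rough_path_def by (auto intro: le_less_trans)
  have wx: "\<omega> p s t \<le> x powr p"
  proof -
    interpret P: bounded_variation "\<lambda>u v. c0 u v powr p" 0 T "enn2real (p_var p Z 0 T) powr p" by (rule bv_p)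
    show ?thesis unfolding \<omega>_def x_def
      using p_var_sum_le[OF p0 fin] st by (intro P.var_least) (auto simp: c0_def)
  qed
  have wst: "0 \<le> \<omega> p s t" using st by (intro control_nonneg[OF ctl]) auto
  define m where "m = max x (x powr p)"
  have m: "0 \<le> m" "x powr p \<le> m powr p" "(x powr p) powr p \<le> m powr p"
    using x0 p0 by (auto simp: m_def intro!: powr_mono2)
  show ?thesis
    unfolding p_var_def
  proof (rule SUP_least)
    fix D assume D: "D \<in> partitions s t"
    have "partition_sum (\<lambda>u v. char_norm n (Y u v) powr p) D \<le>
        partition_sum (\<lambda>u v. ?C powr p * (\<omega> p u v + \<omega> p u v powr p)) D"
      using st by (intro partition_sum_mono[OF D] nrm) auto
    also have "\<dots> = ?C powr p * (partition_sum (\<omega> p) D + partition_sum (\<lambda>u v. \<omega> p u v powr p) D)"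
      unfolding partition_sum_mult partition_sum_add ..
    also have "\<dots> \<le> ?C powr p * (\<omega> p s t + \<omega> p s t powr p)"
      using control_partition_sum[OF ctl D] control_powr_sum[OF ctl p1 D] st by (intro mult_left_mono add_mono) auto
    also have "\<dots> \<le> ?C powr p * (m powr p + m powr p)"
    proof -
      have "\<omega> p s t powr p \<le> (x powr p) powr p" using wx wst p0 by (intro powr_mono2) auto
      then show ?thesis using wx m by (intro mult_left_mono) auto
    qed
    \<comment> \<open>The two regimes contribute \<open>m powr p\<close> each, and
      \<open>2 \<le> 2 powr p\<close> brings the factor under the power.\<close>
    also have "\<dots> \<le> ?C powr p * (2 powr p * m powr p)"
    proof -
      have "2 powr 1 \<le> (2::real) powr p" using p1 by (intro powr_mono) auto
      then have "2 * m powr p \<le> 2 powr p * m powr p" by (intro mult_right_mono) auto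
      then show ?thesis by (intro mult_left_mono) auto
    qed
    also have "\<dots> = (6 * G * C1 * L * m) powr p"
    proof -
      have "6 * G * C1 * L * m = ?C * (2 * m)" by simp
      then have "(6 * G * C1 * L * m) powr p = (?C * (2 * m)) powr p" by (rule arg_cong)
      then show ?thesis by (simp only: powr_mult)
    qed
    finally have "partition_sum (\<lambda>u v. char_norm n (Y u v) powr p) D powr (1 / p) \<le> ((6 * G * C1 * L * m) powr p) powr (1 / p)"
      using p0 by (intro powr_mono2 partition_sum_nonneg[OF D]) auto
    also have "\<dots> = 6 * G * C1 * L * m" using p0 m C0 G0 C1(3) L_nonneg by (simp add: powr_powr)
    finally show "ennreal (partition_sum (\<lambda>u v. char_norm n (Y u v) powr p) D powr (1 / p))
        \<le> ennreal (6 * G * C1 * L * max x (x powr p))" unfolding m_def by (rule ennreal_leI)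
  qed
qed

end

section \<open>Continuity of the lift\<close>

lemma interpolate_min:
  fixes x :: real
  assumes "0 \<le> x" "x \<le> a" "x \<le> b" "0 < \<mu>" "\<mu> < 1"
  shows "x \<le> a powr \<mu> * b powr (1 - \<mu>)"
proof (cases "x = 0")
  case False
  have "x = x powr \<mu> * x powr (1 - \<mu>)" using False assms by (simp flip: powr_add)
  also have "\<dots> \<le> a powr \<mu> * b powr (1 - \<mu>)" using assms by (intro mult_mono powr_mono2) auto
  finally show ?thesis .
qed simp

lemma prod_diff_le:
  fixes x y x' y' :: real
  assumes "\<bar>x - x'\<bar> \<le> a" "\<bar>y\<bar> \<le> C" "\<bar>x'\<bar> \<le> B" "\<bar>y - y'\<bar> \<le> d"
  shows "\<bar>x * y - x' * y'\<bar> \<le> a * C + B * d"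
proof -
  have "x * y - x' * y' = (x - x') * y + x' * (y - y')" by (simp add: algebra_simps)
  also have "\<bar>\<dots>\<bar> \<le> \<bar>x - x'\<bar> * \<bar>y\<bar> + \<bar>x'\<bar> * \<bar>y - y'\<bar>"
    using abs_triangle_ineq[of "(x - x') * y" "x' * (y - y')"] by (simp add: abs_mult)
  also have "\<dots> \<le> a * C + B * d" using assms by (intro add_mono mult_mono) auto
  finally show ?thesis .
qed

lemma conv_diff_le:
  fixes \<phi> :: "'l::finite forest \<Rightarrow> real"
  assumes "\<And>\<rho>. deg \<rho> \<le> n \<Longrightarrow> \<bar>\<phi> \<rho> - \<phi>' \<rho>\<bar> \<le> a" "\<And>\<rho>. deg \<rho> \<le> n \<Longrightarrow> \<bar>\<psi> \<rho>\<bar> \<le> C"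
    "\<And>\<rho>. deg \<rho> \<le> n \<Longrightarrow> \<bar>\<phi>' \<rho>\<bar> \<le> B" "\<And>\<rho>. deg \<rho> \<le> n \<Longrightarrow> \<bar>\<psi> \<rho> - \<psi>' \<rho>\<bar> \<le> d"
    and M: "real (card (fs n :: 'l forest set)) \<le> M"
  shows "\<bar>conv n opr V \<phi> \<psi> \<tau> - conv n opr V \<phi>' \<psi>' \<tau>\<bar> \<le> M * (M * (a * C + B * d))"
proof -
  have nn: "0 \<le> a" "0 \<le> C" "0 \<le> B" "0 \<le> d"
    using assms(1-4)[of "{#}"] by (simp_all add: order_trans[OF abs_ge_zero])
  have "conv n opr V \<phi> \<psi> \<tau> - conv n opr V \<phi>' \<psi>' \<tau> = (\<Sum>\<rho>\<^sub>1\<in>fs n. \<Sum>\<rho>\<^sub>2\<in>fs n.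
      of_bool (V \<rho>\<^sub>2 \<and> deg \<rho>\<^sub>1 + deg \<rho>\<^sub>2 \<le> n \<and> opr \<rho>\<^sub>1 \<rho>\<^sub>2 = \<tau>) * (\<phi> \<rho>\<^sub>1 * \<psi> \<rho>\<^sub>2 - \<phi>' \<rho>\<^sub>1 * \<psi>' \<rho>\<^sub>2))"
    unfolding conv_def by (simp add: sum_subtractf right_diff_distrib)
  also have "\<bar>\<dots>\<bar> \<le> M * (M * (a * C + B * d))"
  proof (intro sum_abs_le[OF _ M])
    fix \<rho>\<^sub>1 \<rho>\<^sub>2 :: "'l forest" assume "\<rho>\<^sub>1 \<in> fs n" "\<rho>\<^sub>2 \<in> fs n"
    then have "\<bar>\<phi> \<rho>\<^sub>1 * \<psi> \<rho>\<^sub>2 - \<phi>' \<rho>\<^sub>1 * \<psi>' \<rho>\<^sub>2\<bar> \<le> a * C + B * d"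
      using assms(1-4) by (intro prod_diff_le) auto
    then show "\<bar>of_bool (V \<rho>\<^sub>2 \<and> deg \<rho>\<^sub>1 + deg \<rho>\<^sub>2 \<le> n \<and> opr \<rho>\<^sub>1 \<rho>\<^sub>2 = \<tau>) * (\<phi> \<rho>\<^sub>1 * \<psi> \<rho>\<^sub>2 - \<phi>' \<rho>\<^sub>1 * \<psi>' \<rho>\<^sub>2)\<bar> \<le> a * C + B * d"
      using nn by simp
  qed (use nn M in \<open>auto intro!: mult_nonneg_nonneg order_trans[OF of_nat_0_le_iff M]\<close>)
  finally show ?thesis .
qed

text \<open>The controls \<open>W m\<close> vary with the approximating path, while
  \<open>H\<close>, \<open>M\<close> and \<open>Lc\<close> do not; this makes the estimates uniform
  in \<open>m\<close>.\<close>

locale lift_sequence =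
  fixes n :: nat and p N H M T Lc :: real and W :: "nat \<Rightarrow> real \<Rightarrow> real \<Rightarrow> real"
    and Z :: "real \<Rightarrow> real \<Rightarrow> 'd::finite forest \<Rightarrow> real" and Z' :: "nat \<Rightarrow> real \<Rightarrow> real \<Rightarrow> 'd forest \<Rightarrow> real"
    and \<beta> :: "'e::finite \<Rightarrow> real \<Rightarrow> 'd forest \<Rightarrow> real" and \<beta>' :: "nat \<Rightarrow> 'e \<Rightarrow> real \<Rightarrow> 'd forest \<Rightarrow> real"
    and \<Phi> :: "real \<Rightarrow> real \<Rightarrow> 'e forest \<Rightarrow> 'd forest \<Rightarrow> real" and \<Phi>' :: "nat \<Rightarrow> real \<Rightarrow> real \<Rightarrow> 'e forest \<Rightarrow> 'd forest \<Rightarrow> real"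
    and e :: "nat \<Rightarrow> real"
  assumes lift: "\<And>m. rough_lift n p N H M 0 T (W m) Z \<beta> \<Phi> Lc"
    and lift': "\<And>m. rough_lift n p N H M 0 T (W m) (Z' m) (\<beta>' m) (\<Phi>' m) Lc"
    and np: "real n \<le> p"
    and e_limit: "e \<longlonglongrightarrow> 0" and e_nonneg: "\<And>m. 0 \<le> e m"
    and dZ: "\<And>m s t \<rho>. 0 \<le> s \<Longrightarrow> s \<le> t \<Longrightarrow> t \<le> T \<Longrightarrow> deg \<rho> \<le> n \<Longrightarrow>
      \<bar>Z s t \<rho> - Z' m s t \<rho>\<bar> \<le> e m * (W m s t powr (1 / p)) ^ deg \<rho>"
    and d\<beta>: "\<And>m j t \<sigma>. 0 \<le> t \<Longrightarrow> t \<le> T \<Longrightarrow> deg \<sigma> \<le> n \<Longrightarrow> \<bar>\<beta> j t \<sigma> - \<beta>' m j t \<sigma>\<bar> \<le> e m"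
begin

abbreviation "KK \<equiv> rough_lift.KK p N H M Lc"
abbreviation "w m s t \<equiv> W m s t powr (1 / p)"

text \<open>The bound on all coefficients carries the induction; the weighted bound on the value is
  what the metric \<open>d_p\<close> measures. The null sequence does not depend on the
  times.\<close>

definition close :: "'e forest \<Rightarrow> bool" where
  "close \<rho> \<longleftrightarrow> (\<exists>\<eta>. \<eta> \<longlonglongrightarrow> 0 \<and> (\<forall>m s t. 0 \<le> s \<longrightarrow> s \<le> t \<longrightarrow> t \<le> T \<longrightarrow>
     (\<forall>\<sigma>. deg \<sigma> \<le> n \<longrightarrow> \<bar>\<Phi> s t \<rho> \<sigma> - \<Phi>' m s t \<rho> \<sigma>\<bar> \<le> \<eta> m) \<and>
     \<bar>\<Phi> s t \<rho> {#} - \<Phi>' m s t \<rho> {#}\<bar> \<le> \<eta> m * w m s t ^ deg \<rho>))"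

lemma close_empty: "close {#}"
proof -
  have "\<Phi> s t {#} \<sigma> - \<Phi>' m s t {#} \<sigma> = 0" if "0 \<le> s" "s \<le> t" "t \<le> T" "deg \<sigma> \<le> n" for m s t \<sigma>
  proof -
    interpret A: rough_lift n p N H M 0 T "W m" Z \<beta> \<Phi> Lc by (rule lift)
    interpret B: rough_lift n p N H M 0 T "W m" "Z' m" "\<beta>' m" "\<Phi>' m" Lc by (rule lift')
    show ?thesis unfolding A.lift_empty[OF that] B.lift_empty[OF that] by (rule diff_self)
  qed
  then show ?thesis unfolding close_def by (intro exI[of _ "\<lambda>_. 0"]) auto
qed

lemma lift_abs_le:
  assumes "deg \<rho> \<le> n" "0 \<le> s" "s \<le> t" "t \<le> T" "deg \<sigma> \<le> n"
  shows "\<bar>\<Phi> s t \<rho> \<sigma>\<bar> \<le> KK \<rho>" "\<bar>\<Phi>' m s t \<rho> \<sigma>\<bar> \<le> KK \<rho>"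
proof -
  interpret A: rough_lift n p N H M 0 T "W m" Z \<beta> \<Phi> Lc by (rule lift)
  interpret B: rough_lift n p N H M 0 T "W m" "Z' m" "\<beta>' m" "\<Phi>' m" Lc by (rule lift')
  show "\<bar>\<Phi> s t \<rho> \<sigma>\<bar> \<le> KK \<rho>" "\<bar>\<Phi>' m s t \<rho> \<sigma>\<bar> \<le> KK \<rho>"
    using A.controlled_bd[OF A.lift_controlled, of \<rho> s t \<sigma>] B.controlled_bd[OF B.lift_controlled, of \<rho> s t \<sigma>] assms by auto
qed

lemma close_plus:
  assumes c: "close \<rho>\<^sub>1" "close \<rho>\<^sub>2" and d: "deg \<rho>\<^sub>1 + deg \<rho>\<^sub>2 \<le> n"
  shows "close (\<rho>\<^sub>1 + \<rho>\<^sub>2)"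
proof -
  obtain \<eta>\<^sub>1 where \<eta>\<^sub>10: "\<eta>\<^sub>1 \<longlonglongrightarrow> 0" and q1: "\<forall>m s t. 0 \<le> s \<longrightarrow> s \<le> t \<longrightarrow> t \<le> T \<longrightarrow>
      (\<forall>\<sigma>. deg \<sigma> \<le> n \<longrightarrow> \<bar>\<Phi> s t \<rho>\<^sub>1 \<sigma> - \<Phi>' m s t \<rho>\<^sub>1 \<sigma>\<bar> \<le> \<eta>\<^sub>1 m) \<and>
      \<bar>\<Phi> s t \<rho>\<^sub>1 {#} - \<Phi>' m s t \<rho>\<^sub>1 {#}\<bar> \<le> \<eta>\<^sub>1 m * w m s t ^ deg \<rho>\<^sub>1"
    using c(1) unfolding close_def by (elim exE conjE) (rule that)
  note \<eta>\<^sub>1 = \<eta>\<^sub>10 q1[rule_format, THEN conjunct1, rule_format] q1[rule_format, THEN conjunct2]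
  obtain \<eta>\<^sub>2 where \<eta>\<^sub>20: "\<eta>\<^sub>2 \<longlonglongrightarrow> 0" and q2: "\<forall>m s t. 0 \<le> s \<longrightarrow> s \<le> t \<longrightarrow> t \<le> T \<longrightarrow>
      (\<forall>\<sigma>. deg \<sigma> \<le> n \<longrightarrow> \<bar>\<Phi> s t \<rho>\<^sub>2 \<sigma> - \<Phi>' m s t \<rho>\<^sub>2 \<sigma>\<bar> \<le> \<eta>\<^sub>2 m) \<and>
      \<bar>\<Phi> s t \<rho>\<^sub>2 {#} - \<Phi>' m s t \<rho>\<^sub>2 {#}\<bar> \<le> \<eta>\<^sub>2 m * w m s t ^ deg \<rho>\<^sub>2"
    using c(2) unfolding close_def by (elim exE conjE) (rule that)
  note \<eta>\<^sub>2 = \<eta>\<^sub>20 q2[rule_format, THEN conjunct1, rule_format] q2[rule_format, THEN conjunct2]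
  have d12: "deg \<rho>\<^sub>1 \<le> n" "deg \<rho>\<^sub>2 \<le> n" using d by auto
  define c1 where "c1 \<rho> = (M * H + 1) * rough_data.Q p N H M ^ (2 * n) * Lc ^ deg \<rho>" for \<rho> :: "'e forest"
  define \<eta> where "\<eta> m = M * (M * (\<bar>\<eta>\<^sub>1 m\<bar> * KK \<rho>\<^sub>2 + KK \<rho>\<^sub>1 * \<bar>\<eta>\<^sub>2 m\<bar>)) + (\<bar>\<eta>\<^sub>1 m\<bar> * c1 \<rho>\<^sub>2 + c1 \<rho>\<^sub>1 * \<bar>\<eta>\<^sub>2 m\<bar>)" for m
  have "\<eta> \<longlonglongrightarrow> M * (M * (\<bar>0\<bar> * KK \<rho>\<^sub>2 + KK \<rho>\<^sub>1 * \<bar>0\<bar>)) + (\<bar>0\<bar> * c1 \<rho>\<^sub>2 + c1 \<rho>\<^sub>1 * \<bar>0\<bar>)"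
    unfolding \<eta>_def by (intro tendsto_intros \<eta>\<^sub>1(1) \<eta>\<^sub>2(1))
  then have lim: "\<eta> \<longlonglongrightarrow> 0" by simp
  have "(\<forall>\<sigma>. deg \<sigma> \<le> n \<longrightarrow> \<bar>\<Phi> s t (\<rho>\<^sub>1 + \<rho>\<^sub>2) \<sigma> - \<Phi>' m s t (\<rho>\<^sub>1 + \<rho>\<^sub>2) \<sigma>\<bar> \<le> \<eta> m) \<and>
     \<bar>\<Phi> s t (\<rho>\<^sub>1 + \<rho>\<^sub>2) {#} - \<Phi>' m s t (\<rho>\<^sub>1 + \<rho>\<^sub>2) {#}\<bar> \<le> \<eta> m * w m s t ^ deg (\<rho>\<^sub>1 + \<rho>\<^sub>2)"
    if st: "0 \<le> s" "s \<le> t" "t \<le> T" for m s t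
  proof -
    interpret A: rough_lift n p N H M 0 T "W m" Z \<beta> \<Phi> Lc by (rule lift)
    interpret B: rough_lift n p N H M 0 T "W m" "Z' m" "\<beta>' m" "\<Phi>' m" Lc by (rule lift')
    have K0: "0 \<le> KK \<rho>\<^sub>1" "0 \<le> KK \<rho>\<^sub>2" by (rule A.KK_nonneg)+
    have c0: "0 \<le> c1 \<rho>" for \<rho> using A.M1 A.H A.Q_ge A.L0 by (simp add: c1_def)
    have M0: "0 \<le> M" using A.M1 by simp
    have part: "0 \<le> M * (M * (\<bar>\<eta>\<^sub>1 m\<bar> * KK \<rho>\<^sub>2 + KK \<rho>\<^sub>1 * \<bar>\<eta>\<^sub>2 m\<bar>))" "0 \<le> \<bar>\<eta>\<^sub>1 m\<bar> * c1 \<rho>\<^sub>2 + c1 \<rho>\<^sub>1 * \<bar>\<eta>\<^sub>2 m\<bar>"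
      using K0 c0 M0 by (intro mult_nonneg_nonneg add_nonneg_nonneg; simp)+
    have 1: "\<bar>\<Phi> s t (\<rho>\<^sub>1 + \<rho>\<^sub>2) \<sigma> - \<Phi>' m s t (\<rho>\<^sub>1 + \<rho>\<^sub>2) \<sigma>\<bar> \<le> \<eta> m" if "deg \<sigma> \<le> n" for \<sigma>
    proof -
      have "\<bar>\<Phi> s t (\<rho>\<^sub>1 + \<rho>\<^sub>2) \<sigma> - \<Phi>' m s t (\<rho>\<^sub>1 + \<rho>\<^sub>2) \<sigma>\<bar> \<le> M * (M * (\<bar>\<eta>\<^sub>1 m\<bar> * KK \<rho>\<^sub>2 + KK \<rho>\<^sub>1 * \<bar>\<eta>\<^sub>2 m\<bar>))"
        unfolding A.lift_plus[OF st d that] B.lift_plus[OF st d that]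
      proof (rule conv_diff_le)
        show "\<bar>\<Phi> s t \<rho>\<^sub>1 \<kappa> - \<Phi>' m s t \<rho>\<^sub>1 \<kappa>\<bar> \<le> \<bar>\<eta>\<^sub>1 m\<bar>" "\<bar>\<Phi> s t \<rho>\<^sub>2 \<kappa> - \<Phi>' m s t \<rho>\<^sub>2 \<kappa>\<bar> \<le> \<bar>\<eta>\<^sub>2 m\<bar>"
          if "deg \<kappa> \<le> n" for \<kappa>
          using \<eta>\<^sub>1(2)[OF st that, of m] \<eta>\<^sub>2(2)[OF st that, of m] by linarith+
      qed (use lift_abs_le d12 st A.M_card in auto)
      then show ?thesis unfolding \<eta>_def using part(2) by linarith
    qed
    have w: "0 \<le> w m s t" by simp
    have "\<bar>\<Phi> s t (\<rho>\<^sub>1 + \<rho>\<^sub>2) {#} - \<Phi>' m s t (\<rho>\<^sub>1 + \<rho>\<^sub>2) {#}\<bar> \<le>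
       (\<bar>\<eta>\<^sub>1 m\<bar> * w m s t ^ deg \<rho>\<^sub>1) * (c1 \<rho>\<^sub>2 * w m s t ^ deg \<rho>\<^sub>2) + (c1 \<rho>\<^sub>1 * w m s t ^ deg \<rho>\<^sub>1) * (\<bar>\<eta>\<^sub>2 m\<bar> * w m s t ^ deg \<rho>\<^sub>2)"
      unfolding A.lift_plus_value[OF st d] B.lift_plus_value[OF st d]
    proof (rule prod_diff_le)
      have "\<eta>\<^sub>1 m * w m s t ^ deg \<rho>\<^sub>1 \<le> \<bar>\<eta>\<^sub>1 m\<bar> * w m s t ^ deg \<rho>\<^sub>1" "\<eta>\<^sub>2 m * w m s t ^ deg \<rho>\<^sub>2 \<le> \<bar>\<eta>\<^sub>2 m\<bar> * w m s t ^ deg \<rho>\<^sub>2"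
        by (intro mult_right_mono; simp)+
      then show "\<bar>\<Phi> s t \<rho>\<^sub>1 {#} - \<Phi>' m s t \<rho>\<^sub>1 {#}\<bar> \<le> \<bar>\<eta>\<^sub>1 m\<bar> * w m s t ^ deg \<rho>\<^sub>1"
        "\<bar>\<Phi> s t \<rho>\<^sub>2 {#} - \<Phi>' m s t \<rho>\<^sub>2 {#}\<bar> \<le> \<bar>\<eta>\<^sub>2 m\<bar> * w m s t ^ deg \<rho>\<^sub>2"
        using \<eta>\<^sub>1(3)[OF st, of m] \<eta>\<^sub>2(3)[OF st, of m] by linarith+
      show "\<bar>\<Phi> s t \<rho>\<^sub>2 {#}\<bar> \<le> c1 \<rho>\<^sub>2 * w m s t ^ deg \<rho>\<^sub>2"
        unfolding c1_def by (rule A.lift_bound[OF d12(2) st, unfolded A.w_def])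
      show "\<bar>\<Phi>' m s t \<rho>\<^sub>1 {#}\<bar> \<le> c1 \<rho>\<^sub>1 * w m s t ^ deg \<rho>\<^sub>1"
        unfolding c1_def by (rule B.lift_bound[OF d12(1) st, unfolded B.w_def])
    qed
    also have "\<dots> = (\<bar>\<eta>\<^sub>1 m\<bar> * c1 \<rho>\<^sub>2 + c1 \<rho>\<^sub>1 * \<bar>\<eta>\<^sub>2 m\<bar>) * w m s t ^ (deg \<rho>\<^sub>1 + deg \<rho>\<^sub>2)"
      by (simp add: power_add algebra_simps)
    also have "\<dots> \<le> \<eta> m * w m s t ^ (deg \<rho>\<^sub>1 + deg \<rho>\<^sub>2)"
      unfolding \<eta>_def using part(1) by (intro mult_right_mono) auto
    finally show ?thesis using 1 by simp
  qed
  then show ?thesis unfolding close_def using lim by blast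
qed

text \<open>The defect of the difference of the two integrands is at most of order \<open>\<omega>\<^sup>\<theta>\<close> and uniformly
  small; interpolating between the two bounds keeps an exponent above 1 and gains a factor tending
  to 0.\<close>

lemma close_node:
  assumes c: "close \<rho>" and d: "deg \<rho> < n"
  shows "close {#Node j \<rho>#}"
proof -
  obtain \<eta> where \<eta>0: "\<eta> \<longlonglongrightarrow> 0" and q: "\<forall>m s t. 0 \<le> s \<longrightarrow> s \<le> t \<longrightarrow> t \<le> T \<longrightarrow>
      (\<forall>\<sigma>. deg \<sigma> \<le> n \<longrightarrow> \<bar>\<Phi> s t \<rho> \<sigma> - \<Phi>' m s t \<rho> \<sigma>\<bar> \<le> \<eta> m) \<and>
      \<bar>\<Phi> s t \<rho> {#} - \<Phi>' m s t \<rho> {#}\<bar> \<le> \<eta> m * w m s t ^ deg \<rho>"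
    using c unfolding close_def by (elim exE conjE) (rule that)
  note \<eta> = \<eta>0 q[rule_format, THEN conjunct1, rule_format]
  let ?\<tau> = "{#Node j \<rho>#}"
  have dn: "deg \<rho> \<le> n" "deg ?\<tau> \<le> n" using d by auto
  define \<theta> where "\<theta> = N / p"
  \<comment> \<open>Halfway between 1 and \<theta>: the interpolated defect keeps an exponent above
    1 and gains the positive power \<open>1 - \<mu>\<close> of the smallness.\<close>
  define \<theta>' where "\<theta>' = (1 + \<theta>) / 2"
  define \<mu> where "\<mu> = \<theta>' / \<theta>"
  have \<theta>: "1 < \<theta>"
  proof -
    interpret A: rough_lift n p N H M 0 T "W 0" Z \<beta> \<Phi> Lc by (rule lift)
    show ?thesis unfolding \<theta>_def by (rule A.theta)
  qed
  have \<theta>': "1 < \<theta>'" and \<mu>: "0 < \<mu>" "\<mu> < 1" "\<theta> * \<mu> = \<theta>'" using \<theta> by (auto simp: \<theta>'_def \<mu>_def field_simps)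
  \<comment> \<open>\<open>\<eta>'\<close> bounds the difference of the coefficients at nonempty
    forests, \<open>\<zeta>\<close> that of the Riemann summands and \<open>\<kappa>\<close> the
    interpolated defect; \<open>\<eta>''\<close> is the total.\<close>
  define \<eta>' where "\<eta>' m = M * (M * (\<bar>\<eta> m\<bar> * Lc + KK \<rho> * e m))" for m
  define \<zeta> where "\<zeta> m = M * (\<eta>' m * H + KK ?\<tau> * e m)" for m
  define K0 where "K0 = M * (3 * M ^ 4 * H ^ 2 * KK \<rho> * Lc) * H"
  define \<kappa> where "\<kappa> m = (2 * K0) powr \<mu> * (3 * \<zeta> m) powr (1 - \<mu>)" for m
  define \<eta>'' where "\<eta>'' m = \<eta>' m + (\<zeta> m + sew_const \<theta>' * \<kappa> m)" for m
  have "\<eta>' \<longlonglongrightarrow> M * (M * (\<bar>0\<bar> * Lc + KK \<rho> * 0))" unfolding \<eta>'_def by (intro tendsto_intros \<eta>(1) e_limit)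
  then have l1: "\<eta>' \<longlonglongrightarrow> 0" by simp
  have "\<zeta> \<longlonglongrightarrow> M * (0 * H + KK ?\<tau> * 0)" unfolding \<zeta>_def by (intro tendsto_intros l1 e_limit)
  then have l2: "\<zeta> \<longlonglongrightarrow> 0" by simp
  have sgn: "0 \<le> \<eta>' m" "0 \<le> \<zeta> m" "0 \<le> K0" "0 \<le> \<kappa> m" "0 \<le> KK \<rho>" "0 \<le> KK ?\<tau>" "0 \<le> M" "0 \<le> H" "0 \<le> Lc" for m
  proof -
    interpret A: rough_lift n p N H M 0 T "W m" Z \<beta> \<Phi> Lc by (rule lift)
    show K: "0 \<le> KK \<rho>" "0 \<le> KK ?\<tau>" by (rule A.KK_nonneg)+
    show M: "0 \<le> M" "0 \<le> H" "0 \<le> Lc" using A.M1 A.H A.L0 by linarith+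
    show 1: "0 \<le> \<eta>' m" unfolding \<eta>'_def using K M e_nonneg by (intro mult_nonneg_nonneg add_nonneg_nonneg) auto
    show "0 \<le> \<zeta> m" unfolding \<zeta>_def using 1 K M e_nonneg by (intro mult_nonneg_nonneg add_nonneg_nonneg) auto
    show "0 \<le> K0" unfolding K0_def using K M by simp
    show "0 \<le> \<kappa> m" by (simp add: \<kappa>_def)
  qed
  have "\<kappa> \<longlonglongrightarrow> (2 * K0) powr \<mu> * (3 * 0) powr (1 - \<mu>)"
    unfolding \<kappa>_def using \<mu> sgn by (intro tendsto_intros tendsto_powr' l2) auto
  then have l3: "\<kappa> \<longlonglongrightarrow> 0" by simp
  have "\<eta>'' \<longlonglongrightarrow> 0 + (0 + sew_const \<theta>' * 0)" unfolding \<eta>''_def by (intro tendsto_intros l1 l2 l3)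
  then have lim: "\<eta>'' \<longlonglongrightarrow> 0" by simp
  have S0: "0 < sew_const \<theta>'" using \<theta>' by (rule sew_const_pos)
  have "(\<forall>\<sigma>. deg \<sigma> \<le> n \<longrightarrow> \<bar>\<Phi> s t ?\<tau> \<sigma> - \<Phi>' m s t ?\<tau> \<sigma>\<bar> \<le> \<eta>'' m) \<and>
     \<bar>\<Phi> s t ?\<tau> {#} - \<Phi>' m s t ?\<tau> {#}\<bar> \<le> \<eta>'' m * w m s t ^ deg ?\<tau>"
    if st: "0 \<le> s" "s \<le> t" "t \<le> T" for m s t
  proof -
    interpret A: rough_lift n p N H M 0 T "W m" Z \<beta> \<Phi> Lc by (rule lift)
    interpret B: rough_lift n p N H M 0 T "W m" "Z' m" "\<beta>' m" "\<Phi>' m" Lc by (rule lift')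
    have sT: "s \<le> T" using st by simp
    note cA = A.lift_controlled[OF dn(1) st(1) sT] and cB = B.lift_controlled[OF dn(1) st(1) sT]
    have ne: "\<bar>\<Phi> s x ?\<tau> \<sigma> - \<Phi>' m s x ?\<tau> \<sigma>\<bar> \<le> \<eta>' m" if "\<sigma> \<noteq> {#}" "deg \<sigma> \<le> n" "s \<le> x" "x \<le> T" for \<sigma> x
      unfolding A.lift_node[OF st(1) that(3,4) d that(2,1)] B.lift_node[OF st(1) that(3,4) d that(2,1)] \<eta>'_def
    proof (rule conv_diff_le)
      show "\<bar>\<Phi> s x \<rho> \<kappa> - \<Phi>' m s x \<rho> \<kappa>\<bar> \<le> \<bar>\<eta> m\<bar>" if "deg \<kappa> \<le> n" for \<kappa>
        using \<eta>(2)[OF st(1) \<open>s \<le> x\<close> \<open>x \<le> T\<close> that, of m] by linarith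
      show "\<bar>\<beta> j x \<kappa>\<bar> \<le> Lc" if "deg \<kappa> \<le> n" for \<kappa>
        using A.controlled_bd[OF A.\<beta>_controlled] \<open>s \<le> x\<close> \<open>x \<le> T\<close> st that by auto
      show "\<bar>\<beta> j x \<kappa> - \<beta>' m j x \<kappa>\<bar> \<le> e m" if "deg \<kappa> \<le> n" for \<kappa>
        using d\<beta> \<open>s \<le> x\<close> \<open>x \<le> T\<close> st that by auto
    qed (use lift_abs_le dn st that A.M_card in auto)
    let ?\<Xi> = "\<lambda>x y. pair0 n (\<Phi> s x ?\<tau>) (Z x y)" and ?\<Xi>' = "\<lambda>x y. pair0 n (\<Phi>' m s x ?\<tau>) (Z' m x y)"
    define \<Delta> where "\<Delta> x y = ?\<Xi> x y - ?\<Xi>' x y" for x y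
    have ZZ: "\<bar>Z x y \<sigma> - Z' m x y \<sigma>\<bar> \<le> e m" if "s \<le> x" "x \<le> y" "y \<le> T" "deg \<sigma> \<le> n" for x y \<sigma>
    proof -
      have "w m x y ^ deg \<sigma> \<le> 1" using A.w_le1[of x y] that st by (intro power_le_one) (auto simp: A.w_def)
      then have "e m * w m x y ^ deg \<sigma> \<le> e m * 1" using e_nonneg by (rule mult_left_mono)
      then show ?thesis using dZ[of x y \<sigma> m] that st by simp
    qed
    have \<Delta>_le: "\<bar>\<Delta> x y\<bar> \<le> \<zeta> m" if xy: "s \<le> x" "x \<le> y" "y \<le> T" for x y
      unfolding \<Delta>_def pair0_def sum_subtractf[symmetric] \<zeta>_def
    proof (rule sum_abs_le)
      fix \<sigma> :: "'d forest" assume "\<sigma> \<in> forests n"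
      then have \<sigma>: "\<sigma> \<noteq> {#}" "deg \<sigma> \<le> n" by (auto simp: forests_def)
      show "\<bar>\<Phi> s x ?\<tau> \<sigma> * Z x y \<sigma> - \<Phi>' m s x ?\<tau> \<sigma> * Z' m x y \<sigma>\<bar> \<le> \<eta>' m * H + KK ?\<tau> * e m"
      proof (rule prod_diff_le)
        show "\<bar>\<Phi> s x ?\<tau> \<sigma> - \<Phi>' m s x ?\<tau> \<sigma>\<bar> \<le> \<eta>' m" by (rule ne[OF \<sigma> xy(1) order_trans[OF xy(2,3)]])
        show "\<bar>Z x y \<sigma>\<bar> \<le> H" using xy st \<sigma> by (intro A.ZH) auto
        show "\<bar>\<Phi>' m s x ?\<tau> \<sigma>\<bar> \<le> KK ?\<tau>" using xy st \<sigma> dn by (intro lift_abs_le) auto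
      qed (rule ZZ[OF xy \<sigma>(2)])
    qed (use card_forests_le[of n, where 'l = 'd] A.M_card sgn e_nonneg in auto)
    have defect: "\<bar>\<Delta> x z - \<Delta> x y - \<Delta> y z\<bar> \<le> \<kappa> m * W m x z powr \<theta>'"
      if xy: "s \<le> x" "x \<le> y" "y \<le> z" "z \<le> T" for x y z
    proof -
      have "\<bar>?\<Xi> x z - ?\<Xi> x y - ?\<Xi> y z\<bar> \<le> K0 * W m x z powr \<theta>"
        unfolding K0_def \<theta>_def
      proof (rule A.node_defect[OF cA _ _ st(1) sT _ xy])
        show "A.controlled single Lc s (\<beta> j)" by (rule A.controlled_subset[OF A.\<beta>_controlled st(1)])
        show "\<not> single \<kappa> \<Longrightarrow> \<beta> j v \<kappa> = 0" for v \<kappa> by (rule A.\<beta>_supp)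
        show "\<Phi> s v ?\<tau> \<sigma> = conv n graftf single (\<Phi> s v \<rho>) (\<beta> j v) \<sigma>"
          if "s \<le> v" "v \<le> T" "deg \<sigma> \<le> n" "\<sigma> \<noteq> {#}" for v \<sigma>
          using A.lift_node[OF st(1) that(1,2) d that(3,4)] .
      qed
      moreover have "\<bar>?\<Xi>' x z - ?\<Xi>' x y - ?\<Xi>' y z\<bar> \<le> K0 * W m x z powr \<theta>"
        unfolding K0_def \<theta>_def
      proof (rule B.node_defect[OF cB _ _ st(1) sT _ xy])
        show "B.controlled single Lc s (\<beta>' m j)" by (rule B.controlled_subset[OF B.\<beta>_controlled st(1)])
        show "\<not> single \<kappa> \<Longrightarrow> \<beta>' m j v \<kappa> = 0" for v \<kappa> by (rule B.\<beta>_supp)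
        show "\<Phi>' m s v ?\<tau> \<sigma> = conv n graftf single (\<Phi>' m s v \<rho>) (\<beta>' m j v) \<sigma>"
          if "s \<le> v" "v \<le> T" "deg \<sigma> \<le> n" "\<sigma> \<noteq> {#}" for v \<sigma>
          using B.lift_node[OF st(1) that(1,2) d that(3,4)] .
      qed
      ultimately have 1: "\<bar>\<Delta> x z - \<Delta> x y - \<Delta> y z\<bar> \<le> 2 * K0 * W m x z powr \<theta>" unfolding \<Delta>_def by linarith
      have 2: "\<bar>\<Delta> x z - \<Delta> x y - \<Delta> y z\<bar> \<le> 3 * \<zeta> m"
        using \<Delta>_le[of x z] \<Delta>_le[of x y] \<Delta>_le[of y z] xy by linarith
      have "\<bar>\<Delta> x z - \<Delta> x y - \<Delta> y z\<bar> \<le> (2 * K0 * W m x z powr \<theta>) powr \<mu> * (3 * \<zeta> m) powr (1 - \<mu>)"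
        using 1 2 \<mu> by (intro interpolate_min) auto
      also have "(2 * K0 * W m x z powr \<theta>) powr \<mu> = (2 * K0) powr \<mu> * W m x z powr \<theta>'"
        by (simp only: powr_mult[of "2 * K0"] powr_powr \<mu>(3))
      finally show ?thesis by (simp add: \<kappa>_def mult_ac)
    qed
    have "(partition_sum \<Delta> \<longlongrightarrow> (\<Phi> s t ?\<tau> {#} - \<Phi> s s ?\<tau> {#}) - (\<Phi>' m s t ?\<tau> {#} - \<Phi>' m s s ?\<tau> {#})) (mesh_to_zero s t)"
    proof -
      have "partition_sum \<Delta> = (\<lambda>D. partition_sum ?\<Xi> D - partition_sum ?\<Xi>' D)"
        unfolding \<Delta>_def by (rule ext) (rule partition_sum_diff)
      then show ?thesis
        using tendsto_diff[OF A.lift_limit[OF st(1) order_refl st(2,3) d] B.lift_limit[OF st(1) order_refl st(2,3) d]] by simp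
    qed
    then have limD: "(partition_sum \<Delta> \<longlongrightarrow> \<Phi> s t ?\<tau> {#} - \<Phi>' m s t ?\<tau> {#}) (mesh_to_zero s t)"
      by (simp add: A.lift_start[OF st(1) sT d] B.lift_start[OF st(1) sT d])
    have "\<bar>(\<Phi> s t ?\<tau> {#} - \<Phi>' m s t ?\<tau> {#}) - \<Delta> s t\<bar> \<le> sew_const \<theta>' * \<kappa> m * W m s t powr \<theta>'"
    proof (rule mesh_limit_bound[OF limD st(2)])
      fix D assume "D \<in> partitions s t"
      then show "\<bar>partition_sum \<Delta> D - \<Delta> s t\<bar> \<le> sew_const \<theta>' * \<kappa> m * W m s t powr \<theta>'"
        using sewing_bound[OF control_subset[OF A.ctl st(1) order_refl] \<theta>' sgn(4), of \<Delta> m D s t] defect st(3) by blast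
    qed
    \<comment> \<open>By \<open>n \<le> p\<close> the exponent \<open>deg ?\<tau> / p\<close> is at
      most 1, hence below \<open>\<theta>'\<close>.\<close>
    moreover have wk: "W m s t powr \<theta>' \<le> w m s t ^ deg ?\<tau>"
    proof (cases "w m s t = 0")
      case True
      then show ?thesis using A.p \<theta>' by simp
    next
      case False
      have W: "0 \<le> W m s t" "W m s t \<le> 1" using control_nonneg[OF A.ctl st] A.\<omega>_le1[OF st] by auto
      have "w m s t ^ deg ?\<tau> = w m s t powr real (deg ?\<tau>)" using False by (intro powr_realpow[symmetric]) (simp add: order_less_le)
      also have "\<dots> = W m s t powr (real (deg ?\<tau>) / p)" by (simp add: powr_powr)
      finally have eq: "w m s t ^ deg ?\<tau> = W m s t powr (real (deg ?\<tau>) / p)" .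
      have "real (deg ?\<tau>) / p \<le> 1" using dn(2) np A.p by (simp add: divide_le_eq)
      then have "real (deg ?\<tau>) / p \<le> \<theta>'" using \<theta>' by simp
      then show ?thesis unfolding eq using W by (intro powr_mono') auto
    qed
    \<comment> \<open>At the starting time the coefficients below \<open>deg ?\<tau>\<close> vanish
      for both lifts, which turns the uniform bound into a weighted one.\<close>
    moreover have "\<bar>\<Delta> s t\<bar> \<le> \<zeta> m * w m s t ^ deg ?\<tau>"
    proof -
      have "\<bar>\<Delta> s t\<bar> \<le> M * ((\<eta>' m * H + KK ?\<tau> * e m) * w m s t ^ deg ?\<tau>)"
        unfolding \<Delta>_def pair0_def sum_subtractf[symmetric]
      proof (rule sum_abs_le)
        fix \<sigma> :: "'d forest" assume "\<sigma> \<in> forests n"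
        then have \<sigma>: "\<sigma> \<noteq> {#}" "deg \<sigma> \<le> n" by (auto simp: forests_def)
        show "\<bar>\<Phi> s s ?\<tau> \<sigma> * Z s t \<sigma> - \<Phi>' m s s ?\<tau> \<sigma> * Z' m s t \<sigma>\<bar> \<le> (\<eta>' m * H + KK ?\<tau> * e m) * w m s t ^ deg ?\<tau>"
        proof (cases "deg \<sigma> < deg ?\<tau>")
          case True
          then show ?thesis
            using A.lift_start_zero[OF st(1) sT dn(2) True] B.lift_start_zero[OF st(1) sT dn(2) True] sgn e_nonneg by simp
        next
          case False
          have ww: "w m s t ^ deg \<sigma> \<le> w m s t ^ deg ?\<tau>"
            using False A.w_le1[OF st] by (intro power_decreasing) (auto simp: A.w_def)
          have "\<bar>\<Phi> s s ?\<tau> \<sigma> * Z s t \<sigma> - \<Phi>' m s s ?\<tau> \<sigma> * Z' m s t \<sigma>\<bar> \<le>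
              \<eta>' m * (H * w m s t ^ deg ?\<tau>) + KK ?\<tau> * (e m * w m s t ^ deg ?\<tau>)"
          proof (rule prod_diff_le)
            show "\<bar>\<Phi> s s ?\<tau> \<sigma> - \<Phi>' m s s ?\<tau> \<sigma>\<bar> \<le> \<eta>' m" by (rule ne[OF \<sigma> order_refl sT])
            have "H * w m s t ^ deg \<sigma> \<le> H * w m s t ^ deg ?\<tau>" using ww sgn(8) by (rule mult_left_mono)
            then show "\<bar>Z s t \<sigma>\<bar> \<le> H * w m s t ^ deg ?\<tau>" using A.Zb[OF st \<sigma>(2)] by linarith
            show "\<bar>\<Phi>' m s s ?\<tau> \<sigma>\<bar> \<le> KK ?\<tau>" using sT st \<sigma> dn by (intro lift_abs_le) auto
            have "e m * w m s t ^ deg \<sigma> \<le> e m * w m s t ^ deg ?\<tau>" using ww e_nonneg by (rule mult_left_mono)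
            then show "\<bar>Z s t \<sigma> - Z' m s t \<sigma>\<bar> \<le> e m * w m s t ^ deg ?\<tau>" using dZ[OF st \<sigma>(2), of m] by linarith
          qed
          then show ?thesis by (simp add: algebra_simps)
        qed
      qed (use card_forests_le[of n, where 'l = 'd] A.M_card sgn e_nonneg in auto)
      then show ?thesis by (simp add: \<zeta>_def mult.assoc)
    qed
    moreover have "sew_const \<theta>' * \<kappa> m * W m s t powr \<theta>' \<le> sew_const \<theta>' * \<kappa> m * w m s t ^ deg ?\<tau>"
      using wk S0 sgn(4) by (intro mult_left_mono) auto
    ultimately have V: "\<bar>\<Phi> s t ?\<tau> {#} - \<Phi>' m s t ?\<tau> {#}\<bar> \<le> (\<zeta> m + sew_const \<theta>' * \<kappa> m) * w m s t ^ deg ?\<tau>"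
      unfolding distrib_right by linarith
    have nn: "0 \<le> \<zeta> m + sew_const \<theta>' * \<kappa> m" using sgn S0 by simp
    have V1: "\<bar>\<Phi> s t ?\<tau> {#} - \<Phi>' m s t ?\<tau> {#}\<bar> \<le> \<eta>'' m * w m s t ^ deg ?\<tau>"
    proof -
      have "(\<zeta> m + sew_const \<theta>' * \<kappa> m) * w m s t ^ deg ?\<tau> \<le> \<eta>'' m * w m s t ^ deg ?\<tau>"
        unfolding \<eta>''_def using sgn by (intro mult_right_mono) auto
      with V show ?thesis by linarith
    qed
    have e2: "0 \<le> \<eta>'' m" unfolding \<eta>''_def using sgn(1) nn by simp
    have "\<bar>\<Phi> s t ?\<tau> \<sigma> - \<Phi>' m s t ?\<tau> \<sigma>\<bar> \<le> \<eta>'' m" if "deg \<sigma> \<le> n" for \<sigma>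
    proof (cases "\<sigma> = {#}")
      case True
      have "w m s t ^ deg ?\<tau> \<le> 1" using A.w_le1[OF st] by (intro power_le_one) (auto simp: A.w_def)
      then have "\<eta>'' m * w m s t ^ deg ?\<tau> \<le> \<eta>'' m * 1" using e2 by (rule mult_left_mono)
      then show ?thesis using order_trans[OF V1] True by simp
    next
      case False
      then show ?thesis using ne[OF False that st(2,3)] nn by (simp add: \<eta>''_def)
    qed
    then show ?thesis using V1 by blast
  qed
  then show ?thesis unfolding close_def using lim by blast
qed

lemma all_close: "deg \<rho> \<le> n \<Longrightarrow> close \<rho>"
proof (induction \<rho> rule: forest_induct)
  case (plus \<rho>\<^sub>1 \<rho>\<^sub>2)
  then show ?case by (intro close_plus) auto
qed (auto intro: close_empty close_node)

end

section \<open>Continuity of the integral\<close>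

lemma powr_control_le:
  fixes x B w :: real
  assumes "0 \<le> x" "x \<le> B * w" "1 \<le> B" "0 \<le> w" "0 < p" "d \<le> n"
  shows "(x powr (1 / p)) ^ d \<le> (B powr (1 / p)) ^ n * (w powr (1 / p)) ^ d"
proof -
  have B: "1 \<le> B powr (1 / p)" using assms by (simp add: ge_one_powr_ge_zero)
  have "x powr (1 / p) \<le> (B * w) powr (1 / p)" using assms by (intro powr_mono2) auto
  also have "\<dots> = B powr (1 / p) * w powr (1 / p)" by (rule powr_mult)
  finally have "(x powr (1 / p)) ^ d \<le> (B powr (1 / p) * w powr (1 / p)) ^ d" by (rule power_mono) simp
  also have "\<dots> = (B powr (1 / p)) ^ d * (w powr (1 / p)) ^ d" by (rule power_mult_distrib)
  also have "\<dots> \<le> (B powr (1 / p)) ^ n * (w powr (1 / p)) ^ d"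
    using B assms(6) by (intro mult_right_mono power_increasing) auto
  finally show ?thesis .
qed

lemma powr_add_le:
  fixes x y r p :: real
  assumes "0 \<le> x" "0 \<le> y" "0 \<le> r" "r \<le> p"
  shows "(x + y) powr r \<le> 2 powr p * (x powr r + y powr r)"
proof -
  have "(x + y) powr r \<le> (2 * max x y) powr r" using assms by (intro powr_mono2) auto
  also have "\<dots> = 2 powr r * max x y powr r" by (rule powr_mult)
  also have "\<dots> \<le> 2 powr p * (x powr r + y powr r)"
    using assms by (intro mult_mono powr_mono) (auto simp: max_def)
  finally show ?thesis .
qed

lemma bc_diff_le:
  assumes C: "0 \<le> C" and bd: "\<And>i q. size q \<le> n - 1 \<Longrightarrow> \<bar>Dm (g i) q x - Dm (g i) q x'\<bar> \<le> C" and \<sigma>: "deg \<sigma> \<le> n"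
  shows "\<bar>bc n g x \<sigma> - bc n g x' \<sigma>\<bar> \<le> C"
proof (cases "\<exists>i q. \<sigma> = {#Node i (leaves q)#}")
  case True
  then obtain i q where eq: "\<sigma> = {#Node i (leaves q)#}" by blast
  have q: "size q \<le> n - 1" using \<sigma> by (simp add: eq)
  have "\<bar>bc n g x \<sigma> - bc n g x' \<sigma>\<bar> = \<bar>Dm (g i) q x - Dm (g i) q x'\<bar> / mfact q"
    unfolding eq bc_leaves[OF q] diff_divide_distrib[symmetric] using mfact_ge1[of q] by simp
  also have "\<dots> \<le> C"
    using bd[OF q, of i] mfact_ge1[of q] mult_mono[of C C 1 "mfact q"] C by (simp add: divide_le_eq)
  finally show ?thesis .
qed (use C in \<open>auto simp: bc_zero\<close>)

text \<open>The restriction \<open>e \<le> 1\<close> keeps the second path within a fixed distance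
  of the first, so that its variation can be bounded through \<open>X\<close> alone.\<close>

locale rough_pair = rough_setting p T X \<gamma> f
  for p T and X :: "real \<Rightarrow> 'd::finite forest \<Rightarrow> real" and \<gamma>
    and f :: "real ^ 'd \<Rightarrow> (real ^ 'd) \<Rightarrow>\<^sub>L (real ^ 'e::finite)" +
  fixes X' :: "real \<Rightarrow> 'd forest \<Rightarrow> real" and e :: real
  assumes rp': "branched_rough_path p T X'"
    and e: "0 < e" "e \<le> 1" and dp: "d_p p T X X' \<le> ennreal e"
begin

sublocale R: rough_setting p T X' \<gamma> f
  by unfold_locales (use p1 T0 rp' \<gamma> Lipf in auto)

abbreviation "Z' \<equiv> increment n X'"
definition nf :: real where "nf = real (card (forests n :: 'd forest set))"

lemma p0: "0 < p"
  using p1 by simp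

lemma start_diff: "norm (proj1 (X 0) - proj1 (X' 0)) \<le> e"
proof -
  have "ennreal (norm (proj1 (X 0) - proj1 (X' 0))) \<le> ennreal e"
    using dp unfolding d_p_def by (rule order_trans[rotated]) simp
  then show ?thesis using e by (simp add: ennreal_le_iff)
qed

definition g :: "'d forest \<Rightarrow> real \<Rightarrow> real \<Rightarrow> real" where
  "g \<rho> u v = \<bar>Z u v \<rho> - Z' u v \<rho>\<bar> powr (p / real (deg \<rho>))"

lemma bv_g:
  assumes \<rho>: "\<rho> \<in> forests n"
  shows "bounded_variation (g \<rho>) 0 T (e powr p)"
proof
  fix D assume D: "D \<in> partitions 0 T"
  let ?S = "partition_sum (g \<rho>) D"
  let ?sup = "\<lambda>\<rho>. SUP D\<in>partitions 0 T. ennreal (partition_sum (g \<rho>) D powr (1 / p))"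
  have "ennreal (?S powr (1 / p)) \<le> ?sup \<rho>" using D by (intro SUP_upper)
  also have "\<dots> \<le> Max (?sup ` forests n)" using \<rho> finite_forests by (intro Max_ge) auto
  also have "\<dots> \<le> ennreal (norm (proj1 (X 0) - proj1 (X' 0))) + Max (?sup ` forests n)" by simp
  also have "\<dots> = d_p p T X X'" unfolding d_p_def g_def[abs_def] ..
  also have "\<dots> \<le> ennreal e" by (rule dp)
  finally have "?S powr (1 / p) \<le> e" using e by (simp add: ennreal_le_iff)
  moreover have "0 \<le> ?S" using D by (rule partition_sum_nonneg) (simp add: g_def)
  ultimately show "?S \<le> e powr p" using p0 by (intro powr_le_imp_le_powr)
qed (simp add: g_def)

text \<open>The variation of the difference, divided by \<open>e powr p\<close>. Its total mass is
  at most the number of forests, and the smallness reappears as the factor \<open>e\<close> in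
  \<open>increment_diff\<close>.\<close>

definition wd :: "real \<Rightarrow> real \<Rightarrow> real" where
  "wd s t = (\<Sum>\<rho>\<in>forests n. 1 / e powr p * var_ctl (g \<rho>) s t)"

lemma wd_control: "control 0 T wd"
  unfolding wd_def[abs_def]
  by (intro control_sum finite_forests control_mult bounded_variation.var_control[OF bv_g]) (use e in auto)

lemma wd_le: "wd 0 T \<le> nf"
proof -
  have "wd 0 T \<le> (\<Sum>\<rho>\<in>(forests n :: 'd forest set). 1)"
    unfolding wd_def
  proof (rule sum_mono)
    fix \<rho> :: "'d forest" assume "\<rho> \<in> forests n"
    from bounded_variation.var_le_K[OF bv_g[OF this], of 0 T] have "var_ctl (g \<rho>) 0 T \<le> e powr p" using T0 by simp
    then show "1 / e powr p * var_ctl (g \<rho>) 0 T \<le> 1" using e by (simp add: divide_le_eq)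
  qed
  then show ?thesis by (simp add: nf_def)
qed

lemma increment_diff:
  assumes st: "0 \<le> s" "s \<le> t" "t \<le> T" and \<rho>: "deg \<rho> \<le> n"
  shows "\<bar>Z s t \<rho> - Z' s t \<rho>\<bar> \<le> e * (wd s t powr (1 / p)) ^ deg \<rho>"
proof (cases "\<rho> = {#} \<or> s = t")
  case True
  then have "Z s t \<rho> = Z' s t \<rho>" using Z_in[OF st] R.Z_in[OF st] Z_refl[of t] R.Z_refl[of t] st by auto
  then show ?thesis using e by simp
next
  case False
  then have d1: "1 \<le> deg \<rho>" using deg_eq_0_iff[of \<rho>] by linarith
  then have f: "\<rho> \<in> forests n" using \<rho> by (simp add: forests_def)
  have d: "0 < real (deg \<rho>)" using d1 by linarith
  interpret G: bounded_variation "g \<rho>" 0 T "e powr p" by (rule bv_g[OF f])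
  have ep: "0 < e powr p" using e by simp
  have "g \<rho> s t \<le> var_ctl (g \<rho>) s t" using False st by (intro G.var_ge) auto
  also have "\<dots> = e powr p * (1 / e powr p * var_ctl (g \<rho>) s t)" using ep by simp
  also have "\<dots> \<le> e powr p * wd s t"
    unfolding wd_def using f finite_forests st ep
    by (intro mult_left_mono member_le_sum mult_nonneg_nonneg control_nonneg[OF bounded_variation.var_control[OF bv_g]]) auto
  finally have le: "\<bar>Z s t \<rho> - Z' s t \<rho>\<bar> powr (1 / (real (deg \<rho>) / p)) \<le> e powr p * wd s t" by (simp add: g_def)
  have "\<bar>Z s t \<rho> - Z' s t \<rho>\<bar> \<le> (e powr p * wd s t) powr (real (deg \<rho>) / p)"
    using le d p0 by (intro powr_le_imp_le_powr) (auto intro: divide_pos_pos)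
  also have "\<dots> = ((e powr p) powr (real (deg \<rho>) / p)) * (wd s t powr (real (deg \<rho>) / p))" by (rule powr_mult)
  also have "(e powr p) powr (real (deg \<rho>) / p) = e ^ deg \<rho>" using p0 e by (simp add: powr_powr powr_realpow)
  also have "wd s t powr (real (deg \<rho>) / p) = (wd s t powr (1 / p)) ^ deg \<rho>"
  proof (cases "wd s t = 0")
    case True
    then show ?thesis using d1 by simp
  next
    case False
    then have "(wd s t powr (1 / p)) ^ deg \<rho> = (wd s t powr (1 / p)) powr real (deg \<rho>)"
      by (intro powr_realpow[symmetric]) simp
    then show ?thesis by (simp add: powr_powr)
  qed
  also have "e ^ deg \<rho> * (wd s t powr (1 / p)) ^ deg \<rho> \<le> e * (wd s t powr (1 / p)) ^ deg \<rho>"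
    using power_decreasing[OF d1, of e] e by (intro mult_right_mono) auto
  finally show ?thesis .
qed

text \<open>The difference of the two paths has variation sums at most 1, since
  \<open>e \<le> 1\<close>. What matters is that the bound does not mention
  \<open>X'\<close>.\<close>

lemma variation_le: "R.\<omega> p 0 T \<le> 2 powr p * nf * (\<omega> p 0 T + 1)"
proof -
  interpret P': bounded_variation "\<lambda>u v. R.c0 u v powr p" 0 T "enn2real (p_var p Z' 0 T) powr p" by (rule R.bv_p)
  interpret P: bounded_variation "\<lambda>u v. c0 u v powr p" 0 T "enn2real (p_var p Z 0 T) powr p" by (rule bv_p)
  have pt: "R.c0 u v powr p \<le> (\<Sum>\<rho>\<in>forests n. 2 powr p * (c0 u v powr p + g \<rho> u v))" for u v
  proof -
    have "R.c0 u v \<in> (\<lambda>\<rho>. \<bar>Z' u v \<rho>\<bar> powr (1 / real (deg \<rho>))) ` forests n"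
      unfolding R.c0_def char_norm_def using finite_forests forests_nonempty[OF n1] by (intro Max_in) auto
    then obtain \<rho> :: "'d forest" where \<rho>: "\<rho> \<in> forests n" "R.c0 u v = \<bar>Z' u v \<rho>\<bar> powr (1 / real (deg \<rho>))" by blast
    have d1: "1 \<le> real (deg \<rho>)" using \<rho>(1) by (simp add: forests_def)
    let ?r = "p / real (deg \<rho>)"
    have r: "0 \<le> ?r" "?r \<le> p" using d1 p0 by (auto simp: divide_le_eq mult_le_cancel_left1)
    have "R.c0 u v powr p = \<bar>Z' u v \<rho>\<bar> powr ?r" by (simp add: \<rho>(2) powr_powr)
    also have "\<dots> \<le> (\<bar>Z u v \<rho>\<bar> + \<bar>Z u v \<rho> - Z' u v \<rho>\<bar>) powr ?r" using r by (intro powr_mono2) auto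
    also have "\<dots> \<le> 2 powr p * (\<bar>Z u v \<rho>\<bar> powr ?r + \<bar>Z u v \<rho> - Z' u v \<rho>\<bar> powr ?r)" using r by (intro powr_add_le) auto
    also have "\<dots> \<le> 2 powr p * (c0 u v powr p + g \<rho> u v)"
    proof -
      have "\<bar>Z u v \<rho>\<bar> powr (1 / real (deg \<rho>)) \<le> c0 u v"
        unfolding c0_def char_norm_def using \<rho>(1) finite_forests by (intro Max_ge) auto
      then have "(\<bar>Z u v \<rho>\<bar> powr (1 / real (deg \<rho>))) powr p \<le> c0 u v powr p" using p0 by (intro powr_mono2) auto
      then show ?thesis by (intro mult_left_mono add_mono) (auto simp: powr_powr g_def)
    qed
    also have "\<dots> \<le> (\<Sum>\<rho>\<in>forests n. 2 powr p * (c0 u v powr p + g \<rho> u v))"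
      using \<rho>(1) finite_forests by (intro member_le_sum) (auto simp: g_def)
    finally show ?thesis .
  qed
  have "var_ctl (\<lambda>u v. R.c0 u v powr p) 0 T \<le> 2 powr p * nf * (\<omega> p 0 T + 1)"
  proof (rule P'.var_least)
    fix D assume D: "D \<in> partitions 0 T"
    have "partition_sum (\<lambda>u v. R.c0 u v powr p) D \<le>
        partition_sum (\<lambda>u v. \<Sum>\<rho>\<in>forests n. 2 powr p * (c0 u v powr p + g \<rho> u v)) D"
      by (intro partition_sum_mono[OF D] pt)
    also have "\<dots> = (\<Sum>\<rho>\<in>forests n. 2 powr p * (partition_sum (\<lambda>u v. c0 u v powr p) D + partition_sum (g \<rho>) D))"
      unfolding partition_sum_sum partition_sum_mult partition_sum_add ..
    also have "\<dots> \<le> (\<Sum>\<rho>\<in>(forests n :: 'd forest set). 2 powr p * (\<omega> p 0 T + 1))"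
    proof (intro sum_mono mult_left_mono add_mono)
      fix \<rho> :: "'d forest" assume "\<rho> \<in> forests n"
      then have "partition_sum (g \<rho>) D \<le> e powr p" using D by (rule bounded_variation.g_bounded[OF bv_g])
      also have "\<dots> \<le> 1" using e p0 by (simp add: powr_le1)
      finally show "partition_sum (g \<rho>) D \<le> 1" .
    qed (use P.var_upper[OF D] in \<open>auto simp: \<omega>_def\<close>)
    finally show "partition_sum (\<lambda>u v. R.c0 u v powr p) D \<le> 2 powr p * nf * (\<omega> p 0 T + 1)" by (simp add: mult_ac nf_def)
  qed (use T0 in simp)
  then show ?thesis by (simp add: R.\<omega>_def)
qed

text \<open>Bounds the total mass of the three summands of \<open>W\<close> through \<open>X\<close>
  only. \<open>H\<close> inherits this, as a sequence of approximating paths requires.\<close>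

definition B :: real where "B = max 1 (\<omega> p 0 T + 2 powr p * nf * (\<omega> p 0 T + 1) + nf)"

definition W :: "real \<Rightarrow> real \<Rightarrow> real" where "W s t = 1 / B * ((\<omega> p s t + R.\<omega> p s t) + wd s t)"

lemma B1: "1 \<le> B"
  by (simp add: B_def)

lemma W_control: "control 0 T W"
  unfolding W_def[abs_def] by (intro control_mult control_plus \<omega>_control R.\<omega>_control wd_control) (use B1 in auto)

lemma W_ge:
  assumes "0 \<le> s" "s \<le> t" "t \<le> T"
  shows "\<omega> p s t \<le> B * W s t" "R.\<omega> p s t \<le> B * W s t" "wd s t \<le> B * W s t"
    "0 \<le> \<omega> p s t" "0 \<le> R.\<omega> p s t" "0 \<le> wd s t" "0 \<le> W s t"
proof -
  show "0 \<le> \<omega> p s t" "0 \<le> R.\<omega> p s t" "0 \<le> wd s t" "0 \<le> W s t"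
    using control_nonneg[OF \<omega>_control[OF order_refl]] control_nonneg[OF R.\<omega>_control[OF order_refl]]
      control_nonneg[OF wd_control] control_nonneg[OF W_control] assms by auto
  then show "\<omega> p s t \<le> B * W s t" "R.\<omega> p s t \<le> B * W s t" "wd s t \<le> B * W s t"
    using B1 by (auto simp: W_def)
qed

lemma W_le1:
  assumes "0 \<le> s" "s \<le> t" "t \<le> T"
  shows "W s t \<le> 1"
proof -
  have "W s t \<le> W 0 T" using assms by (intro control_mono[OF W_control]) auto
  also have "\<dots> \<le> 1"
  proof -
    have "\<omega> p 0 T + R.\<omega> p 0 T + wd 0 T \<le> B" unfolding B_def using variation_le wd_le by (intro max.coboundedI2) linarith
    then show ?thesis using B1 by (simp add: W_def divide_le_eq)
  qed
  finally show ?thesis .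
qed

definition H :: real where "H = (B powr (1 / p)) ^ n"

lemma H1: "1 \<le> H"
  unfolding H_def using B1 p0 by (intro one_le_power) (simp add: ge_one_powr_ge_zero)

lemma pair_bounds:
  assumes st: "0 \<le> s" "s \<le> t" "t \<le> T" and \<rho>: "deg \<rho> \<le> n"
  shows "\<bar>Z s t \<rho>\<bar> \<le> H * (W s t powr (1 / p)) ^ deg \<rho>" "\<bar>Z' s t \<rho>\<bar> \<le> H * (W s t powr (1 / p)) ^ deg \<rho>"
    "\<bar>Z s t \<rho> - Z' s t \<rho>\<bar> \<le> e * H * (W s t powr (1 / p)) ^ deg \<rho>"
proof -
  note W = W_ge[OF st] and c = powr_control_le[OF _ _ B1 _ p0 \<rho>, folded H_def]
  show "\<bar>Z s t \<rho>\<bar> \<le> H * (W s t powr (1 / p)) ^ deg \<rho>"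
    using Z_bound[OF order_refl st \<rho>] c[OF W(4,1,7)] by linarith
  show "\<bar>Z' s t \<rho>\<bar> \<le> H * (W s t powr (1 / p)) ^ deg \<rho>"
    using R.Z_bound[OF order_refl st \<rho>] c[OF W(5,2,7)] by linarith
  have "e * (wd s t powr (1 / p)) ^ deg \<rho> \<le> e * (H * (W s t powr (1 / p)) ^ deg \<rho>)"
    using c[OF W(6,3,7)] e by (intro mult_left_mono) auto
  then show "\<bar>Z s t \<rho> - Z' s t \<rho>\<bar> \<le> e * H * (W s t powr (1 / p)) ^ deg \<rho>"
    using increment_diff[OF st \<rho>] by (simp add: mult.assoc)
qed

lemma path_diff:
  assumes t: "0 \<le> t" "t \<le> T"
  shows "norm (proj1 (X t) - proj1 (X' t)) \<le> e * (1 + real CARD('d) * H)"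
proof -
  let ?x = "proj1 (X t) - proj1 (X 0)" and ?x' = "proj1 (X' t) - proj1 (X' 0)"
  have "norm (?x - ?x') \<le> (\<Sum>i\<in>UNIV. \<bar>(?x - ?x') $ i\<bar>)" by (rule norm_le_l1_cart)
  also have "\<dots> \<le> (\<Sum>i\<in>(UNIV :: 'd set). e * H)"
  proof (rule sum_mono)
    fix i :: 'd
    have w: "W 0 t powr (1 / p) \<le> 1" using W_le1[of 0 t] W_ge(7)[of 0 t] t p0 by (intro powr_le1) auto
    have "(?x - ?x') $ i = Z 0 t {#bullet i#} - Z' 0 t {#bullet i#}"
      using proj1_increment[OF Xc _ _ n1, of 0 t i] proj1_increment[OF R.Xc _ _ n1, of 0 t i] t T0 by simp
    then have "\<bar>(?x - ?x') $ i\<bar> \<le> e * H * (W 0 t powr (1 / p))"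
      using pair_bounds(3)[of 0 t "{#bullet i#}"] t n1 by simp
    also have "\<dots> \<le> e * H * 1" using w e H1 by (intro mult_left_mono) auto
    finally show "\<bar>(?x - ?x') $ i\<bar> \<le> e * H" by simp
  qed
  finally have 1: "norm (?x - ?x') \<le> real CARD('d) * (e * H)" by simp
  have "proj1 (X t) - proj1 (X' t) = (proj1 (X 0) - proj1 (X' 0)) + (?x - ?x')" by simp
  then have "norm (proj1 (X t) - proj1 (X' t)) \<le> norm (proj1 (X 0) - proj1 (X' 0)) + norm (?x - ?x')"
    by (metis norm_triangle_ineq)
  then show ?thesis using 1 start_diff by (simp add: algebra_simps)
qed

text \<open>Derivatives below order \<open>n - 1\<close> are Lipschitz and those of order
  \<open>n - 1\<close> are Hoelder, whence the two powers of \<delta>, the bound for the distance of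
  the paths.\<close>

lemma integrand_diff:
  assumes t: "0 \<le> t" "t \<le> T" and \<sigma>: "deg \<sigma> \<le> n"
  defines "\<delta> \<equiv> e * (1 + real CARD('d) * H)"
  shows "\<bar>\<beta> j t \<sigma> - R.\<beta> j t \<sigma>\<bar> \<le> L * (\<delta> + \<delta> powr (N - real n))"
  unfolding \<beta>_bc R.\<beta>_bc
proof (rule bc_diff_le)
  have \<delta>: "0 \<le> \<delta>" using e H1 by (simp add: \<delta>_def)
  then show "0 \<le> L * (\<delta> + \<delta> powr (N - real n))" using L_nonneg by simp
  let ?x = "proj1 (X t)" and ?x' = "proj1 (X' t)"
  have xd: "norm (?x - ?x') \<le> \<delta>" unfolding \<delta>_def by (rule path_diff[OF t])
  have nN: "0 < N - real n" using N_bounds(1) by simp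
  have Ne: "N - real n = min 1 (\<gamma> - 1 + 1 - real n)" by (simp add: N_def)
  fix i :: 'd and q :: "'d multiset" assume q: "size q \<le> n - 1"
  show "\<bar>Dm (comp_fun f j i) q ?x - Dm (comp_fun f j i) q ?x'\<bar> \<le> L * (\<delta> + \<delta> powr (N - real n))"
  proof (cases "size q = n - 1")
    case True
    have "\<bar>Dm (comp_fun f j i) q ?x - Dm (comp_fun f j i) q ?x'\<bar> \<le> L * norm (?x - ?x') powr (N - real n)"
      unfolding L_def Ne by (rule smooth_comp_fun(3)[OF Lipf n1 n_lt_\<gamma> True])
    also have "\<dots> \<le> L * (\<delta> + \<delta> powr (N - real n))"
    proof -
      have "norm (?x - ?x') powr (N - real n) \<le> \<delta> powr (N - real n)" using xd nN by (intro powr_mono2) auto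
      then show ?thesis using \<delta> L_nonneg by (intro mult_left_mono) auto
    qed
    finally show ?thesis .
  next
    case False
    let ?vs = "map (\<lambda>i. axis i (1::real)) (SOME is. mset is = q)"
    have len: "length (SOME is. mset is = q) = size q" by (metis mset_some_list size_mset)
    have sf: "size q < strict_floor (\<gamma> - 1)" using False q smooth_comp_fun(4)[OF Lipf n1 n_lt_\<gamma>] by linarith
    have "\<bar>Dm (comp_fun f j i) q ?x - Dm (comp_fun f j i) q ?x'\<bar> \<le> norm (iter_deriv f ?vs ?x - iter_deriv f ?vs ?x')"
      unfolding Dm_def using sf by (intro comp_fun_diff[OF Lipf]) (simp add: len)
    also have "\<dots> \<le> L * norm (?x - ?x')"
      unfolding L_def using sf by (intro Lip_lipschitz[OF Lipf]) (auto simp: len norm_axis_1)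
    also have "\<dots> \<le> L * (\<delta> + \<delta> powr (N - real n))"
      using xd L_nonneg by (intro mult_left_mono) (auto intro: add_increasing2)
    finally show ?thesis .
  qed
qed (rule \<sigma>)

lemma pair_lift:
  assumes M: "real (card (fs n :: 'd forest set)) \<le> M" "\<forall>\<rho> :: 'd forest. deg \<rho> \<le> n \<longrightarrow> real (size (coproduct \<rho>)) \<le> M"
  shows "lift n 0 T Z \<beta> \<Phi> \<Longrightarrow> rough_lift n p N H M 0 T W Z \<beta> \<Phi> (A H * L)"
    and "lift n 0 T Z' R.\<beta> \<Phi>' \<Longrightarrow> rough_lift n p N H M 0 T W Z' R.\<beta> \<Phi>' (A H * L)"
proof -
  have "rough_data n p N H M 0 T W Z"
    using M W_le1 pair_bounds(1) H1 p0 N_bounds by (intro rough_dataI[OF _ _ W_control]) auto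
  then show "lift n 0 T Z \<beta> \<Phi> \<Longrightarrow> rough_lift n p N H M 0 T W Z \<beta> \<Phi> (A H * L)"
    by (rule rough_liftI) auto
  have "rough_data n p N H M 0 T W Z'"
    using M W_le1 pair_bounds(2) H1 p0 N_bounds by (intro R.rough_dataI[OF _ _ W_control]) auto
  then show "lift n 0 T Z' R.\<beta> \<Phi>' \<Longrightarrow> rough_lift n p N H M 0 T W Z' R.\<beta> \<Phi>' (A H * L)"
    by (rule R.rough_liftI) auto
qed

end

context rough_setting
begin

lemma integral_start:
  assumes Y: "is_rough_integral p T f X Y" and s: "0 \<le> s" "s \<le> T"
  shows "proj1 (Y s s) = 0"
proof -
  obtain \<Phi> where \<Phi>1: "lift n 0 T Z \<beta> \<Phi>"
    and \<Phi>2: "\<forall>s t \<rho>. 0 \<le> s \<and> s \<le> t \<and> t \<le> T \<longrightarrow> \<Phi> s t \<rho> {#} = Y s t \<rho>"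
    using integral_lift[OF Y] by (elim exE conjE)
  have "Y s s {#bullet j#} = 0" for j
    using lift.lift_start[OF \<Phi>1 s, of "{#}" j] n1 s by (simp add: \<Phi>2)
  then show ?thesis by (simp add: proj1_def vec_eq_iff)
qed

text \<open>Chen's relation says that \<open>Y s t\<close> solves the equation for the increment of
  \<open>Y 0\<close>, and in a group the solution is unique.\<close>

lemma increment_integral:
  assumes Y: "is_rough_integral p T f X Y" and st: "0 \<le> s" "s \<le> t" "t \<le> T"
  shows "increment n (Y 0) s t = Y s t"
proof (rule increment_eqI)
  show "Y 0 ` {0..T} \<subseteq> characters n" using integral_in[OF Y] by auto
  show "Y s t \<in> characters n" by (rule integral_in[OF Y st])
  show "star n (Y 0 s) (Y s t) = Y 0 t"
  proof
    fix \<rho>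
    have "Y 0 t \<in> characters n" using st by (intro integral_in[OF Y]) auto
    then show "star n (Y 0 s) (Y s t) \<rho> = Y 0 t \<rho>"
      using integral_chen[OF Y order_refl st, of \<rho>] characters_high[of "Y 0 t" n \<rho>] by (auto simp: star_def)
  qed
qed (use st in auto)

text \<open>Continuity along a sequence approaching the fixed path \<open>X\<close>, the form in
  which the comparison of lifts by null sequences applies.\<close>

lemma integral_continuous:
  fixes X' :: "nat \<Rightarrow> real \<Rightarrow> 'd forest \<Rightarrow> real"
  assumes Y: "is_rough_integral p T f X Y"
    and X': "\<And>m. branched_rough_path p T (X' m)" and Y': "\<And>m. is_rough_integral p T f (X' m) (Y' m)"
    and dX: "\<And>m. d_p p T X (X' m) \<le> ennreal (1 / (real m + 1))" and \<epsilon>: "0 < \<epsilon>"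
  shows "\<exists>m. d_p p T (Y 0) (Y' m 0) < \<epsilon>"
proof -
  define e where "e m = 1 / (real m + 1)" for m :: nat
  have e: "0 < e m" "e m \<le> 1" for m by (simp_all add: e_def)
  have e_lim: "e \<longlonglongrightarrow> 0"
    unfolding e_def[abs_def] using LIMSEQ_inverse_real_of_nat by (simp add: inverse_eq_divide add.commute)
  have pr: "rough_pair p T X \<gamma> f (X' m) (e m)" for m
    using X' e dX by unfold_locales (auto simp: e_def)
  have rs: "rough_setting p T (X' m) \<gamma> f" for m
    by unfold_locales (use p1 T0 X' \<gamma> Lipf in auto)
  obtain M where M: "real (card (fs n :: 'd forest set)) \<le> M" "\<forall>\<rho> :: 'd forest. deg \<rho> \<le> n \<longrightarrow> real (size (coproduct \<rho>)) \<le> M"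
    using ex_forest_bound by blast
  obtain \<Phi> where \<Phi>1: "lift n 0 T Z \<beta> \<Phi>"
    and \<Phi>2: "\<forall>s t \<rho>. 0 \<le> s \<and> s \<le> t \<and> t \<le> T \<longrightarrow> \<Phi> s t \<rho> {#} = Y s t \<rho>"
    using integral_lift[OF Y] by (elim exE conjE)
  define \<beta>' where "\<beta>' m = rough_setting.\<beta> p (X' m) f" for m
  have "\<forall>m. \<exists>\<Phi>. lift n 0 T (increment n (X' m)) (\<beta>' m) \<Phi> \<and>
      (\<forall>s t \<rho>. 0 \<le> s \<and> s \<le> t \<and> t \<le> T \<longrightarrow> \<Phi> s t \<rho> {#} = Y' m s t \<rho>)"
    unfolding \<beta>'_def using rough_setting.integral_lift[OF rs Y'] by blast
  then obtain \<Phi>' where \<Phi>': "\<forall>m. lift n 0 T (increment n (X' m)) (\<beta>' m) (\<Phi>' m) \<and>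
      (\<forall>s t \<rho>. 0 \<le> s \<and> s \<le> t \<and> t \<le> T \<longrightarrow> \<Phi>' m s t \<rho> {#} = Y' m s t \<rho>)"
    by (rule choice[THEN exE])
  define H where "H = rough_pair.H p T X"
  define W where "W m = rough_pair.W p T X (X' m) (e m)" for m
  define \<delta> where "\<delta> m = e m * (1 + real CARD('d) * H)" for m
  define e' where "e' m = e m * H + L * (\<delta> m + \<delta> m powr (N - real n))" for m
  have H1: "1 \<le> H" unfolding H_def by (rule rough_pair.H1[OF pr[of 0]])
  have \<delta>0: "0 \<le> \<delta> m" for m using e(1)[of m] H1 by (simp add: \<delta>_def)
  have "\<delta> \<longlonglongrightarrow> 0 * (1 + real CARD('d) * H)" unfolding \<delta>_def by (intro tendsto_intros e_lim)
  then have \<delta>_lim: "\<delta> \<longlonglongrightarrow> 0" by simp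
  have "e' \<longlonglongrightarrow> 0 * H + L * (0 + 0 powr (N - real n))"
    unfolding e'_def using N_bounds(1) \<delta>0 by (intro tendsto_intros tendsto_powr' e_lim \<delta>_lim) auto
  then have e'_lim: "e' \<longlonglongrightarrow> 0" by simp
  have tail: "0 \<le> L * (\<delta> m + \<delta> m powr (N - real n))" for m using L_nonneg \<delta>0 by simp
  interpret S: lift_sequence n p N H M T "A H * L" W Z "\<lambda>m. increment n (X' m)" \<beta> \<beta>' \<Phi> \<Phi>' e'
  proof (rule lift_sequence.intro)
    fix m
    interpret P: rough_pair p T X \<gamma> f "X' m" "e m" by (rule pr)
    show "rough_lift n p N H M 0 T (W m) Z \<beta> \<Phi> (A H * L)"
      unfolding H_def W_def by (rule P.pair_lift(1)[OF M \<Phi>1])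
    show "rough_lift n p N H M 0 T (W m) (increment n (X' m)) (\<beta>' m) (\<Phi>' m) (A H * L)"
      unfolding H_def W_def \<beta>'_def using \<Phi>' by (intro P.pair_lift(2)[OF M]) (simp add: \<beta>'_def)
    show "0 \<le> e' m" unfolding e'_def using e(1)[of m] H1 tail[of m] by simp
    show "\<bar>Z s t \<rho> - increment n (X' m) s t \<rho>\<bar> \<le> e' m * (W m s t powr (1 / p)) ^ deg \<rho>"
      if "0 \<le> s" "s \<le> t" "t \<le> T" "deg \<rho> \<le> n" for s t \<rho>
    proof -
      have "e m * H * (W m s t powr (1 / p)) ^ deg \<rho> \<le> e' m * (W m s t powr (1 / p)) ^ deg \<rho>"
        unfolding e'_def using tail[of m] by (intro mult_right_mono) auto
      then show ?thesis using P.pair_bounds(3)[OF that] unfolding H_def W_def by linarith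
    qed
    show "\<bar>\<beta> j t \<sigma> - \<beta>' m j t \<sigma>\<bar> \<le> e' m" if "0 \<le> t" "t \<le> T" "deg \<sigma> \<le> n" for j t \<sigma>
    proof -
      have "0 \<le> e m * H" using e(1)[of m] H1 by simp
      then show ?thesis using P.integrand_diff[OF that, of j] unfolding e'_def \<beta>'_def \<delta>_def H_def by linarith
    qed
  qed (rule n_le e'_lim)+
  have "\<forall>\<rho>\<in>forests n. \<exists>\<eta>. \<eta> \<longlonglongrightarrow> 0 \<and> (\<forall>m s t. 0 \<le> s \<longrightarrow> s \<le> t \<longrightarrow> t \<le> T \<longrightarrow>
     \<bar>\<Phi> s t \<rho> {#} - \<Phi>' m s t \<rho> {#}\<bar> \<le> \<eta> m * (W m s t powr (1 / p)) ^ deg \<rho>)"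
  proof
    fix \<rho> :: "'e forest" assume "\<rho> \<in> forests n"
    then have "S.close \<rho>" by (intro S.all_close) (simp add: forests_def)
    then show "\<exists>\<eta>. \<eta> \<longlonglongrightarrow> 0 \<and> (\<forall>m s t. 0 \<le> s \<longrightarrow> s \<le> t \<longrightarrow> t \<le> T \<longrightarrow>
       \<bar>\<Phi> s t \<rho> {#} - \<Phi>' m s t \<rho> {#}\<bar> \<le> \<eta> m * (W m s t powr (1 / p)) ^ deg \<rho>)"
      unfolding S.close_def by blast
  qed
  then obtain \<eta> where \<eta>: "\<forall>\<rho>\<in>forests n. \<eta> \<rho> \<longlonglongrightarrow> 0 \<and> (\<forall>m s t. 0 \<le> s \<longrightarrow> s \<le> t \<longrightarrow> t \<le> T \<longrightarrow>
     \<bar>\<Phi> s t \<rho> {#} - \<Phi>' m s t \<rho> {#}\<bar> \<le> \<eta> \<rho> m * (W m s t powr (1 / p)) ^ deg \<rho>)"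
    by (rule bchoice[THEN exE])
  \<comment> \<open>Under the power \<open>p / deg \<rho>\<close> a difference of order
    \<open>w ^ deg \<rho>\<close> becomes a multiple of \<open>W m\<close>, whose sums are at most
    1. The final power \<open>1 / p\<close> leaves the exponent \<open>1 / deg \<rho>\<close> on the
    null sequence.\<close>
  define E where "E m = (\<Sum>\<rho>\<in>forests n. \<bar>\<eta> \<rho> m\<bar> powr (1 / real (deg \<rho>)))" for m
  have dY: "d_p p T (Y 0) (Y' m 0) \<le> ennreal (E m)" for m
  proof -
    interpret P: rough_pair p T X \<gamma> f "X' m" "e m" by (rule pr)
    have p0: "0 < p" by (rule P.p0)
    have Wc: "control 0 T (W m)" unfolding W_def by (rule P.W_control)
    have start: "proj1 (Y 0 0) - proj1 (Y' m 0 0) = 0"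
      using integral_start[OF Y, of 0] P.R.integral_start[OF Y'[of m], of 0] T0 by simp
    have each: "(SUP D\<in>partitions 0 T. ennreal (partition_sum (\<lambda>u v.
         \<bar>increment n (Y 0) u v \<rho> - increment n (Y' m 0) u v \<rho>\<bar> powr (p / real (deg \<rho>))) D powr (1 / p))) \<le> ennreal (E m)"
      if \<rho>: "\<rho> \<in> forests n" for \<rho>
    proof (rule SUP_least)
      fix D assume D: "D \<in> partitions 0 T"
      have d: "0 < deg \<rho>" using \<rho> by (simp add: forests_def)
      let ?r = "p / real (deg \<rho>)"
      let ?S = "partition_sum (\<lambda>u v. \<bar>increment n (Y 0) u v \<rho> - increment n (Y' m 0) u v \<rho>\<bar> powr ?r) D"
      have r: "0 < ?r" using d p0 by simp
      have "?S \<le> partition_sum (\<lambda>u v. \<bar>\<eta> \<rho> m\<bar> powr ?r * W m u v) D"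
      proof (rule partition_sum_mono[OF D])
        fix u v assume "0 \<le> u" "u < v" "v \<le> T"
        then have uv: "0 \<le> u" "u \<le> v" "v \<le> T" by auto
        have w0: "0 \<le> W m u v" by (rule control_nonneg[OF Wc uv])
        have "\<bar>\<Phi> u v \<rho> {#} - \<Phi>' m u v \<rho> {#}\<bar> \<le> \<eta> \<rho> m * (W m u v powr (1 / p)) ^ deg \<rho>"
          using \<eta> \<rho> uv by blast
        also have "\<dots> \<le> \<bar>\<eta> \<rho> m\<bar> * (W m u v powr (1 / p)) ^ deg \<rho>" by (intro mult_right_mono) auto
        finally have le: "\<bar>Y u v \<rho> - Y' m u v \<rho>\<bar> \<le> \<bar>\<eta> \<rho> m\<bar> * (W m u v powr (1 / p)) ^ deg \<rho>"
          using \<Phi>2 \<Phi>' uv by simp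
        have "\<bar>increment n (Y 0) u v \<rho> - increment n (Y' m 0) u v \<rho>\<bar> powr ?r = \<bar>Y u v \<rho> - Y' m u v \<rho>\<bar> powr ?r"
          unfolding increment_integral[OF Y uv] P.R.increment_integral[OF Y'[of m] uv] ..
        also have "\<dots> \<le> (\<bar>\<eta> \<rho> m\<bar> * (W m u v powr (1 / p)) ^ deg \<rho>) powr ?r" using le r by (intro powr_mono2) auto
        also have "\<dots> = \<bar>\<eta> \<rho> m\<bar> powr ?r * ((W m u v powr (1 / p)) ^ deg \<rho>) powr ?r" by (rule powr_mult)
        also have "((W m u v powr (1 / p)) ^ deg \<rho>) powr ?r = W m u v"
        proof (cases "W m u v = 0")
          case True
          then show ?thesis using d by simp
        next
          case False
          then have "(W m u v powr (1 / p)) ^ deg \<rho> = (W m u v powr (1 / p)) powr real (deg \<rho>)"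
            by (intro powr_realpow[symmetric]) simp
          then show ?thesis using d p0 w0 by (simp del: deg_eq_0_iff add: powr_powr)
        qed
        finally show "\<bar>increment n (Y 0) u v \<rho> - increment n (Y' m 0) u v \<rho>\<bar> powr ?r \<le> \<bar>\<eta> \<rho> m\<bar> powr ?r * W m u v" .
      qed
      also have "\<dots> = \<bar>\<eta> \<rho> m\<bar> powr ?r * partition_sum (W m) D" by (rule partition_sum_mult)
      also have "\<dots> \<le> \<bar>\<eta> \<rho> m\<bar> powr ?r * 1"
      proof -
        have "partition_sum (W m) D \<le> W m 0 T" by (rule control_partition_sum[OF Wc D]) auto
        also have "\<dots> \<le> 1" unfolding W_def using T0 by (intro P.W_le1) auto
        finally show ?thesis by (intro mult_left_mono) auto
      qed
      finally have S: "?S \<le> \<bar>\<eta> \<rho> m\<bar> powr ?r" by simp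
      have "0 \<le> ?S" using D by (rule partition_sum_nonneg) simp
      then have "?S powr (1 / p) \<le> (\<bar>\<eta> \<rho> m\<bar> powr ?r) powr (1 / p)" using S p0 by (intro powr_mono2) auto
      also have "\<dots> = \<bar>\<eta> \<rho> m\<bar> powr (1 / real (deg \<rho>))" using p0 by (simp add: powr_powr)
      also have "\<dots> \<le> E m" unfolding E_def using \<rho> finite_forests by (intro member_le_sum) auto
      finally show "ennreal (?S powr (1 / p)) \<le> ennreal (E m)" by (rule ennreal_leI)
    qed
    show ?thesis
      unfolding d_p_def start norm_zero ennreal_0 add_0
    proof (rule Max.boundedI)
      show "x \<le> ennreal (E m)" if "x \<in> (\<lambda>\<rho>. SUP D\<in>partitions 0 T. ennreal (partition_sum (\<lambda>u v.
         \<bar>increment n (Y 0) u v \<rho> - increment n (Y' m 0) u v \<rho>\<bar> powr (p / real (deg \<rho>))) D powr (1 / p))) ` forests n" for x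
        using that each by blast
    qed (use finite_forests forests_nonempty[OF n1] in auto)
  qed
  have "E \<longlonglongrightarrow> (\<Sum>\<rho>\<in>(forests n :: 'e forest set). \<bar>0\<bar> powr (1 / real (deg \<rho>)))"
    unfolding E_def
  proof (intro tendsto_sum tendsto_powr' tendsto_rabs tendsto_const)
    fix \<rho> :: "'e forest" assume "\<rho> \<in> forests n"
    then show "\<eta> \<rho> \<longlonglongrightarrow> 0" "\<bar>0::real\<bar> \<noteq> 0 \<or> 0 < 1 / real (deg \<rho>) \<and> (\<forall>\<^sub>F m in sequentially. 0 \<le> \<bar>\<eta> \<rho> m\<bar>)"
      using \<eta> by (auto simp: forests_def)
  qed
  then have "(\<lambda>m. ennreal (E m)) \<longlonglongrightarrow> ennreal 0" by (intro tendsto_ennrealI) simp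
  then have "\<forall>\<^sub>F m in sequentially. ennreal (E m) < \<epsilon>" using \<epsilon> by (intro order_tendstoD(2)) auto
  then obtain m where "ennreal (E m) < \<epsilon>" by (auto simp: eventually_sequentially)
  then show ?thesis using dY[of m] by (intro exI[of _ m]) (rule le_less_trans)
qed

end

theorem theorem17:
  fixes p \<gamma> :: real
  assumes "1 \<le> p" and "p < \<gamma>"
  shows
    "(\<forall>T > 0. \<forall>f :: real ^ 'd::finite \<Rightarrow> (real ^ 'd) \<Rightarrow>\<^sub>L (real ^ 'e::finite). Lip (\<gamma> - 1) f \<longrightarrow>
        (\<forall>X. branched_rough_path p T X \<longrightarrow> (\<exists>Y. is_rough_integral p T f X Y)) \<and>
        (\<forall>X Y. branched_rough_path p T X \<and> is_rough_integral p T f X Y \<longrightarrow>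
          (\<forall>\<epsilon> > 0. \<exists>\<delta> > 0. \<forall>X' Y'.
            branched_rough_path p T X' \<and> is_rough_integral p T f X' Y' \<and> d_p p T X X' < \<delta> \<longrightarrow>
            d_p p T (Y 0) (Y' 0) < \<epsilon>))) \<and>
     (\<exists>C :: real. \<forall>T > 0. \<forall>f :: real ^ 'd \<Rightarrow> (real ^ 'd) \<Rightarrow>\<^sub>L (real ^ 'e). \<forall>X Y.
        Lip (\<gamma> - 1) f \<and> branched_rough_path p T X \<and> is_rough_integral p T f X Y \<longrightarrow>
        (\<forall>s t. 0 \<le> s \<and> s < t \<and> t \<le> T \<longrightarrow>
          (let x = enn2real (p_var p (increment (level p) X) s t)
           in p_var p Y s t \<le> ennreal (C * enn2real (Lip_norm (\<gamma> - 1) f) * max x (x powr p)))))"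
proof (intro conjI allI impI)
  fix T :: real and f :: "real ^ 'd \<Rightarrow> (real ^ 'd) \<Rightarrow>\<^sub>L (real ^ 'e)"
  assume T: "0 < T" and f: "Lip (\<gamma> - 1) f"
  have setting: "rough_setting p T X \<gamma> f" if "branched_rough_path p T X" for X
    by unfold_locales (use assms T f that in auto)
  show "\<exists>Y. is_rough_integral p T f X Y" if "branched_rough_path p T X" for X
    by (rule rough_setting.integral_exists[OF setting[OF that]])
  fix X :: "real \<Rightarrow> 'd forest \<Rightarrow> real" and Y :: "real \<Rightarrow> real \<Rightarrow> 'e forest \<Rightarrow> real" and \<epsilon> :: ennreal
  assume XY: "branched_rough_path p T X \<and> is_rough_integral p T f X Y" and \<epsilon>: "0 < \<epsilon>"
  then have X: "branched_rough_path p T X" and Y: "is_rough_integral p T f X Y" by simp_all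
  let ?P = "\<lambda>\<delta> X' Y'. branched_rough_path p T X' \<and> is_rough_integral p T f X' Y' \<and> d_p p T X X' < \<delta>"
  show "\<exists>\<delta>>0. \<forall>X' Y'. ?P \<delta> X' Y' \<longrightarrow> d_p p T (Y 0) (Y' 0) < \<epsilon>"
  \<comment> \<open>If no \<delta> works, the values \<open>1 / (m + 1)\<close> yield a sequence of
    counterexamples, which \<open>integral_continuous\<close> excludes.\<close>
  proof (rule ccontr)
    assume neg: "\<not> ?thesis"
    have "\<exists>Z. ?P (ennreal (1 / (real m + 1))) (fst Z) (snd Z) \<and> \<not> d_p p T (Y 0) (snd Z 0) < \<epsilon>" for m :: nat
    proof -
      have "0 < ennreal (1 / (real m + 1))" by simp
      with neg have "\<exists>X' Y'. ?P (ennreal (1 / (real m + 1))) X' Y' \<and> \<not> d_p p T (Y 0) (Y' 0) < \<epsilon>" by blast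
      then show ?thesis by simp
    qed
    then have "\<exists>Z. \<forall>m. ?P (ennreal (1 / (real m + 1))) (fst (Z m)) (snd (Z m)) \<and> \<not> d_p p T (Y 0) (snd (Z m) 0) < \<epsilon>"
      by (intro choice allI)
    then obtain Z where Z: "?P (ennreal (1 / (real m + 1))) (fst (Z m)) (snd (Z m))"
      "\<not> d_p p T (Y 0) (snd (Z m) 0) < \<epsilon>" for m :: nat by blast
    have "\<exists>m. d_p p T (Y 0) (snd (Z m) 0) < \<epsilon>"
      by (rule rough_setting.integral_continuous[OF setting[OF X] Y, of "\<lambda>m. fst (Z m)"])
        (use Z(1) \<epsilon> in \<open>auto intro: less_imp_le\<close>)
    then show False using Z(2) by blast
  qed
next
  define n where "n = level p"
  define N where "N = rough_setting.N p \<gamma>"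
  obtain M where M: "real (card (fs n :: 'd forest set)) \<le> M"
    "\<forall>\<rho> :: 'd forest. deg \<rho> \<le> n \<longrightarrow> real (size (coproduct \<rho>)) \<le> M"
    using ex_forest_bound by blast
  obtain G where G: "\<forall>\<rho> :: 'e forest. deg \<rho> \<le> n \<longrightarrow> real (size (coproduct \<rho>)) \<le> G"
    using ex_forest_bound by blast
  define G' where "G' = max 1 G"
  have G': "1 \<le> G'" "\<forall>\<rho> :: 'e forest. deg \<rho> \<le> n \<longrightarrow> real (size (coproduct \<rho>)) \<le> G'"
    using G by (force simp: G'_def)+
  \<comment> \<open>Outside the locale these constants take only numbers and the label type as
    arguments, so \<open>C\<close> can be fixed before \<open>T\<close>, \<open>f\<close> and
    \<open>X\<close>.\<close>
  define A where "A = rough_setting.A TYPE('d) p \<gamma> 1"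
  define C1 where "C1 = max 0 (max (A * rough_setting.KQ p \<gamma> M p) (A * rough_setting.KQ p \<gamma> M ((p + N) / 2)))"
  show "\<exists>C :: real. \<forall>T > 0. \<forall>f :: real ^ 'd \<Rightarrow> (real ^ 'd) \<Rightarrow>\<^sub>L (real ^ 'e). \<forall>X Y.
        Lip (\<gamma> - 1) f \<and> branched_rough_path p T X \<and> is_rough_integral p T f X Y \<longrightarrow>
        (\<forall>s t. 0 \<le> s \<and> s < t \<and> t \<le> T \<longrightarrow>
          (let x = enn2real (p_var p (increment (level p) X) s t)
           in p_var p Y s t \<le> ennreal (C * enn2real (Lip_norm (\<gamma> - 1) f) * max x (x powr p))))"
  proof (intro exI[of _ "6 * G' * C1"] allI impI; elim conjE)
    fix T s t :: real and f :: "real ^ 'd \<Rightarrow> (real ^ 'd) \<Rightarrow>\<^sub>L (real ^ 'e)"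
      and X :: "real \<Rightarrow> 'd forest \<Rightarrow> real" and Y :: "real \<Rightarrow> real \<Rightarrow> 'e forest \<Rightarrow> real"
    assume T: "0 < T" and f: "Lip (\<gamma> - 1) f" and X: "branched_rough_path p T X"
      and Y: "is_rough_integral p T f X Y" and st: "0 \<le> s" "s < t" "t \<le> T"
    interpret S: rough_setting p T X \<gamma> f
      by unfold_locales (use assms T f X in auto)
    show "let x = enn2real (p_var p (increment (level p) X) s t)
       in p_var p Y s t \<le> ennreal (6 * G' * C1 * enn2real (Lip_norm (\<gamma> - 1) f) * max x (x powr p))"
      using S.integral_bound[OF Y M[unfolded n_def] G'(1) G'(2)[unfolded n_def] _ _ _ st, of C1]
      by (simp add: Let_def C1_def A_def N_def S.L_def)
  qed
qed

end
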